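(* Up to topological equivalence, there is exactly one optimal SN-flow on the sphere $S^2$ whose saddle-node point is of saddle–source type.
   Context: Flows are generated by smooth vector fields on a closed connected surface $M$. Two flows on $M$ are topologically equivalent if there is a homeomorphism $h:M\to M$ mapping trajectories of the first onto trajectories of the second and preserving their direction. A Morse flow is a flow with finitely many singular points, all hyperbolic, whose non-wandering set is the set of singular points, and whose stable and unstable manifolds intersect transversally. An SN-flow is a flow such that: (1) it has exactly one non-hyperbolic singular point, which is of saddle-node type (locally, up to topological equivalence and reversal of time, the singular point of $\dot x=x,\ \dot y=y^2$), and all other singular points are hyperbolic; (2) all the other conditions in the definition of a Morse flow hold; (3) each separatrix bounding a hyperbolic sector of the saddle-node has its other limit set equal to a source or a sink. An SN-flow on $M$ is optimal if no SN-flow on $M$ has fewer singular points. The saddle-node has type saddle–source if exactly one (non-constant) trajectory enters it. *)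

theory Defs
  imports "HOL-Analysis.Analysis"
begin

(* Throughout, M is meant to be a closed connected smooth surface embedded in a Euclidean
   space, and a flow on M is a map phi t x, of which only the values for x in M matter. *)

section \<open>Smooth flows\<close>

primrec Ck_on :: "nat \<Rightarrow> 'a::real_normed_vector set \<Rightarrow> ('a \<Rightarrow> 'b::real_normed_vector) \<Rightarrow> bool" where
  "Ck_on 0 U f \<longleftrightarrow> continuous_on U f"
| "Ck_on (Suc k) U f \<longleftrightarrow>
     (\<forall>x\<in>U. f differentiable (at x)) \<and> (\<forall>v. Ck_on k U (\<lambda>x. frechet_derivative f (at x) v))"

definition smooth_along :: "'a::real_normed_vector set \<Rightarrow> ('a \<Rightarrow> 'b::real_normed_vector) \<Rightarrow> bool" where
  "smooth_along M f \<longleftrightarrow>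
     (\<exists>U g. open U \<and> M \<subseteq> U \<and> (\<forall>k. Ck_on k U g) \<and> (\<forall>x\<in>M. g x = f x))"

definition velocity :: "(real \<Rightarrow> 'a \<Rightarrow> 'a) \<Rightarrow> 'a \<Rightarrow> 'a::real_normed_vector" where
  "velocity \<phi> x = vector_derivative (\<lambda>t. \<phi> t x) (at 0)"

(* The flow generated by its velocity field: phi _ x is the integral curve starting at x.
   The group law follows from the uniqueness of integral curves. *)
definition smooth_flow :: "'a::real_normed_vector set \<Rightarrow> (real \<Rightarrow> 'a \<Rightarrow> 'a) \<Rightarrow> bool" where
  "smooth_flow M \<phi> \<longleftrightarrow>
     smooth_along M (velocity \<phi>) \<and>
     (\<forall>x\<in>M. \<phi> 0 x = x \<and>
        (\<forall>t. \<phi> t x \<in> M \<and> ((\<lambda>t. \<phi> t x) has_vector_derivative velocity \<phi> (\<phi> t x)) (at t)))"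

definition trajectory :: "(real \<Rightarrow> 'a \<Rightarrow> 'a) \<Rightarrow> 'a \<Rightarrow> 'a set" where
  "trajectory \<phi> x = range (\<lambda>t. \<phi> t x)"

definition topologically_equivalent ::
  "'a::topological_space set \<Rightarrow> (real \<Rightarrow> 'a \<Rightarrow> 'a) \<Rightarrow> (real \<Rightarrow> 'a \<Rightarrow> 'a) \<Rightarrow> bool" where
  "topologically_equivalent M \<phi> \<psi> \<longleftrightarrow>
     (\<exists>h g. homeomorphism M M h g \<and>
        (\<forall>x\<in>M. \<exists>\<tau>::real \<Rightarrow> real. strict_mono \<tau> \<and> surj \<tau> \<and> (\<forall>t. h (\<phi> t x) = \<psi> (\<tau> t) (h x))))"

section \<open>Singular points\<close>

definition singular_points :: "'a::real_normed_vector set \<Rightarrow> (real \<Rightarrow> 'a \<Rightarrow> 'a) \<Rightarrow> 'a set" where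
  "singular_points M \<phi> = {x \<in> M. velocity \<phi> x = 0}"

(* Velocities at x of the C1 curves lying in W: the tangent space at x when W is an
   embedded surface, or a stable or unstable manifold. *)
definition tangent_vectors :: "'a::real_normed_vector set \<Rightarrow> 'a \<Rightarrow> 'a set" where
  "tangent_vectors W x =
     {vector_derivative \<gamma> (at 0) | \<gamma>::real \<Rightarrow> 'a.
        \<gamma> C1_differentiable_on {-1<..<1} \<and> \<gamma> ` {-1<..<1} \<subseteq> W \<and> \<gamma> 0 = x}"

(* z is an eigenvalue, with eigenvector u + i v, of the complexification of A on V. *)
definition complex_eigenvalue_on :: "'a::real_vector set \<Rightarrow> ('a \<Rightarrow> 'a) \<Rightarrow> complex \<Rightarrow> bool" where
  "complex_eigenvalue_on V A z \<longleftrightarrow>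
     (\<exists>u\<in>V. \<exists>v\<in>V. (u \<noteq> 0 \<or> v \<noteq> 0) \<and>
        A u = Re z *\<^sub>R u - Im z *\<^sub>R v \<and> A v = Im z *\<^sub>R u + Re z *\<^sub>R v)"

(* The derivative within M is determined only on tangent vectors of M; on these it is the
   linear part of the vector field at a singular point. *)
definition linear_part_eigenvalue ::
  "'a::real_normed_vector set \<Rightarrow> (real \<Rightarrow> 'a \<Rightarrow> 'a) \<Rightarrow> 'a \<Rightarrow> complex \<Rightarrow> bool" where
  "linear_part_eigenvalue M \<phi> p z \<longleftrightarrow>
     complex_eigenvalue_on (tangent_vectors M p) (frechet_derivative (velocity \<phi>) (at p within M)) z"

definition hyperbolic :: "'a::real_normed_vector set \<Rightarrow> (real \<Rightarrow> 'a \<Rightarrow> 'a) \<Rightarrow> 'a \<Rightarrow> bool" where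
  "hyperbolic M \<phi> p \<longleftrightarrow> (\<forall>z. linear_part_eigenvalue M \<phi> p z \<longrightarrow> Re z \<noteq> 0)"

definition source :: "'a::real_normed_vector set \<Rightarrow> (real \<Rightarrow> 'a \<Rightarrow> 'a) \<Rightarrow> 'a \<Rightarrow> bool" where
  "source M \<phi> p \<longleftrightarrow>
     p \<in> singular_points M \<phi> \<and> (\<forall>z. linear_part_eigenvalue M \<phi> p z \<longrightarrow> Re z > 0)"

definition sink :: "'a::real_normed_vector set \<Rightarrow> (real \<Rightarrow> 'a \<Rightarrow> 'a) \<Rightarrow> 'a \<Rightarrow> bool" where
  "sink M \<phi> p \<longleftrightarrow>
     p \<in> singular_points M \<phi> \<and> (\<forall>z. linear_part_eigenvalue M \<phi> p z \<longrightarrow> Re z < 0)"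

section \<open>Limit behaviour\<close>

definition nonwandering_set :: "'a::topological_space set \<Rightarrow> (real \<Rightarrow> 'a \<Rightarrow> 'a) \<Rightarrow> 'a set" where
  "nonwandering_set M \<phi> =
     {x \<in> M. \<forall>U. open U \<longrightarrow> x \<in> U \<longrightarrow> (\<forall>T. \<exists>t\<ge>T. \<exists>y\<in>U \<inter> M. \<phi> t y \<in> U)}"

definition omega_limit :: "(real \<Rightarrow> 'a \<Rightarrow> 'a::topological_space) \<Rightarrow> 'a \<Rightarrow> 'a set" where
  "omega_limit \<phi> x =
     {y. \<exists>s::nat \<Rightarrow> real. filterlim s at_top sequentially \<and> (\<lambda>n. \<phi> (s n) x) \<longlonglongrightarrow> y}"

definition alpha_limit :: "(real \<Rightarrow> 'a \<Rightarrow> 'a::topological_space) \<Rightarrow> 'a \<Rightarrow> 'a set" where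
  "alpha_limit \<phi> x =
     {y. \<exists>s::nat \<Rightarrow> real. filterlim s at_bot sequentially \<and> (\<lambda>n. \<phi> (s n) x) \<longlonglongrightarrow> y}"

definition stable_manifold ::
  "'a::topological_space set \<Rightarrow> (real \<Rightarrow> 'a \<Rightarrow> 'a) \<Rightarrow> 'a \<Rightarrow> 'a set" where
  "stable_manifold M \<phi> p = {x \<in> M. ((\<lambda>t. \<phi> t x) \<longlongrightarrow> p) at_top}"

definition unstable_manifold ::
  "'a::topological_space set \<Rightarrow> (real \<Rightarrow> 'a \<Rightarrow> 'a) \<Rightarrow> 'a \<Rightarrow> 'a set" where
  "unstable_manifold M \<phi> p = {x \<in> M. ((\<lambda>t. \<phi> t x) \<longlongrightarrow> p) at_bot}"

(* A non-hyperbolic singular point x itself is exempt: at a saddle-node both of its own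
   manifolds have x on their boundary. At hyperbolic singular points and along all
   non-constant trajectories the condition is imposed, also for the manifolds of a
   saddle-node. *)
definition transversal_manifolds ::
  "'a::real_normed_vector set \<Rightarrow> (real \<Rightarrow> 'a \<Rightarrow> 'a) \<Rightarrow> bool" where
  "transversal_manifolds M \<phi> \<longleftrightarrow>
     (\<forall>p\<in>singular_points M \<phi>. \<forall>q\<in>singular_points M \<phi>.
        \<forall>x\<in>unstable_manifold M \<phi> p \<inter> stable_manifold M \<phi> q.
          (x \<in> singular_points M \<phi> \<longrightarrow> hyperbolic M \<phi> x) \<longrightarrow>
          (\<forall>w\<in>tangent_vectors M x.
             \<exists>u\<in>tangent_vectors (unstable_manifold M \<phi> p) x.
             \<exists>v\<in>tangent_vectors (stable_manifold M \<phi> q) x. w = u + v))"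

section \<open>Saddle-nodes\<close>

definition flows_to ::
  "('a \<Rightarrow> 'a) \<Rightarrow> 'a::real_normed_vector set \<Rightarrow> 'a \<Rightarrow> 'a \<Rightarrow> bool" where
  "flows_to F U x y \<longleftrightarrow>
     (\<exists>T\<ge>0. \<exists>\<gamma>::real \<Rightarrow> 'a. \<gamma> 0 = x \<and> \<gamma> T = y \<and>
        (\<forall>t\<in>{0..T}. \<gamma> t \<in> U \<and> (\<gamma> has_vector_derivative F (\<gamma> t)) (at t within {0..T})))"

definition saddle_node_model :: "real \<times> real \<Rightarrow> real \<times> real" where
  "saddle_node_model z = (fst z, (snd z)\<^sup>2)"

(* h carries the oriented trajectory arcs in the neighbourhood U of p to those of the model
   in a ball about 0, all orientations being reversed if the flag is set. Taking a ball guarantees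
   that each half-axis meets the chart in a single arc ending at 0. *)
definition saddle_node_chart ::
  "'a::real_normed_vector set \<Rightarrow> (real \<Rightarrow> 'a \<Rightarrow> 'a) \<Rightarrow> 'a \<Rightarrow> bool \<Rightarrow> 'a set \<Rightarrow>
   ('a \<Rightarrow> real \<times> real) \<Rightarrow> bool" where
  "saddle_node_chart M \<phi> p reversed U h \<longleftrightarrow>
     openin (top_of_set M) U \<and> p \<in> U \<and> h p = 0 \<and>
     (\<exists>\<epsilon>>0. (\<exists>g. homeomorphism U (ball 0 \<epsilon>) h g) \<and>
        (\<forall>x\<in>U. \<forall>y\<in>U. flows_to (velocity \<phi>) U x y \<longleftrightarrow>
           (if reversed then flows_to saddle_node_model (ball 0 \<epsilon>) (h y) (h x)
            else flows_to saddle_node_model (ball 0 \<epsilon>) (h x) (h y))))"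

definition saddle_node :: "'a::real_normed_vector set \<Rightarrow> (real \<Rightarrow> 'a \<Rightarrow> 'a) \<Rightarrow> 'a \<Rightarrow> bool" where
  "saddle_node M \<phi> p \<longleftrightarrow> (\<exists>reversed U h. saddle_node_chart M \<phi> p reversed U h)"

(* The hyperbolic sectors of the model are the two open quadrants below the x-axis; they
   are bounded by the negative y-axis and the two halves of the x-axis. *)
definition on_hyperbolic_separatrix ::
  "'a::real_normed_vector set \<Rightarrow> (real \<Rightarrow> 'a \<Rightarrow> 'a) \<Rightarrow> 'a \<Rightarrow> 'a \<Rightarrow> bool" where
  "on_hyperbolic_separatrix M \<phi> p x \<longleftrightarrow>
     (\<exists>reversed U h. saddle_node_chart M \<phi> p reversed U h \<and> x \<in> U \<and>
        (fst (h x) = 0 \<and> snd (h x) < 0 \<or> fst (h x) \<noteq> 0 \<and> snd (h x) = 0))"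

definition separatrix_condition ::
  "'a::real_normed_vector set \<Rightarrow> (real \<Rightarrow> 'a \<Rightarrow> 'a) \<Rightarrow> 'a \<Rightarrow> bool" where
  "separatrix_condition M \<phi> p \<longleftrightarrow>
     (\<forall>x. on_hyperbolic_separatrix M \<phi> p x \<longrightarrow>
        (omega_limit \<phi> x = {p} \<longrightarrow>
           (\<exists>q. (source M \<phi> q \<or> sink M \<phi> q) \<and> alpha_limit \<phi> x = {q})) \<and>
        (alpha_limit \<phi> x = {p} \<longrightarrow>
           (\<exists>q. (source M \<phi> q \<or> sink M \<phi> q) \<and> omega_limit \<phi> x = {q})))"

section \<open>SN-flows\<close>

definition SN_flow :: "'a::real_normed_vector set \<Rightarrow> (real \<Rightarrow> 'a \<Rightarrow> 'a) \<Rightarrow> bool" where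
  "SN_flow M \<phi> \<longleftrightarrow>
     smooth_flow M \<phi> \<and>
     finite (singular_points M \<phi>) \<and>
     nonwandering_set M \<phi> = singular_points M \<phi> \<and>
     transversal_manifolds M \<phi> \<and>
     (\<exists>p. {x \<in> singular_points M \<phi>. \<not> hyperbolic M \<phi> x} = {p} \<and>
          saddle_node M \<phi> p \<and> separatrix_condition M \<phi> p)"

definition optimal_SN_flow :: "'a::real_normed_vector set \<Rightarrow> (real \<Rightarrow> 'a \<Rightarrow> 'a) \<Rightarrow> bool" where
  "optimal_SN_flow M \<phi> \<longleftrightarrow>
     SN_flow M \<phi> \<and>
     (\<forall>\<psi>. SN_flow M \<psi> \<longrightarrow> card (singular_points M \<phi>) \<le> card (singular_points M \<psi>))"

definition saddle_source_type :: "'a::real_normed_vector set \<Rightarrow> (real \<Rightarrow> 'a \<Rightarrow> 'a) \<Rightarrow> bool" where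
  "saddle_source_type M \<phi> \<longleftrightarrow>
     (\<exists>p\<in>singular_points M \<phi>. \<not> hyperbolic M \<phi> p \<and>
        (\<exists>!C. \<exists>x\<in>stable_manifold M \<phi> p - singular_points M \<phi>. C = trajectory \<phi> x))"

abbreviation S2 :: "(real ^ 3) set" where
  "S2 \<equiv> sphere 0 1"

end

theory Submission
  imports Defs
begin

text \<open>Uniqueness: with three singular points there are a source, a sink and the saddle-node. A
  function \<open>V\<close> conjugates the flow on the basin of the sink to the logistic flow on the unit
  interval, and \<open>W\<close> does the same for the source and reversed time; \<open>V - W\<close> is then strictly
  decreasing off the singular points. The trajectories tending to the sink are parametrized by
  the circle \<open>V = 1/2\<close>. Those among them that come from the saddle-node form a closed arc of it, and
  the remaining open arc is identified with the punctured circle \<open>W = 1/2\<close>, the puncture being the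
  only trajectory entering the saddle-node. A homeomorphism between the sink circles of two
  such flows that respects the arcs extends along the trajectories by matching \<open>V - W\<close>.

  Minimality of three: by the separatrix condition the separatrices entering and leaving the
  saddle-node have a source or a sink at their other ends.

  Existence: the linear source in the plane with singular point \<open>(0, -1)\<close> becomes, under stereographic
  projection, a north-south flow on the sphere. Near the origin it is replaced by the field
  \<open>(x, y^2)\<close>.\<close>

section \<open>Integral curves of Lipschitz vector fields\<close>

text \<open>Once a smooth flow is known to be continuous, smoothness matters for uniqueness only
  through a quadratic Lyapunov function at the sink and, in reversed time, at the source.
  \<open>V\<close> is the time of entry into its sublevel set, rescaled; so the conjugacy with an
  explicit flow needs no linearisation of the sink, and the crossing times of the circle
  \<open>V = 1/2\<close> are closed formulas. The saddle-node enters only through its topological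
  chart. The obstacle is continuity of the equivalence on \<open>V = 1\<close>: for points tending
  to the trajectory from the source to the saddle-node, the crossing points with the circle need not
  converge. There compactness decides. \<open>V - W\<close> is continuous and equals
  \<open>1 - W\<close> on this set, where \<open>W\<close> is injective, so a limit of image points
  is determined by its height. Two different trajectories leave the saddle-node, hence the closed
  arc is not a single point and there is only one type of circle with an arc. In the example the
  source lies below the origin because the trajectory entering the origin in the model is the
  negative y-axis.\<close>

lemma C1_lipschitz_on_compact:
  fixes g :: "'a::euclidean_space \<Rightarrow> 'a"
  assumes g: "Ck_on (Suc 0) U g" and U: "open U" and K: "compact K" "K \<subseteq> U"
  obtains L where "L-lipschitz_on K g"
proof -
  define f' where "f' = (\<lambda>x. Blinfun (frechet_derivative g (at x)))"
  have der: "(g has_derivative blinfun_apply (f' x)) (at x)" if "x \<in> U" for x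
    using g that unfolding f'_def
    by (metis Ck_on.simps(2) bounded_linear_Blinfun_apply frechet_derivative_works has_derivative_bounded_linear)
  have "continuous_on U f'"
  proof (rule continuous_on_blinfun_componentwise)
    fix i :: 'a
    have "continuous_on U (\<lambda>x. frechet_derivative g (at x) i)" using g by simp
    moreover have "blinfun_apply (f' x) i = frechet_derivative g (at x) i" if "x \<in> U" for x
      using der[OF that] frechet_derivative_at by metis
    ultimately show "continuous_on U (\<lambda>x. blinfun_apply (f' x) i)"
      by (simp cong: continuous_on_cong)
  qed
  then have "continuous_on (UNIV \<times> U) (\<lambda>z. f' (snd z))"
    by (rule continuous_on_compose2[OF _ continuous_on_snd]) auto
  \<comment> \<open>\<open>K\<close> need not be convex (a sphere is not), so a bound on the
    derivative does not give a Lipschitz constant directly; local Lipschitz continuity and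
    compactness do.\<close>
  then have "local_lipschitz (UNIV::real set) U (\<lambda>_. g)"
    by (intro c1_implies_local_lipschitz[where f' = "\<lambda>z. f' (snd z)"]) (auto simp: der U)
  then have ll: "local_lipschitz {0::real} K (\<lambda>_. g)"
    by (rule local_lipschitz_subset) (use K in auto)
  show ?thesis
    by (rule local_lipschitz_compact_implies_lipschitz[OF ll K(1)]) (auto intro: that)
qed

text \<open>Gronwall's estimate: the squared distance, weighted by \<open>exp (- 2 * L * s)\<close>,
  does not increase. The square keeps the distance differentiable where the curves meet.\<close>

lemma integral_curves_distance:
  fixes F :: "'a::real_inner \<Rightarrow> 'a"
  assumes L: "L-lipschitz_on K F" and t: "0 \<le> t" "t \<le> T"
    and a: "\<And>s. s \<in> {0..T} \<Longrightarrow> a s \<in> K \<and> (a has_vector_derivative F (a s)) (at s within {0..T})"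
    and b: "\<And>s. s \<in> {0..T} \<Longrightarrow> b s \<in> K \<and> (b has_vector_derivative F (b s)) (at s within {0..T})"
  shows "norm (a t - b t) \<le> exp (L * t) * norm (a 0 - b 0)"
proof -
  define d where "d = (\<lambda>s. exp (- (2 * L * s)) * ((a s - b s) \<bullet> (a s - b s)))"
  have ca: "continuous_on {0..T} a"
    by (rule continuous_on_vector_derivative[of _ _ "\<lambda>s. F (a s)"]) (use a in blast)
  have cb: "continuous_on {0..T} b"
    by (rule continuous_on_vector_derivative[of _ _ "\<lambda>s. F (b s)"]) (use b in blast)
  have "d t \<le> d 0"
  proof (rule DERIV_nonpos_imp_decreasing_open[OF t(1)])
    show "continuous_on {0..t} d"
      unfolding d_def by (intro continuous_intros continuous_on_subset[OF ca] continuous_on_subset[OF cb]) (use t in auto)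
    fix s assume s: "0 < s" "s < t"
    then have sT: "s \<in> {0..T}" "at s within {0..T} = at s" using t by (auto intro: at_within_interior)
    have da: "(a has_vector_derivative F (a s)) (at s)" and db: "(b has_vector_derivative F (b s)) (at s)"
      using a[OF sT(1)] b[OF sT(1)] sT(2) by auto
    have dd: "((\<lambda>s. (a s - b s) \<bullet> (a s - b s)) has_real_derivative
        2 * ((F (a s) - F (b s)) \<bullet> (a s - b s))) (at s)"
    proof -
      have e: "((\<lambda>s. a s - b s) has_derivative (\<lambda>h. h *\<^sub>R (F (a s) - F (b s)))) (at s)"
        using has_vector_derivative_diff[OF da db] by (simp add: has_vector_derivative_def)
      show ?thesis
        unfolding has_field_derivative_def
        by (rule has_derivative_eq_rhs[OF has_derivative_inner[OF e e]]) (auto simp: fun_eq_iff inner_commute)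
    qed
    have "(d has_real_derivative - (2 * L) * exp (- (2 * L * s)) * ((a s - b s) \<bullet> (a s - b s))
       + 2 * ((F (a s) - F (b s)) \<bullet> (a s - b s)) * exp (- (2 * L * s))) (at s)"
      unfolding d_def by (rule derivative_eq_intros dd refl)+ simp
    moreover have "(F (a s) - F (b s)) \<bullet> (a s - b s) \<le> L * ((a s - b s) \<bullet> (a s - b s))"
    proof -
      have "(F (a s) - F (b s)) \<bullet> (a s - b s) \<le> norm (F (a s) - F (b s)) * norm (a s - b s)"
        by (rule norm_cauchy_schwarz)
      also have "\<dots> \<le> (L * norm (a s - b s)) * norm (a s - b s)"
        using lipschitz_on_normD[OF L] a[OF sT(1)] b[OF sT(1)] by (intro mult_right_mono) auto
      finally show ?thesis by (simp add: power2_norm_eq_inner power2_eq_square flip: power2_norm_eq_inner)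
    qed
    then have "2 * ((F (a s) - F (b s)) \<bullet> (a s - b s)) * exp (- (2 * L * s))
      \<le> 2 * (L * ((a s - b s) \<bullet> (a s - b s))) * exp (- (2 * L * s))"
      by (intro mult_right_mono) auto
    ultimately show "\<exists>y. (d has_real_derivative y) (at s) \<and> y \<le> 0"
      by (intro exI[of _ "- (2 * L) * exp (- (2 * L * s)) * ((a s - b s) \<bullet> (a s - b s))
       + 2 * ((F (a s) - F (b s)) \<bullet> (a s - b s)) * exp (- (2 * L * s))"] conjI) (simp_all add: algebra_simps)
  qed
  then have "exp (- (2 * L * t)) * (norm (a t - b t))\<^sup>2 \<le> (norm (a 0 - b 0))\<^sup>2"
    by (simp add: d_def power2_norm_eq_inner)
  then have "(norm (a t - b t))\<^sup>2 \<le> exp (2 * L * t) * (norm (a 0 - b 0))\<^sup>2"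
    by (simp add: exp_minus field_simps)
  also have "\<dots> = (exp (L * t) * norm (a 0 - b 0))\<^sup>2"
    by (simp add: power_mult_distrib algebra_simps flip: exp_of_nat_mult)
  finally show ?thesis by (simp add: power2_le_iff_abs_le)
qed

corollary integral_curves_unique:
  fixes F :: "'a::real_inner \<Rightarrow> 'a"
  assumes "L-lipschitz_on K F" "0 \<le> t" "t \<le> T"
    and "\<And>s. s \<in> {0..T} \<Longrightarrow> a s \<in> K \<and> (a has_vector_derivative F (a s)) (at s within {0..T})"
    and "\<And>s. s \<in> {0..T} \<Longrightarrow> b s \<in> K \<and> (b has_vector_derivative F (b s)) (at s within {0..T})"
    and "a 0 = b 0"
  shows "a t = b t"
  using integral_curves_distance[OF assms(1-5)] assms(6) by simp

section \<open>Flows on compact spaces\<close>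

text \<open>Only the topological data of a flow. The classification is carried out at this level,
  where a flow and its reversal have equal rights.\<close>

locale compact_flow =
  fixes M :: "'a::metric_space set" and \<phi> :: "real \<Rightarrow> 'a \<Rightarrow> 'a"
  assumes compact_M: "compact M"
    and continuous_flow: "continuous_on (UNIV \<times> M) (\<lambda>(t, x). \<phi> t x)"
    and flow_in: "x \<in> M \<Longrightarrow> \<phi> t x \<in> M"
    and flow_0: "x \<in> M \<Longrightarrow> \<phi> 0 x = x"
    and flow_add: "x \<in> M \<Longrightarrow> \<phi> (s + t) x = \<phi> s (\<phi> t x)"
begin

lemma flow_inverse: "x \<in> M \<Longrightarrow> \<phi> (- t) (\<phi> t x) = x" "x \<in> M \<Longrightarrow> \<phi> t (\<phi> (- t) x) = x"
  using flow_add[of x "- t" t] flow_add[of x t "- t"] flow_0 by auto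

lemma continuous_on_flow [continuous_intros]:
  assumes "continuous_on A f" "continuous_on A g" "\<And>x. x \<in> A \<Longrightarrow> g x \<in> M"
  shows "continuous_on A (\<lambda>x. \<phi> (f x) (g x))"
  using continuous_on_compose2[OF continuous_flow continuous_on_Pair[OF assms(1,2)]] assms(3) by auto

lemma tendsto_flow:
  assumes "(f \<longlongrightarrow> t) F" "(g \<longlongrightarrow> x) F" "x \<in> M" "\<forall>\<^sub>F i in F. g i \<in> M"
  shows "((\<lambda>i. \<phi> (f i) (g i)) \<longlongrightarrow> \<phi> t x) F"
  using continuous_on_tendsto_compose[OF continuous_flow tendsto_Pair[OF assms(1,2)]] assms(3,4) by simp

lemma reverse: "compact_flow M (\<lambda>t. \<phi> (- t))"
proof
  show "continuous_on (UNIV \<times> M) (\<lambda>(t, x). \<phi> (- t) x)"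
    unfolding case_prod_beta by (intro continuous_intros) auto
  show "\<phi> (- (s + t)) x = \<phi> (- s) (\<phi> (- t) x)" if "x \<in> M" for s t x
    using flow_add[OF that, of "- s" "- t"] by simp
qed (use compact_M flow_in flow_0 in \<open>simp_all\<close>)

end

section \<open>Time reversal\<close>

definition reverse_flow :: "(real \<Rightarrow> 'a \<Rightarrow> 'a) \<Rightarrow> real \<Rightarrow> 'a \<Rightarrow> 'a" where
  "reverse_flow \<phi> t = \<phi> (- t)"

lemma reverse_flow_reverse_flow [simp]: "reverse_flow (reverse_flow \<phi>) = \<phi>"
  by (simp add: reverse_flow_def fun_eq_iff)

lemma compact_flow_reverse: "compact_flow M \<phi> \<Longrightarrow> compact_flow M (reverse_flow \<phi>)"
  using compact_flow.reverse[of M \<phi>] by (simp add: reverse_flow_def[abs_def])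

lemma velocity_reverse_flow:
  assumes "smooth_flow M \<phi>" "x \<in> M"
  shows "velocity (reverse_flow \<phi>) x = - velocity \<phi> x"
proof -
  have "((\<lambda>t. \<phi> t x) has_vector_derivative velocity \<phi> x) (at (- 0))"
    using assms unfolding smooth_flow_def by (metis minus_zero)
  from vector_diff_chain_within[OF has_vector_derivative_minus[OF has_vector_derivative_id]
      has_vector_derivative_at_within[OF this]]
  show ?thesis
    by (auto simp: velocity_def reverse_flow_def o_def intro!: vector_derivative_at)
qed

lemma frechet_derivative_uminus:
  "f differentiable (at x) \<Longrightarrow> frechet_derivative (\<lambda>x. - f x) (at x) v = - frechet_derivative f (at x) v"
  by (metis frechet_derivative_at frechet_derivative_works has_derivative_minus)

lemma Ck_on_cong:
  assumes "open U" "\<And>x. x \<in> U \<Longrightarrow> f x = g x" "Ck_on k U f"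
  shows "Ck_on k U g"
  using assms(2,3)
proof (induction k arbitrary: f g)
  case 0
  then show ?case by (simp cong: continuous_on_cong)
next
  case (Suc k)
  have D: "(g has_derivative frechet_derivative f (at x)) (at x)" if "x \<in> U" for x
    using has_derivative_transform_within_open[OF _ assms(1) that, of f "frechet_derivative f (at x)" UNIV g]
      Suc.prems that by (auto simp: frechet_derivative_works)
  then have E: "frechet_derivative g (at x) = frechet_derivative f (at x)" if "x \<in> U" for x
    using that frechet_derivative_at by metis
  show ?case
    unfolding Ck_on.simps
  proof (intro conjI ballI allI)
    show "g differentiable at x" if "x \<in> U" for x using D[OF that] by (rule differentiableI)
    show "Ck_on k U (\<lambda>x. frechet_derivative g (at x) v)" for v
      by (rule Suc.IH[of "\<lambda>x. frechet_derivative f (at x) v"]) (use E Suc.prems in auto)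
  qed
qed

lemma Ck_on_uminus: "open U \<Longrightarrow> Ck_on k U f \<Longrightarrow> Ck_on k U (\<lambda>x. - f x)"
proof (induction k arbitrary: f)
  case (Suc k)
  then show ?case
    using Ck_on_cong[OF \<open>open U\<close>, of "\<lambda>x. - frechet_derivative f (at x) v"
        "\<lambda>x. frechet_derivative (\<lambda>x. - f x) (at x) v" k for v]
    by (auto simp: frechet_derivative_uminus)
qed (auto intro: continuous_on_minus)

lemma smooth_flow_reverse:
  assumes "smooth_flow M \<phi>"
  shows "smooth_flow M (reverse_flow \<phi>)"
proof -
  obtain U g where U: "open U" "M \<subseteq> U" "\<And>k. Ck_on k U g" "\<And>x. x \<in> M \<Longrightarrow> g x = velocity \<phi> x"
    using assms unfolding smooth_flow_def smooth_along_def by blast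
  have "smooth_along M (velocity (reverse_flow \<phi>))"
    unfolding smooth_along_def
    by (rule exI[of _ U], rule exI[of _ "\<lambda>x. - g x"])
      (use U velocity_reverse_flow[OF assms] in \<open>auto intro: Ck_on_uminus\<close>)
  moreover have "((\<lambda>t. reverse_flow \<phi> t x) has_vector_derivative velocity (reverse_flow \<phi>) (reverse_flow \<phi> t x)) (at t)"
    if "x \<in> M" for x t
  proof -
    have "((\<lambda>t. \<phi> t x) has_vector_derivative velocity \<phi> (\<phi> (- t) x)) (at (- t))"
      using assms that unfolding smooth_flow_def by auto
    from vector_diff_chain_within[OF has_vector_derivative_minus[OF has_vector_derivative_id]
        has_vector_derivative_at_within[OF this]]
    have "((\<lambda>t. \<phi> (- t) x) has_vector_derivative - velocity \<phi> (\<phi> (- t) x)) (at t)"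
      by (simp add: o_def)
    moreover have "\<phi> (- t) x \<in> M" using assms that by (auto simp: smooth_flow_def)
    ultimately show ?thesis
      using velocity_reverse_flow[OF assms] by (simp add: reverse_flow_def[abs_def])
  qed
  ultimately show ?thesis
    using assms unfolding smooth_flow_def reverse_flow_def by simp
qed

section \<open>Continuity and group law of a smooth flow\<close>

context
  fixes M :: "'a::euclidean_space set" and \<phi>
  assumes M: "compact M" and \<phi>: "smooth_flow M \<phi>"
begin

lemma smooth_flow_curve:
  "x \<in> M \<Longrightarrow> \<phi> s x \<in> M \<and> ((\<lambda>s. \<phi> s x) has_vector_derivative velocity \<phi> (\<phi> s x)) (at s within S)"
  using \<phi> unfolding smooth_flow_def by (auto intro: has_vector_derivative_at_within)

lemma smooth_flow_lipschitz:
  obtains L where "L-lipschitz_on M (velocity \<phi>)"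
proof -
  obtain U g where U: "open U" "M \<subseteq> U" "\<And>k. Ck_on k U g" "\<And>x. x \<in> M \<Longrightarrow> g x = velocity \<phi> x"
    using \<phi> unfolding smooth_flow_def smooth_along_def by blast
  obtain L where "L-lipschitz_on M g" using C1_lipschitz_on_compact[OF U(3,1) M U(2)] .
  then have "L-lipschitz_on M (velocity \<phi>)" by (rule lipschitz_on_transform) (use U in auto)
  then show ?thesis ..
qed

lemma smooth_flow_distance:
  "\<exists>L\<ge>0. \<forall>x\<in>M. \<forall>y\<in>M. \<forall>t\<ge>0. norm (\<phi> t x - \<phi> t y) \<le> exp (L * t) * norm (x - y)"
proof -
  obtain L where L: "L-lipschitz_on M (velocity \<phi>)" using smooth_flow_lipschitz .
  moreover have "norm (\<phi> t x - \<phi> t y) \<le> exp (L * t) * norm (x - y)" if "x \<in> M" "y \<in> M" "0 \<le> t" for x y t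
    using integral_curves_distance[OF L that(3) order_refl, of "\<lambda>t. \<phi> t x" "\<lambda>t. \<phi> t y"] smooth_flow_curve that \<phi>
    by (simp add: smooth_flow_def)
  ultimately show ?thesis using lipschitz_on_nonneg by blast
qed

lemma smooth_flow_unique:
  assumes "0 \<le> t" "t \<le> T" "\<gamma> 0 = x"
    and "\<And>s. s \<in> {0..T} \<Longrightarrow> \<gamma> s \<in> M \<and> (\<gamma> has_vector_derivative velocity \<phi> (\<gamma> s)) (at s within {0..T})"
  shows "\<gamma> t = \<phi> t x"
proof -
  obtain L where L: "L-lipschitz_on M (velocity \<phi>)" using smooth_flow_lipschitz .
  have "x \<in> M" using assms by force
  then show ?thesis
    using integral_curves_unique[OF L assms(1,2,4), of "\<lambda>t. \<phi> t x"] smooth_flow_curve assms(3) \<phi>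
    by (simp add: smooth_flow_def)
qed

lemma smooth_flow_add_nonneg:
  assumes "x \<in> M" "0 \<le> s"
  shows "\<phi> (s + t) x = \<phi> s (\<phi> t x)"
proof (rule smooth_flow_unique[OF assms(2) order_refl, of "\<lambda>s. \<phi> (s + t) x"])
  fix r assume "r \<in> {0..s}"
  have "((\<lambda>s. \<phi> s x) has_vector_derivative velocity \<phi> (\<phi> (r + t) x)) (at (r + t) within (\<lambda>s. s + t) ` {0..s})"
    using smooth_flow_curve[OF assms(1)] by blast
  from vector_diff_chain_within[OF has_vector_derivative_add[OF has_vector_derivative_id has_vector_derivative_const] this]
  show "\<phi> (r + t) x \<in> M \<and> ((\<lambda>s. \<phi> (s + t) x) has_vector_derivative velocity \<phi> (\<phi> (r + t) x)) (at r within {0..s})"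
    using smooth_flow_curve[OF assms(1)] by (simp add: o_def)
qed simp

end

text \<open>For nonnegative \<open>s\<close> both sides are integral curves in \<open>s\<close> with
  the same start. Uniqueness is stated forward in time, so negative \<open>s\<close> is handled in
  the reversed flow.\<close>

lemma smooth_flow_add:
  fixes M :: "'a::euclidean_space set"
  assumes "compact M" "smooth_flow M \<phi>" "x \<in> M"
  shows "\<phi> (s + t) x = \<phi> s (\<phi> t x)"
proof (cases "0 \<le> s")
  case False
  have "reverse_flow \<phi> (- s + - t) x = reverse_flow \<phi> (- s) (reverse_flow \<phi> (- t) x)"
    by (rule smooth_flow_add_nonneg[OF assms(1) smooth_flow_reverse]) (use assms False in auto)
  then show ?thesis by (simp add: reverse_flow_def add.commute)
qed (rule smooth_flow_add_nonneg[OF assms])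

text \<open>Joint continuity follows from continuity in \<open>t\<close> and a Lipschitz bound in
  \<open>x\<close> that is locally uniform in \<open>t\<close>. The constant \<open>L + L'\<close>
  serves both signs of time at once, one summand coming from the flow and the other from its
  reversal.\<close>

lemma smooth_flow_compact_flow:
  fixes M :: "'a::euclidean_space set"
  assumes "compact M" "smooth_flow M \<phi>"
  shows "compact_flow M \<phi>"
proof
  obtain L where L: "0 \<le> L" "\<forall>x\<in>M. \<forall>y\<in>M. \<forall>t\<ge>0. norm (\<phi> t x - \<phi> t y) \<le> exp (L * t) * norm (x - y)"
    using smooth_flow_distance[OF assms] by blast
  obtain L' where L': "0 \<le> L'" "\<forall>x\<in>M. \<forall>y\<in>M. \<forall>t\<ge>0.
      norm (reverse_flow \<phi> t x - reverse_flow \<phi> t y) \<le> exp (L' * t) * norm (x - y)"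
    using smooth_flow_distance[OF assms(1) smooth_flow_reverse[OF assms(2)]] by blast
  have est: "norm (\<phi> t x - \<phi> t y) \<le> exp ((L + L') * \<bar>t\<bar>) * norm (x - y)" if "x \<in> M" "y \<in> M" for x y t
  proof (cases "0 \<le> t")
    case True
    then have "norm (\<phi> t x - \<phi> t y) \<le> exp (L * t) * norm (x - y)" using L(2) that by blast
    also have "exp (L * t) \<le> exp ((L + L') * \<bar>t\<bar>)" using True L'(1) by (simp add: algebra_simps)
    finally show ?thesis by (simp add: mult_right_mono)
  next
    case False
    then have "norm (reverse_flow \<phi> (- t) x - reverse_flow \<phi> (- t) y) \<le> exp (L' * - t) * norm (x - y)"
      using L'(2)[rule_format, OF that, of "- t"] by simp
    also have "exp (L' * - t) \<le> exp ((L + L') * \<bar>t\<bar>)"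
      using False L(1) mult_nonneg_nonneg[of L "- t"] by (simp add: algebra_simps)
    finally show ?thesis by (simp add: mult_right_mono reverse_flow_def)
  qed
  have "local_lipschitz UNIV M \<phi>"
  proof (rule local_lipschitzI)
    fix t :: real and x assume "x \<in> M"
    have "(exp ((L + L') * (\<bar>t\<bar> + 1)))-lipschitz_on (cball x 1 \<inter> M) (\<phi> s)" if "s \<in> cball t 1" for s
    proof (rule lipschitz_onI)
      fix y z assume yz: "y \<in> cball x 1 \<inter> M" "z \<in> cball x 1 \<inter> M"
      have "norm (\<phi> s y - \<phi> s z) \<le> exp ((L + L') * \<bar>s\<bar>) * norm (y - z)"
        using est[of y z s] yz by simp
      also have "exp ((L + L') * \<bar>s\<bar>) \<le> exp ((L + L') * (\<bar>t\<bar> + 1))"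
        using that L(1) L'(1) by (auto simp: dist_real_def intro!: mult_left_mono)
      finally show "dist (\<phi> s y) (\<phi> s z) \<le> exp ((L + L') * (\<bar>t\<bar> + 1)) * dist y z"
        unfolding dist_norm by (simp add: mult_right_mono)
    qed simp
    then show "\<exists>u>0. \<exists>K. \<forall>s\<in>cball t u \<inter> UNIV. K-lipschitz_on (cball x u \<inter> M) (\<phi> s)"
      using zero_less_one by blast
  qed
  moreover have "continuous_on UNIV (\<lambda>t. \<phi> t x)" if "x \<in> M" for x
    using smooth_flow_curve[OF assms that]
    by (auto intro!: continuous_on_vector_derivative[of _ _ "\<lambda>t. velocity \<phi> (\<phi> t x)"])
  ultimately show "continuous_on (UNIV \<times> M) (\<lambda>(t, x). \<phi> t x)"
    by (rule continuous_on_TimesI)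
  show "\<phi> (s + t) x = \<phi> s (\<phi> t x)" if "x \<in> M" for s t x
    by (rule smooth_flow_add[OF assms that])
  show "\<phi> t x \<in> M" if "x \<in> M" for t x using smooth_flow_curve[OF assms that] by blast
  show "\<phi> 0 x = x" if "x \<in> M" for x using assms(2) that unfolding smooth_flow_def by blast
qed (rule assms)

text \<open>The counterpart of \<open>flows_to\<close> for a given global flow: by uniqueness of
  integral curves the curve in \<open>flows_to\<close> can only be the trajectory itself, which
  makes charts accessible to \<open>compact_flow\<close> arguments.\<close>

definition orbit_arc_in :: "(real \<Rightarrow> 'a \<Rightarrow> 'a) \<Rightarrow> 'a set \<Rightarrow> 'a \<Rightarrow> 'a \<Rightarrow> bool" where
  "orbit_arc_in \<phi> U x y \<longleftrightarrow> (\<exists>T\<ge>0. \<phi> T x = y \<and> (\<forall>t\<in>{0..T}. \<phi> t x \<in> U))"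

lemma flows_to_iff_orbit_arc:
  fixes M :: "'a::euclidean_space set"
  assumes "compact M" "smooth_flow M \<phi>" "U \<subseteq> M" "x \<in> U"
  shows "flows_to (velocity \<phi>) U x y \<longleftrightarrow> orbit_arc_in \<phi> U x y"
proof
  assume "flows_to (velocity \<phi>) U x y"
  then obtain T \<gamma> where g: "T \<ge> 0" "\<gamma> 0 = x" "\<gamma> T = y"
    "\<And>t. t \<in> {0..T} \<Longrightarrow> \<gamma> t \<in> U \<and> (\<gamma> has_vector_derivative velocity \<phi> (\<gamma> t)) (at t within {0..T})"
    unfolding flows_to_def by blast
  have "\<gamma> t = \<phi> t x" if "t \<in> {0..T}" for t
    by (rule smooth_flow_unique[where T = T]) (use that g assms in auto)
  then have "\<phi> T x = y \<and> (\<forall>t\<in>{0..T}. \<phi> t x \<in> U)" using g by (metis atLeastAtMost_iff order_refl)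
  then show "orbit_arc_in \<phi> U x y"
    unfolding orbit_arc_in_def using g(1) by blast
next
  assume "orbit_arc_in \<phi> U x y"
  then obtain T where T: "T \<ge> 0" "\<phi> T x = y" "\<forall>t\<in>{0..T}. \<phi> t x \<in> U"
    unfolding orbit_arc_in_def by blast
  have "x \<in> M" using assms by auto
  then have "\<phi> 0 x = x" using assms(2) unfolding smooth_flow_def by blast
  moreover have "\<forall>t\<in>{0..T}. \<phi> t x \<in> U \<and> ((\<lambda>t. \<phi> t x) has_vector_derivative velocity \<phi> (\<phi> t x)) (at t within {0..T})"
    using T(3) smooth_flow_curve[OF assms(1,2) \<open>x \<in> M\<close>] by blast
  ultimately show "flows_to (velocity \<phi>) U x y"
    unfolding flows_to_def
    by (intro exI[of _ T] conjI T(1) exI[of _ "\<lambda>t. \<phi> t x"] T(2))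
qed

lemma (in compact_flow) orbit_arc_in_reverse:
  assumes "x \<in> M"
  shows "orbit_arc_in \<phi> U x y \<Longrightarrow> orbit_arc_in (reverse_flow \<phi>) U y x"
proof -
  assume "orbit_arc_in \<phi> U x y"
  then obtain T where T: "T \<ge> 0" "\<phi> T x = y" "\<forall>t\<in>{0..T}. \<phi> t x \<in> U" unfolding orbit_arc_in_def by blast
  have "\<phi> (- t) y = \<phi> (T - t) x" for t using flow_add[OF assms, of "- t" T] T(2) by simp
  then show ?thesis
    unfolding orbit_arc_in_def reverse_flow_def using T flow_0[OF assms] by (intro exI[of _ T]) auto
qed

section \<open>Basin functions\<close>

text \<open>The logistic flow $v' = -v (1 - v)$ on the unit interval.\<close>

definition lgs :: "real \<Rightarrow> real \<Rightarrow> real" where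
  "lgs t v = v / (v + exp t * (1 - v))"

lemma lgs_denominator_pos: "0 \<le> (v::real) \<Longrightarrow> v \<le> 1 \<Longrightarrow> 0 < v + exp t * (1 - v)"
  by (cases "v = 0") (auto intro: add_pos_nonneg)

lemma lgs_simps [simp]: "lgs t 0 = 0" "lgs t 1 = 1" "lgs 0 v = v" "lgs t (1/2) = 1 / (1 + exp t)"
  by (auto simp: lgs_def field_simps)

lemma lgs_bounds: "0 \<le> v \<Longrightarrow> v \<le> 1 \<Longrightarrow> 0 \<le> lgs t v \<and> lgs t v \<le> 1"
  using lgs_denominator_pos[of v t] by (simp add: lgs_def)

lemma lgs_eq_0_iff: "0 \<le> v \<Longrightarrow> v \<le> 1 \<Longrightarrow> lgs t v = 0 \<longleftrightarrow> v = 0"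
  using lgs_denominator_pos[of v t] by (simp add: lgs_def)

lemma lgs_eq_1_iff: "0 \<le> v \<Longrightarrow> v \<le> 1 \<Longrightarrow> lgs t v = 1 \<longleftrightarrow> v = 1"
  using lgs_denominator_pos[of v t] by (auto simp: lgs_def divide_eq_1_iff)

text \<open>The reflection of the interval exchanges the two equilibria and reverses time. It turns
  the law of \<open>W\<close>, which holds in reversed time, into a forward law for
  \<open>1 - W\<close>.\<close>

lemma lgs_complement: "0 \<le> v \<Longrightarrow> v \<le> 1 \<Longrightarrow> lgs (- t) v = 1 - lgs t (1 - v)"
  using lgs_denominator_pos[of v "- t"] lgs_denominator_pos[of "1 - v" t]
  by (simp add: lgs_def exp_minus field_simps)

lemma lgs_lgs:
  assumes "0 \<le> v" "v \<le> 1"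
  shows "lgs s (lgs t v) = lgs (s + t) v"
proof -
  define D where "D = v + exp t * (1 - v)"
  have D: "D > 0" using lgs_denominator_pos assms by (simp add: D_def)
  have "1 - v / D = exp t * (1 - v) / D" using D by (simp add: D_def field_simps)
  then have "lgs s (v / D) = (v / D) / ((v + exp (s + t) * (1 - v)) / D)"
    by (simp add: lgs_def exp_add add_divide_distrib mult.assoc)
  also have "\<dots> = lgs (s + t) v" using D by (simp add: lgs_def)
  finally show ?thesis by (simp add: lgs_def D_def)
qed

lemma lgs_strict_decreasing: "0 < v \<Longrightarrow> v < 1 \<Longrightarrow> s < t \<Longrightarrow> lgs t v < lgs s v"
  unfolding lgs_def using lgs_denominator_pos[of v s] by (intro divide_strict_left_mono mult_pos_pos) (auto intro: add_pos_pos)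

lemma lgs_decreasing: "0 \<le> v \<Longrightarrow> v \<le> 1 \<Longrightarrow> s \<le> t \<Longrightarrow> lgs t v \<le> lgs s v"
  using lgs_strict_decreasing[of v s t] by (cases "v = 0"; cases "v = 1"; cases "s = t") auto

lemma continuous_on_lgs [continuous_intros]:
  assumes "continuous_on A f" "continuous_on A g" "\<And>x. x \<in> A \<Longrightarrow> 0 \<le> g x \<and> g x \<le> 1"
  shows "continuous_on A (\<lambda>x. lgs (f x) (g x))"
proof -
  have "g x + exp (f x) * (1 - g x) \<noteq> 0" if "x \<in> A" for x
    using lgs_denominator_pos[of "g x" "f x"] assms(3)[OF that] by linarith
  then show ?thesis unfolding lgs_def by (intro continuous_intros assms(1,2)) auto
qed

lemma lgs_tendsto_0:
  assumes "0 \<le> v" "v < 1"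
  shows "((\<lambda>t. lgs t v) \<longlongrightarrow> 0) at_top"
proof -
  have "filterlim (\<lambda>t. v + exp t * (1 - v)) at_top at_top"
    by (rule filterlim_tendsto_add_at_top[OF tendsto_const])
      (use assms in \<open>auto intro!: filterlim_at_top_mult_tendsto_pos[OF tendsto_const] exp_at_top\<close>)
  then show ?thesis
    unfolding lgs_def by (intro tendsto_divide_0[OF tendsto_const] filterlim_at_top_imp_at_infinity)
qed

lemma lgs_tendsto_1:
  assumes "0 < v" "v \<le> 1"
  shows "((\<lambda>t. lgs t v) \<longlongrightarrow> 1) at_bot"
proof -
  have "((\<lambda>t. 1 - lgs t (1 - v)) \<longlongrightarrow> 1 - 0) at_top"
    by (intro tendsto_intros lgs_tendsto_0) (use assms in auto)
  moreover have "(\<lambda>t. lgs (- t) v) = (\<lambda>t. 1 - lgs t (1 - v))"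
    using lgs_complement[of v] assms by (auto simp: fun_eq_iff)
  ultimately show ?thesis by (simp add: filterlim_at_bot_mirror)
qed

lemma lgs_eq_half: "0 < v \<Longrightarrow> v < 1 \<Longrightarrow> lgs (ln (v / (1 - v))) v = 1/2"
  by (simp add: lgs_def field_simps)

text \<open>Off any ball about \<open>k\<close> the continuous function
  \<open>\<bar>f x\<bar>\<close> has a positive minimum by compactness.\<close>

lemma compact_tendsto_unique_zero:
  fixes f :: "'a::metric_space \<Rightarrow> real"
  assumes "compact M" "continuous_on M f" "k \<in> M" "\<And>x. x \<in> M \<Longrightarrow> f x = 0 \<Longrightarrow> x = k"
    and "((\<lambda>t. f (u t)) \<longlongrightarrow> 0) F" "\<forall>\<^sub>F t in F. u t \<in> M"
  shows "(u \<longlongrightarrow> k) F"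
proof (rule tendstoI)
  fix e :: real assume e: "e > 0"
  have K: "compact (M - ball k e)" using assms(1) by (intro compact_diff) auto
  have "\<exists>m>0. \<forall>x\<in>M - ball k e. m \<le> \<bar>f x\<bar>"
  proof (cases "M - ball k e = {}")
    case False
    have "continuous_on (M - ball k e) (\<lambda>x. \<bar>f x\<bar>)"
      by (intro continuous_intros continuous_on_subset[OF assms(2)]) auto
    from continuous_attains_inf[OF K False this] obtain x
      where x: "x \<in> M - ball k e" "\<forall>y\<in>M - ball k e. \<bar>f x\<bar> \<le> \<bar>f y\<bar>" by blast
    have "f x \<noteq> 0" using assms(4)[of x] x(1) e by auto
    then show ?thesis using x by (intro exI[of _ "\<bar>f x\<bar>"]) auto
  qed (auto intro: exI[of _ 1])
  then obtain m where m: "m > 0" "\<And>x. x \<in> M - ball k e \<Longrightarrow> m \<le> \<bar>f x\<bar>" by blast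
  have "\<forall>\<^sub>F t in F. \<bar>f (u t)\<bar> < m"
    using tendstoD[OF assms(5) m(1)] by (simp add: dist_real_def)
  with assms(6) show "\<forall>\<^sub>F t in F. dist (u t) k < e"
  proof eventually_elim
    case (elim t)
    then have "u t \<in> ball k e" using m(2)[of "u t"] by force
    then show ?case by (simp add: dist_commute)
  qed
qed

lemma compact_tendsto_unique_cluster_point:
  fixes u :: "nat \<Rightarrow> 'a::metric_space"
  assumes "compact M" "\<And>n. u n \<in> M"
    and "\<And>r l. strict_mono r \<Longrightarrow> (u \<circ> r) \<longlonglongrightarrow> l \<Longrightarrow> l \<in> M \<Longrightarrow> l = y"
  shows "u \<longlonglongrightarrow> y"
proof (rule ccontr)
  assume "\<not> u \<longlonglongrightarrow> y"
  then obtain e where e: "e > 0" "\<not> (\<forall>\<^sub>F n in sequentially. dist (u n) y < e)"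
    unfolding tendsto_iff by blast
  obtain r :: "nat \<Rightarrow> nat" where r: "strict_mono r" "\<And>n. \<not> dist (u (r n)) y < e"
    using not_eventually_sequentiallyD[OF e(2)] by blast
  have "\<forall>n. (u \<circ> r) n \<in> M" using assms(2) by simp
  then obtain l r' where l: "l \<in> M" "strict_mono r'" "((u \<circ> r) \<circ> r') \<longlonglongrightarrow> l"
    using assms(1) unfolding compact_def by blast
  have "(u \<circ> (r \<circ> r')) \<longlonglongrightarrow> l" using l(3) by (simp add: o_assoc)
  then have "l = y" using assms(3)[of "r \<circ> r'" l] r(1) l(1,2) strict_mono_o by blast
  then have "\<forall>\<^sub>F n in sequentially. dist (((u \<circ> r) \<circ> r') n) y < e" using l(3) e(1) tendstoD by blast
  then show False using r(2) by (auto simp: eventually_sequentially)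
qed

text \<open>The basin of \<open>k\<close> is \<open>V < 1\<close> and its complement is
  \<open>V = 1\<close>. In place of the usual Lyapunov inequality an exact law of motion is
  demanded, although \<open>V\<close> is merely continuous; times can then be computed from values
  of \<open>V\<close>.\<close>

locale basin = compact_flow M \<phi> for M :: "'a::metric_space set" and \<phi> +
  fixes k :: 'a and V :: "'a \<Rightarrow> real"
  assumes continuous_V: "continuous_on M V"
    and V_bounds: "x \<in> M \<Longrightarrow> 0 \<le> V x \<and> V x \<le> 1"
    and attractor_in: "k \<in> M"
    and V_eq_0_iff: "x \<in> M \<Longrightarrow> V x = 0 \<longleftrightarrow> x = k"
    and V_flow: "x \<in> M \<Longrightarrow> V (\<phi> t x) = lgs t (V x)"
begin

definition core :: "'a set" where "core = {x \<in> M. 0 < V x \<and> V x < 1}"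
definition section_circle :: "'a set" where "section_circle = {x \<in> M. V x = 1/2}"
text \<open>The solution \<open>t\<close> of \<open>lgs t (V x) = 1/2\<close>; meaningful on
  \<open>core\<close>, the punctured basin.\<close>

definition crossing_time :: "'a \<Rightarrow> real" where "crossing_time x = ln (V x / (1 - V x))"
definition crossing :: "'a \<Rightarrow> 'a" where "crossing x = \<phi> (crossing_time x) x"

lemma core_in: "x \<in> core \<Longrightarrow> x \<in> M"
  by (simp add: core_def)

lemma section_circle_core: "section_circle \<subseteq> core"
  by (auto simp: section_circle_def core_def)

lemma V_cases:
  assumes "x \<in> M" obtains "x = k" | "x \<in> core" | "V x = 1"
  using V_bounds[OF assms] V_eq_0_iff[OF assms] assms by (fastforce simp: core_def)

lemma attractor_fixed: "\<phi> t k = k"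
  using V_eq_0_iff[of "\<phi> t k"] V_flow[of k t] V_eq_0_iff[of k] attractor_in flow_in by simp

lemma fixed_point_V:
  assumes "x \<in> M" "\<And>t. \<phi> t x = x" "x \<noteq> k"
  shows "V x = 1"
proof (rule V_cases[OF assms(1)])
  assume "x \<in> core"
  then have "lgs 1 (V x) < lgs 0 (V x)" by (intro lgs_strict_decreasing) (auto simp: core_def)
  then show ?thesis using V_flow[OF assms(1), of 1] assms(2) by simp
qed (use assms in auto)

lemma flow_core: "x \<in> core \<Longrightarrow> \<phi> t x \<in> core"
  using V_flow[of x t] lgs_bounds[of "V x" t] lgs_eq_0_iff[of "V x" t] lgs_eq_1_iff[of "V x" t] flow_in[of x t]
  by (auto simp: core_def less_le)

lemma tendsto_attractor_iff:
  assumes "x \<in> M"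
  shows "((\<lambda>t. \<phi> t x) \<longlongrightarrow> k) at_top \<longleftrightarrow> V x < 1"
proof
  assume lim: "((\<lambda>t. \<phi> t x) \<longlongrightarrow> k) at_top"
  have "((\<lambda>t. V (\<phi> t x)) \<longlongrightarrow> V k) at_top"
    by (rule continuous_on_tendsto_compose[OF continuous_V lim attractor_in]) (simp add: flow_in assms)
  moreover have "V k = 0" using V_eq_0_iff attractor_in by blast
  ultimately have lim: "((\<lambda>t. lgs t (V x)) \<longlongrightarrow> 0) at_top" by (simp add: V_flow assms)
  have "V x \<noteq> 1"
  proof
    assume "V x = 1"
    then have "((\<lambda>t::real. 1::real) \<longlongrightarrow> 0) at_top" using lim by simp
    then show False by (simp add: tendsto_const_iff)
  qed
  then show "V x < 1" using V_bounds[OF assms] by simp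
next
  assume "V x < 1"
  then have "((\<lambda>t. V (\<phi> t x)) \<longlongrightarrow> 0) at_top"
    using lgs_tendsto_0[of "V x"] V_bounds assms by (simp add: V_flow)
  then show "((\<lambda>t. \<phi> t x) \<longlongrightarrow> k) at_top"
    using compact_tendsto_unique_zero[OF compact_M continuous_V attractor_in, of "\<lambda>t. \<phi> t x" at_top] V_eq_0_iff flow_in assms by simp
qed

lemma crossing_in: "x \<in> core \<Longrightarrow> crossing x \<in> section_circle"
  unfolding crossing_def crossing_time_def section_circle_def core_def
  using V_flow flow_in lgs_eq_half by auto

lemma flow_crossing: "x \<in> core \<Longrightarrow> \<phi> (- crossing_time x) (crossing x) = x"
  unfolding crossing_def using flow_inverse(1) core_in by blast

text \<open>A trajectory meets the circle only once, since \<open>lgs u (1/2) = 1/2\<close> forces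
  \<open>u = 0\<close>.\<close>

lemma crossing_eqI:
  assumes "c \<in> section_circle" "x = \<phi> t c"
  shows "crossing x = c"
proof -
  have cM: "c \<in> M" and Vc: "V c = 1/2" using assms(1) by (auto simp: section_circle_def)
  have x: "x \<in> core" using assms section_circle_core flow_core by blast
  let ?s = "crossing_time x + t"
  have eq: "crossing x = \<phi> ?s c" unfolding crossing_def using flow_add[OF cM] assms(2) by simp
  then have "lgs ?s (1/2) = 1/2"
    using crossing_in[OF x] V_flow[OF cM, of ?s] Vc by (simp add: section_circle_def)
  then have "exp ?s = 1" by (simp add: add_pos_pos field_simps)
  then have "?s = 0" by simp
  then show ?thesis using eq flow_0[OF cM] by metis
qed

lemma continuous_on_crossing_time: "continuous_on core crossing_time"
  unfolding crossing_time_def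
  by (intro continuous_intros continuous_on_subset[OF continuous_V]) (auto simp: core_def)

lemma continuous_on_crossing: "continuous_on core crossing"
  unfolding crossing_def
  by (intro continuous_on_flow continuous_on_crossing_time continuous_intros) (auto simp: core_def)

lemma core_open_in_M: "openin (top_of_set M) core"
proof -
  have "core = M \<inter> V -` {0<..<1}" by (auto simp: core_def)
  then show ?thesis using continuous_openin_preimage_gen[OF continuous_V] by auto
qed

end

section \<open>Topological classification\<close>

text \<open>On \<^term>\<open>{x \<in> M. V x = 1}\<close> we shall have the source, the saddle-node
  and the trajectory between them.\<close>

locale sn_system = A: basin M \<phi> k V + B: basin M "reverse_flow \<phi>" s W
  for M :: "'a::metric_space set" and \<phi> k V s W +
  assumes W_inj: "inj_on W {x \<in> M. V x = 1}"
    and W_surj: "{0..1} \<subseteq> W ` {x \<in> M. V x = 1}"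
begin

text \<open>Its value is 1 at the source, -1 at the sink, and 0 where \<open>V\<close> and
  \<open>W\<close> are both 1, which is the saddle-node. Each of \<open>V\<close> and
  \<open>W\<close> alone is constant along some nonconstant trajectories.\<close>

definition height :: "'a \<Rightarrow> real" where "height x = V x - W x"

lemma continuous_on_height: "continuous_on M height"
  unfolding height_def by (intro continuous_intros A.continuous_V B.continuous_V)

lemma W_flow: "x \<in> M \<Longrightarrow> W (\<phi> t x) = lgs (- t) (W x)"
  using B.V_flow[of x "- t"] by (simp add: reverse_flow_def)

lemma V_source: "V s = 1"
proof -
  obtain x where "x \<in> M" "V x = 1" "W x = 0" using W_surj by force
  then show ?thesis using B.V_eq_0_iff by metis
qed

lemma W_attractor: "W k = 1"
proof (rule B.fixed_point_V[OF A.attractor_in])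
  show "reverse_flow \<phi> t k = k" for t by (simp add: reverse_flow_def A.attractor_fixed)
  show "k \<noteq> s" using V_source A.V_eq_0_iff[OF A.attractor_in] by auto
qed

lemma W_core_pos: "x \<in> A.core \<Longrightarrow> 0 < W x"
  using B.V_eq_0_iff[of x] B.V_bounds[of x] V_source by (fastforce simp: A.core_def)

lemma height_flow:
  assumes "x \<in> M"
  shows "height (\<phi> t x) = lgs t (V x) + lgs t (1 - W x) - 1"
  unfolding height_def using A.V_flow[OF assms] W_flow[OF assms] lgs_complement[of "W x" t] B.V_bounds[OF assms] by simp

lemma height_decreasing:
  assumes "x \<in> A.core" "t < u"
  shows "height (\<phi> u x) < height (\<phi> t x)"
proof -
  have x: "x \<in> M" "0 < V x" "V x < 1" using assms by (auto simp: A.core_def)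
  show ?thesis
    using lgs_strict_decreasing[OF x(2,3) assms(2)] lgs_decreasing[of "1 - W x" t u] B.V_bounds[OF x(1)] assms(2)
    by (simp add: height_flow x(1))
qed

lemma height_inj: "x \<in> A.core \<Longrightarrow> height (\<phi> t x) = height (\<phi> u x) \<Longrightarrow> t = u"
  using height_decreasing[of x t u] height_decreasing[of x u t] by (cases t u rule: linorder_cases) auto

lemma height_less_iff: "x \<in> A.core \<Longrightarrow> height (\<phi> u x) < height (\<phi> t x) \<longleftrightarrow> t < u"
  using height_decreasing[of x t u] height_decreasing[of x u t] by (cases t u rule: linorder_cases) auto

lemma height_eq_m1: "x \<in> M \<Longrightarrow> height x = - 1 \<Longrightarrow> x = k"
  using A.V_bounds[of x] B.V_bounds[of x] A.V_eq_0_iff[of x] by (simp add: height_def)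

end

text \<open>Here \<open>a\<close> and \<open>b\<close> stand for \<open>1 - W\<close> at the points
  where two trajectories cross their circles. A trajectory from the source has heights filling the
  interval from -1 to 1, one from the saddle-node (\<open>a = 0\<close>) only the interval from -1
  to 0. Heights can be matched between trajectories of the same kind; the last disjunct singles out
  the mixed case.\<close>

lemma lgs_height_surj:
  assumes "0 \<le> a" "a < 1" "0 \<le> b" "b < 1"
  shows "\<exists>u. lgs u (1/2) + lgs u b - 1 = lgs t (1/2) + lgs t a - 1 \<or> (a = 0 \<longleftrightarrow> b \<noteq> 0)"
proof (cases "a = 0 \<or> b = 0")
  case True
  then show ?thesis by (intro exI[of _ t]) auto
next
  case False
  then have ab: "0 < a" "a < 1" "0 < b" "b < 1" using assms by auto
  define f where "f = (\<lambda>u. lgs u (1/2) + lgs u b - 1)"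
  define y where "y = lgs t (1/2) + lgs t a - 1"
  have a1: "0 < lgs t a" "lgs t a < 1"
    using lgs_bounds[of a t] lgs_eq_0_iff[of a t] lgs_eq_1_iff[of a t] ab by (auto simp: less_le)
  have h1: "0 < lgs t (1/2)" "lgs t (1/2) < 1" by (auto simp: add_pos_pos)
  have top: "(f \<longlongrightarrow> 0 + 0 - 1) at_top" and bot: "(f \<longlongrightarrow> 1 + 1 - 1) at_bot"
    unfolding f_def using ab by (intro tendsto_intros lgs_tendsto_0 lgs_tendsto_1; simp)+
  have "\<forall>\<^sub>F u in at_top. f u < y" by (rule order_tendstoD(2)[OF top]) (use a1 h1 in \<open>unfold y_def, linarith\<close>)
  moreover have "\<forall>\<^sub>F u in at_bot. y < f u" by (rule order_tendstoD(1)[OF bot]) (use a1 h1 in \<open>unfold y_def, linarith\<close>)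
  ultimately obtain p q where pq: "f p < y" "y < f q"
    by (meson eventually_happens trivial_limit_at_bot_linorder trivial_limit_at_top_linorder)
  have "continuous_on UNIV f" unfolding f_def by (intro continuous_intros) (use ab in auto)
  then have "connected (range f)" using connected_continuous_image connected_UNIV by blast
  then have "y \<in> range f" using connectedD_interval[of "range f" "f p" "f q" y] pq by auto
  then show ?thesis by (auto simp: f_def y_def)
qed

text \<open>On the circle \<open>W = 1\<close> marks the trajectories that do not come from the
  source, so \<open>g_W\<close> says that \<open>g\<close> respects the arcs; by the previous lemma
  this is what matching heights requires.\<close>

locale sn_pair = S: sn_system M \<phi> k V s W + S': sn_system M \<psi> k' V' s' W'
  for M :: "'a::metric_space set" and \<phi> k V s W \<psi> k' V' s' W' +
  fixes g g'
  assumes hom: "homeomorphism {x \<in> M. V x = 1/2} {x \<in> M. V' x = 1/2} g g'"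
    and g_W: "c \<in> M \<Longrightarrow> V c = 1/2 \<Longrightarrow> W' (g c) = 1 \<longleftrightarrow> W c = 1"
begin

lemma g_section: "c \<in> S.A.section_circle \<Longrightarrow> g c \<in> S'.A.section_circle"
  "c \<in> S.A.section_circle \<Longrightarrow> g' (g c) = c"
  "c' \<in> S'.A.section_circle \<Longrightarrow> g (g' c') = c'"
  "c' \<in> S'.A.section_circle \<Longrightarrow> g' c' \<in> S.A.section_circle"
  using hom unfolding homeomorphism_def S.A.section_circle_def S'.A.section_circle_def by blast+

lemma swap: "sn_pair M \<psi> k' V' s' W' \<phi> k V s W g' g"
proof (intro sn_pair.intro sn_pair_axioms.intro)
  show "sn_system M \<psi> k' V' s' W'" "sn_system M \<phi> k V s W" by unfold_locales
  show "homeomorphism {x \<in> M. V' x = 1/2} {x \<in> M. V x = 1/2} g' g" using hom homeomorphism_sym by blast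
  show "W (g' c) = 1 \<longleftrightarrow> W' c = 1" if "c \<in> M" "V' c = 1/2" for c
    using g_W[of "g' c"] g_section(3,4)[of c] that by (simp add: S.A.section_circle_def S'.A.section_circle_def)
qed

text \<open>The graph of the future equivalence, given as a relation because in this form it is
  symmetric in the two flows: every fact about the inverse map is the same fact in the swapped
  locale. On \<open>V = 1\<close> no trajectory crosses the circle, and points are matched by
  \<open>W\<close> instead.\<close>

definition rel :: "'a \<Rightarrow> 'a \<Rightarrow> bool" where
  "rel x y \<longleftrightarrow> x = k \<and> y = k' \<or>
     x \<in> M \<and> y \<in> M \<and> V x = 1 \<and> V' y = 1 \<and> W x = W' y \<or>
     x \<in> S.A.core \<and> y \<in> S'.A.core \<and> g (S.A.crossing x) = S'.A.crossing y \<and> S.height x = S'.height y"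

lemma rel_swap: "rel x y \<longleftrightarrow> sn_pair.rel M \<psi> k' V' W' \<phi> k V W g' y x"
proof -
  interpret sw: sn_pair M \<psi> k' V' s' W' \<phi> k V s W g' g by (rule swap)
  have "g (S.A.crossing x) = S'.A.crossing y \<longleftrightarrow> g' (S'.A.crossing y) = S.A.crossing x"
    if "x \<in> S.A.core" "y \<in> S'.A.core"
    using g_section(2,3) S.A.crossing_in[OF that(1)] S'.A.crossing_in[OF that(2)] by metis
  then show ?thesis unfolding rel_def sw.rel_def by auto
qed

lemma rel_in: "rel x y \<Longrightarrow> x \<in> M \<and> y \<in> M"
  unfolding rel_def using S.A.attractor_in S'.A.attractor_in S.A.core_in S'.A.core_in by blast

lemma rel_height: "rel x y \<Longrightarrow> S.height x = S'.height y"
  unfolding rel_def using S.W_attractor S'.W_attractor S.A.V_eq_0_iff[OF S.A.attractor_in]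
    S'.A.V_eq_0_iff[OF S'.A.attractor_in] by (auto simp: S.height_def S'.height_def)

lemma rel_core: "rel x y \<Longrightarrow> x \<in> S.A.core \<Longrightarrow>
    y \<in> S'.A.core \<and> g (S.A.crossing x) = S'.A.crossing y \<and> S.height x = S'.height y"
  unfolding rel_def using S.A.V_eq_0_iff[OF S.A.attractor_in] by (auto simp: S.A.core_def)

lemma orbit_rel_ex:
  assumes c: "c \<in> S.A.section_circle"
  shows "\<exists>u. rel (\<phi> t c) (\<psi> u (g c))"
proof -
  have c': "g c \<in> S'.A.section_circle" using g_section(1)[OF c] .
  have core: "c \<in> S.A.core" "g c \<in> S'.A.core" using c c' S.A.section_circle_core S'.A.section_circle_core by auto
  have M: "c \<in> M" "g c \<in> M" "V c = 1/2" "V' (g c) = 1/2"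
    using c c' by (auto simp: S.A.section_circle_def S'.A.section_circle_def)
  have "0 < W c" "0 < W' (g c)" "W c \<le> 1" "W' (g c) \<le> 1"
    using S.W_core_pos S'.W_core_pos core S.B.V_bounds S'.B.V_bounds M by auto
  then obtain u where "lgs u (1/2) + lgs u (1 - W' (g c)) - 1 = lgs t (1/2) + lgs t (1 - W c) - 1"
    using lgs_height_surj[of "1 - W c" "1 - W' (g c)" t] g_W[OF M(1,3)] by auto
  then have "S.height (\<phi> t c) = S'.height (\<psi> u (g c))"
    using S.height_flow[OF M(1), of t] S'.height_flow[OF M(2), of u] M by simp
  then have "rel (\<phi> t c) (\<psi> u (g c))"
    unfolding rel_def using S.A.flow_core[OF core(1)] S'.A.flow_core[OF core(2)]
      S.A.crossing_eqI[OF c refl] S'.A.crossing_eqI[OF c' refl] by auto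
  then show ?thesis ..
qed

lemma rel_ex: assumes "x \<in> M" shows "\<exists>y. rel x y"
proof (rule S.A.V_cases[OF assms])
  assume "x = k" then show ?thesis by (auto simp: rel_def)
next
  assume "V x = 1"
  moreover have "W x \<in> {0..1}" using S.B.V_bounds assms by auto
  then obtain y where "y \<in> {x \<in> M. V' x = 1}" "W x = W' y" using S'.W_surj by (meson imageE subsetD)
  ultimately have "rel x y" using assms unfolding rel_def by simp
  then show ?thesis ..
next
  assume "x \<in> S.A.core"
  then show ?thesis
    using orbit_rel_ex[OF S.A.crossing_in, of x "- S.A.crossing_time x"] S.A.flow_crossing[of x] by auto
qed

lemma rel_unique:
  assumes "rel x y" "rel x z" shows "y = z"
proof (rule S.A.V_cases[of x])
  show "x \<in> M" using rel_in assms by blast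
next
  assume "x = k"
  then show ?thesis using assms S.A.V_eq_0_iff[OF S.A.attractor_in] by (auto simp: rel_def S.A.core_def)
next
  assume "V x = 1"
  then have "y \<in> {y \<in> M. V' y = 1}" "z \<in> {y \<in> M. V' y = 1}" "W' y = W' z"
    using assms S.A.V_eq_0_iff[OF S.A.attractor_in] by (auto simp: rel_def S.A.core_def)
  then show ?thesis using S'.W_inj by (meson inj_onD)
next
  assume x: "x \<in> S.A.core"
  let ?c = "S'.A.crossing y"
  have yz: "y \<in> S'.A.core" "z \<in> S'.A.core" "S'.A.crossing z = ?c" "S'.height y = S'.height z"
    using rel_core[OF assms(1) x] rel_core[OF assms(2) x] by auto
  have "y = \<psi> (- S'.A.crossing_time y) ?c" "z = \<psi> (- S'.A.crossing_time z) ?c"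
    using S'.A.flow_crossing yz by metis+
  moreover have "?c \<in> S'.A.core" using S'.A.crossing_in[OF yz(1)] S'.A.section_circle_core by blast
  ultimately show ?thesis using S'.height_inj yz(4) by metis
qed

definition h :: "'a \<Rightarrow> 'a" where "h x = (THE y. rel x y)"

lemma rel_h: "x \<in> M \<Longrightarrow> rel x (h x)"
  unfolding h_def by (rule theI') (use rel_ex rel_unique in blast)

lemma h_eqI: "rel x y \<Longrightarrow> h x = y"
  using rel_h rel_unique rel_in by blast

text \<open>An image point is its crossing point on the circle carried along for some time. The
  crossing points converge because \<open>S.A.crossing\<close> and \<open>g\<close> are continuous;
  the times converge because the heights do and height is strictly monotone along each
  trajectory.\<close>

lemma h_tendsto_core:
  assumes "x \<in> S.A.core" "X \<longlonglongrightarrow> x" "\<And>n. X n \<in> M"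
  shows "(\<lambda>n. h (X n)) \<longlonglongrightarrow> h x"
proof -
  have xM: "x \<in> M" using assms(1) S.A.core_in by blast
  define y where "y = h x"
  define Y where "Y n = h (X n)" for n
  define c where "c = S'.A.crossing y"
  define C where "C n = S'.A.crossing (Y n)" for n
  define t where "t = - S'.A.crossing_time y"
  define T where "T n = - S'.A.crossing_time (Y n)" for n
  have y: "y \<in> S'.A.core" "g (S.A.crossing x) = c" "S.height x = S'.height y"
    using rel_core[OF rel_h[OF xM] assms(1)] by (auto simp: y_def c_def)
  have ev: "\<forall>\<^sub>F n in sequentially. X n \<in> S.A.core"
  proof -
    obtain Q where Q: "open Q" "S.A.core = M \<inter> Q" using S.A.core_open_in_M by (auto simp: openin_open)
    then have "\<forall>\<^sub>F n in sequentially. X n \<in> Q" using assms(1,2) topological_tendstoD by blast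
    then show ?thesis using Q assms(3) by simp
  qed
  have Ycore: "Y n \<in> S'.A.core \<and> g (S.A.crossing (X n)) = C n \<and> S.height (X n) = S'.height (Y n)"
    if "X n \<in> S.A.core" for n
    using rel_core[OF rel_h[OF assms(3)] that] by (simp add: Y_def C_def)
  have cx: "(\<lambda>n. S.A.crossing (X n)) \<longlonglongrightarrow> S.A.crossing x"
    by (rule continuous_on_tendsto_compose[OF S.A.continuous_on_crossing assms(2,1) ev])
  have cg: "continuous_on S.A.section_circle g" using hom by (simp add: homeomorphism_def S.A.section_circle_def)
  have "(\<lambda>n. g (S.A.crossing (X n))) \<longlonglongrightarrow> g (S.A.crossing x)"
    by (rule continuous_on_tendsto_compose[OF cg cx S.A.crossing_in[OF assms(1)]])
      (use ev S.A.crossing_in in \<open>auto elim: eventually_mono\<close>)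
  then have "(\<lambda>n. g (S.A.crossing (X n))) \<longlonglongrightarrow> c" using y(2) by simp
  then have C: "C \<longlonglongrightarrow> c"
    by (rule Lim_transform_eventually) (use ev Ycore in \<open>auto elim: eventually_mono\<close>)
  have cM: "c \<in> M" "c \<in> S'.A.core"
    using S'.A.crossing_in[OF y(1)] S'.A.section_circle_core S'.A.core_in by (auto simp: c_def)
  have CM: "\<forall>\<^sub>F n in sequentially. C n \<in> M \<and> C n \<in> S'.A.core \<and> Y n = \<psi> (T n) (C n)"
    using ev
  proof eventually_elim
    case (elim n)
    then have "Y n \<in> S'.A.core" using Ycore by blast
    then show ?case using S'.A.crossing_in S'.A.section_circle_core S'.A.core_in S'.A.flow_crossing[of "Y n"]
      unfolding C_def T_def by auto
  qed
  have yt: "y = \<psi> t c" using S'.A.flow_crossing[OF y(1)] by (simp add: t_def c_def)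
  have lim_height: "(\<lambda>n. S'.height (\<psi> u (C n))) \<longlonglongrightarrow> S'.height (\<psi> u c)" for u
    by (rule continuous_on_tendsto_compose[OF S'.continuous_on_height S'.A.tendsto_flow[OF tendsto_const C cM(1)]])
      (use CM S'.A.flow_in cM in \<open>auto elim: eventually_mono\<close>)
  have lim_Y: "(\<lambda>n. S'.height (Y n)) \<longlonglongrightarrow> S'.height (\<psi> t c)"
  proof -
    have "(\<lambda>n. S.height (X n)) \<longlonglongrightarrow> S.height x"
      by (rule continuous_on_tendsto_compose[OF S.continuous_on_height assms(2) xM]) (simp add: assms(3))
    then show ?thesis using rel_height[OF rel_h[OF assms(3)]] y(3) yt by (simp add: Y_def)
  qed
  \<comment> \<open>For a fixed time \<open>u\<close> the heights of \<open>\<psi> u (C n)\<close>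
    converge, so comparing them with the heights of \<open>Y n\<close> tells on which side of
    \<open>u\<close> the time \<open>T n\<close> eventually lies.\<close>
  have "T \<longlonglongrightarrow> t"
  proof (rule order_tendstoI)
    fix u assume u: "u < t"
    then have "S'.height (\<psi> t c) < S'.height (\<psi> u c)" using S'.height_less_iff cM by blast
    then have "\<forall>\<^sub>F n in sequentially. 0 < S'.height (\<psi> u (C n)) - S'.height (Y n)"
      by (intro order_tendstoD(1)[OF tendsto_diff[OF lim_height[of u] lim_Y]]) simp
    with CM show "\<forall>\<^sub>F n in sequentially. u < T n"
    proof eventually_elim
      case (elim n)
      with S'.height_less_iff[of "C n"] show ?case by (metis diff_gt_0_iff_gt)
    qed
  next
    fix u assume u: "t < u"
    then have "S'.height (\<psi> u c) < S'.height (\<psi> t c)" using S'.height_less_iff cM by blast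
    then have "\<forall>\<^sub>F n in sequentially. 0 < S'.height (Y n) - S'.height (\<psi> u (C n))"
      by (intro order_tendstoD(1)[OF tendsto_diff[OF lim_Y lim_height[of u]]]) simp
    with CM show "\<forall>\<^sub>F n in sequentially. T n < u"
    proof eventually_elim
      case (elim n)
      with S'.height_less_iff[of "C n"] show ?case by (metis diff_gt_0_iff_gt)
    qed
  qed
  then have "(\<lambda>n. \<psi> (T n) (C n)) \<longlonglongrightarrow> y"
    unfolding yt by (rule S'.A.tendsto_flow[OF _ C cM(1)]) (use CM in \<open>auto elim: eventually_mono\<close>)
  then have "Y \<longlonglongrightarrow> y"
    by (rule Lim_transform_eventually) (use CM in \<open>auto elim: eventually_mono\<close>)
  then show ?thesis by (simp add: Y_def[abs_def] y_def)
qed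

text \<open>Limits have equal heights. Height -1 occurs only at the sink; a limit in either core is
  settled by continuity of the map or of its inverse there; and if neither point is in a core, equal
  heights on \<open>V = 1\<close> mean equal values of \<open>W\<close>.\<close>

lemma rel_cluster:
  assumes "X \<longlonglongrightarrow> x" "\<And>n. X n \<in> M" "x \<in> M" "(\<lambda>n. h (X n)) \<longlonglongrightarrow> y" "y \<in> M"
  shows "rel x y"
proof -
  interpret sw: sn_pair M \<psi> k' V' s' W' \<phi> k V s W g' g by (rule swap)
  have hM: "h (X n) \<in> M" for n using rel_in rel_h assms(2) by blast
  have hh: "sw.h (h (X n)) = X n" for n
    using rel_swap rel_h[OF assms(2)] sw.h_eqI by blast
  have L: "S.height x = S'.height y"
  proof (rule LIMSEQ_unique)
    show "(\<lambda>n. S.height (X n)) \<longlonglongrightarrow> S.height x"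
      by (rule continuous_on_tendsto_compose[OF S.continuous_on_height assms(1,3)]) (simp add: assms(2))
    have "(\<lambda>n. S'.height (h (X n))) \<longlonglongrightarrow> S'.height y"
      by (rule continuous_on_tendsto_compose[OF S'.continuous_on_height assms(4,5)]) (simp add: hM)
    then show "(\<lambda>n. S.height (X n)) \<longlonglongrightarrow> S'.height y"
      using rel_height[OF rel_h[OF assms(2)]] by simp
  qed
  show ?thesis
  proof (rule S'.A.V_cases[OF assms(5)])
    assume y: "y = k'"
    then have "S.height x = - 1" using L S'.W_attractor S'.A.V_eq_0_iff[OF S'.A.attractor_in] by (simp add: S'.height_def)
    then show ?thesis using S.height_eq_m1[OF assms(3)] y by (simp add: rel_def)
  next
    assume "y \<in> S'.A.core"
    then have "(\<lambda>n. sw.h (h (X n))) \<longlonglongrightarrow> sw.h y" using sw.h_tendsto_core assms(4) hM by blast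
    then have "x = sw.h y" using hh LIMSEQ_unique assms(1) by simp
    then show ?thesis using rel_swap sw.rel_h[OF assms(5)] by simp
  next
    assume y: "V' y = 1"
    show ?thesis
    proof (rule S.A.V_cases[OF assms(3)])
      assume "x = k"
      then have "S'.height y = - 1" using L S.W_attractor S.A.V_eq_0_iff[OF S.A.attractor_in] by (simp add: S.height_def)
      then show ?thesis using y S'.B.V_bounds[OF assms(5)] by (simp add: S'.height_def)
    next
      assume "x \<in> S.A.core"
      then have "h x = y" using h_tendsto_core assms(1,2,4) LIMSEQ_unique by blast
      then show ?thesis using rel_h assms(3) by blast
    next
      assume "V x = 1"
      then show ?thesis using L y assms(3,5) by (simp add: rel_def S.height_def S'.height_def)
    qed
  qed
qed

lemma continuous_on_h: "continuous_on M h"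
  unfolding continuous_on_sequentially
proof (intro allI ballI impI)
  fix X x assume x: "x \<in> M" and "(\<forall>n. X n \<in> M) \<and> X \<longlonglongrightarrow> x"
  then have X: "\<And>n. X n \<in> M" "X \<longlonglongrightarrow> x" by auto
  show "(h \<circ> X) \<longlonglongrightarrow> h x"
  \<comment> \<open>In a compact space a closed graph gives continuity: every convergent subsequence
    of images has the one limit that \<open>rel\<close> allows.\<close>
  proof (rule compact_tendsto_unique_cluster_point[OF S.A.compact_M])
    show "(h \<circ> X) n \<in> M" for n using rel_in rel_h X(1) by force
    fix r l assume r: "strict_mono r" "(h \<circ> X \<circ> r) \<longlonglongrightarrow> l" "l \<in> M"
    have "rel x l"
      by (rule rel_cluster[of "X \<circ> r"]) (use X r x LIMSEQ_subseq_LIMSEQ in \<open>auto simp: o_def\<close>)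
    then show "l = h x" using h_eqI by simp
  qed
qed

lemma orbit_rel_ex':
  assumes "rel x y" "x \<in> S.A.core"
  shows "\<exists>u. rel (\<phi> t x) (\<psi> u y)"
proof -
  let ?c = "S.A.crossing x"
  have y: "y \<in> S'.A.core" "g ?c = S'.A.crossing y" using rel_core[OF assms] by auto
  have c: "?c \<in> S.A.section_circle" using S.A.crossing_in assms by blast
  obtain u where u: "rel (\<phi> (t - S.A.crossing_time x) ?c) (\<psi> u (g ?c))" using orbit_rel_ex[OF c] by blast
  have "\<phi> (t - S.A.crossing_time x) ?c = \<phi> t x"
    using S.A.flow_add[of ?c t "- S.A.crossing_time x"] S.A.flow_crossing[OF assms(2)] c by (simp add: S.A.section_circle_def)
  moreover have "\<psi> u (g ?c) = \<psi> (u + S'.A.crossing_time y) y"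
    using S'.A.flow_add[of y u "S'.A.crossing_time y"] y S'.A.core_in by (simp add: S'.A.crossing_def)
  ultimately show ?thesis using u by auto
qed

text \<open>On \<open>V = 1\<close> time need not be changed, as \<open>W\<close> obeys the same
  logistic law for both flows. In the core \<open>\<tau>\<close> is increasing because both heights
  decrease, and onto by the swapped statement.\<close>

lemma orbit_correspondence:
  assumes "rel x y"
  shows "\<exists>\<tau>. strict_mono \<tau> \<and> surj \<tau> \<and> (\<forall>t. rel (\<phi> t x) (\<psi> (\<tau> t) y))"
proof (rule S.A.V_cases[of x])
  show "x \<in> M" using assms rel_in by blast
next
  assume "x = k"
  then have "y = k'" using assms S.A.V_eq_0_iff[OF S.A.attractor_in] by (auto simp: rel_def S.A.core_def)
  then have "\<forall>t. rel (\<phi> t x) (\<psi> (id t) y)" using \<open>x = k\<close> S.A.attractor_fixed S'.A.attractor_fixed by (simp add: rel_def)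
  then show ?thesis by (intro exI[of _ id]) (simp add: strict_mono_def)
next
  assume x: "V x = 1"
  then have xy: "x \<in> M" "y \<in> M" "V' y = 1" "W x = W' y"
    using assms S.A.V_eq_0_iff[OF S.A.attractor_in] by (auto simp: rel_def S.A.core_def)
  then have "\<forall>t. rel (\<phi> t x) (\<psi> (id t) y)"
    unfolding rel_def using x S.A.V_flow S'.A.V_flow S.W_flow S'.W_flow S.A.flow_in S'.A.flow_in by simp
  then show ?thesis by (intro exI[of _ id]) (simp add: strict_mono_def)
next
  assume x: "x \<in> S.A.core"
  interpret sw: sn_pair M \<psi> k' V' s' W' \<phi> k V s W g' g by (rule swap)
  have y: "y \<in> S'.A.core" using rel_core[OF assms x] by blast
  obtain \<tau> where \<tau>: "\<And>t. rel (\<phi> t x) (\<psi> (\<tau> t) y)" using orbit_rel_ex'[OF assms x] by metis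
  have "\<tau> a < \<tau> b" if "a < b" for a b
    using S.height_less_iff[OF x, of b a] S'.height_less_iff[OF y, of "\<tau> b" "\<tau> a"] rel_height[OF \<tau>[of a]] rel_height[OF \<tau>[of b]] that
    by simp
  moreover have "\<exists>t. \<tau> t = u" for u
  proof -
    obtain t where "sw.rel (\<psi> u y) (\<phi> t x)" using sw.orbit_rel_ex'[of y x u] rel_swap assms y by blast
    then have "\<psi> u y = \<psi> (\<tau> t) y" using rel_swap \<tau> rel_unique by blast
    then show ?thesis using S'.height_inj[OF y, of u "\<tau> t"] by auto
  qed
  ultimately show ?thesis using \<tau> by (intro exI[of _ \<tau>]) (simp add: strict_mono_def surj_def, metis)
qed

theorem equivalent: "topologically_equivalent M \<phi> \<psi>"
proof -
  interpret sw: sn_pair M \<psi> k' V' s' W' \<phi> k V s W g' g by (rule swap)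
  have inv: "sw.h (h x) = x" "h (sw.h x) = x" "h x \<in> M" "sw.h x \<in> M" if "x \<in> M" for x
    using that rel_swap rel_h sw.rel_h h_eqI sw.h_eqI rel_in by blast+
  have "homeomorphism M M h sw.h"
    by (rule homeomorphismI) (use inv continuous_on_h sw.continuous_on_h in auto)
  moreover have "\<exists>\<tau>::real \<Rightarrow> real. strict_mono \<tau> \<and> surj \<tau> \<and> (\<forall>t. h (\<phi> t x) = \<psi> (\<tau> t) (h x))" if "x \<in> M" for x
    using orbit_correspondence[OF rel_h[OF that]] h_eqI by metis
  ultimately show ?thesis unfolding topologically_equivalent_def by blast
qed

end

section \<open>Arcs in circles\<close>

text \<open>\<^term>\<open>q\<close> traverses the closed curve \<^term>\<open>C\<close> once, and the arc \<^term>\<open>J\<close> during the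
  first half of the time.\<close>

definition arc_parametrization :: "'a::topological_space set \<Rightarrow> (real \<Rightarrow> 'a) \<Rightarrow> 'a set \<Rightarrow> bool" where
  "arc_parametrization C q J \<longleftrightarrow> continuous_on {0..2} q \<and> q ` {0..2} = C \<and> J = q ` {0<..<1} \<and>
     (\<forall>s\<in>{0..2}. \<forall>t\<in>{0..2}. q s = q t \<longleftrightarrow> s = t \<or> s = 0 \<and> t = 2 \<or> s = 2 \<and> t = 0)"

text \<open>A continuous map from a compact space to a Hausdorff space is a quotient map: preimages
  under \<open>g\<close> of closed sets are images under \<open>q\<close> of compact sets.\<close>

lemma continuous_on_compact_quotient:
  fixes q :: "'a::t2_space \<Rightarrow> 'b::t2_space" and g :: "'b \<Rightarrow> 'c::topological_space"
  assumes "compact K" "continuous_on K q" "continuous_on K (\<lambda>s. g (q s))"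
  shows "continuous_on (q ` K) g"
proof -
  have "closed (g -` B \<inter> q ` K)" if "closed B" for B
  proof -
    have "closedin (top_of_set K) (K \<inter> (\<lambda>s. g (q s)) -` B)"
      using continuous_closedin_preimage[OF assms(3) that] .
    then have "compact (K \<inter> (\<lambda>s. g (q s)) -` B)" using assms(1) closedin_compact by blast
    then have "compact (q ` (K \<inter> (\<lambda>s. g (q s)) -` B))"
      by (intro compact_continuous_image continuous_on_subset[OF assms(2)]) auto
    moreover have "q ` (K \<inter> (\<lambda>s. g (q s)) -` B) = g -` B \<inter> q ` K" by auto
    ultimately show ?thesis using compact_imp_closed by metis
  qed
  then show ?thesis
    using continuous_on_closed_vimage[of "q ` K" g] compact_continuous_image[OF assms(2,1)] compact_imp_closed by blast
qed

text \<open>Both parametrizations identify 0 with 2 and nothing else, so sending \<open>q s\<close>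
  to \<open>q' s\<close> is well defined and bijective, and continuous as a map from a
  quotient.\<close>

lemma arc_parametrization_homeomorphism:
  fixes C :: "'a::t2_space set" and C' :: "'b::t2_space set"
  assumes q: "arc_parametrization C q J" and q': "arc_parametrization C' q' J'"
  shows "\<exists>g g'. homeomorphism C C' g g' \<and> g ` J = J'"
proof -
  define g where "g c = q' (SOME s. s \<in> {0..2} \<and> q s = c)" for c
  define g' where "g' c = q (SOME s. s \<in> {0..2} \<and> q' s = c)" for c
  have gq: "g (q s) = q' s" if "s \<in> {0..2}" for s
  proof -
    have "(SOME r. r \<in> {0..2} \<and> q r = q s) \<in> {0..2} \<and> q (SOME r. r \<in> {0..2} \<and> q r = q s) = q s"
      by (rule someI[of _ s]) (use that in auto)
    then show ?thesis using q q' that unfolding g_def arc_parametrization_def by blast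
  qed
  have gq': "g' (q' s) = q s" if "s \<in> {0..2}" for s
  proof -
    have "(SOME r. r \<in> {0..2} \<and> q' r = q' s) \<in> {0..2} \<and> q' (SOME r. r \<in> {0..2} \<and> q' r = q' s) = q' s"
      by (rule someI[of _ s]) (use that in auto)
    then show ?thesis using q q' that unfolding g'_def arc_parametrization_def by blast
  qed
  have C: "C = q ` {0..2}" "C' = q' ` {0..2}" and cq: "continuous_on {0..2} q" "continuous_on {0..2} q'"
    and J: "J = q ` {0<..<1}" "J' = q' ` {0<..<1}"
    using q q' by (auto simp: arc_parametrization_def)
  have "continuous_on C g"
    unfolding C by (intro continuous_on_compact_quotient compact_Icc cq continuous_on_eq[OF cq(2)]) (simp add: gq)
  moreover have "continuous_on C' g'"
    unfolding C by (intro continuous_on_compact_quotient compact_Icc cq continuous_on_eq[OF cq(1)]) (simp add: gq')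
  moreover have "g (g' y) = y" "g' y \<in> C" if "y \<in> C'" for y using that gq gq' by (auto simp: C)
  moreover have "g' (g x) = x" "g x \<in> C'" if "x \<in> C" for x using that gq gq' by (auto simp: C)
  ultimately have "homeomorphism C C' g g'" by (intro homeomorphismI) auto
  moreover have "g ` J = J'" unfolding J image_image using gq by (intro image_cong) auto
  ultimately show ?thesis by blast
qed

lemma arc_parametrization_homeomorphic:
  assumes "arc_parametrization D q (f ` J)" "homeomorphism C D f f'" "J \<subseteq> C"
  shows "arc_parametrization C (f' \<circ> q) J"
proof -
  have qD: "q s \<in> D" if "s \<in> {0..2}" for s using assms(1) that unfolding arc_parametrization_def by blast
  have inj: "f' x = f' y \<longleftrightarrow> x = y" if "x \<in> D" "y \<in> D" for x y
    using assms(2) that unfolding homeomorphism_def by metis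
  have "J = f' ` (f ` J)"
  proof -
    have "f' (f x) = x" if "x \<in> J" for x using assms(2,3) that unfolding homeomorphism_def by blast
    then show ?thesis by (force simp: image_image)
  qed
  moreover have "continuous_on {0..2} (f' \<circ> q)"
    using assms(1,2) unfolding arc_parametrization_def homeomorphism_def by (metis continuous_on_compose)
  moreover have "(f' \<circ> q) ` {0..2} = C"
    using assms(1,2) unfolding arc_parametrization_def homeomorphism_def image_comp[symmetric] by simp
  moreover have "J = (f' \<circ> q) ` {0<..<1}"
    using assms(1) calculation(1) unfolding arc_parametrization_def image_comp[symmetric] by simp
  ultimately show ?thesis
    using assms(1) inj qD unfolding arc_parametrization_def by simp
qed

lemma open_connected_bounded_real:
  fixes P :: "real set"
  assumes "open P" "connected P" "P \<subseteq> {a..b}" "P \<noteq> {}"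
  obtains u v where "a \<le> u" "u < v" "v \<le> b" "P = {u<..<v}"
proof
  have bdd: "bdd_below P" "bdd_above P" using assms(3) by (auto intro!: bdd_belowI[of _ a] bdd_aboveI[of _ b])
  show "a \<le> Inf P" by (rule cInf_greatest[OF assms(4)]) (use assms(3) in auto)
  show "Sup P \<le> b" by (rule cSup_least[OF assms(4)]) (use assms(3) in auto)
  have sub: "P \<subseteq> {Inf P<..<Sup P}"
  proof
    fix x assume x: "x \<in> P"
    then obtain e where e: "e > 0" "ball x e \<subseteq> P" using assms(1) open_contains_ball by blast
    then have "x - e/2 \<in> P" "x + e/2 \<in> P" by (auto simp: subset_iff dist_real_def)
    then have "Inf P \<le> x - e/2" "x + e/2 \<le> Sup P" using cInf_lower cSup_upper bdd by auto
    then show "x \<in> {Inf P<..<Sup P}" using e by simp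
  qed
  then show "Inf P < Sup P" using assms(4) by force
  show "P = {Inf P<..<Sup P}"
  proof (intro subset_antisym sub subsetI)
    fix x assume "x \<in> {Inf P<..<Sup P}"
    then obtain p r where "p \<in> P" "p < x" "r \<in> P" "x < r"
      using cInf_lessD[OF assms(4)] less_cSupD[OF assms(4)] by (metis greaterThanLessThan_iff)
    then show "x \<in> P" using connectedD_interval[OF assms(2), of p r x] by auto
  qed
qed

lemma cis_Arg2pi: "norm z = 1 \<Longrightarrow> cis (Arg2pi z) = z"
  using Arg2pi_eq[of z] by (simp add: cis_conv_exp)

lemma Arg2pi_cis: "0 \<le> x \<Longrightarrow> x < 2 * pi \<Longrightarrow> Arg2pi (cis x) = x"
  by (rule Arg2pi_unique[of 1]) (auto simp: cis_conv_exp)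

lemma cis_inj: "cis x = cis y \<Longrightarrow> 0 \<le> x - y \<Longrightarrow> x - y < 2 * pi \<Longrightarrow> x = y"
proof -
  assume "cis x = cis y" "0 \<le> x - y" "x - y < 2 * pi"
  then have "cis (x - y) = 1" by (metis cis_divide cis_neq_zero divide_self)
  then show "x = y" using Arg2pi_cis[of "x - y"] Arg2pi_cis[of 0] \<open>0 \<le> x - y\<close> \<open>x - y < 2 * pi\<close> by simp
qed

text \<open>Cut the circle at \<open>b\<close> and measure angles from there; the connected open set
  becomes an open interval of angles from \<open>u\<close> to \<open>v\<close>. The second omitted
  point \<open>a\<close> makes the complementary closed arc nondegenerate.\<close>

lemma circle_arc_parametrization:
  assumes J: "openin (top_of_set (sphere (0::complex) 1)) J" "connected J" "J \<noteq> {}"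
    and ab: "a \<in> sphere 0 1 - J" "b \<in> sphere 0 1 - J" "a \<noteq> b"
  shows "\<exists>q. arc_parametrization (sphere 0 1) q J"
proof -
  obtain Q where Q: "open Q" "J = sphere 0 1 \<inter> Q" using J(1) by (auto simp: openin_open)
  define p where "p \<theta> = b * cis \<theta>" for \<theta>
  have b: "norm b = 1" "b \<noteq> 0" using ab by auto
  have arg: "p (Arg2pi (z / b)) = z" if "norm z = 1" for z
    using cis_Arg2pi[of "z / b"] that b by (simp add: p_def norm_divide)
  have argp: "Arg2pi (p \<theta> / b) = \<theta>" if "0 \<le> \<theta>" "\<theta> < 2 * pi" for \<theta>
    using Arg2pi_cis[OF that] b by (simp add: p_def)
  have arg0: "0 < Arg2pi (z / b)" if "norm z = 1" "z \<noteq> b" for z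
  proof -
    have "Arg2pi (z / b) \<noteq> 0"
    proof
      assume "Arg2pi (z / b) = 0"
      then have "z = b" using arg[OF that(1)] by (simp add: p_def)
      with that show False by simp
    qed
    then show ?thesis using Arg2pi_ge_0[of "z / b"] by linarith
  qed
  define P where "P = (\<lambda>z. Arg2pi (z / b)) ` J"
  have JJ: "norm z = 1 \<and> z \<noteq> b" if "z \<in> J" for z using that ab Q by auto
  have P_eq: "P = {0<..<2*pi} \<inter> p -` Q"
  proof (intro subset_antisym subsetI)
    fix \<theta> assume "\<theta> \<in> P"
    then obtain z where "z \<in> J" "\<theta> = Arg2pi (z / b)" by (auto simp: P_def)
    then show "\<theta> \<in> {0<..<2*pi} \<inter> p -` Q" using arg0 arg JJ Q Arg2pi_lt_2pi by auto
  next
    fix \<theta> assume "\<theta> \<in> {0<..<2*pi} \<inter> p -` Q"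
    then have "p \<theta> \<in> J" "Arg2pi (p \<theta> / b) = \<theta>" using Q argp by (auto simp: p_def norm_mult b)
    then show "\<theta> \<in> P" unfolding P_def by force
  qed
  have "continuous_on UNIV p" unfolding p_def by (intro continuous_intros)
  then have "open (p -` Q)" using Q(1) continuous_on_open_vimage[of UNIV p] by auto
  then have "open P" unfolding P_eq by (intro open_Int) auto
  moreover have "connected P"
  proof -
    have "continuous_on J (\<lambda>z. Arg2pi (z / b))"
    proof (rule continuous_on_compose2[of "- \<real>\<^sub>\<ge>\<^sub>0" Arg2pi])
      show "continuous_on (- \<real>\<^sub>\<ge>\<^sub>0) Arg2pi"
        by (intro continuous_at_imp_continuous_on ballI continuous_at_Arg2pi) auto
      show "continuous_on J (\<lambda>z. z / b)" by (intro continuous_intros) (use b in auto)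
      have "z / b \<notin> \<real>\<^sub>\<ge>\<^sub>0" if "z \<in> J" for z
      proof
        assume "z / b \<in> \<real>\<^sub>\<ge>\<^sub>0"
        then have "Arg2pi (z / b) = 0" using Arg2pi_eq_0 complex_is_Real_iff
          by (auto simp: complex_nonneg_Reals_iff)
        then show False using arg0[of z] JJ[OF that] by simp
      qed
      then show "(\<lambda>z. z / b) ` J \<subseteq> - \<real>\<^sub>\<ge>\<^sub>0" by auto
    qed
    then show ?thesis unfolding P_def using J(2) connected_continuous_image by blast
  qed
  moreover have "P \<subseteq> {0..2*pi}" "P \<noteq> {}" using P_eq J(3) by (auto simp: P_def)
  ultimately obtain u v where uv: "0 \<le> u" "u < v" "v \<le> 2 * pi" "P = {u<..<v}"
    using open_connected_bounded_real by metis
  \<comment> \<open>An interval of full length would contain the angle of \<open>a\<close>. Equality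
    would also give the second piece of \<open>m\<close> below slope 0 and destroy
    injectivity.\<close>
  have "v - u < 2 * pi"
  proof (rule ccontr)
    assume "\<not> ?thesis"
    then have "P = {0<..<2*pi}" using uv by auto
    moreover have "Arg2pi (a / b) \<in> {0<..<2*pi}" using arg0[of a] ab Arg2pi_lt_2pi by auto
    ultimately have "Arg2pi (a / b) \<in> P" by simp
    then obtain z where "z \<in> J" "Arg2pi (z / b) = Arg2pi (a / b)" unfolding P_def by force
    then have "z = a" using arg JJ ab by (metis DiffD1 mem_sphere_0)
    then show False using \<open>z \<in> J\<close> ab by auto
  qed
  \<comment> \<open>Piecewise linear: the angles of the arc during the first unit of time, the
    remaining angles up to \<open>u + 2 * pi\<close> during the second.\<close>
  define m where "m s = u + (v - u) * min s 1 + (u + 2 * pi - v) * max (s - 1) 0" for s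
  have m01: "m 0 = u" "m 1 = v" "m 2 = u + 2 * pi" by (auto simp: m_def)
  have m_mono: "m s < m t" if "s < t" for s t
  proof (cases "s < 1")
    case True
    then have "(v - u) * min s 1 < (v - u) * min t 1" using that uv by (intro mult_strict_left_mono) auto
    moreover have "(u + 2 * pi - v) * max (s - 1) 0 \<le> (u + 2 * pi - v) * max (t - 1) 0"
      using that \<open>v - u < 2 * pi\<close> by (intro mult_left_mono) auto
    ultimately show ?thesis by (simp add: m_def)
  next
    case False
    then have "(u + 2 * pi - v) * max (s - 1) 0 < (u + 2 * pi - v) * max (t - 1) 0"
      using that \<open>v - u < 2 * pi\<close> by (intro mult_strict_left_mono) auto
    then show ?thesis using False that by (simp add: m_def)
  qed
  have m_cont: "continuous_on A m" for A unfolding m_def by (intro continuous_intros)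
  have m_surj: "\<exists>s. x \<le> s \<and> s \<le> z \<and> m s = y" if "m x \<le> y" "y \<le> m z" "x \<le> z" for x y z
    by (rule IVT'[OF that m_cont])
  have m_le: "m s \<le> m t \<longleftrightarrow> s \<le> t" for s t using m_mono[of s t] m_mono[of t s] by (cases s t rule: linorder_cases) auto
  have m_inj: "m s = m t \<longleftrightarrow> s = t" for s t using m_mono[of s t] m_mono[of t s] by (cases s t rule: linorder_cases) auto
  have period: "p (x + 2 * pi) = p x" for x by (simp add: p_def cis_mult[symmetric])
  have p_inj: "s = t \<or> s = 0 \<and> t = 2" if "p (m s) = p (m t)" "s \<le> t" "0 \<le> s" "t \<le> 2" for s t
  proof -
    have "cis (m t) = cis (m s)" using that(1) b by (simp add: p_def)
    moreover have "m s \<le> m t" "u \<le> m s" "m t \<le> u + 2 * pi" using that m_le m01 by metis+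
    ultimately have "m t = m s \<or> m t - m s = 2 * pi" using cis_inj[of "m t" "m s"] by argo
    then show ?thesis
    proof
      assume "m t - m s = 2 * pi"
      then have "m t = m 2" "m s = m 0" using \<open>u \<le> m s\<close> \<open>m t \<le> u + 2 * pi\<close> m01 by linarith+
      then show ?thesis using m_inj by blast
    qed (simp add: m_inj)
  qed
  have "arc_parametrization (sphere 0 1) (\<lambda>s. p (m s)) J"
    unfolding arc_parametrization_def
  proof (intro conjI ballI)
    show "continuous_on {0..2} (\<lambda>s. p (m s))"
      using continuous_on_compose2[OF \<open>continuous_on UNIV p\<close> m_cont] by auto
    show "(\<lambda>s. p (m s)) ` {0..2} = sphere 0 1"
    proof (intro subset_antisym subsetI)
      fix z :: complex assume "z \<in> sphere 0 1"
      then have z: "norm z = 1" by simp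
      define \<theta> where "\<theta> = Arg2pi (z / b)"
      have \<theta>: "0 \<le> \<theta>" "\<theta> < 2 * pi" "p \<theta> = z" using arg[OF z] Arg2pi_ge_0 Arg2pi_lt_2pi by (auto simp: \<theta>_def)
      define y where "y = (if \<theta> < u then \<theta> + 2 * pi else \<theta>)"
      have "p y = z" "m 0 \<le> y" "y \<le> m 2" using \<theta> period uv by (auto simp: y_def m01)
      then obtain s where "0 \<le> s" "s \<le> 2" "m s = y" using m_surj[of 0 y 2] by auto
      then show "z \<in> (\<lambda>s. p (m s)) ` {0..2}" using \<open>p y = z\<close> by auto
    qed (auto simp: p_def norm_mult b)
    have "m ` {0<..<1} = {u<..<v}"
    proof (intro subset_antisym subsetI)
      fix y assume y: "y \<in> {u<..<v}"
      then obtain s where "0 \<le> s" "s \<le> 1" "m s = y" using m_surj[of 0 y 1] m01 by auto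
      moreover have "s \<noteq> 0" "s \<noteq> 1" using y m01 \<open>m s = y\<close> by auto
      ultimately show "y \<in> m ` {0<..<1}" by force
    qed (use m_mono m01 in force)
    moreover have "J = p ` P"
      unfolding P_def image_image using arg JJ by force
    ultimately show "J = (\<lambda>s. p (m s)) ` {0<..<1}" using uv(4) by (metis image_image)
    fix s t :: real assume "s \<in> {0..2}" "t \<in> {0..2}"
    then show "p (m s) = p (m t) \<longleftrightarrow> s = t \<or> s = 0 \<and> t = 2 \<or> s = 2 \<and> t = 0"
      using p_inj[of s t] p_inj[of t s] m01 period by (cases "s \<le> t") auto
  qed
  then show ?thesis by blast
qed

lemma homeomorphic_circle_arc_parametrization:
  fixes C :: "'a::t2_space set"
  assumes C: "C homeomorphic sphere (0::complex) 1"
    and J: "openin (top_of_set C) J" "connected J" "J \<noteq> {}"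
    and ab: "a \<in> C - J" "b \<in> C - J" "a \<noteq> b"
  shows "\<exists>q. arc_parametrization C q J"
proof -
  obtain f f' where f: "homeomorphism C (sphere (0::complex) 1) f f'" using C by (auto simp: homeomorphic_def)
  have JC: "J \<subseteq> C" using J(1) openin_imp_subset by blast
  have inj: "f x = f y \<longleftrightarrow> x = y" if "x \<in> C" "y \<in> C" for x y
    using f that unfolding homeomorphism_def by metis
  have fC: "f x \<in> sphere 0 1" if "x \<in> C" for x using f that unfolding homeomorphism_def by blast
  have "openin (top_of_set (sphere 0 1)) (f ` J)"
    using homeomorphism_imp_open_map[OF f J(1)] .
  moreover have "connected (f ` J)"
    using J(2) f JC connected_continuous_image continuous_on_subset unfolding homeomorphism_def by metis
  moreover have "f a \<in> sphere 0 1 - f ` J" "f b \<in> sphere 0 1 - f ` J" "f a \<noteq> f b"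
    using ab inj fC JC by blast+
  ultimately obtain q where "arc_parametrization (sphere 0 1) q (f ` J)"
    using circle_arc_parametrization J(3) by (metis image_is_empty)
  then show ?thesis using arc_parametrization_homeomorphic[OF _ f JC] by blast
qed

section \<open>Basin functions of asymptotically stable points\<close>

lemma lgs_mono:
  assumes "0 \<le> v" "v \<le> w" "w \<le> 1"
  shows "lgs t v \<le> lgs t w"
proof -
  have "0 < v + exp t * (1 - v)" "0 < w + exp t * (1 - w)" using lgs_denominator_pos assms by auto
  moreover have "v * (w + exp t * (1 - w)) \<le> w * (v + exp t * (1 - v))"
    using assms mult_right_mono[of v w "exp t"] by (simp add: algebra_simps)
  ultimately show ?thesis
    unfolding lgs_def by (intro mult_imp_div_pos_le) (simp_all add: pos_le_divide_eq)
qed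

lemma lgs_half_surj:
  assumes "0 < m" "m < 1" obtains t where "lgs t (1/2) = m"
proof
  show "lgs (ln ((1 - m) / m)) (1/2) = m" using assms by (simp add: field_simps)
qed

text \<open>What a hyperbolic sink provides: a positively invariant neighbourhood with exponentially
  decaying \<open>L\<close>. \<open>N\<close> is a separate parameter because \<open>L\<close> may
  be small elsewhere too, so that \<open>N\<close> is only part of a sublevel set.\<close>

locale trapping = compact_flow M \<phi> for M :: "'a::metric_space set" and \<phi> +
  fixes N :: "'a set" and L :: "'a \<Rightarrow> real" and k :: 'a and c \<epsilon> :: real
  assumes closed_N: "closedin (top_of_set M) N"
    and c: "0 < c" and \<epsilon>: "0 < \<epsilon>"
    and k_in: "k \<in> N" and L_k: "L k = 0"
    and L_bounds: "x \<in> N \<Longrightarrow> 0 \<le> L x \<and> L x \<le> \<epsilon>"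
    and L_eq_0: "x \<in> N \<Longrightarrow> L x = 0 \<Longrightarrow> x = k"
    and L_flow: "x \<in> N \<Longrightarrow> 0 \<le> t \<Longrightarrow> \<phi> t x \<in> N \<and> L (\<phi> t x) \<le> exp (- c * t) * L x"
    and open_interior: "openin (top_of_set M) {x \<in> N. L x < \<epsilon>}"
begin

lemma N_M: "x \<in> N \<Longrightarrow> x \<in> M"
  using closed_N closedin_imp_subset by blast

lemma fixed_k: "\<phi> t k = k"
proof -
  have *: "\<phi> t k = k" if "t \<ge> 0" for t
  proof -
    have "\<phi> t k \<in> N" "L (\<phi> t k) \<le> 0" using L_flow[OF k_in that] L_k by auto
    then show ?thesis using L_eq_0[of "\<phi> t k"] L_bounds[of "\<phi> t k"] by simp
  qed
  show ?thesis
  proof (cases "t \<ge> 0")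
    case False
    then show ?thesis using *[of "- t"] flow_inverse(1)[OF N_M[OF k_in], of "- t"] by simp
  qed (rule *)
qed

text \<open>\<^term>\<open>lgs (- t) (1/2)\<close> increases with \<^term>\<open>t\<close>, so \<^term>\<open>entry x\<close> is a rescaling of the
  time at which the trajectory of \<^term>\<open>x\<close> enters \<^term>\<open>N\<close>.\<close>

definition entry_values :: "'a \<Rightarrow> real set" where
  "entry_values x = insert 1 {lgs (- t) (1/2) | t. \<phi> t x \<in> N}"

definition entry :: "'a \<Rightarrow> real" where "entry x = Inf (entry_values x)"

lemma entry_values_bounds: "y \<in> entry_values x \<Longrightarrow> 0 \<le> y \<and> y \<le> 1"
  unfolding entry_values_def using lgs_bounds[of "1/2"] by (auto simp del: lgs_simps(4) simp: lgs_simps(2))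

text \<open>The inserted 1 makes the set nonempty for trajectories that never meet \<open>N\<close>;
  they receive the value 1, as points outside the basin should.\<close>

lemma entry_values_bdd: "bdd_below (entry_values x)" "entry_values x \<noteq> {}"
  using entry_values_bounds by (auto simp: bdd_below_def entry_values_def)

lemma entry_bounds: "0 \<le> entry x \<and> entry x \<le> 1"
  unfolding entry_def
  by (intro conjI cInf_greatest[OF entry_values_bdd(2)] cInf_lower[OF _ entry_values_bdd(1)])
    (simp add: entry_values_bounds, simp add: entry_values_def)

lemma entry_le: "\<phi> t x \<in> N \<Longrightarrow> entry x \<le> lgs (- t) (1/2)"
  unfolding entry_def
  by (rule cInf_lower[OF _ entry_values_bdd(1)]) (auto simp: entry_values_def simp del: lgs_simps(4))

text \<open>Some earlier time already lies in \<open>N\<close>, and the decay of \<open>L\<close>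
  during the remaining time is strict. So the point at time \<open>t\<close> is in the relatively
  open part of \<open>N\<close>, not merely in \<open>N\<close>.\<close>

lemma entry_less:
  assumes "x \<in> M" "entry x < lgs (- t) (1/2)"
  shows "\<phi> t x \<in> N \<and> L (\<phi> t x) < \<epsilon>"
proof -
  obtain y where y: "y \<in> entry_values x" "y < lgs (- t) (1/2)"
    using cInf_lessD[OF entry_values_bdd(2)] assms(2) unfolding entry_def by blast
  moreover have "lgs (- t) (1/2) \<le> 1" using lgs_bounds[of "1/2" "- t"] by simp
  ultimately obtain s where s: "\<phi> s x \<in> N" "lgs (- s) (1/2) < lgs (- t) (1/2)" by (auto simp: entry_values_def)
  have st: "s < t" using s(2) by (simp add: add_pos_pos field_simps)
  have "\<phi> t x = \<phi> (t - s) (\<phi> s x)" using flow_add[OF assms(1), of "t - s" s] by simp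
  then have "\<phi> t x \<in> N" and *: "L (\<phi> t x) \<le> exp (- c * (t - s)) * L (\<phi> s x)"
    using L_flow[OF s(1), of "t - s"] st by auto
  have "exp (- c * (t - s)) * L (\<phi> s x) \<le> exp (- c * (t - s)) * \<epsilon>"
    using L_bounds[OF s(1)] by (intro mult_left_mono) auto
  also have "\<dots> < 1 * \<epsilon>" using st c \<epsilon> by (intro mult_strict_right_mono) auto
  finally show ?thesis using * \<open>\<phi> t x \<in> N\<close> by simp
qed

text \<open>Shifting time by \<open>s\<close> acts on the rescaled entry times as \<open>lgs\<close>
  by the group law. The reverse inequality is this one with \<open>- s\<close> at the point
  \<open>\<phi> s x\<close>.\<close>

lemma entry_flow_aux:
  assumes x: "x \<in> M"
  shows "lgs (- s) (entry (\<phi> s x)) \<le> entry x"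
  unfolding entry_def[of x]
proof (rule cInf_greatest[OF entry_values_bdd(2)])
  fix y assume "y \<in> entry_values x"
  then consider "y = 1" | t where "y = lgs (- t) (1/2)" "\<phi> t x \<in> N" by (auto simp: entry_values_def)
  then show "lgs (- s) (entry (\<phi> s x)) \<le> y"
  proof cases
    case 1
    then show ?thesis using lgs_bounds[of "entry (\<phi> s x)" "- s"] entry_bounds[of "\<phi> s x"] by simp
  next
    case 2
    have "\<phi> (t - s) (\<phi> s x) = \<phi> t x" using flow_add[OF x, of "t - s" s] by simp
    then have "entry (\<phi> s x) \<le> lgs (- (t - s)) (1/2)" using entry_le[of "t - s" "\<phi> s x"] 2 by (simp del: lgs_simps(4))
    then have "lgs (- s) (entry (\<phi> s x)) \<le> lgs (- s) (lgs (- (t - s)) (1/2))"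
      by (intro lgs_mono) (use entry_bounds[of "\<phi> s x"] lgs_bounds[of "1/2" "- (t - s)"] in \<open>auto simp del: lgs_simps(4)\<close>)
    also have "\<dots> = y" by (subst lgs_lgs) (use 2 in \<open>auto simp del: lgs_simps(4)\<close>)
    finally show ?thesis .
  qed
qed

lemma entry_flow:
  assumes x: "x \<in> M"
  shows "entry (\<phi> s x) = lgs s (entry x)"
proof (rule antisym)
  have "lgs s (lgs (- s) (entry (\<phi> s x))) \<le> lgs s (entry x)"
    using entry_flow_aux[OF x] lgs_bounds[of "entry (\<phi> s x)" "- s"] entry_bounds by (intro lgs_mono) auto
  then show "entry (\<phi> s x) \<le> lgs s (entry x)" using entry_bounds by (simp add: lgs_lgs)
  show "lgs s (entry x) \<le> entry (\<phi> s x)"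
    using entry_flow_aux[OF flow_in[OF x], of "- s" s] flow_inverse(1)[OF x] by simp
qed

lemma eventually_flow:
  assumes "x \<in> M" "openin (top_of_set M) S" "\<phi> t x \<in> S"
  shows "\<forall>\<^sub>F y in at x within M. \<phi> t y \<in> S"
proof -
  obtain Q where Q: "open Q" "S = M \<inter> Q" using assms(2) by (auto simp: openin_open)
  have "((\<lambda>y. \<phi> t y) \<longlongrightarrow> \<phi> t x) (at x within M)"
    by (rule tendsto_flow) (auto simp: assms(1) eventually_at_filter)
  then have "\<forall>\<^sub>F y in at x within M. \<phi> t y \<in> Q" using topological_tendstoD Q assms(3) by blast
  moreover have "\<forall>\<^sub>F y in at x within M. y \<in> M" by (simp add: eventually_at_filter)
  ultimately show ?thesis by eventually_elim (use Q flow_in in auto)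
qed

text \<open>Choose a time whose rescaled value lies strictly between \<open>a\<close> and
  \<open>entry x\<close>. Being outside \<open>N\<close> at that time is an open condition as
  \<open>N\<close> is closed, and being in the open part of \<open>N\<close> is one as well: these
  give the two semicontinuities.\<close>

lemma continuous_on_entry: "continuous_on M entry"
  unfolding continuous_on_def
proof (intro ballI order_tendstoI)
  fix x a assume x: "x \<in> M" and a: "a < entry x"
  have inM: "\<forall>\<^sub>F y in at x within M. y \<in> M" by (simp add: eventually_at_filter)
  show "\<forall>\<^sub>F y in at x within M. a < entry y"
  proof (cases "a < 0")
    case True
    then show ?thesis using entry_bounds by (intro always_eventually allI) (meson less_le_trans)
  next
    case False
    define m where "m = (a + entry x) / 2"
    have m: "a < m" "m < entry x" "0 < m" "m < 1" using a False entry_bounds[of x] by (auto simp: m_def)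
    obtain t where t: "lgs (- t) (1/2) = m" using lgs_half_surj[OF m(3,4)] by (metis minus_minus)
    have "\<phi> t x \<in> M - N" using entry_le[of t x] t m flow_in[OF x] by force
    moreover have "openin (top_of_set M) (M - N)" using closed_N by (simp add: openin_diff)
    ultimately have "\<forall>\<^sub>F y in at x within M. \<phi> t y \<in> M - N" using eventually_flow x by blast
    with inM show ?thesis
    proof eventually_elim
      case (elim y)
      then show ?case using entry_less[of y t] t m by force
    qed
  qed
next
  fix x a assume x: "x \<in> M" and a: "entry x < a"
  have inM: "\<forall>\<^sub>F y in at x within M. y \<in> M" by (simp add: eventually_at_filter)
  show "\<forall>\<^sub>F y in at x within M. entry y < a"
  proof (cases "1 < a")
    case True
    then show ?thesis using entry_bounds by (intro always_eventually allI) (meson le_less_trans)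
  next
    case False
    define m where "m = (a + entry x) / 2"
    have m: "m < a" "entry x < m" "0 < m" "m < 1" using a False entry_bounds[of x] by (auto simp: m_def)
    obtain t where t: "lgs (- t) (1/2) = m" using lgs_half_surj[OF m(3,4)] by (metis minus_minus)
    have "\<phi> t x \<in> {x \<in> N. L x < \<epsilon>}" using entry_less[OF x, of t] t m by simp
    then have "\<forall>\<^sub>F y in at x within M. \<phi> t y \<in> {x \<in> N. L x < \<epsilon>}" using eventually_flow x open_interior by blast
    with inM show ?thesis
    proof eventually_elim
      case (elim y)
      then show ?case using entry_le[of t y] t m by simp
    qed
  qed
qed

text \<open>Value 0 means that the whole backward trajectory lies in \<open>N\<close>; decay over a
  time \<open>n\<close> then bounds \<open>L x\<close> by \<open>exp (- c * n) * \<epsilon>\<close>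
  for every \<open>n\<close>.\<close>

lemma entry_eq_0_iff:
  assumes x: "x \<in> M"
  shows "entry x = 0 \<longleftrightarrow> x = k"
proof
  assume e: "entry x = 0"
  have inN: "\<phi> t x \<in> N" for t using entry_less[OF x, of t] e by (simp add: add_pos_pos)
  have "L x \<le> exp (- c * real n) * \<epsilon>" for n
  proof -
    have "\<phi> (real n) (\<phi> (- real n) x) = x" using flow_inverse(2)[OF x] .
    then have "L x \<le> exp (- c * real n) * L (\<phi> (- real n) x)" using L_flow[OF inN[of "- real n"], of "real n"] by simp
    also have "\<dots> \<le> exp (- c * real n) * \<epsilon>" using L_bounds[OF inN[of "- real n"]] by (intro mult_left_mono) auto
    finally show ?thesis .
  qed
  moreover have "(\<lambda>n. exp (- c * real n) * \<epsilon>) \<longlonglongrightarrow> 0 * \<epsilon>"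
  proof (intro tendsto_intros)
    have "filterlim (\<lambda>n. c * real n) at_top sequentially"
      by (rule filterlim_tendsto_pos_mult_at_top[OF tendsto_const c filterlim_real_sequentially])
    then have "filterlim (\<lambda>n. - c * real n) at_bot sequentially"
      by (simp add: filterlim_uminus_at_top)
    then show "(\<lambda>n. exp (- c * real n)) \<longlonglongrightarrow> 0" by (rule filterlim_compose[OF exp_at_bot])
  qed
  ultimately have "L x \<le> 0 * \<epsilon>" by (intro LIMSEQ_le_const) auto
  moreover have "x \<in> N" using inN[of 0] flow_0[OF x] by simp
  ultimately show "x = k" using L_bounds[of x] L_eq_0[of x] by simp
next
  assume "x = k"
  have "entry k \<le> 0"
  proof (rule ccontr)
    assume "\<not> entry k \<le> 0"
    then have "0 < entry k / 2" "entry k / 2 < 1" using entry_bounds[of k] by auto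
    then obtain t where "lgs t (1/2) = entry k / 2" using lgs_half_surj by metis
    moreover have "entry k \<le> lgs t (1/2)" using entry_le[of "- t" k] fixed_k k_in by simp
    ultimately show False using \<open>0 < entry k / 2\<close> by linarith
  qed
  then show "entry x = 0" using entry_bounds[of k] \<open>x = k\<close> by simp
qed

text \<open>The value 1/2 belongs to entry time 0. Closedness of \<open>N\<close> puts
  \<open>x\<close> into \<open>N\<close> as a limit from positive times, while
  \<open>L x < \<epsilon>\<close> would let the trajectory be in \<open>N\<close> already at
  slightly negative times.\<close>

lemma entry_eq_half_iff:
  assumes x: "x \<in> M"
  shows "entry x = 1/2 \<longleftrightarrow> x \<in> N \<and> L x = \<epsilon>"
proof
  assume "x \<in> N \<and> L x = \<epsilon>"
  then show "entry x = 1/2" using entry_le[of 0 x] entry_less[OF x, of 0] flow_0[OF x] by force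
next
  assume e: "entry x = 1/2"
  have xN: "x \<in> N"
  proof -
    obtain K where K: "closed K" "N = M \<inter> K" using closed_N by (auto simp: closedin_closed)
    have "((\<lambda>t. \<phi> t x) \<longlongrightarrow> \<phi> 0 x) (at_right 0)"
      by (rule tendsto_flow) (auto simp: x)
    moreover have "\<forall>\<^sub>F t in at_right 0. \<phi> t x \<in> K"
    proof (rule eventually_mono[OF eventually_at_right_less[of 0]])
      fix t :: real assume "0 < t"
      then have "1/2 < lgs (- t) (1/2)" by (simp add: add_pos_pos field_simps)
      then show "\<phi> t x \<in> K" using entry_less[OF x, of t] e K by simp
    qed
    ultimately have "\<phi> 0 x \<in> K" using Lim_in_closed_set[OF K(1)] by force
    then show ?thesis using flow_0[OF x] K x by simp
  qed
  moreover have "\<not> L x < \<epsilon>"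
  proof
    assume "L x < \<epsilon>"
    obtain Q where Q: "open Q" "{x \<in> N. L x < \<epsilon>} = M \<inter> Q" using open_interior by (auto simp: openin_open)
    have lim: "((\<lambda>t. \<phi> t x) \<longlongrightarrow> \<phi> 0 x) (at_left 0)"
      by (rule tendsto_flow) (auto simp: x)
    have "\<phi> 0 x \<in> Q" using \<open>L x < \<epsilon>\<close> xN Q(2) flow_0[OF x] by auto
    then have "\<forall>\<^sub>F t in at_left 0. \<phi> t x \<in> Q" using topological_tendstoD[OF lim Q(1)] by blast
    moreover have "\<forall>\<^sub>F t in at_left (0::real). t < 0" by (simp add: eventually_at_filter)
    ultimately have "\<forall>\<^sub>F t in at_left 0. t < 0 \<and> \<phi> t x \<in> Q" by eventually_elim auto
    from eventually_happens'[OF trivial_limit_at_left_real this]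
    obtain t :: real where "t < 0" "\<phi> t x \<in> Q" by blast
    then have "\<phi> t x \<in> N" using Q(2) flow_in[OF x] by auto
    then have "entry x \<le> lgs (- t) (1/2)" by (rule entry_le)
    also have "\<dots> < 1/2" using \<open>t < 0\<close> by (simp add: add_pos_pos field_simps)
    finally show False using e by simp
  qed
  ultimately show "x \<in> N \<and> L x = \<epsilon>" using L_bounds[of x] by simp
qed

lemma basin_entry: "basin M \<phi> k entry"
  by unfold_locales (use continuous_on_entry entry_bounds N_M[OF k_in] entry_eq_0_iff entry_flow in auto)

end

text \<open>Take a level \<open>m\<close> strictly between the values at time 1 and time 0. Points
  near \<open>x\<close> start above \<open>m\<close>, are below it at time 1, and stay below it, so
  they cannot return.\<close>

lemma (in compact_flow) wandering_of_decreasing: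
  assumes f: "continuous_on M f" and le: "\<And>y t. y \<in> M \<Longrightarrow> 0 \<le> t \<Longrightarrow> f (\<phi> t y) \<le> (f y :: real)"
    and x: "x \<in> M" "f (\<phi> 1 x) < f x"
  shows "x \<notin> nonwandering_set M \<phi>"
proof
  assume nw: "x \<in> nonwandering_set M \<phi>"
  define m where "m = (f (\<phi> 1 x) + f x) / 2"
  have c1: "continuous_on M (\<lambda>y. f (\<phi> 1 y))"
    by (rule continuous_on_compose2[OF f]) (auto intro!: continuous_intros simp: flow_in)
  have "openin (top_of_set M) ((M \<inter> f -` {m<..}) \<inter> (M \<inter> (\<lambda>y. f (\<phi> 1 y)) -` {..<m}))"
    by (intro openin_Int continuous_openin_preimage_gen f c1) auto
  then obtain U where U: "open U" "(M \<inter> f -` {m<..}) \<inter> (M \<inter> (\<lambda>y. f (\<phi> 1 y)) -` {..<m}) = M \<inter> U"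
    by (auto simp: openin_open)
  have "x \<in> U" using U(2) x by (auto simp: m_def)
  then obtain t y where t: "t \<ge> 1" "y \<in> U \<inter> M" "\<phi> t y \<in> U"
    using nw U(1) unfolding nonwandering_set_def by blast
  have "\<phi> t y = \<phi> (t - 1) (\<phi> 1 y)" using flow_add[of y "t - 1" 1] t(2) by simp
  then have "f (\<phi> t y) \<le> f (\<phi> 1 y)" using le[of "\<phi> 1 y" "t - 1"] flow_in t by simp
  moreover have "f (\<phi> 1 y) < m" "m < f (\<phi> t y)" using U(2) t flow_in[of y t] by auto
  ultimately show False by simp
qed

section \<open>Tangent vectors and linear parts\<close>

lemma tangent_vectors_derivative:
  assumes F: "(F has_derivative A) (at x within M)"
    and \<gamma>: "\<gamma> C1_differentiable_on {-1<..<1}" "\<gamma> ` {-1<..<1} \<subseteq> M" "\<gamma> 0 = x"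
  shows "((\<lambda>t. F (\<gamma> t)) has_vector_derivative A (vector_derivative \<gamma> (at 0))) (at 0)"
proof -
  have "(\<gamma> has_vector_derivative vector_derivative \<gamma> (at 0)) (at 0)"
    using \<gamma>(1) by (auto simp: C1_differentiable_on_eq vector_derivative_works[symmetric])
  then have d: "(\<gamma> has_vector_derivative vector_derivative \<gamma> (at 0)) (at 0 within {-1<..<1})"
    by (rule has_vector_derivative_at_within)
  have "(F has_derivative A) (at (\<gamma> 0) within \<gamma> ` {-1<..<1})"
    using F \<gamma>(2,3) has_derivative_subset by blast
  from vector_derivative_diff_chain_within[OF d this]
  show ?thesis by (simp add: o_def at_within_open[of 0 "{-1<..<1}"])
qed

lemma tangent_vectors_derivative_unique:
  assumes "(F has_derivative A) (at x within M)" "(F has_derivative B) (at x within M)"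
    and "v \<in> tangent_vectors M x"
  shows "A v = B v"
  using assms(3) tangent_vectors_derivative[OF assms(1)] tangent_vectors_derivative[OF assms(2)]
    vector_derivative_unique_at unfolding tangent_vectors_def by blast

lemma inner_constant_derivative:
  assumes "(f has_vector_derivative f') (at 0)" "(g has_vector_derivative g') (at 0)"
    and "\<And>t. t \<in> {-1<..<1} \<Longrightarrow> f t \<bullet> g t = c"
  shows "f 0 \<bullet> g' + f' \<bullet> g 0 = 0"
proof -
  have "((\<lambda>t. f t \<bullet> g t) has_derivative (\<lambda>h. f 0 \<bullet> (h *\<^sub>R g') + (h *\<^sub>R f') \<bullet> g 0)) (at 0)"
    by (rule has_derivative_inner[OF assms(1,2)[unfolded has_vector_derivative_def]])
  then have "((\<lambda>t. c) has_derivative (\<lambda>h. f 0 \<bullet> (h *\<^sub>R g') + (h *\<^sub>R f') \<bullet> g 0)) (at 0)"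
    using has_derivative_transform_within_open[where s = "{-1<..<1}" and g = "\<lambda>t. c" and f = "\<lambda>t. f t \<bullet> g t"] assms(3) by auto
  from has_derivative_unique[OF this has_derivative_const] have "(\<lambda>h. f 0 \<bullet> (h *\<^sub>R g') + (h *\<^sub>R f') \<bullet> g 0) = (\<lambda>h. 0)" .
  from fun_cong[OF this, of 1] show ?thesis by simp
qed

lemma tangent_vectors_S2:
  assumes x: "x \<in> S2"
  shows "tangent_vectors S2 x = {v. v \<bullet> x = 0}"
proof (intro subset_antisym subsetI)
  fix v assume "v \<in> tangent_vectors S2 x"
  then obtain \<gamma> where \<gamma>: "\<gamma> C1_differentiable_on {-1<..<1}" "\<gamma> ` {-1<..<1} \<subseteq> S2" "\<gamma> 0 = x" "v = vector_derivative \<gamma> (at 0)"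
    unfolding tangent_vectors_def by blast
  have d: "(\<gamma> has_vector_derivative v) (at 0)"
    using \<gamma>(1,4) by (auto simp: C1_differentiable_on_eq vector_derivative_works[symmetric])
  have "\<gamma> t \<bullet> \<gamma> t = 1" if "t \<in> {-1<..<1}" for t
  proof -
    have "\<gamma> t \<in> S2" using \<gamma>(2) that by blast
    then show ?thesis by (simp add: dot_square_norm)
  qed
  from inner_constant_derivative[OF d d this] show "v \<in> {v. v \<bullet> x = 0}" using \<gamma>(3) by (simp add: inner_commute)
next
  fix v assume "v \<in> {v. v \<bullet> x = 0}"
  then have vx: "v \<bullet> x = 0" by simp
  define n where "n = norm v"
  define u where "u = v /\<^sub>R n"
  have ux: "u \<bullet> x = 0" "x \<bullet> u = 0" "n *\<^sub>R u = v"
    using vx by (cases "v = 0"; auto simp: u_def n_def inner_commute)+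
  have uu: "n = 0 \<or> u \<bullet> u = 1" by (cases "v = 0") (auto simp: u_def n_def dot_square_norm power2_eq_square)
  \<comment> \<open>The great circle through \<open>x\<close> with initial velocity
    \<open>v\<close>; for \<open>v = 0\<close> it is constant, since then
    \<open>n = 0\<close>.\<close>
  define \<gamma> where "\<gamma> t = cos (n * t) *\<^sub>R x + sin (n * t) *\<^sub>R u" for t
  have d: "(\<gamma> has_vector_derivative (- (n * sin (n * t))) *\<^sub>R x + (n * cos (n * t)) *\<^sub>R u) (at t)" for t
    unfolding \<gamma>_def by (auto intro!: derivative_eq_intros simp: mult.commute)
  have "\<gamma> C1_differentiable_on {-1<..<1}"
    unfolding C1_differentiable_on_def
    by (intro exI[of _ "\<lambda>t. (- (n * sin (n * t))) *\<^sub>R x + (n * cos (n * t)) *\<^sub>R u"] conjI ballI d continuous_intros)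
  moreover have "\<gamma> t \<in> S2" for t
  proof -
    have xx: "x \<bullet> x = 1" using x by (simp add: dot_square_norm)
    have "\<gamma> t \<bullet> \<gamma> t = (cos (n * t))\<^sup>2 * (x \<bullet> x) + (sin (n * t))\<^sup>2 * (u \<bullet> u)"
      by (simp add: \<gamma>_def inner_add_left inner_add_right ux power2_eq_square)
    also have "\<dots> = 1" using uu xx by auto
    finally show ?thesis by (simp add: dot_square_norm power2_eq_1_iff) (metis abs_norm_cancel abs_1 abs_minus_cancel)
  qed
  moreover have "\<gamma> 0 = x" by (simp add: \<gamma>_def)
  moreover have "vector_derivative \<gamma> (at 0) = v" using vector_derivative_at[OF d[of 0]] ux by simp
  ultimately show "v \<in> tangent_vectors S2 x" unfolding tangent_vectors_def by blast
qed

lemma smooth_flow_differentiable: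
  assumes "smooth_flow M \<phi>" "x \<in> M"
  shows "(velocity \<phi> has_derivative frechet_derivative (velocity \<phi>) (at x within M)) (at x within M)"
proof -
  obtain U g where U: "open U" "M \<subseteq> U" "\<And>k. Ck_on k U g" "\<And>x. x \<in> M \<Longrightarrow> g x = velocity \<phi> x"
    using assms(1) unfolding smooth_flow_def smooth_along_def by blast
  have "g differentiable (at x)" using U(3)[of "Suc 0"] U(2) assms(2) by auto
  then obtain g' where "(g has_derivative g') (at x)" by (auto simp: differentiable_def)
  then have "(g has_derivative g') (at x within M)" by (rule has_derivative_at_withinI)
  then have "(velocity \<phi> has_derivative g') (at x within M)"
    by (rule has_derivative_transform[OF assms(2), rotated]) (use U(4) in auto)
  then show ?thesis by (metis differentiableI frechet_derivative_works)
qed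

lemma linear_part_eigenvalue_iff:
  assumes "(velocity \<phi> has_derivative A) (at p within M)"
  shows "linear_part_eigenvalue M \<phi> p z \<longleftrightarrow> complex_eigenvalue_on (tangent_vectors M p) A z"
proof -
  have "(velocity \<phi> has_derivative frechet_derivative (velocity \<phi>) (at p within M)) (at p within M)"
    using assms differentiableI frechet_derivative_works by blast
  from tangent_vectors_derivative_unique[OF this assms] show ?thesis
    unfolding linear_part_eigenvalue_def complex_eigenvalue_on_def by (metis (no_types, lifting))
qed

lemma velocity_tangent_S2:
  assumes "smooth_flow S2 \<phi>" "x \<in> S2"
  shows "velocity \<phi> x \<bullet> x = 0"
proof -
  have 0: "\<phi> 0 x = x" and c: "\<phi> t x \<in> S2" and d: "((\<lambda>t. \<phi> t x) has_vector_derivative velocity \<phi> (\<phi> t x)) (at t)" for t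
    using assms unfolding smooth_flow_def by blast+
  have "\<phi> t x \<bullet> \<phi> t x = 1" for t using c[of t] by (simp add: dot_square_norm)
  from inner_constant_derivative[OF d[of 0] d[of 0] this] show ?thesis unfolding 0 by (simp add: inner_commute)
qed

section \<open>Hyperbolic sinks on the sphere\<close>

text \<open>The root with the principal square root has the larger real part. If the trace is
  nonnegative this part is nonnegative; if the trace is negative, the determinant is at most 0 and
  the square root is real and at least the modulus of the trace. The vectors
  \<open>(b, z - a)\<close> and \<open>(z - d, c)\<close> are eigenvectors when nonzero.\<close>

lemma eigenvector_nonneg_2x2:
  fixes a b c d :: real
  assumes "\<not> (a + d < 0 \<and> 0 < a * d - b * c)"
  shows "\<exists>(z::complex) (w1::complex) (w2::complex). 0 \<le> Re z \<and> (w1 \<noteq> 0 \<or> w2 \<noteq> 0) \<and> a * w1 + b * w2 = z * w1 \<and> c * w1 + d * w2 = z * w2"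
proof -
  define tr where "tr = a + d"
  define dt where "dt = a * d - b * c"
  define s where "s = csqrt (of_real (tr\<^sup>2 - 4 * dt))"
  define z where "z = (of_real tr + s) / 2"
  have s2: "s\<^sup>2 = of_real (tr\<^sup>2 - 4 * dt)" by (simp add: s_def)
  have z: "(z - a) * (z - d) = of_real b * of_real c"
  proof -
    have "4 * (z\<^sup>2 - of_real tr * z + of_real dt) = s\<^sup>2 - of_real (tr\<^sup>2 - 4 * dt)"
      by (simp add: z_def field_simps power2_eq_square)
    then have "4 * (z\<^sup>2 - of_real tr * z + of_real dt) = 0" unfolding s2 by (simp only: diff_self)
    then have "z\<^sup>2 - of_real tr * z + of_real dt = 0" by (metis mult_eq_0_iff zero_neq_numeral)
    then show ?thesis by (simp add: tr_def dt_def algebra_simps power2_eq_square)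
  qed
  have "0 \<le> tr + Re s"
  proof (cases "tr < 0")
    case True
    then have "dt \<le> 0" using assms by (simp add: tr_def dt_def)
    then have "tr\<^sup>2 \<le> tr\<^sup>2 - 4 * dt" by simp
    then have "\<bar>tr\<bar> \<le> sqrt (tr\<^sup>2 - 4 * dt)" using real_le_rsqrt by (metis real_sqrt_abs real_sqrt_le_mono)
    moreover have "Re s = sqrt (tr\<^sup>2 - 4 * dt)"
    proof -
      have "0 \<le> tr\<^sup>2 - 4 * dt" using \<open>dt \<le> 0\<close> zero_le_power2[of tr] by linarith
      then show ?thesis unfolding s_def by (subst csqrt_of_real_nonneg) auto
    qed
    ultimately show ?thesis by simp
  next
    case False
    moreover have "0 \<le> Re s" unfolding s_def by (rule Re_csqrt)
    ultimately show ?thesis by simp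
  qed
  then have Re: "0 \<le> Re z" by (simp add: z_def)
  have "\<exists>(w1::complex) (w2::complex). (w1 \<noteq> 0 \<or> w2 \<noteq> 0) \<and> a * w1 + b * w2 = z * w1 \<and> c * w1 + d * w2 = z * w2"
  proof (cases "b = 0 \<and> c = 0")
    case True
    then have "z = a \<or> z = d" using z by auto
    then show ?thesis
    proof
      assume "z = a"
      show ?thesis by (rule exI[of _ 1], rule exI[of _ 0]) (use True \<open>z = a\<close> in simp)
    next
      assume "z = d"
      show ?thesis by (rule exI[of _ 0], rule exI[of _ 1]) (use True \<open>z = d\<close> in simp)
    qed
  next
    case False
    have "a * complex_of_real b + b * (z - a) = z * complex_of_real b \<and> c * complex_of_real b + d * (z - a) = z * (z - a)"
      "a * (z - d) + b * complex_of_real c = z * (z - d) \<and> c * (z - d) + d * complex_of_real c = z * complex_of_real c"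
      using z by (auto simp: algebra_simps)
    moreover have "of_real b \<noteq> (0::complex) \<or> of_real c \<noteq> (0::complex)" using False by simp
    ultimately show ?thesis by metis
  qed
  then show ?thesis using Re by blast
qed

text \<open>For a matrix $A$ with trace $\tau < 0$ and determinant $\delta > 0$ the function
  $\delta |v|^2 + |(\tau - A) v|^2$ decreases along $v' = A v$: by Cayley--Hamilton its derivative
  is $2 \delta \tau |v|^2$.\<close>

definition lyapunov :: "real \<Rightarrow> real \<Rightarrow> real \<Rightarrow> real \<Rightarrow> real \<Rightarrow> real \<Rightarrow> real" where
  "lyapunov a b c d p q = (a * d - b * c) * (p\<^sup>2 + q\<^sup>2) + (d * p - b * q)\<^sup>2 + (a * q - c * p)\<^sup>2"

text \<open>The partial derivative of the quadratic form in \<open>p\<close>; the next definition is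
  the one in \<open>q\<close>.\<close>

definition lyapunov_p :: "real \<Rightarrow> real \<Rightarrow> real \<Rightarrow> real \<Rightarrow> real \<Rightarrow> real \<Rightarrow> real" where
  "lyapunov_p a b c d p q = 2 * (a * d - b * c) * p + 2 * d * (d * p - b * q) - 2 * c * (a * q - c * p)"

definition lyapunov_q :: "real \<Rightarrow> real \<Rightarrow> real \<Rightarrow> real \<Rightarrow> real \<Rightarrow> real \<Rightarrow> real" where
  "lyapunov_q a b c d p q = 2 * (a * d - b * c) * q - 2 * b * (d * p - b * q) + 2 * a * (a * q - c * p)"

lemma lyapunov_ge: "(a * d - b * c) * (p\<^sup>2 + q\<^sup>2) \<le> lyapunov a b c d p q"
  by (simp add: lyapunov_def)

lemma lyapunov_scale: "lyapunov a b c d (l * p) (l * q) = l\<^sup>2 * lyapunov a b c d p q"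
  by (simp add: lyapunov_def power2_eq_square algebra_simps)

text \<open>\<open>\<rho>\<close> and \<open>\<sigma>\<close> are the nonlinear remainders. The
  constant \<open>K\<close> bounds the gradient by \<open>K * r\<close> and the form by
  \<open>K * r\<^sup>2\<close>, where \<open>r\<close> is the norm of \<open>(p, q)\<close>. The
  tolerance \<open>\<delta>\<close> is chosen so that the remainders consume half of the linear
  decay \<open>2 * dt * (a + d) * r\<^sup>2\<close>; the other half yields the rate
  \<open>\<kappa>\<close>.\<close>

lemma lyapunov_decay:
  assumes "a + d < 0" "0 < a * d - b * c"
  obtains \<delta> \<kappa> where "0 < \<delta>" "0 < \<kappa>"
    "\<And>p q \<rho> \<sigma>. \<bar>\<rho>\<bar> \<le> \<delta> * sqrt (p\<^sup>2 + q\<^sup>2) \<Longrightarrow> \<bar>\<sigma>\<bar> \<le> \<delta> * sqrt (p\<^sup>2 + q\<^sup>2) \<Longrightarrow>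
      lyapunov_p a b c d p q * (a * p + b * q + \<rho>) + lyapunov_q a b c d p q * (c * p + d * q + \<sigma>)
      \<le> - \<kappa> * lyapunov a b c d p q"
proof -
  define S where "S = \<bar>a\<bar> + \<bar>b\<bar> + \<bar>c\<bar> + \<bar>d\<bar>"
  define dt where "dt = a * d - b * c"
  define K where "K = 2 * dt + 4 * S * S"
  define \<delta> where "\<delta> = - dt * (a + d) / (2 * K)"
  define \<kappa> where "\<kappa> = - dt * (a + d) / K"
  have S: "0 \<le> S" "\<bar>a\<bar> \<le> S" "\<bar>b\<bar> \<le> S" "\<bar>c\<bar> \<le> S" "\<bar>d\<bar> \<le> S" by (auto simp: S_def)
  have dt: "0 < dt" using assms by (simp add: dt_def)
  have K: "0 < K" using dt S by (simp add: K_def add_pos_nonneg)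
  have pos: "0 < - dt * (a + d)" using dt assms by (simp add: mult_pos_neg)
  show ?thesis
  proof
    show "0 < \<delta>" unfolding \<delta>_def by (rule divide_pos_pos[OF pos]) (use K in simp)
    show \<kappa>: "0 < \<kappa>" unfolding \<kappa>_def by (rule divide_pos_pos[OF pos K])
    fix p q \<rho> \<sigma> :: real
    define r where "r = sqrt (p\<^sup>2 + q\<^sup>2)"
    assume "\<bar>\<rho>\<bar> \<le> \<delta> * sqrt (p\<^sup>2 + q\<^sup>2)" "\<bar>\<sigma>\<bar> \<le> \<delta> * sqrt (p\<^sup>2 + q\<^sup>2)"
    then have e: "\<bar>\<rho>\<bar> \<le> \<delta> * r" "\<bar>\<sigma>\<bar> \<le> \<delta> * r" by (auto simp: r_def)
    have r: "0 \<le> r" "r\<^sup>2 = p\<^sup>2 + q\<^sup>2" "\<bar>p\<bar> \<le> r" "\<bar>q\<bar> \<le> r"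
      by (auto simp: r_def intro!: real_le_rsqrt)
    have lin: "\<bar>x * p - y * q\<bar> \<le> (\<bar>x\<bar> + \<bar>y\<bar>) * r" "\<bar>x * q - y * p\<bar> \<le> (\<bar>x\<bar> + \<bar>y\<bar>) * r" for x y
    proof -
      have "\<bar>x * p\<bar> \<le> \<bar>x\<bar> * r" "\<bar>y * q\<bar> \<le> \<bar>y\<bar> * r" "\<bar>x * q\<bar> \<le> \<bar>x\<bar> * r" "\<bar>y * p\<bar> \<le> \<bar>y\<bar> * r"
        using r by (auto simp: abs_mult intro!: mult_left_mono)
      then show "\<bar>x * p - y * q\<bar> \<le> (\<bar>x\<bar> + \<bar>y\<bar>) * r" "\<bar>x * q - y * p\<bar> \<le> (\<bar>x\<bar> + \<bar>y\<bar>) * r"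
        using abs_triangle_ineq4[of "x * p" "y * q"] abs_triangle_ineq4[of "x * q" "y * p"] by (auto simp: distrib_right)
    qed
    have Sr: "\<bar>d * p - b * q\<bar> \<le> S * r" "\<bar>a * q - c * p\<bar> \<le> S * r"
      using lin(1)[of d b] lin(2)[of a c] r(1) mult_right_mono[of "\<bar>d\<bar> + \<bar>b\<bar>" S r] mult_right_mono[of "\<bar>a\<bar> + \<bar>c\<bar>" S r]
      by (auto simp: S_def)
    have SS: "\<bar>x * y\<bar> \<le> S * (S * r)" if "\<bar>x\<bar> \<le> S" "\<bar>y\<bar> \<le> S * r" for x y
      using that S r by (auto simp: abs_mult intro!: mult_mono)
    have dtp: "\<bar>dt * p\<bar> \<le> dt * r" "\<bar>dt * q\<bar> \<le> dt * r" using r dt by (auto simp: abs_mult)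
    have P: "\<bar>lyapunov_p a b c d p q\<bar> \<le> K * r" "\<bar>lyapunov_q a b c d p q\<bar> \<le> K * r"
      using SS[OF S(5) Sr(1)] SS[OF S(4) Sr(2)] SS[OF S(3) Sr(1)] SS[OF S(2) Sr(2)] dtp
      unfolding lyapunov_p_def lyapunov_q_def K_def dt_def[symmetric] by (auto simp: algebra_simps abs_le_iff)
    have Kd: "2 * K * \<delta> = - dt * (a + d)" using K by (simp add: \<delta>_def)
    have \<kappa>K: "\<kappa> * K = - dt * (a + d)" using K by (simp add: \<kappa>_def)
    have prod: "\<bar>x * y\<bar> \<le> K * \<delta> * r\<^sup>2" if "\<bar>x\<bar> \<le> K * r" "\<bar>y\<bar> \<le> \<delta> * r" for x y
    proof -
      have "\<bar>x * y\<bar> \<le> (K * r) * (\<delta> * r)" unfolding abs_mult using that K r by (intro mult_mono) auto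
      then show ?thesis by (simp add: power2_eq_square algebra_simps)
    qed
    have "lyapunov_p a b c d p q * (a * p + b * q + \<rho>) + lyapunov_q a b c d p q * (c * p + d * q + \<sigma>)
      = 2 * dt * (a + d) * r\<^sup>2 + (lyapunov_p a b c d p q * \<rho> + lyapunov_q a b c d p q * \<sigma>)"
      unfolding r(2) by (simp add: lyapunov_p_def lyapunov_q_def dt_def power2_eq_square algebra_simps)
    also have "\<dots> \<le> 2 * dt * (a + d) * r\<^sup>2 + 2 * (K * \<delta> * r\<^sup>2)"
      using prod[OF P(1) e(1)] prod[OF P(2) e(2)] by linarith
    also have "\<dots> = (2 * dt * (a + d) + 2 * K * \<delta>) * r\<^sup>2" by (simp add: algebra_simps)
    also have "\<dots> = - (\<kappa> * K) * r\<^sup>2" unfolding Kd \<kappa>K by (simp add: algebra_simps)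
    also have "\<dots> = - \<kappa> * (K * r\<^sup>2)" by simp
    also have "\<dots> \<le> - \<kappa> * lyapunov a b c d p q"
    proof -
      have "(d * p - b * q)\<^sup>2 \<le> (S * r)\<^sup>2" "(a * q - c * p)\<^sup>2 \<le> (S * r)\<^sup>2"
        using Sr S r by (auto simp flip: abs_le_square_iff simp: abs_mult)
      then have "lyapunov a b c d p q \<le> dt * r\<^sup>2 + (S * r)\<^sup>2 + (S * r)\<^sup>2"
        unfolding lyapunov_def dt_def[symmetric] r(2)[symmetric] by simp
      also have "\<dots> \<le> K * r\<^sup>2"
      proof -
        have "K * r\<^sup>2 = 2 * (dt * r\<^sup>2) + 4 * (S * r)\<^sup>2" by (simp add: K_def power2_eq_square algebra_simps)
        moreover have "0 \<le> dt * r\<^sup>2" using dt by simp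
        ultimately show ?thesis using zero_le_power2[of "S * r"] by linarith
      qed
      finally show ?thesis using \<kappa> by simp
    qed
    finally show "lyapunov_p a b c d p q * (a * p + b * q + \<rho>) + lyapunov_q a b c d p q * (c * p + d * q + \<sigma>)
      \<le> - \<kappa> * lyapunov a b c d p q" .
  qed
qed

lemma has_derivative_lyapunov:
  assumes "(p has_real_derivative p') (at t)" "(q has_real_derivative q') (at t)"
  shows "((\<lambda>t. lyapunov a b c d (p t) (q t)) has_real_derivative
    lyapunov_p a b c d (p t) (q t) * p' + lyapunov_q a b c d (p t) (q t) * q') (at t)"
  unfolding lyapunov_def power2_eq_square
  by (rule derivative_eq_intros assms refl)+ (simp add: lyapunov_p_def lyapunov_q_def algebra_simps)

section \<open>Coordinates about a sink of the sphere\<close>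

lemma orthonormal_frame:
  fixes k :: "real ^ 3"
  assumes "norm k = 1"
  obtains e1 e2 where "norm e1 = 1" "norm e2 = 1" "e1 \<bullet> k = 0" "e2 \<bullet> k = 0" "e1 \<bullet> e2 = 0"
    "\<And>x. x = (x \<bullet> k) *\<^sub>R k + (x \<bullet> e1) *\<^sub>R e1 + (x \<bullet> e2) *\<^sub>R e2"
proof -
  obtain f where f: "orthogonal_transformation f" "f (axis 3 1 :: real ^ 3) = k"
    using orthogonal_transformation_exists_1[of "axis 3 1 :: real ^ 3" k] assms by (auto simp: norm_axis_1)
  have lin: "linear f" and inn: "f x \<bullet> f y = x \<bullet> y" for x y using f(1) by (auto simp: orthogonal_transformation_def)
  show ?thesis
  proof (rule that[of "f (axis 1 1)" "f (axis 2 1)"])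
    fix x
    obtain y where x: "x = f y" using orthogonal_transformation_surj[OF f(1)] by (meson surjD)
    have y: "y = (y \<bullet> axis 3 1) *\<^sub>R axis 3 1 + (y \<bullet> axis 1 1) *\<^sub>R axis 1 1 + (y \<bullet> axis 2 1) *\<^sub>R (axis 2 1 :: real ^ 3)"
      unfolding cart_eq_inner_axis[symmetric] by (simp add: vec_eq_iff forall_3 axis_def)
    have "f y = f ((y \<bullet> axis 3 1) *\<^sub>R axis 3 1 + (y \<bullet> axis 1 1) *\<^sub>R axis 1 1 + (y \<bullet> axis 2 1) *\<^sub>R (axis 2 1 :: real ^ 3))"
      using y by simp
    then show "x = (x \<bullet> k) *\<^sub>R k + (x \<bullet> f (axis 1 1)) *\<^sub>R f (axis 1 1) + (x \<bullet> f (axis 2 1)) *\<^sub>R f (axis 2 1)"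
      unfolding x f(2)[symmetric] inn by (simp add: linear_add[OF lin] linear_scale[OF lin])
  qed (use f orthogonal_transformation_norm[OF f(1)] in \<open>auto simp: f(2)[symmetric] inn inner_axis_axis\<close>)
qed

context
  fixes \<phi> :: "real \<Rightarrow> real ^ 3 \<Rightarrow> real ^ 3" and k e1 e2 :: "real ^ 3"
  assumes smooth: "smooth_flow S2 \<phi>" and sink: "sink S2 \<phi> k"
    and e: "norm e1 = 1" "norm e2 = 1" "e1 \<bullet> k = 0" "e2 \<bullet> k = 0" "e1 \<bullet> e2 = 0"
    and expand: "\<And>x. x = (x \<bullet> k) *\<^sub>R k + (x \<bullet> e1) *\<^sub>R e1 + (x \<bullet> e2) *\<^sub>R e2"
begin

private definition "A = frechet_derivative (velocity \<phi>) (at k within S2)"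

text \<open>The Lyapunov form of the linear part, evaluated at the orthogonal projection of
  \<open>x\<close> to the tangent plane at \<open>k\<close>. It takes the same values on both
  hemispheres, whence the conditions on \<open>x \<bullet> k\<close> below.\<close>

private definition "Lf x = lyapunov (A e1 \<bullet> e1) (A e2 \<bullet> e1) (A e1 \<bullet> e2) (A e2 \<bullet> e2) (x \<bullet> e1) (x \<bullet> e2)"

private definition "rr x = sqrt ((x \<bullet> e1)\<^sup>2 + (x \<bullet> e2)\<^sup>2)"

private lemma k_sing: "k \<in> S2" "velocity \<phi> k = 0" "norm k = 1" "k \<bullet> k = 1"
  using sink by (auto simp: sink_def singular_points_def dot_square_norm)

private lemma deriv_A: "(velocity \<phi> has_derivative A) (at k within S2)"
  unfolding A_def by (rule smooth_flow_differentiable[OF smooth k_sing(1)])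

private lemma linear_A: "linear A"
  using deriv_A has_derivative_linear by blast

text \<open>Differentiate the orthogonality of velocity and position along a curve through
  \<open>k\<close>; the other term vanishes with the velocity at \<open>k\<close>.\<close>

private lemma A_tangent:
  assumes "v \<bullet> k = 0" shows "A v \<bullet> k = 0"
proof -
  obtain \<gamma> where \<gamma>: "\<gamma> C1_differentiable_on {-1<..<1}" "\<gamma> ` {-1<..<1} \<subseteq> S2" "\<gamma> 0 = k" "v = vector_derivative \<gamma> (at 0)"
    using assms tangent_vectors_S2[OF k_sing(1)] unfolding tangent_vectors_def by blast
  have d: "(\<gamma> has_vector_derivative v) (at 0)"
    using \<gamma>(1,4) by (auto simp: C1_differentiable_on_eq vector_derivative_works[symmetric])
  have dF: "((\<lambda>t. velocity \<phi> (\<gamma> t)) has_vector_derivative A v) (at 0)"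
    using tangent_vectors_derivative[OF deriv_A \<gamma>(1-3)] by (simp add: \<gamma>(4))
  have "velocity \<phi> (\<gamma> t) \<bullet> \<gamma> t = 0" if "t \<in> {-1<..<1}" for t
    using \<gamma>(2) that velocity_tangent_S2[OF smooth] by blast
  from inner_constant_derivative[OF dF d this] show ?thesis using k_sing(2) \<gamma>(3) by simp
qed

private lemma A_expand: "A e1 = (A e1 \<bullet> e1) *\<^sub>R e1 + (A e1 \<bullet> e2) *\<^sub>R e2" "A e2 = (A e2 \<bullet> e1) *\<^sub>R e1 + (A e2 \<bullet> e2) *\<^sub>R e2"
  using expand[of "A e1"] expand[of "A e2"] A_tangent[OF e(3)] A_tangent[OF e(4)] by simp_all

text \<open>Otherwise there is a complex eigenvector with eigenvalue of nonnegative real part; its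
  real and imaginary parts, placed in the tangent plane, contradict the definition of a
  sink.\<close>

private lemma trace_det: "A e1 \<bullet> e1 + A e2 \<bullet> e2 < 0" "0 < (A e1 \<bullet> e1) * (A e2 \<bullet> e2) - (A e2 \<bullet> e1) * (A e1 \<bullet> e2)"
proof -
  let ?a = "A e1 \<bullet> e1" and ?b = "A e2 \<bullet> e1" and ?c = "A e1 \<bullet> e2" and ?d = "A e2 \<bullet> e2"
  have "?a + ?d < 0 \<and> 0 < ?a * ?d - ?b * ?c"
  proof (rule ccontr)
    assume "\<not> ?thesis"
    then obtain z w1 w2 :: complex where z: "0 \<le> Re z" "w1 \<noteq> 0 \<or> w2 \<noteq> 0"
      "?a * w1 + ?b * w2 = z * w1" "?c * w1 + ?d * w2 = z * w2"
      using eigenvector_nonneg_2x2 by blast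
    define u where "u = Re w1 *\<^sub>R e1 + Re w2 *\<^sub>R e2"
    define v where "v = Im w1 *\<^sub>R e1 + Im w2 *\<^sub>R e2"
    have Ae: "A (p *\<^sub>R e1 + q *\<^sub>R e2) = (?a * p + ?b * q) *\<^sub>R e1 + (?c * p + ?d * q) *\<^sub>R e2" for p q
    proof -
      have "A (p *\<^sub>R e1 + q *\<^sub>R e2) = p *\<^sub>R A e1 + q *\<^sub>R A e2"
        by (simp add: linear_add[OF linear_A] linear_scale[OF linear_A])
      also have "\<dots> = p *\<^sub>R (?a *\<^sub>R e1 + ?c *\<^sub>R e2) + q *\<^sub>R (?b *\<^sub>R e1 + ?d *\<^sub>R e2)" using A_expand by simp
      finally show ?thesis by (simp add: algebra_simps)
    qed
    have coords: "u \<bullet> e1 = Re w1" "u \<bullet> e2 = Re w2" "v \<bullet> e1 = Im w1" "v \<bullet> e2 = Im w2"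
      using e inner_commute[of e2 e1] by (auto simp: u_def v_def inner_add_left dot_square_norm)
    have eqs: "?a * Re w1 + ?b * Re w2 = Re z * Re w1 - Im z * Im w1" "?c * Re w1 + ?d * Re w2 = Re z * Re w2 - Im z * Im w2"
      "?a * Im w1 + ?b * Im w2 = Im z * Re w1 + Re z * Im w1" "?c * Im w1 + ?d * Im w2 = Im z * Re w2 + Re z * Im w2"
      using z(3,4)[THEN arg_cong, of Re] z(3,4)[THEN arg_cong, of Im] by (auto simp: algebra_simps)
    have "u \<noteq> 0 \<or> v \<noteq> 0" using z(2) coords by (metis complex_eq_iff inner_zero_left zero_complex.simps)
    moreover have "u \<in> tangent_vectors S2 k" "v \<in> tangent_vectors S2 k"
      using e by (auto simp: tangent_vectors_S2[OF k_sing(1)] u_def v_def inner_add_left)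
    moreover have "A u = Re z *\<^sub>R u - Im z *\<^sub>R v" "A v = Im z *\<^sub>R u + Re z *\<^sub>R v"
      unfolding u_def v_def Ae eqs by (simp_all add: algebra_simps)
    ultimately have "linear_part_eigenvalue S2 \<phi> k z"
      unfolding linear_part_eigenvalue_def complex_eigenvalue_on_def A_def[symmetric] by blast
    then show False using sink z(1) unfolding sink_def by force
  qed
  then show "?a + ?d < 0" "0 < ?a * ?d - ?b * ?c" by auto
qed

private lemma rr_S2:
  assumes "x \<in> S2" shows "(rr x)\<^sup>2 = 1 - (x \<bullet> k)\<^sup>2" "(x \<bullet> k)\<^sup>2 + (x \<bullet> e1)\<^sup>2 + (x \<bullet> e2)\<^sup>2 = 1"
proof -
  have "x \<bullet> x = ((x \<bullet> k) *\<^sub>R k + (x \<bullet> e1) *\<^sub>R e1 + (x \<bullet> e2) *\<^sub>R e2) \<bullet> x" using expand by metis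
  also have "\<dots> = (x \<bullet> k)\<^sup>2 + (x \<bullet> e1)\<^sup>2 + (x \<bullet> e2)\<^sup>2"
    by (simp add: inner_add_left) (simp add: power2_eq_square inner_commute)
  finally show *: "(x \<bullet> k)\<^sup>2 + (x \<bullet> e1)\<^sup>2 + (x \<bullet> e2)\<^sup>2 = 1" using assms by (simp add: dot_square_norm)
  then show "(rr x)\<^sup>2 = 1 - (x \<bullet> k)\<^sup>2" by (simp add: rr_def)
qed

text \<open>The coordinate along \<open>k\<close> differs from 1 only to second order, so the
  tangential radius controls the whole distance.\<close>

private lemma near_k:
  assumes "x \<in> S2" "0 \<le> x \<bullet> k"
  shows "\<bar>x \<bullet> k - 1\<bar> \<le> (rr x)\<^sup>2" "norm (x - k) \<le> 2 * rr x"
proof -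
  have le: "x \<bullet> k \<le> 1" using Cauchy_Schwarz_ineq2[of x k] assms k_sing by auto
  then have "(x \<bullet> k)\<^sup>2 \<le> x \<bullet> k" using assms(2) by (simp add: power2_eq_square mult_left_le)
  then show *: "\<bar>x \<bullet> k - 1\<bar> \<le> (rr x)\<^sup>2" using rr_S2[OF assms(1)] le by simp
  have "(norm (x - k))\<^sup>2 = 2 * (1 - x \<bullet> k)"
    using assms(1) k_sing by (simp add: power2_norm_eq_inner inner_diff_left inner_diff_right inner_commute) (simp add: dot_square_norm)
  also have "\<dots> \<le> (2 * rr x)\<^sup>2" using * le by (simp add: power_mult_distrib)
  finally show "norm (x - k) \<le> 2 * rr x" by (rule power2_le_imp_le) (simp add: rr_def)
qed

text \<open>The remainder has two parts: the error \<open>R\<close> of differentiability, and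
  \<open>(y \<bullet> k - 1) * (A k \<bullet> e0)\<close>, because \<open>y - k\<close> is not
  tangent. The value of \<open>A\<close> on \<open>k\<close> is not prescribed by the field on the
  sphere, but its coefficient is of second order.\<close>

private lemma Lf_decay:
  obtains \<rho> \<kappa> where "0 < \<rho>" "0 < \<kappa>"
    "\<And>x t. x \<in> S2 \<Longrightarrow> 0 < \<phi> t x \<bullet> k \<Longrightarrow> rr (\<phi> t x) < \<rho> \<Longrightarrow>
      \<exists>D. ((\<lambda>t. Lf (\<phi> t x)) has_real_derivative D) (at t) \<and> D \<le> - \<kappa> * Lf (\<phi> t x)"
proof -
  let ?a = "A e1 \<bullet> e1" and ?b = "A e2 \<bullet> e1" and ?c = "A e1 \<bullet> e2" and ?d = "A e2 \<bullet> e2"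
  obtain \<delta> \<kappa> where \<delta>: "0 < \<delta>" "0 < \<kappa>"
    "\<And>p q \<rho> \<sigma>. \<bar>\<rho>\<bar> \<le> \<delta> * sqrt (p\<^sup>2 + q\<^sup>2) \<Longrightarrow> \<bar>\<sigma>\<bar> \<le> \<delta> * sqrt (p\<^sup>2 + q\<^sup>2) \<Longrightarrow>
      lyapunov_p ?a ?b ?c ?d p q * (?a * p + ?b * q + \<rho>) + lyapunov_q ?a ?b ?c ?d p q * (?c * p + ?d * q + \<sigma>)
      \<le> - \<kappa> * lyapunov ?a ?b ?c ?d p q"
    using lyapunov_decay[OF trace_det] by blast
  have "\<delta> / 4 > 0" using \<delta> by simp
  then obtain d0 where d0: "d0 > 0" "\<And>y. y \<in> S2 \<Longrightarrow> norm (y - k) < d0 \<Longrightarrow>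
      norm (velocity \<phi> y - velocity \<phi> k - A (y - k)) \<le> \<delta> / 4 * norm (y - k)"
    using deriv_A unfolding has_derivative_within_alt by blast
  \<comment> \<open>The first bound gives \<open>norm (y - k) < d0\<close>, the second makes
    \<open>rr y * norm (A k)\<close> at most \<open>\<delta> / 2\<close>; adding 1 avoids division
    by 0.\<close>
  define \<rho> where "\<rho> = min (d0 / 2) (\<delta> / (2 * (norm (A k) + 1)))"
  have \<rho>: "0 < \<rho>" using d0 \<delta> by (auto simp: \<rho>_def intro!: divide_pos_pos mult_pos_pos add_nonneg_pos)
  have est: "\<bar>velocity \<phi> y \<bullet> e0 - (A e1 \<bullet> e0 * (y \<bullet> e1) + A e2 \<bullet> e0 * (y \<bullet> e2))\<bar> \<le> \<delta> * rr y"
    if y: "y \<in> S2" "0 < y \<bullet> k" "rr y < \<rho>" and e0: "norm e0 = 1" for y e0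
  proof -
    define R where "R = velocity \<phi> y - A (y - k)"
    have nn: "norm (y - k) \<le> 2 * rr y" "\<bar>y \<bullet> k - 1\<bar> \<le> (rr y)\<^sup>2" using near_k[of y] y by auto
    then have "norm (y - k) < d0" using y(3) by (simp add: \<rho>_def)
    then have "norm R \<le> \<delta> / 4 * norm (y - k)" using d0(2)[OF y(1)] k_sing by (simp add: R_def)
    also have "\<dots> \<le> \<delta> / 4 * (2 * rr y)" using nn \<delta> by (intro mult_left_mono) auto
    finally have R: "norm R \<le> \<delta> / 2 * rr y" by simp
    have "\<bar>R \<bullet> e0\<bar> \<le> \<delta> / 2 * rr y" using Cauchy_Schwarz_ineq2[of R e0] e0 R by simp
    moreover have "\<bar>(y \<bullet> k - 1) * (A k \<bullet> e0)\<bar> \<le> \<delta> / 2 * rr y"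
    proof -
      have r0: "0 \<le> rr y" by (simp add: rr_def)
      have "\<bar>(y \<bullet> k - 1) * (A k \<bullet> e0)\<bar> \<le> (rr y)\<^sup>2 * norm (A k)"
        unfolding abs_mult using nn Cauchy_Schwarz_ineq2[of "A k" e0] e0 by (intro mult_mono) auto
      also have "\<dots> = rr y * (rr y * norm (A k))" by (simp add: power2_eq_square)
      also have "\<dots> \<le> rr y * (\<delta> / 2)"
      proof (intro mult_left_mono r0)
        have "rr y * norm (A k) \<le> \<rho> * (norm (A k) + 1)" using y(3) r0 by (intro mult_mono) auto
        also have "\<dots> \<le> \<delta> / (2 * (norm (A k) + 1)) * (norm (A k) + 1)" by (intro mult_right_mono) (auto simp: \<rho>_def)
        also have "\<dots> = \<delta> / 2" using norm_ge_zero[of "A k"] by (simp add: field_simps add_nonneg_eq_0_iff)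
        finally show "rr y * norm (A k) \<le> \<delta> / 2" .
      qed
      finally show ?thesis by (simp add: mult.commute)
    qed
    moreover have "velocity \<phi> y \<bullet> e0 - (A e1 \<bullet> e0 * (y \<bullet> e1) + A e2 \<bullet> e0 * (y \<bullet> e2)) = R \<bullet> e0 + (y \<bullet> k - 1) * (A k \<bullet> e0)"
    proof -
      have "y - k = (y \<bullet> k - 1) *\<^sub>R k + (y \<bullet> e1) *\<^sub>R e1 + (y \<bullet> e2) *\<^sub>R e2"
        using expand[of y] by (simp add: algebra_simps)
      then have "A (y - k) = (y \<bullet> k - 1) *\<^sub>R A k + (y \<bullet> e1) *\<^sub>R A e1 + (y \<bullet> e2) *\<^sub>R A e2"
        by (simp add: linear_add[OF linear_A] linear_scale[OF linear_A])
      moreover have "velocity \<phi> y = R + A (y - k)" by (simp add: R_def)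
      ultimately show ?thesis by (simp add: inner_add_left)
    qed
    ultimately show ?thesis by simp
  qed
  show ?thesis
  proof (rule that[OF \<rho> \<delta>(2)])
    fix x t assume x: "x \<in> S2" "0 < \<phi> t x \<bullet> k" "rr (\<phi> t x) < \<rho>"
    let ?y = "\<phi> t x"
    have y: "?y \<in> S2" and d: "((\<lambda>t. \<phi> t x) has_vector_derivative velocity \<phi> ?y) (at t)"
      using smooth x(1) unfolding smooth_flow_def by blast+
    have dd: "((\<lambda>t. \<phi> t x \<bullet> e0) has_real_derivative velocity \<phi> ?y \<bullet> e0) (at t)" for e0
      using bounded_linear.has_vector_derivative[OF bounded_linear_inner_left d]
      by (simp add: has_real_derivative_iff_has_vector_derivative)
    let ?\<rho> = "velocity \<phi> ?y \<bullet> e1 - (?a * (?y \<bullet> e1) + ?b * (?y \<bullet> e2))"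
    let ?\<sigma> = "velocity \<phi> ?y \<bullet> e2 - (?c * (?y \<bullet> e1) + ?d * (?y \<bullet> e2))"
    have "lyapunov_p ?a ?b ?c ?d (?y \<bullet> e1) (?y \<bullet> e2) * (velocity \<phi> ?y \<bullet> e1) + lyapunov_q ?a ?b ?c ?d (?y \<bullet> e1) (?y \<bullet> e2) * (velocity \<phi> ?y \<bullet> e2) \<le> - \<kappa> * Lf ?y"
      using \<delta>(3)[of ?\<rho> "?y \<bullet> e1" "?y \<bullet> e2" ?\<sigma>] est[OF y x(2,3) e(1)] est[OF y x(2,3) e(2)]
      by (simp add: rr_def Lf_def)
    moreover have "((\<lambda>t. Lf (\<phi> t x)) has_real_derivative lyapunov_p ?a ?b ?c ?d (?y \<bullet> e1) (?y \<bullet> e2) * (velocity \<phi> ?y \<bullet> e1) + lyapunov_q ?a ?b ?c ?d (?y \<bullet> e1) (?y \<bullet> e2) * (velocity \<phi> ?y \<bullet> e2)) (at t)"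
      unfolding Lf_def by (rule has_derivative_lyapunov[OF dd dd])
    ultimately show "\<exists>D. ((\<lambda>t. Lf (\<phi> t x)) has_real_derivative D) (at t) \<and> D \<le> - \<kappa> * Lf ?y" by blast
  qed
qed

text \<open>Projected to the tangent plane the level set is an ellipse, which is pushed radially to
  the unit circle. As the form is at least the determinant times the squared radius, the bound on
  \<open>\<epsilon>\<close> keeps the ellipse inside the unit disc, so it lifts to the open
  hemisphere.\<close>

private lemma level_circle:
  assumes \<epsilon>: "0 < \<epsilon>" "\<epsilon> < (A e1 \<bullet> e1) * (A e2 \<bullet> e2) - (A e2 \<bullet> e1) * (A e1 \<bullet> e2)"
  shows "{x \<in> S2. 0 \<le> x \<bullet> k \<and> Lf x = \<epsilon>} homeomorphic sphere (0::complex) 1"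
proof -
  let ?Q = "lyapunov (A e1 \<bullet> e1) (A e2 \<bullet> e1) (A e1 \<bullet> e2) (A e2 \<bullet> e2)"
  let ?m = "(A e1 \<bullet> e1) * (A e2 \<bullet> e2) - (A e2 \<bullet> e1) * (A e1 \<bullet> e2)"
  let ?C = "{x \<in> S2. 0 \<le> x \<bullet> k \<and> Lf x = \<epsilon>}"
  define z where "z x = Complex (x \<bullet> e1) (x \<bullet> e2)" for x
  define G where "G x = z x /\<^sub>R norm (z x)" for x
  have z_eq: "z = (\<lambda>x. of_real (x \<bullet> e1) + \<i> * of_real (x \<bullet> e2))" by (auto simp: z_def complex_eq_iff fun_eq_iff)
  have z0: "z x \<noteq> 0" if "x \<in> ?C" for x
  proof
    assume "z x = 0"
    then have "x \<bullet> e1 = 0" "x \<bullet> e2 = 0" by (auto simp: z_def complex_eq_iff)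
    then show False using that \<epsilon> by (simp add: Lf_def lyapunov_def)
  qed
  have contL: "continuous_on UNIV Lf" unfolding Lf_def lyapunov_def by (intro continuous_intros)
  have "closed {x. Lf x = \<epsilon>}" using continuous_closed_preimage_constant[OF contL closed_UNIV] by simp
  moreover have "closed {x. 0 \<le> x \<bullet> k}" by (simp add: closed_Collect_le continuous_intros)
  ultimately have "compact (S2 \<inter> ({x. 0 \<le> x \<bullet> k} \<inter> {x. Lf x = \<epsilon>}))" by (intro compact_Int_closed closed_Int) auto
  moreover have "S2 \<inter> ({x. 0 \<le> x \<bullet> k} \<inter> {x. Lf x = \<epsilon>}) = ?C" by auto
  ultimately have cC: "compact ?C" by simp
  have "continuous_on ?C G" unfolding G_def z_eq
    by (intro continuous_intros) (use z0 in \<open>auto simp: z_eq\<close>)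
  moreover have "G ` ?C = sphere 0 1"
  proof (intro subset_antisym subsetI)
    fix w :: complex assume "w \<in> sphere 0 1"
    then have w: "norm w = 1" "(Re w)\<^sup>2 + (Im w)\<^sup>2 = 1" by (auto simp: cmod_power2[symmetric])
    define Qw where "Qw = ?Q (Re w) (Im w)"
    have Qw: "?m \<le> Qw" using lyapunov_ge[of "A e1 \<bullet> e1" "A e2 \<bullet> e2" "A e2 \<bullet> e1" "A e1 \<bullet> e2" "Re w" "Im w"] w by (simp add: Qw_def)
    define l where "l = sqrt (\<epsilon> / Qw)"
    have l: "0 < l" "l\<^sup>2 = \<epsilon> / Qw" "l\<^sup>2 < 1" using Qw \<epsilon> by (auto simp: l_def)
    define x where "x = sqrt (1 - l\<^sup>2) *\<^sub>R k + (l * Re w) *\<^sub>R e1 + (l * Im w) *\<^sub>R e2"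
    have xe: "x \<bullet> k = sqrt (1 - l\<^sup>2)" "x \<bullet> e1 = l * Re w" "x \<bullet> e2 = l * Im w"
      using e k_sing inner_commute[of k e1] inner_commute[of k e2] inner_commute[of e2 e1]
      by (auto simp: x_def inner_add_left dot_square_norm)
    have "x \<bullet> x = x \<bullet> k * sqrt (1 - l\<^sup>2) + x \<bullet> e1 * (l * Re w) + x \<bullet> e2 * (l * Im w)"
      by (subst (2) x_def) (simp add: inner_add_right)
    also have "\<dots> = (sqrt (1 - l\<^sup>2))\<^sup>2 + l\<^sup>2 * ((Re w)\<^sup>2 + (Im w)\<^sup>2)" unfolding xe by (simp add: power2_eq_square algebra_simps)
    also have "\<dots> = 1" using w l by simp
    finally have "x \<in> S2" by (simp add: norm_eq_1)
    moreover have "Lf x = \<epsilon>" unfolding Lf_def xe lyapunov_scale using l Qw \<epsilon> by (simp add: Qw_def[symmetric])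
    ultimately have "x \<in> ?C" using xe l by auto
    moreover have "G x = w"
    proof -
      have "z x = l *\<^sub>R w" by (simp add: z_def xe complex_eq_iff)
      then show ?thesis using l w by (simp add: G_def)
    qed
    ultimately show "w \<in> G ` ?C" by blast
  qed (use z0 in \<open>auto simp: G_def\<close>)
  moreover have "inj_on G ?C"
  proof (rule inj_onI)
    fix x y assume xy: "x \<in> ?C" "y \<in> ?C" "G x = G y"
    define l where "l = norm (z x) / norm (z y)"
    have l: "0 < l" using z0[OF xy(1)] z0[OF xy(2)] by (simp add: l_def)
    have "z x = norm (z x) *\<^sub>R G x" using z0[OF xy(1)] by (simp add: G_def)
    also have "\<dots> = l *\<^sub>R z y" unfolding xy(3) using z0[OF xy(2)] by (simp add: G_def l_def divide_inverse)
    finally have zz: "x \<bullet> e1 = l * (y \<bullet> e1)" "x \<bullet> e2 = l * (y \<bullet> e2)" by (auto simp: z_def complex_eq_iff)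
    have "\<epsilon> = l\<^sup>2 * \<epsilon>" using xy(1,2) zz lyapunov_scale by (simp add: Lf_def)
    then have "l\<^sup>2 = 1" using \<epsilon> by simp
    then have "l = 1" using l by (simp add: power2_eq_1_iff)
    then have eq: "x \<bullet> e1 = y \<bullet> e1" "x \<bullet> e2 = y \<bullet> e2" using zz by auto
    have "x \<in> S2" "y \<in> S2" using xy by auto
    from rr_S2(2)[OF this(1)] rr_S2(2)[OF this(2)] have "(x \<bullet> k)\<^sup>2 = (y \<bullet> k)\<^sup>2" unfolding eq by linarith
    then have "x \<bullet> k = y \<bullet> k" using xy power2_eq_imp_eq by blast
    then show "x = y" using expand[of x] expand[of y] eq by metis
  qed
  ultimately show ?thesis using homeomorphism_compact[OF cC] unfolding homeomorphic_def by blast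
qed

lemma sink_trapping_region:
  obtains N L c \<epsilon> where "trapping S2 \<phi> N L k c \<epsilon>" "{x \<in> N. L x = \<epsilon>} homeomorphic sphere (0::complex) 1"
proof -
  interpret F: compact_flow S2 \<phi> by (rule smooth_flow_compact_flow[OF compact_sphere smooth])
  let ?m = "(A e1 \<bullet> e1) * (A e2 \<bullet> e2) - (A e2 \<bullet> e1) * (A e1 \<bullet> e2)"
  obtain \<rho> \<kappa> where \<rho>: "0 < \<rho>" "0 < \<kappa>" and decay:
    "\<And>x t. x \<in> S2 \<Longrightarrow> 0 < \<phi> t x \<bullet> k \<Longrightarrow> rr (\<phi> t x) < \<rho> \<Longrightarrow>
      \<exists>D. ((\<lambda>t. Lf (\<phi> t x)) has_real_derivative D) (at t) \<and> D \<le> - \<kappa> * Lf (\<phi> t x)"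
    using Lf_decay by blast
  \<comment> \<open>Then \<open>Lf x \<le> \<epsilon>\<close> forces the squared radius to be at
    most half the minimum of \<open>\<rho>\<^sup>2\<close> and 1: strictly inside the region of
    decay and off the equator.\<close>
  define \<epsilon> where "\<epsilon> = ?m * (min (\<rho>\<^sup>2) 1 / 2)"
  define N where "N = {x \<in> S2. 0 \<le> x \<bullet> k \<and> Lf x \<le> \<epsilon>}"
  define P where "P = {x \<in> S2. 0 < x \<bullet> k \<and> rr x < \<rho>}"
  have m: "0 < ?m" by (rule trace_det)
  have \<epsilon>: "0 < \<epsilon>" "\<epsilon> < ?m"
  proof -
    have "0 < min (\<rho>\<^sup>2) 1 / 2" "min (\<rho>\<^sup>2) 1 / 2 < 1" using \<rho> by auto
    from mult_pos_pos[OF m this(1)] mult_strict_left_mono[OF this(2) m]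
    show "0 < \<epsilon>" "\<epsilon> < ?m" by (simp_all only: \<epsilon>_def mult_1_right)
  qed
  have contL: "continuous_on A' Lf" for A' unfolding Lf_def lyapunov_def by (intro continuous_intros)
  have contr: "continuous_on A' rr" for A' unfolding rr_def by (intro continuous_intros)
  have Lf_ge: "?m * (rr x)\<^sup>2 \<le> Lf x" for x
    using lyapunov_ge[of "A e1 \<bullet> e1" "A e2 \<bullet> e2" "A e2 \<bullet> e1" "A e1 \<bullet> e2"] by (simp add: Lf_def rr_def)
  have NP: "x \<in> P" if "x \<in> N" for x
  proof -
    have "?m * (rr x)\<^sup>2 \<le> ?m * (min (\<rho>\<^sup>2) 1 / 2)" using Lf_ge[of x] that by (simp add: N_def \<epsilon>_def)
    then have r: "(rr x)\<^sup>2 \<le> min (\<rho>\<^sup>2) 1 / 2" using m by simp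
    have "min (\<rho>\<^sup>2) 1 \<le> \<rho>\<^sup>2" "min (\<rho>\<^sup>2) 1 \<le> 1" "0 < \<rho>\<^sup>2" using \<rho> by auto
    with r have "(rr x)\<^sup>2 < \<rho>\<^sup>2" "(rr x)\<^sup>2 < 1" by linarith+
    then have "rr x < \<rho>" "x \<bullet> k \<noteq> 0" using \<rho> rr_S2[of x] that power2_less_imp_less[of "rr x" \<rho>] by (auto simp: N_def)
    then show ?thesis using that by (auto simp: N_def P_def)
  qed
  have Lf_0: "0 \<le> Lf x" for x using Lf_ge[of x] m by (meson mult_nonneg_nonneg order_trans less_imp_le zero_le_power2)
  have exp_decay: "Lf (\<phi> t x) \<le> exp (- \<kappa> * t) * Lf x" if H: "x \<in> S2" "0 \<le> t" "\<And>s. 0 \<le> s \<Longrightarrow> s \<le> t \<Longrightarrow> \<phi> s x \<in> P" for x t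
  proof -
    have "exp (\<kappa> * t) * Lf (\<phi> t x) \<le> exp (\<kappa> * 0) * Lf (\<phi> 0 x)"
    proof (rule DERIV_nonpos_imp_nonincreasing[OF H(2)])
      fix s assume s: "0 \<le> s" "s \<le> t"
      then obtain D where D: "((\<lambda>t. Lf (\<phi> t x)) has_real_derivative D) (at s)" "D \<le> - \<kappa> * Lf (\<phi> s x)"
        using decay[OF H(1)] H(3)[OF s] by (auto simp: P_def)
      have "((\<lambda>t. exp (\<kappa> * t) * Lf (\<phi> t x)) has_real_derivative (\<kappa> * exp (\<kappa> * s)) * Lf (\<phi> s x) + D * exp (\<kappa> * s)) (at s)"
        by (rule derivative_eq_intros D(1) refl)+ simp
      moreover have "(\<kappa> * exp (\<kappa> * s)) * Lf (\<phi> s x) + D * exp (\<kappa> * s) = exp (\<kappa> * s) * (\<kappa> * Lf (\<phi> s x) + D)"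
        by (simp add: algebra_simps)
      moreover have "exp (\<kappa> * s) * (\<kappa> * Lf (\<phi> s x) + D) \<le> 0" using D(2) by (simp add: mult_le_0_iff)
      ultimately show "\<exists>y. ((\<lambda>t. exp (\<kappa> * t) * Lf (\<phi> t x)) has_real_derivative y) (at s) \<and> y \<le> 0" by metis
    qed
    then show ?thesis using F.flow_0[OF H(1)] by (simp add: exp_minus field_simps)
  qed
  have closedN: "closedin (top_of_set S2) N"
  proof -
    have "closed ({x. 0 \<le> x \<bullet> k} \<inter> {x. Lf x \<le> \<epsilon>})"
      by (intro closed_Int closed_Collect_le contL continuous_intros)
    moreover have "N = S2 \<inter> ({x. 0 \<le> x \<bullet> k} \<inter> {x. Lf x \<le> \<epsilon>})" by (auto simp: N_def)
    ultimately show ?thesis using closedin_closed_Int by metis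
  qed
  have stay: "\<phi> t x \<in> N" if "x \<in> N" "0 \<le> t" "\<And>s. 0 \<le> s \<Longrightarrow> s \<le> t \<Longrightarrow> \<phi> s x \<in> P" for x t
  proof -
    have "x \<in> S2" using that by (simp add: N_def)
    then have "Lf (\<phi> t x) \<le> exp (- \<kappa> * t) * Lf x" using exp_decay that by blast
    also have "\<dots> \<le> 1 * \<epsilon>" using that Lf_0[of x] \<rho> by (intro mult_mono) (auto simp: N_def)
    finally show ?thesis using that(3)[of t] that(2) by (simp add: N_def P_def)
  qed
  \<comment> \<open>First exit time: before it the trajectory stays in \<open>N\<close>, so at that
    time too by closedness, and \<open>N\<close> lies inside \<open>P\<close>.\<close>
  have in_P: "\<phi> t x \<in> P" if x: "x \<in> N" and t: "0 \<le> t" for x t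
  proof (rule ccontr)
    assume nP: "\<phi> t x \<notin> P"
    have xS: "x \<in> S2" using x by (simp add: N_def)
    have contx: "continuous_on UNIV (\<lambda>s. \<phi> s x)" by (intro F.continuous_on_flow continuous_intros xS)
    define E where "E = {s. 0 \<le> s \<and> (\<phi> s x \<bullet> k \<le> 0 \<or> \<rho> \<le> rr (\<phi> s x))}"
    have E: "s \<in> E \<longleftrightarrow> 0 \<le> s \<and> \<phi> s x \<notin> P" for s using F.flow_in[OF xS] by (auto simp: E_def P_def)
    have "E = {0..} \<inter> ({s. \<phi> s x \<bullet> k \<le> 0} \<union> {s. \<rho> \<le> rr (\<phi> s x)})" by (auto simp: E_def)
    moreover have "closed \<dots>"
      by (intro closed_Int closed_Un closed_Collect_le continuous_intros contx continuous_on_compose2[OF contr contx]) auto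
    ultimately have cE: "closed E" by simp
    have "E \<noteq> {}" "bdd_below E" using nP t E by (auto simp: E_def)
    then have i: "Inf E \<in> E" using cE closed_contains_Inf by blast
    define i0 where "i0 = Inf E"
    have i': "i0 \<in> E" using i by (simp only: i0_def)
    have before: "\<phi> s x \<in> P" if "0 \<le> s" "s < i0" for s
      using that E cInf_lower[OF _ \<open>bdd_below E\<close>, of s] by (auto simp: i0_def)
    have i0: "0 < i0"
    proof -
      have "\<phi> 0 x \<in> P" using NP[OF x] F.flow_0[OF xS] by simp
      then have "i0 \<noteq> 0" using i' E[of 0] by metis
      moreover have "0 \<le> i0" using i' E[of i0] by blast
      ultimately show ?thesis by simp
    qed
    have "\<phi> s x \<in> N" if "0 \<le> s" "s < i0" for s using stay[OF x that(1)] before that by auto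
    then have ev: "\<forall>\<^sub>F s in at_left i0. \<phi> s x \<in> N" using i0
      by (auto simp: eventually_at_left_field intro!: exI[of _ 0])
    obtain K where K: "closed K" "N = S2 \<inter> K" using closedN by (auto simp: closedin_closed)
    have "((\<lambda>s. \<phi> s x) \<longlongrightarrow> \<phi> i0 x) (at_left i0)" by (rule F.tendsto_flow) (use xS in auto)
    then have "\<phi> i0 x \<in> K"
      by (rule Lim_in_closed_set[OF K(1), rotated 2]) (use ev K in \<open>auto elim: eventually_mono\<close>)
    then have "\<phi> i0 x \<in> P" using NP K F.flow_in[OF xS] by auto
    then show False using i' E[of i0] by blast
  qed
  have "trapping S2 \<phi> N Lf k \<kappa> \<epsilon>"
  proof
    show "closedin (top_of_set S2) N" by (rule closedN)
    show "Lf k = 0" using e by (simp add: Lf_def lyapunov_def inner_commute)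
    then show "k \<in> N" using k_sing \<epsilon> by (simp add: N_def)
    show "0 \<le> Lf x \<and> Lf x \<le> \<epsilon>" if "x \<in> N" for x using that Lf_0 by (simp add: N_def)
    show "x = k" if "x \<in> N" "Lf x = 0" for x
    proof -
      have "?m * (rr x)\<^sup>2 \<le> 0" using Lf_ge[of x] that by simp
      then have "(rr x)\<^sup>2 = 0" using m by (simp add: mult_le_0_iff)
      then show ?thesis using near_k[of x] that by (simp add: N_def)
    qed
    show "\<phi> t x \<in> N \<and> Lf (\<phi> t x) \<le> exp (- \<kappa> * t) * Lf x" if "x \<in> N" "0 \<le> t" for x t
      using stay[OF that] exp_decay[of x t] in_P[OF that(1)] that by (simp add: N_def)
    have eq: "{x \<in> N. Lf x < \<epsilon>} = S2 \<inter> ({x. 0 < x \<bullet> k} \<inter> {x. Lf x < \<epsilon>})"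
      using NP by (auto simp: N_def P_def)
    show "openin (top_of_set S2) {x \<in> N. Lf x < \<epsilon>}"
      unfolding eq by (intro openin_open_Int open_Int open_Collect_less contL continuous_intros)
  qed (rule \<rho>(2), rule \<epsilon>(1))
  moreover have "{x \<in> N. Lf x = \<epsilon>} = {x \<in> S2. 0 \<le> x \<bullet> k \<and> Lf x = \<epsilon>}" by (auto simp: N_def)
  ultimately show ?thesis using that level_circle[OF \<epsilon>] by metis
qed

end

theorem sink_basin:
  assumes "smooth_flow S2 \<phi>" "sink S2 \<phi> k"
  obtains V where "basin S2 \<phi> k V" "{x \<in> S2. V x = 1/2} homeomorphic sphere (0::complex) 1"
proof -
  have "norm k = 1" using assms(2) by (auto simp: sink_def singular_points_def)
  then obtain e1 e2 where "norm e1 = 1" "norm e2 = 1" "e1 \<bullet> k = 0" "e2 \<bullet> k = 0" "e1 \<bullet> e2 = 0"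
    "\<And>x. x = (x \<bullet> k) *\<^sub>R k + (x \<bullet> e1) *\<^sub>R e1 + (x \<bullet> e2) *\<^sub>R e2"
    using orthonormal_frame by metis
  from sink_trapping_region[OF assms this] obtain N L c \<epsilon>
    where N: "trapping S2 \<phi> N L k c \<epsilon>" "{x \<in> N. L x = \<epsilon>} homeomorphic sphere (0::complex) 1" by metis
  interpret trapping S2 \<phi> N L k c \<epsilon> by (rule N)
  have "{x \<in> S2. entry x = 1/2} = {x \<in> N. L x = \<epsilon>}" using entry_eq_half_iff N_M by blast
  then show ?thesis using that[OF basin_entry] N(2) by simp
qed

lemma sink_reverse_flow:
  assumes "smooth_flow M \<phi>" "source M \<phi> s"
  shows "sink M (reverse_flow \<phi>) s"
proof -
  have s: "s \<in> M" using assms(2) by (simp add: source_def singular_points_def)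
  let ?A = "frechet_derivative (velocity \<phi>) (at s within M)"
  have "((\<lambda>x. - velocity \<phi> x) has_derivative (\<lambda>h. - ?A h)) (at s within M)"
    by (intro has_derivative_minus smooth_flow_differentiable assms(1) s)
  then have d: "(velocity (reverse_flow \<phi>) has_derivative (\<lambda>h. - ?A h)) (at s within M)"
    by (rule has_derivative_transform[OF s, rotated]) (use velocity_reverse_flow[OF assms(1)] in auto)
  have "linear_part_eigenvalue M \<phi> s (- z)" if z: "linear_part_eigenvalue M (reverse_flow \<phi>) s z" for z
  proof -
    obtain u v where uv: "u \<in> tangent_vectors M s" "v \<in> tangent_vectors M s" "u \<noteq> 0 \<or> v \<noteq> 0"
      "- ?A u = Re z *\<^sub>R u - Im z *\<^sub>R v" "- ?A v = Im z *\<^sub>R u + Re z *\<^sub>R v"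
      using z unfolding linear_part_eigenvalue_iff[OF d] complex_eigenvalue_on_def by blast
    have "?A u = Re (- z) *\<^sub>R u - Im (- z) *\<^sub>R v" "?A v = Im (- z) *\<^sub>R u + Re (- z) *\<^sub>R v"
      using uv(4,5) by (simp_all add: minus_equation_iff[of "?A u"] minus_equation_iff[of "?A v"])
    then show ?thesis unfolding linear_part_eigenvalue_def complex_eigenvalue_on_def using uv(1-3) by blast
  qed
  then show ?thesis
    using assms(2) velocity_reverse_flow[OF assms(1) s] unfolding source_def sink_def singular_points_def by force
qed

section \<open>Limit sets\<close>

lemma alpha_limit_eq_omega_limit_reverse: "alpha_limit \<phi> x = omega_limit (reverse_flow \<phi>) x"
proof -
  have "(\<exists>s. filterlim s at_bot sequentially \<and> (\<lambda>n. \<phi> (s n) x) \<longlonglongrightarrow> y) \<longleftrightarrow>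
    (\<exists>s. filterlim s at_top sequentially \<and> (\<lambda>n. \<phi> (- s n) x) \<longlonglongrightarrow> y)" (is "?L \<longleftrightarrow> ?R") for y
  proof
    assume ?L
    then obtain s where "filterlim s at_bot sequentially" "(\<lambda>n. \<phi> (s n) x) \<longlonglongrightarrow> y" by blast
    then have "filterlim (\<lambda>n. - s n) at_top sequentially \<and> (\<lambda>n. \<phi> (- (- s n)) x) \<longlonglongrightarrow> y"
      by (simp add: filterlim_uminus_at_top)
    then show ?R by (rule exI[of _ "\<lambda>n. - s n"])
  next
    assume ?R
    then obtain s where "filterlim s at_top sequentially" "(\<lambda>n. \<phi> (- s n) x) \<longlonglongrightarrow> y" by blast
    then have "filterlim (\<lambda>n. - s n) at_bot sequentially \<and> (\<lambda>n. \<phi> (- s n) x) \<longlonglongrightarrow> y"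
      by (simp add: filterlim_uminus_at_top)
    then show ?L by (rule exI[of _ "\<lambda>n. - s n"])
  qed
  then show ?thesis by (simp add: alpha_limit_def omega_limit_def reverse_flow_def)
qed

lemma omega_limit_of_tendsto:
  fixes p :: "'a::t2_space"
  assumes "((\<lambda>t. \<phi> t x) \<longlongrightarrow> p) at_top"
  shows "omega_limit \<phi> x = {p}"
proof (intro subset_antisym subsetI)
  fix y assume "y \<in> omega_limit \<phi> x"
  then obtain s where s: "filterlim s at_top sequentially" "(\<lambda>n. \<phi> (s n) x) \<longlonglongrightarrow> y"
    by (auto simp: omega_limit_def)
  have "(\<lambda>n. \<phi> (s n) x) \<longlonglongrightarrow> p" by (rule filterlim_compose[OF assms s(1)])
  then show "y \<in> {p}" using LIMSEQ_unique s(2) by blast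
next
  fix y assume "y \<in> {p}"
  moreover have "(\<lambda>n. \<phi> (real n) x) \<longlonglongrightarrow> p" by (rule filterlim_compose[OF assms filterlim_real_sequentially])
  ultimately show "y \<in> omega_limit \<phi> x" using filterlim_real_sequentially unfolding omega_limit_def by blast
qed

context compact_flow begin

lemma tendsto_of_omega_limit:
  assumes x: "x \<in> M" and sub: "omega_limit \<phi> x \<subseteq> {p}"
  shows "((\<lambda>t. \<phi> t x) \<longlongrightarrow> p) at_top"
proof (rule tendstoI, rule ccontr)
  fix e :: real assume "e > 0" "\<not> (\<forall>\<^sub>F t in at_top. dist (\<phi> t x) p < e)"
  then have "\<forall>n. \<exists>t\<ge>real n. \<not> dist (\<phi> t x) p < e" by (auto simp: eventually_at_top_linorder)
  then obtain s where s: "\<And>n. s n \<ge> real n" "\<And>n. \<not> dist (\<phi> (s n) x) p < e" by metis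
  have "\<forall>n. \<phi> (s n) x \<in> M" using flow_in x by blast
  then obtain l r where l: "strict_mono r" "((\<lambda>n. \<phi> (s n) x) \<circ> r) \<longlonglongrightarrow> l"
    using compact_M[unfolded compact_def, THEN spec, of "\<lambda>n. \<phi> (s n) x"] by blast
  have "filterlim s at_top sequentially"
    by (rule filterlim_at_top_mono[OF filterlim_real_sequentially]) (use s in auto)
  then have "filterlim (\<lambda>n. s (r n)) at_top sequentially"
    by (rule filterlim_compose) (rule filterlim_subseq[OF l(1)])
  then have "l \<in> omega_limit \<phi> x" using l(2) unfolding omega_limit_def o_def by blast
  then have "l = p" using sub by blast
  then have "\<forall>\<^sub>F n in sequentially. dist (\<phi> (s (r n)) x) p < e"
    using tendstoD[OF l(2) \<open>e > 0\<close>] by (simp add: o_def)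
  then show False using s(2) by (auto simp: eventually_sequentially)
qed

lemma omega_limit_nonwandering:
  assumes x: "x \<in> M"
  shows "omega_limit \<phi> x \<subseteq> nonwandering_set M \<phi>"
proof
  fix y assume "y \<in> omega_limit \<phi> x"
  then obtain s where s: "filterlim s at_top sequentially" "(\<lambda>n. \<phi> (s n) x) \<longlonglongrightarrow> y"
    by (auto simp: omega_limit_def)
  have "y \<in> M" using closed_sequentially[OF compact_imp_closed[OF compact_M] _ s(2)] flow_in x by blast
  moreover have "\<exists>t\<ge>T. \<exists>z\<in>U \<inter> M. \<phi> t z \<in> U" if U: "open U" "y \<in> U" for U T
  proof -
    have ev: "\<forall>\<^sub>F n in sequentially. \<phi> (s n) x \<in> U" using topological_tendstoD s(2) U by blast
    from eventually_happens'[OF trivial_limit_sequentially this] obtain m where m: "\<phi> (s m) x \<in> U" by blast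
    have "\<forall>\<^sub>F n in sequentially. s m + T \<le> s n" using s(1) by (auto simp: filterlim_at_top)
    with ev have "\<forall>\<^sub>F n in sequentially. \<phi> (s n) x \<in> U \<and> s m + T \<le> s n" by eventually_elim auto
    from eventually_happens'[OF trivial_limit_sequentially this]
    obtain n where n: "\<phi> (s n) x \<in> U" "s m + T \<le> s n" by blast
    have "\<phi> (s n - s m) (\<phi> (s m) x) = \<phi> (s n) x" using flow_add[OF x, of "s n - s m" "s m"] by simp
    then have "\<phi> (s n - s m) (\<phi> (s m) x) \<in> U" using n by simp
    moreover have "\<phi> (s m) x \<in> U \<inter> M" using m flow_in x by blast
    moreover have "T \<le> s n - s m" using n by simp
    ultimately show ?thesis by blast
  qed
  ultimately show "y \<in> nonwandering_set M \<phi>" unfolding nonwandering_set_def by blast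
qed

end

context basin begin

text \<open>The set \<open>V = 1\<close> is invariant and closed, and \<open>k\<close> is not in
  it.\<close>

lemma attractor_in_omega_limit:
  assumes x: "x \<in> M" and k: "k \<in> omega_limit \<phi> x"
  shows "V x < 1"
proof (rule ccontr)
  assume "\<not> V x < 1"
  then have "V x = 1" using V_bounds[OF x] by simp
  then have V1: "V (\<phi> t x) = 1" for t using V_flow[OF x] by simp
  obtain s where "(\<lambda>n. \<phi> (s n) x) \<longlonglongrightarrow> k" using k by (auto simp: omega_limit_def)
  then have "(\<lambda>n. V (\<phi> (s n) x)) \<longlonglongrightarrow> V k"
    by (rule continuous_on_tendsto_compose[OF continuous_V _ attractor_in]) (simp add: flow_in x)
  then have "V k = 1" unfolding V1 by (simp add: LIMSEQ_const_iff)
  then show False using V_eq_0_iff[OF attractor_in] by simp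
qed

text \<open>In backward time a positive value of \<open>V\<close> tends to 1 and cannot come close
  to \<open>V k = 0\<close>.\<close>

lemma attractor_in_alpha_limit:
  assumes x: "x \<in> M" and k: "k \<in> omega_limit (reverse_flow \<phi>) x"
  shows "x = k"
proof -
  obtain s where s: "filterlim s at_top sequentially" "(\<lambda>n. \<phi> (- s n) x) \<longlonglongrightarrow> k"
    using k by (auto simp: omega_limit_def reverse_flow_def)
  have "(\<lambda>n. V (\<phi> (- s n) x)) \<longlonglongrightarrow> V k"
    by (rule continuous_on_tendsto_compose[OF continuous_V s(2) attractor_in]) (simp add: flow_in x)
  moreover have "V k = 0" using V_eq_0_iff[OF attractor_in] by simp
  ultimately have lim: "(\<lambda>n. lgs (- s n) (V x)) \<longlonglongrightarrow> 0" using V_flow[OF x] by simp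
  have "\<not> 0 < V x"
  proof
    assume "0 < V x"
    moreover have "filterlim (\<lambda>n. - s n) at_bot sequentially" using s(1) by (simp add: filterlim_uminus_at_top)
    ultimately have "(\<lambda>n. lgs (- s n) (V x)) \<longlonglongrightarrow> 1"
      using filterlim_compose[OF lgs_tendsto_1] V_bounds[OF x] by blast
    then show False using LIMSEQ_unique[OF lim, of 1] by simp
  qed
  then show ?thesis using V_bounds[OF x] V_eq_0_iff[OF x] by simp
qed

end

lemma (in compact_flow) fixed_point_of_tendsto:
  assumes "x \<in> M" "\<And>t. \<phi> t x = x" "((\<lambda>t. \<phi> t x) \<longlongrightarrow> p) at_top"
  shows "p = x"
  using assms(3) unfolding assms(2) by (simp add: tendsto_const_iff)

lemma singular_point_fixed:
  fixes M :: "'a::euclidean_space set"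
  assumes "compact M" "smooth_flow M \<phi>" "x \<in> singular_points M \<phi>"
  shows "\<phi> t x = x"
proof -
  interpret compact_flow M \<phi> by (rule smooth_flow_compact_flow[OF assms(1,2)])
  have x: "x \<in> M" "velocity \<phi> x = 0" using assms(3) by (auto simp: singular_points_def)
  have nonneg: "x = \<phi> t x" if "0 \<le> t" for t
    by (rule smooth_flow_unique[OF assms(1,2) that order_refl, of "\<lambda>_. x" x]) (use x in auto)
  show ?thesis
  proof (cases "0 \<le> t")
    case False
    then have "\<phi> t x = \<phi> t (\<phi> (- t) x)" using nonneg[of "- t"] by simp
    then show ?thesis using flow_inverse(2)[OF x(1)] by simp
  qed (use nonneg in simp)
qed

lemma fixed_point_singular:
  assumes "x \<in> M" "\<And>t. \<phi> t x = x"
  shows "x \<in> singular_points M \<phi>"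
  unfolding singular_points_def velocity_def using assms by (simp add: vector_derivative_at)

section \<open>Saddle-node charts\<close>

text \<open>A chart matches arcs but not times, so convergence to \<open>p\<close> has to be
  recovered. \<open>R\<close> is reachability in the model ball, in either direction of time, and
  \<open>d\<close> spans a half-axis; one statement thus serves all three separatrices.
  \<open>into\<close> says that the half-axis is run through towards 0, \<open>stay\<close> that
  nothing else can be reached from it.\<close>

lemma (in compact_flow) branch_limit:
  fixes h :: "'a \<Rightarrow> real \<times> real"
  assumes U: "U \<subseteq> M" "p \<in> U" "h p = 0" and hom: "homeomorphism U (ball 0 \<epsilon>) h g"
    and p: "\<And>t. \<phi> t p = p"
    and R: "\<And>x y. x \<in> U \<Longrightarrow> y \<in> U \<Longrightarrow> orbit_arc_in \<phi> U x y \<longleftrightarrow> R (h x) (h y)"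
    and d: "norm d = 1"
    and into: "\<And>r r'. 0 < r' \<Longrightarrow> r' \<le> r \<Longrightarrow> r < \<epsilon> \<Longrightarrow> R (r *\<^sub>R d) (r' *\<^sub>R d)"
    and stay: "\<And>r w. 0 < r \<Longrightarrow> r < \<epsilon> \<Longrightarrow> R (r *\<^sub>R d) w \<Longrightarrow> \<exists>r'. 0 < r' \<and> r' \<le> r \<and> w = r' *\<^sub>R d"
    and r: "0 < r" "r < \<epsilon>"
  shows "((\<lambda>t. \<phi> t (g (r *\<^sub>R d))) \<longlongrightarrow> p) at_top"
    and "0 \<le> t \<Longrightarrow> \<exists>r'. 0 < r' \<and> r' \<le> r \<and> \<phi> t (g (r *\<^sub>R d)) = g (r' *\<^sub>R d)"
proof -
  have in_ball: "q *\<^sub>R d \<in> ball 0 \<epsilon>" if "0 < q" "q < \<epsilon>" for q using that d by simp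
  have gU: "g z \<in> U" "h (g z) = z" if "z \<in> ball 0 \<epsilon>" for z using hom that unfolding homeomorphism_def by blast+
  have hU: "g (h x) = x" if "x \<in> U" for x using hom that unfolding homeomorphism_def by blast
  have g0: "g 0 = p" using hU[OF U(2)] U(3) by simp
  have reach: "\<exists>T\<ge>0. \<phi> T (g (q *\<^sub>R d)) = g (q' *\<^sub>R d) \<and> (\<forall>t\<in>{0..T}. \<phi> t (g (q *\<^sub>R d)) \<in> U)"
    if q: "0 < q'" "q' \<le> q" "q < \<epsilon>" for q q'
  proof -
    have "orbit_arc_in \<phi> U (g (q *\<^sub>R d)) (g (q' *\<^sub>R d))"
      using R gU in_ball into[OF q] q by simp
    then show ?thesis unfolding orbit_arc_in_def .
  qed
  have on: "\<exists>q'. 0 < q' \<and> q' \<le> q \<and> \<phi> t (g (q *\<^sub>R d)) = g (q' *\<^sub>R d)" if q: "0 < q" "q < \<epsilon>" and t: "0 \<le> t" for q t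
  proof -
    let ?x = "g (q *\<^sub>R d)"
    have x: "?x \<in> U" "?x \<in> M" "h ?x = q *\<^sub>R d" using gU[OF in_ball[OF q]] U by auto
    have "\<exists>T\<ge>t. \<forall>s\<in>{0..T}. \<phi> s ?x \<in> U"
    proof (rule ccontr)
      assume no: "\<not> ?thesis"
      \<comment> \<open>If the trajectory did not stay in \<open>U\<close> up to time
        \<open>t\<close>, all these points, which tend to \<open>p\<close>, would be reached within
        \<open>{0..t}\<close>; a limit of their times would bring the trajectory to the fixed point
        \<open>p\<close> in finite time.\<close>
      define Q where "Q n = q / real (n + 1)" for n
      have Q: "0 < Q n" "Q n \<le> q" for n using q by (auto simp: Q_def field_simps)
      obtain T where T: "\<And>n. 0 \<le> T n" "\<And>n. \<phi> (T n) ?x = g (Q n *\<^sub>R d)" "\<And>n. \<forall>s\<in>{0..T n}. \<phi> s ?x \<in> U"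
        using reach[OF Q q(2)] by metis
      have "T n \<in> {0..t}" for n
      proof (rule ccontr)
        assume "T n \<notin> {0..t}"
        then have "t \<le> T n" using T(1)[of n] by simp
        then show False using no T(3)[of n] by blast
      qed
      then obtain l \<rho> where l: "strict_mono \<rho>" "(T \<circ> \<rho>) \<longlonglongrightarrow> l"
        using compact_Icc[of 0 t] unfolding compact_def by blast
      have "(\<lambda>n. \<phi> ((T \<circ> \<rho>) n) ?x) \<longlonglongrightarrow> \<phi> l ?x"
        by (rule tendsto_flow[OF l(2)]) (use x in auto)
      moreover have "(\<lambda>n. \<phi> ((T \<circ> \<rho>) n) ?x) \<longlonglongrightarrow> p"
      proof -
        have "(\<lambda>n. Q n *\<^sub>R d) \<longlonglongrightarrow> 0 *\<^sub>R d"
          unfolding Q_def by (intro tendsto_intros) (use LIMSEQ_Suc[OF lim_const_over_n[of q]] in simp)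
        then have "(\<lambda>n. Q (\<rho> n) *\<^sub>R d) \<longlonglongrightarrow> 0"
          using LIMSEQ_subseq_LIMSEQ[OF _ l(1)] by (force simp: o_def)
        moreover have "continuous_on (ball 0 \<epsilon>) g" using hom by (simp add: homeomorphism_def)
        moreover have "\<forall>n. Q (\<rho> n) *\<^sub>R d \<in> ball 0 \<epsilon>" using in_ball Q q by (meson le_less_trans)
        ultimately have "(\<lambda>n. g (Q (\<rho> n) *\<^sub>R d)) \<longlonglongrightarrow> g 0"
          using r by (intro continuous_on_tendsto_compose[of "ball 0 \<epsilon>" g]) auto
        then show ?thesis using T(2) g0 by (simp add: o_def)
      qed
      ultimately have "\<phi> l ?x = p" using LIMSEQ_unique by blast
      then have "?x = p" using flow_inverse(1)[OF x(2), of l] p by metis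
      then have "q *\<^sub>R d = 0" using x(3) U(3) by simp
      then show False using q d by auto
    qed
    then obtain T where T: "t \<le> T" "\<forall>s\<in>{0..T}. \<phi> s ?x \<in> U" by (elim exE conjE)
    then have sU: "\<forall>s\<in>{0..t}. \<phi> s ?x \<in> U" by simp
    have arc: "orbit_arc_in \<phi> U ?x (\<phi> t ?x)"
      unfolding orbit_arc_in_def by (rule exI[of _ t]) (use t sU in simp)
    have tU: "\<phi> t ?x \<in> U" using sU t by simp
    have "R (q *\<^sub>R d) (h (\<phi> t ?x))" using R[OF x(1) tU] arc x(3) by simp
    then obtain q' where "0 < q'" "q' \<le> q" "h (\<phi> t ?x) = q' *\<^sub>R d" using stay q by blast
    then show ?thesis using hU[OF tU] by metis
  qed
  show "0 \<le> t \<Longrightarrow> \<exists>r'. 0 < r' \<and> r' \<le> r \<and> \<phi> t (g (r *\<^sub>R d)) = g (r' *\<^sub>R d)" using on[OF r] .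
  show "((\<lambda>t. \<phi> t (g (r *\<^sub>R d))) \<longlongrightarrow> p) at_top"
  proof (rule tendstoI)
    fix e :: real assume e: "0 < e"
    have gc: "continuous_on (ball 0 \<epsilon>) g" using hom by (simp add: homeomorphism_def)
    have "0 \<in> ball 0 \<epsilon>" using r by simp
    from gc[unfolded continuous_on_iff, rule_format, OF this e]
    obtain \<delta> where \<delta>: "0 < \<delta>" "\<And>z. z \<in> ball 0 \<epsilon> \<Longrightarrow> dist z 0 < \<delta> \<Longrightarrow> dist (g z) (g 0) < e"
      by blast
    define q where "q = min r (\<delta> / 2)"
    have q: "0 < q" "q \<le> r" "q < \<epsilon>" "q < \<delta>" using \<delta>(1) r by (auto simp: q_def)
    obtain T where T: "0 \<le> T" "\<phi> T (g (r *\<^sub>R d)) = g (q *\<^sub>R d)" using reach[OF q(1,2) r(2)] by blast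
    have x: "g (r *\<^sub>R d) \<in> M" using gU[OF in_ball[OF r]] U by blast
    have "dist (\<phi> t (g (r *\<^sub>R d))) p < e" if t: "T \<le> t" for t
    proof -
      have eq: "\<phi> t (g (r *\<^sub>R d)) = \<phi> (t - T) (g (q *\<^sub>R d))" using flow_add[OF x, of "t - T" T] T(2) by simp
      obtain q' where q': "0 < q'" "q' \<le> q" "\<phi> (t - T) (g (q *\<^sub>R d)) = g (q' *\<^sub>R d)"
        using on[OF q(1,3), of "t - T"] t by auto
      have "\<phi> t (g (r *\<^sub>R d)) = g (q' *\<^sub>R d)" using eq q'(3) by simp
      then show ?thesis using \<delta>(2)[of "q' *\<^sub>R d"] in_ball[of q'] q q' d g0 by (simp add: dist_norm)
    qed
    then show "\<forall>\<^sub>F t in at_top. dist (\<phi> t (g (r *\<^sub>R d))) p < e" by (auto simp: eventually_at_top_linorder)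
  qed
qed

section \<open>The model field on its half-axes\<close>

lemma saddle_node_model_lipschitz:
  assumes "0 < \<epsilon>"
  shows "(1 + 2 * \<epsilon>)-lipschitz_on (ball 0 \<epsilon>) saddle_node_model"
proof (rule lipschitz_onI)
  fix z w :: "real \<times> real" assume zw: "z \<in> ball 0 \<epsilon>" "w \<in> ball 0 \<epsilon>"
  have s: "\<bar>snd z\<bar> \<le> \<epsilon>" "\<bar>snd w\<bar> \<le> \<epsilon>" using zw norm_snd_le[of "snd z" "fst z"] norm_snd_le[of "snd w" "fst w"] by auto
  have c: "\<bar>fst z - fst w\<bar> \<le> norm (z - w)" "\<bar>snd z - snd w\<bar> \<le> norm (z - w)"
    using norm_fst_le[of "fst (z - w)" "snd (z - w)", unfolded prod.collapse]
      norm_snd_le[of "snd (z - w)" "fst (z - w)", unfolded prod.collapse] by auto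
  have "norm (saddle_node_model z - saddle_node_model w) \<le> \<bar>fst z - fst w\<bar> + \<bar>(snd z)\<^sup>2 - (snd w)\<^sup>2\<bar>"
    using norm_Pair_le[of "fst z - fst w" "(snd z)\<^sup>2 - (snd w)\<^sup>2"] by (simp add: saddle_node_model_def)
  also have "(snd z)\<^sup>2 - (snd w)\<^sup>2 = (snd z + snd w) * (snd z - snd w)" by (simp add: power2_eq_square algebra_simps)
  also have "\<bar>fst z - fst w\<bar> + \<bar>(snd z + snd w) * (snd z - snd w)\<bar> \<le> norm (z - w) + (2 * \<epsilon>) * norm (z - w)"
    unfolding abs_mult using c s by (intro add_mono mult_mono) auto
  finally show "dist (saddle_node_model z) (saddle_node_model w) \<le> (1 + 2 * \<epsilon>) * dist z w"
    by (simp add: dist_norm algebra_simps)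
qed (use assms in simp)

text \<open>On the negative y-axis the model is solved by \<open>- 1 / (1 / r + t)\<close>, which
  creeps towards 0; on the x-axis the exponential solutions move away. Hence one separatrix of the
  hyperbolic sectors enters and two leave.\<close>

lemma model_y_axis_into:
  assumes "0 < r'" "r' \<le> r" "r < \<epsilon>"
  shows "flows_to saddle_node_model (ball 0 \<epsilon>) (r *\<^sub>R (0, -1)) (r' *\<^sub>R (0, -1))"
  unfolding flows_to_def
proof (intro exI[of _ "1 / r' - 1 / r"] exI[of _ "\<lambda>t. (0, - 1 / (1 / r + t))"] conjI ballI)
  let ?\<gamma> = "\<lambda>t. (0, - 1 / (1 / r + t)) :: real \<times> real"
  show "0 \<le> 1 / r' - 1 / r" using assms by (simp add: frac_le)
  show "?\<gamma> 0 = r *\<^sub>R (0, -1)" using assms by simp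
  show "?\<gamma> (1 / r' - 1 / r) = r' *\<^sub>R (0, -1)" by simp
  fix t assume "t \<in> {0..1 / r' - 1 / r}"
  then have t: "0 \<le> t" by simp
  have p: "0 < 1 / r + t" using t assms by (intro add_pos_nonneg) auto
  have "1 / (1 / r + t) \<le> 1 / (1 / r)" using t assms by (intro divide_left_mono mult_pos_pos p) auto
  then show "?\<gamma> t \<in> ball 0 \<epsilon>" using assms p by simp
  have "((\<lambda>t. - 1 / (1 / r + t)) has_real_derivative (- 1 / (1 / r + t))\<^sup>2) (at t within {0..1 / r' - 1 / r})"
    by (rule derivative_eq_intros refl)+ (use p in \<open>auto simp: power2_eq_square\<close>)
  then show "(?\<gamma> has_vector_derivative saddle_node_model (?\<gamma> t)) (at t within {0..1 / r' - 1 / r})"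
    unfolding saddle_node_model_def
    by (intro has_vector_derivative_Pair) (simp_all add: has_real_derivative_iff_has_vector_derivative)
qed

lemma model_y_axis_stay:
  assumes r: "0 < r" "r < \<epsilon>" and w: "flows_to saddle_node_model (ball 0 \<epsilon>) (r *\<^sub>R (0, -1)) w"
  shows "\<exists>r'. 0 < r' \<and> r' \<le> r \<and> w = r' *\<^sub>R (0, -1)"
proof -
  obtain T \<gamma> where \<gamma>: "0 \<le> T" "\<gamma> 0 = r *\<^sub>R (0, -1)" "\<gamma> T = w"
    "\<And>t. t \<in> {0..T} \<Longrightarrow> \<gamma> t \<in> ball 0 \<epsilon> \<and> (\<gamma> has_vector_derivative saddle_node_model (\<gamma> t)) (at t within {0..T})"
    using w unfolding flows_to_def by blast
  let ?c = "\<lambda>t. (0, - 1 / (1 / r + t)) :: real \<times> real"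
  have "\<gamma> T = ?c T"
  proof (rule integral_curves_unique[OF saddle_node_model_lipschitz \<gamma>(1) order_refl])
    show "0 < \<epsilon>" using r by simp
    show "\<gamma> 0 = ?c 0" using \<gamma>(2) r by simp
    show "\<gamma> s \<in> ball 0 \<epsilon> \<and> (\<gamma> has_vector_derivative saddle_node_model (\<gamma> s)) (at s within {0..T})"
      if "s \<in> {0..T}" for s using \<gamma>(4)[OF that] .
    fix t assume "t \<in> {0..T}"
    then have t: "0 \<le> t" by simp
    have p: "0 < 1 / r + t" using t r by (intro add_pos_nonneg) auto
    have "1 / (1 / r + t) \<le> 1 / (1 / r)" using t r by (intro divide_left_mono mult_pos_pos p) auto
    then have "?c t \<in> ball 0 \<epsilon>" using r p by simp
    moreover have "((\<lambda>t. - 1 / (1 / r + t)) has_real_derivative (- 1 / (1 / r + t))\<^sup>2) (at t within {0..T})"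
      by (rule derivative_eq_intros refl)+ (use p in \<open>auto simp: power2_eq_square\<close>)
    then have "(?c has_vector_derivative saddle_node_model (?c t)) (at t within {0..T})"
      unfolding saddle_node_model_def
      by (intro has_vector_derivative_Pair) (simp_all add: has_real_derivative_iff_has_vector_derivative)
    ultimately show "?c t \<in> ball 0 \<epsilon> \<and> (?c has_vector_derivative saddle_node_model (?c t)) (at t within {0..T})" ..
  qed
  moreover have p: "0 < 1 / r + T" using \<gamma>(1) r by (intro add_pos_nonneg) auto
  moreover have "1 / (1 / r + T) \<le> 1 / (1 / r)" using \<gamma>(1) r by (intro divide_left_mono mult_pos_pos p) auto
  ultimately show ?thesis using \<gamma>(3) by (intro exI[of _ "1 / (1 / r + T)"]) auto
qed

lemma model_x_axis_into:
  assumes "0 < r'" "r' \<le> r" "r < \<epsilon>" and \<sigma>: "\<bar>\<sigma>\<bar> = 1"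
  shows "flows_to saddle_node_model (ball 0 \<epsilon>) (r' *\<^sub>R (\<sigma>, 0)) (r *\<^sub>R (\<sigma>, 0))"
  unfolding flows_to_def
proof (intro exI[of _ "ln (r / r')"] exI[of _ "\<lambda>t. (r' * \<sigma> * exp t, 0)"] conjI ballI)
  let ?\<gamma> = "\<lambda>t. (r' * \<sigma> * exp t, 0) :: real \<times> real"
  show "0 \<le> ln (r / r')" using assms by simp
  show "?\<gamma> 0 = r' *\<^sub>R (\<sigma>, 0)" by simp
  show "?\<gamma> (ln (r / r')) = r *\<^sub>R (\<sigma>, 0)" using assms by simp
  fix t assume "t \<in> {0..ln (r / r')}"
  then have "exp t \<le> exp (ln (r / r'))" by simp
  then have "r' * exp t \<le> r" using assms by (simp add: field_simps)
  then show "?\<gamma> t \<in> ball 0 \<epsilon>" using assms by (simp add: abs_mult)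
  have "((\<lambda>t. r' * \<sigma> * exp t) has_real_derivative r' * \<sigma> * exp t) (at t within {0..ln (r / r')})"
    by (rule derivative_eq_intros refl)+ simp
  then show "(?\<gamma> has_vector_derivative saddle_node_model (?\<gamma> t)) (at t within {0..ln (r / r')})"
    unfolding saddle_node_model_def
    by (intro has_vector_derivative_Pair) (simp_all add: has_real_derivative_iff_has_vector_derivative)
qed

lemma model_x_axis_stay:
  assumes r: "0 < r" "r < \<epsilon>" and \<sigma>: "\<bar>\<sigma>\<bar> = 1" and w: "flows_to saddle_node_model (ball 0 \<epsilon>) w (r *\<^sub>R (\<sigma>, 0))"
  shows "\<exists>r'. 0 < r' \<and> r' \<le> r \<and> w = r' *\<^sub>R (\<sigma>, 0)"
proof -
  obtain T \<gamma> where \<gamma>: "0 \<le> T" "\<gamma> 0 = w" "\<gamma> T = r *\<^sub>R (\<sigma>, 0)"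
    "\<And>t. t \<in> {0..T} \<Longrightarrow> \<gamma> t \<in> ball 0 \<epsilon> \<and> (\<gamma> has_vector_derivative saddle_node_model (\<gamma> t)) (at t within {0..T})"
    using w unfolding flows_to_def by blast
  let ?c = "\<lambda>t. (r * \<sigma> * exp (- t), 0) :: real \<times> real"
  have lip: "(1 + 2 * \<epsilon>)-lipschitz_on (ball 0 \<epsilon>) (\<lambda>z. - saddle_node_model z)"
    using saddle_node_model_lipschitz r by simp
  have "\<gamma> (T - T) = ?c T"
  proof (rule integral_curves_unique[OF lip \<gamma>(1) order_refl, of "\<lambda>t. \<gamma> (T - t)" ?c])
    show "\<gamma> (T - 0) = ?c 0" using \<gamma>(3) by simp
  next
    fix s assume s: "s \<in> {0..T}"
    then have Ts: "T - s \<in> {0..T}" by auto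
    have im: "(\<lambda>s. T - s) ` {0..T} \<subseteq> {0..T}" by auto
    have "(\<gamma> has_vector_derivative saddle_node_model (\<gamma> (T - s))) (at (T - s) within (\<lambda>s. T - s) ` {0..T})"
      using has_vector_derivative_within_subset[OF _ im] \<gamma>(4)[OF Ts] by blast
    moreover have "((\<lambda>s. T - s) has_vector_derivative - 1) (at s within {0..T})"
      by (auto intro!: derivative_eq_intros)
    ultimately have "((\<lambda>t. \<gamma> (T - t)) has_vector_derivative - saddle_node_model (\<gamma> (T - s))) (at s within {0..T})"
      using vector_diff_chain_within[of "\<lambda>s. T - s" "- 1" s "{0..T}" \<gamma>] by (simp add: o_def)
    then show "\<gamma> (T - s) \<in> ball 0 \<epsilon> \<and> ((\<lambda>t. \<gamma> (T - t)) has_vector_derivative - saddle_node_model (\<gamma> (T - s))) (at s within {0..T})"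
      using \<gamma>(4)[OF Ts] by blast
  next
    fix s assume "s \<in> {0..T}"
    then have "exp (- s) \<le> 1" by simp
    then have "r * exp (- s) \<le> r" using r by (simp add: mult_left_le)
    then have "r * exp (- s) < \<epsilon>" using r by linarith
    then have "?c s \<in> ball 0 \<epsilon>" using r \<sigma> by (simp add: abs_mult)
    moreover have "((\<lambda>t. r * \<sigma> * exp (- t)) has_real_derivative - (r * \<sigma> * exp (- s))) (at s within {0..T})"
      by (rule derivative_eq_intros refl)+ simp
    then have "(?c has_vector_derivative (- (r * \<sigma> * exp (- s)), 0)) (at s within {0..T})"
      by (intro has_vector_derivative_Pair) (simp_all add: has_real_derivative_iff_has_vector_derivative)
    ultimately show "?c s \<in> ball 0 \<epsilon> \<and> (?c has_vector_derivative - saddle_node_model (?c s)) (at s within {0..T})"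
      by (simp add: saddle_node_model_def)
  qed
  moreover have "r * exp (- T) \<le> r" using r \<gamma>(1) by (simp add: mult_left_le)
  ultimately show ?thesis using \<gamma>(2) r by (intro exI[of _ "r * exp (- T)"]) auto
qed

text \<open>\<open>\<psi>\<close> is the flow with the time direction of the model, which the chart
  may reverse. \<open>x0\<close> is taken on the negative y-axis, \<open>x1\<close> and
  \<open>x2\<close> on the two halves of the x-axis.\<close>

lemma saddle_node_separatrices:
  assumes smooth: "smooth_flow S2 \<phi>" and p: "p \<in> singular_points S2 \<phi>" and sn: "saddle_node S2 \<phi> p"
  obtains \<psi> x0 x1 x2 where "\<psi> = \<phi> \<or> \<psi> = reverse_flow \<phi>"
    "on_hyperbolic_separatrix S2 \<phi> p x0" "on_hyperbolic_separatrix S2 \<phi> p x1"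
    "x0 \<in> S2 - {p}" "x1 \<in> S2 - {p}" "x2 \<in> S2 - {p}"
    "((\<lambda>t. \<psi> t x0) \<longlongrightarrow> p) at_top" "((\<lambda>t. reverse_flow \<psi> t x1) \<longlongrightarrow> p) at_top" "((\<lambda>t. reverse_flow \<psi> t x2) \<longlongrightarrow> p) at_top"
    "\<And>t. \<psi> t x1 \<noteq> x2"
proof -
  obtain rev U h where ch: "saddle_node_chart S2 \<phi> p rev U h" using sn by (auto simp: saddle_node_def)
  then obtain \<epsilon> g where c: "openin (top_of_set S2) U" "p \<in> U" "h p = 0" "\<epsilon> > 0" "homeomorphism U (ball 0 \<epsilon>) h g"
    "\<And>x y. x \<in> U \<Longrightarrow> y \<in> U \<Longrightarrow> flows_to (velocity \<phi>) U x y \<longleftrightarrow>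
      (if rev then flows_to saddle_node_model (ball 0 \<epsilon>) (h y) (h x) else flows_to saddle_node_model (ball 0 \<epsilon>) (h x) (h y))"
    unfolding saddle_node_chart_def by metis
  have U: "U \<subseteq> S2" using c(1) openin_imp_subset by blast
  interpret F: compact_flow S2 \<phi> by (rule smooth_flow_compact_flow[OF compact_sphere smooth])
  define \<psi> where "\<psi> = (if rev then reverse_flow \<phi> else \<phi>)"
  interpret G: compact_flow S2 \<psi> using F.compact_flow_axioms compact_flow_reverse[OF F.compact_flow_axioms] by (simp add: \<psi>_def)
  interpret H: compact_flow S2 "reverse_flow \<psi>" using G.compact_flow_axioms by (rule compact_flow_reverse)
  have arc: "orbit_arc_in \<phi> U x y \<longleftrightarrow> flows_to (velocity \<phi>) U x y" if "x \<in> U" for x y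
    using flows_to_iff_orbit_arc[OF compact_sphere smooth U that] by simp
  have rev_arc: "orbit_arc_in (reverse_flow \<phi>) U x y \<longleftrightarrow> orbit_arc_in \<phi> U y x" if "x \<in> U" "y \<in> U" for x y
    using F.orbit_arc_in_reverse[of y U x] compact_flow.orbit_arc_in_reverse[OF compact_flow_reverse[OF F.compact_flow_axioms], of x U y]
      that U by auto
  have G_arc: "orbit_arc_in \<psi> U x y \<longleftrightarrow> flows_to saddle_node_model (ball 0 \<epsilon>) (h x) (h y)" if "x \<in> U" "y \<in> U" for x y
    using arc rev_arc c(6) that by (simp add: \<psi>_def)
  have H_arc: "orbit_arc_in (reverse_flow \<psi>) U x y \<longleftrightarrow> flows_to saddle_node_model (ball 0 \<epsilon>) (h y) (h x)" if "x \<in> U" "y \<in> U" for x y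
    using arc rev_arc c(6) that by (simp add: \<psi>_def)
  have fix\<phi>: "\<phi> t p = p" for t by (rule singular_point_fixed[OF compact_sphere smooth p])
  have fix\<psi>: "\<psi> t p = p" "reverse_flow \<psi> t p = p" for t using fix\<phi> by (auto simp: \<psi>_def reverse_flow_def)
  define r where "r = \<epsilon> / 2"
  have r: "0 < r" "r < \<epsilon>" using c(4) by (auto simp: r_def)
  have gU: "g z \<in> U" "h (g z) = z" if "z \<in> ball 0 \<epsilon>" for z using c(5) that unfolding homeomorphism_def by blast+
  define x0 where "x0 = g (r *\<^sub>R (0, -1))"
  define x1 where "x1 = g (r *\<^sub>R (1, 0))"
  define x2 where "x2 = g (r *\<^sub>R (-1, 0))"
  have x: "x0 \<in> U" "x1 \<in> U" "x2 \<in> U" "h x0 = (0, - r)" "h x1 = (r, 0)" "h x2 = (- r, 0)"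
    unfolding x0_def x1_def x2_def using gU r by auto
  have y_axis: "((\<lambda>t. \<psi> t x0) \<longlongrightarrow> p) at_top"
    unfolding x0_def
    by (rule G.branch_limit(1)[OF U c(2,3,5) fix\<psi>(1) G_arc _ model_y_axis_into model_y_axis_stay r]) auto
  have x_axis: "((\<lambda>t. reverse_flow \<psi> t (g (r *\<^sub>R (\<sigma>, 0)))) \<longlongrightarrow> p) at_top"
    "\<And>t. 0 \<le> t \<Longrightarrow> \<exists>r'. 0 < r' \<and> r' \<le> r \<and> reverse_flow \<psi> t (g (r *\<^sub>R (\<sigma>, 0))) = g (r' *\<^sub>R (\<sigma>, 0))" if "\<bar>\<sigma>\<bar> = 1" for \<sigma>
    by (rule H.branch_limit[OF U c(2,3,5) fix\<psi>(2) H_arc _ model_x_axis_into[OF _ _ _ that] model_x_axis_stay[OF _ _ that] r]; use that in auto)+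
  have diff: "\<psi> t x1 \<noteq> x2" for t
  proof
    assume eq: "\<psi> t x1 = x2"
    have x1S: "x1 \<in> S2" "x2 \<in> S2" using x U by auto
    \<comment> \<open>Going back by \<open>T\<close> from \<open>x2\<close> is going back by the
      nonnegative time \<open>T - t\<close> from \<open>x1\<close>; the resulting point would lie on
      both halves of the x-axis.\<close>
    define T where "T = \<bar>t\<bar>"
    have "reverse_flow \<psi> T x2 = reverse_flow \<psi> (T - t) x1"
      using eq G.flow_add[OF x1S(1), of "- T" t] by (simp add: reverse_flow_def)
    moreover obtain r2 where "0 < r2" "r2 \<le> r" "reverse_flow \<psi> T x2 = g (r2 *\<^sub>R (-1, 0))"
      using x_axis(2)[of "-1" T] by (auto simp: x2_def T_def)
    moreover obtain r1 where "0 < r1" "r1 \<le> r" "reverse_flow \<psi> (T - t) x1 = g (r1 *\<^sub>R (1, 0))"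
      using x_axis(2)[of 1 "T - t"] by (auto simp: x1_def T_def abs_ge_self)
    ultimately have "h (g (r2 *\<^sub>R (-1, 0))) = h (g (r1 *\<^sub>R (1, 0)))" by simp
    then show False using gU(2)[of "r2 *\<^sub>R (-1, 0)"] gU(2)[of "r1 *\<^sub>R (1, 0)"] \<open>0 < r1\<close> \<open>0 < r2\<close> \<open>r1 \<le> r\<close> \<open>r2 \<le> r\<close> r by simp
  qed
  show ?thesis
  proof (rule that[of \<psi> x0 x1 x2])
    show "\<psi> = \<phi> \<or> \<psi> = reverse_flow \<phi>" by (simp add: \<psi>_def)
    show "on_hyperbolic_separatrix S2 \<phi> p x0" "on_hyperbolic_separatrix S2 \<phi> p x1"
      unfolding on_hyperbolic_separatrix_def using ch x r by fastforce+
    show "x0 \<in> S2 - {p}" "x1 \<in> S2 - {p}" "x2 \<in> S2 - {p}" using x U c(3) r by (auto simp: zero_prod_def)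
    show "((\<lambda>t. reverse_flow \<psi> t x1) \<longlongrightarrow> p) at_top" "((\<lambda>t. reverse_flow \<psi> t x2) \<longlongrightarrow> p) at_top"
      using x_axis(1)[of 1] x_axis(1)[of "-1"] by (simp_all add: x1_def x2_def)
  qed (use y_axis diff in auto)
qed

section \<open>Optimal SN-flows on the sphere\<close>

lemma source_basin:
  assumes "smooth_flow S2 \<phi>" "source S2 \<phi> s"
  obtains W where "basin S2 (reverse_flow \<phi>) s W" "{x \<in> S2. W x = 1/2} homeomorphic sphere (0::complex) 1"
  by (rule sink_basin[OF smooth_flow_reverse[OF assms(1)] sink_reverse_flow[OF assms]]) (rule that)

lemma sink_not_alpha_limit:
  assumes "smooth_flow S2 \<phi>" "sink S2 \<phi> k" "x \<in> S2" "k \<in> alpha_limit \<phi> x"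
  shows "x = k"
proof -
  obtain V where "basin S2 \<phi> k V" by (rule sink_basin[OF assms(1,2)])
  then show ?thesis
    using basin.attractor_in_alpha_limit assms(3,4) alpha_limit_eq_omega_limit_reverse by metis
qed

lemma source_not_omega_limit:
  assumes "smooth_flow S2 \<phi>" "source S2 \<phi> s" "x \<in> S2" "s \<in> omega_limit \<phi> x"
  shows "x = s"
proof -
  have "s \<in> alpha_limit (reverse_flow \<phi>) x" using assms(4) by (simp add: alpha_limit_eq_omega_limit_reverse)
  then show ?thesis
    using sink_not_alpha_limit[OF smooth_flow_reverse[OF assms(1)] sink_reverse_flow[OF assms(1,2)] assms(3)] by blast
qed

text \<open>The conditions on eigenvalues would conflict only after exhibiting an eigenvalue.
  Dynamically, the circle in the basin of a sink supplies another point tending to it, whereas a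
  source attracts no point but itself.\<close>

lemma sink_not_source:
  assumes "smooth_flow S2 \<phi>" "sink S2 \<phi> k"
  shows "\<not> source S2 \<phi> k"
proof
  assume src: "source S2 \<phi> k"
  obtain V where V: "basin S2 \<phi> k V" "{x \<in> S2. V x = 1/2} homeomorphic sphere (0::complex) 1"
    by (rule sink_basin[OF assms]) (rule that)
  interpret basin S2 \<phi> k V by (rule V)
  have "{x \<in> S2. V x = 1/2} \<noteq> {}"
  proof
    assume "{x \<in> S2. V x = 1/2} = {}"
    then have "sphere (0::complex) 1 = {}" using V(2) homeomorphic_empty(2) by metis
    then show False by simp
  qed
  then obtain x where x: "x \<in> S2" "V x = 1/2" by blast
  then have "((\<lambda>t. \<phi> t x) \<longlongrightarrow> k) at_top" using tendsto_attractor_iff by simp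
  then have "k \<in> omega_limit \<phi> x" using omega_limit_of_tendsto by blast
  then have "x = k" using source_not_omega_limit assms(1) src x(1) by blast
  then show False using V_eq_0_iff[OF x(1)] x(2) by simp
qed

lemma saddle_node_not_source_or_sink:
  assumes "\<not> hyperbolic M \<phi> p" shows "\<not> source M \<phi> p" "\<not> sink M \<phi> p"
  using assms unfolding hyperbolic_def source_def sink_def by force+

text \<open>The far end of a separatrix is a source or a sink. A sink is the alpha-limit of no other
  point and a source the omega-limit of none, so an incoming separatrix starts at a source and an
  outgoing one ends at a sink; \<open>x0\<close> and \<open>x1\<close> provide one of each, whatever
  the orientation of the chart.\<close>

lemma SN_flow_source_sink:
  assumes sn: "SN_flow S2 \<phi>"
  obtains p \<psi> x0 x1 x2 s k where "{x \<in> singular_points S2 \<phi>. \<not> hyperbolic S2 \<phi> x} = {p}"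
    "source S2 \<phi> s" "sink S2 \<phi> k" "s \<noteq> k" "s \<noteq> p" "k \<noteq> p"
    "\<psi> = \<phi> \<and> alpha_limit \<phi> x0 = {s} \<or> \<psi> = reverse_flow \<phi>"
    "x0 \<in> S2 - {p}" "x1 \<in> S2 - {p}" "x2 \<in> S2 - {p}"
    "((\<lambda>t. \<psi> t x0) \<longlongrightarrow> p) at_top" "((\<lambda>t. reverse_flow \<psi> t x1) \<longlongrightarrow> p) at_top" "((\<lambda>t. reverse_flow \<psi> t x2) \<longlongrightarrow> p) at_top"
    "\<And>t. \<psi> t x1 \<noteq> x2"
proof -
  have smooth: "smooth_flow S2 \<phi>" using sn by (simp add: SN_flow_def)
  interpret F: compact_flow S2 \<phi> by (rule smooth_flow_compact_flow[OF compact_sphere smooth])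
  interpret R: compact_flow S2 "reverse_flow \<phi>" using F.compact_flow_axioms by (rule compact_flow_reverse)
  obtain p where p: "{x \<in> singular_points S2 \<phi>. \<not> hyperbolic S2 \<phi> x} = {p}" "saddle_node S2 \<phi> p" "separatrix_condition S2 \<phi> p"
    using sn unfolding SN_flow_def by blast
  have pS: "p \<in> singular_points S2 \<phi>" "\<not> hyperbolic S2 \<phi> p" using p(1) by blast+
  obtain \<psi> x0 x1 x2 where x: "\<psi> = \<phi> \<or> \<psi> = reverse_flow \<phi>"
    "on_hyperbolic_separatrix S2 \<phi> p x0" "on_hyperbolic_separatrix S2 \<phi> p x1"
    "x0 \<in> S2 - {p}" "x1 \<in> S2 - {p}" "x2 \<in> S2 - {p}"
    "((\<lambda>t. \<psi> t x0) \<longlongrightarrow> p) at_top" "((\<lambda>t. reverse_flow \<psi> t x1) \<longlongrightarrow> p) at_top" "((\<lambda>t. reverse_flow \<psi> t x2) \<longlongrightarrow> p) at_top"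
    "\<And>t. \<psi> t x1 \<noteq> x2"
    using saddle_node_separatrices[OF smooth pS(1) p(2)] by blast
  have fixed: "\<phi> t q = q" if "q \<in> singular_points S2 \<phi>" for q t
    by (rule singular_point_fixed[OF compact_sphere smooth that])
  have incoming: "\<exists>q. source S2 \<phi> q \<and> alpha_limit \<phi> y = {q}"
    if y: "on_hyperbolic_separatrix S2 \<phi> p y" "y \<in> S2 - {p}" "((\<lambda>t. \<phi> t y) \<longlongrightarrow> p) at_top" for y
  proof -
    obtain q where q: "source S2 \<phi> q \<or> sink S2 \<phi> q" "alpha_limit \<phi> y = {q}"
      using p(3) y(1) omega_limit_of_tendsto[of \<phi> y p] y(3) unfolding separatrix_condition_def by blast
    have "\<not> sink S2 \<phi> q"
    proof
      assume k: "sink S2 \<phi> q"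
      then have "y = q" using sink_not_alpha_limit[OF smooth k, of y] q(2) y(2) by blast
      then have "\<phi> t y = y" for t using fixed k by (simp add: sink_def)
      then have "p = y" using F.fixed_point_of_tendsto y(2,3) by blast
      then show False using y(2) by blast
    qed
    then show ?thesis using q by blast
  qed
  have outgoing: "\<exists>q. sink S2 \<phi> q \<and> omega_limit \<phi> y = {q}"
    if y: "on_hyperbolic_separatrix S2 \<phi> p y" "y \<in> S2 - {p}" "((\<lambda>t. reverse_flow \<phi> t y) \<longlongrightarrow> p) at_top" for y
  proof -
    have "alpha_limit \<phi> y = {p}" unfolding alpha_limit_eq_omega_limit_reverse by (rule omega_limit_of_tendsto[of "reverse_flow \<phi>" y p]) (rule y(3))
    then obtain q where q: "source S2 \<phi> q \<or> sink S2 \<phi> q" "omega_limit \<phi> y = {q}"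
      using p(3) y(1) unfolding separatrix_condition_def by blast
    have "\<not> source S2 \<phi> q"
    proof
      assume k: "source S2 \<phi> q"
      then have "y = q" using source_not_omega_limit[OF smooth k, of y] q(2) y(2) by blast
      then have "reverse_flow \<phi> t y = y" for t using fixed k by (simp add: source_def reverse_flow_def)
      then have "p = y" using R.fixed_point_of_tendsto y(2,3) by blast
      then show False using y(2) by blast
    qed
    then show ?thesis using q by blast
  qed
  have "\<exists>s k. source S2 \<phi> s \<and> sink S2 \<phi> k \<and> (\<psi> = \<phi> \<and> alpha_limit \<phi> x0 = {s} \<or> \<psi> = reverse_flow \<phi>)"
    using x(1)
  proof
    assume "\<psi> = \<phi>"
    then show ?thesis using incoming[OF x(2,4)] outgoing[OF x(3,5)] x(7,8) by blast
  next
    assume "\<psi> = reverse_flow \<phi>"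
    then show ?thesis using incoming[OF x(3,5)] outgoing[OF x(2,4)] x(7,8) by auto
  qed
  then obtain s k where sk: "source S2 \<phi> s" "sink S2 \<phi> k" "\<psi> = \<phi> \<and> alpha_limit \<phi> x0 = {s} \<or> \<psi> = reverse_flow \<phi>" by blast
  show ?thesis
    by (rule that[OF p(1) sk(1,2) _ _ _ sk(3) x(4-10)])
      (use sk sink_not_source[OF smooth] saddle_node_not_source_or_sink[OF pS(2)] in blast)+
qed

lemma SN_flow_card_ge_3:
  assumes "SN_flow S2 \<phi>"
  shows "3 \<le> card (singular_points S2 \<phi>)"
proof -
  obtain p \<psi> x0 x1 x2 s k where *: "{x \<in> singular_points S2 \<phi>. \<not> hyperbolic S2 \<phi> x} = {p}"
    "source S2 \<phi> s" "sink S2 \<phi> k" "s \<noteq> k" "s \<noteq> p" "k \<noteq> p"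
    using SN_flow_source_sink[OF assms] .
  then have "{s, k, p} \<subseteq> singular_points S2 \<phi>" by (auto simp: source_def sink_def)
  moreover have "finite (singular_points S2 \<phi>)" using assms by (simp add: SN_flow_def)
  ultimately have "card {s, k, p} \<le> card (singular_points S2 \<phi>)" using card_mono by blast
  then show ?thesis using *(4-6) by simp
qed

section \<open>Extraction of the classifying data\<close>

lemma connected_punctured_circle:
  fixes C :: "'a::t2_space set"
  assumes C: "C homeomorphic sphere (0::complex) 1" and a: "a \<in> C"
  shows "connected (C - {a})" "C - {a} \<noteq> {}"
proof -
  obtain f f' where f: "homeomorphism C (sphere (0::complex) 1) f f'" using C by (auto simp: homeomorphic_def)
  have fa: "f a \<in> sphere 0 1" using f a by (auto simp: homeomorphism_def)
  have inj: "f x = f y \<longleftrightarrow> x = y" if "x \<in> C" "y \<in> C" for x y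
    using f that unfolding homeomorphism_def by metis
  have im: "f ` (C - {a}) = sphere 0 1 - {f a}"
    using f inj a unfolding homeomorphism_def by (auto 0 4)
  have "homeomorphism (C - {a}) (f ` (C - {a})) f f'"
    by (rule homeomorphism_of_subsets[OF f]) auto
  then have h: "(C - {a}) homeomorphic (sphere 0 1 - {f a})" unfolding im homeomorphic_def by blast
  have h2: "(sphere 0 1 - {f a}) homeomorphic {x::complex. 1 \<bullet> x = 0}"
    by (rule homeomorphic_punctured_sphere_hyperplane) (use fa in auto)
  from homeomorphic_trans[OF h h2] have "(C - {a}) homeomorphic {x::complex. 1 \<bullet> x = 0}" .
  moreover have "connected {x::complex. 1 \<bullet> x = 0}" by (intro convex_connected convex_hyperplane)
  moreover have "(0::complex) \<in> {x::complex. 1 \<bullet> x = 0}" by simp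
  ultimately show "connected (C - {a})" "C - {a} \<noteq> {}"
    using homeomorphic_connectedness homeomorphic_empty(2) by (blast, metis empty_iff homeomorphic_empty(1,2))
qed

theorem SN_flow_sn_system:
  assumes sn: "SN_flow S2 \<phi>" and type: "saddle_source_type S2 \<phi>" and card: "card (singular_points S2 \<phi>) \<le> 3"
  obtains k V s W q where "sn_system S2 \<phi> k V s W"
    "arc_parametrization {x \<in> S2. V x = 1/2} q {x \<in> S2. V x = 1/2 \<and> W x < 1}"
proof -
  have smooth: "smooth_flow S2 \<phi>" and fin: "finite (singular_points S2 \<phi>)"
    and nw: "nonwandering_set S2 \<phi> = singular_points S2 \<phi>" using sn by (auto simp: SN_flow_def)
  obtain p \<psi> x0 x1 x2 s k where p: "{x \<in> singular_points S2 \<phi>. \<not> hyperbolic S2 \<phi> x} = {p}"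
    and sk: "source S2 \<phi> s" "sink S2 \<phi> k" "s \<noteq> k" "s \<noteq> p" "k \<noteq> p"
    and \<psi>: "\<psi> = \<phi> \<and> alpha_limit \<phi> x0 = {s} \<or> \<psi> = reverse_flow \<phi>"
    and x: "x0 \<in> S2 - {p}" "x1 \<in> S2 - {p}" "x2 \<in> S2 - {p}"
    "((\<lambda>t. \<psi> t x0) \<longlongrightarrow> p) at_top" "((\<lambda>t. reverse_flow \<psi> t x1) \<longlongrightarrow> p) at_top" "((\<lambda>t. reverse_flow \<psi> t x2) \<longlongrightarrow> p) at_top"
    and diff: "\<And>t. \<psi> t x1 \<noteq> x2"
    by (rule SN_flow_source_sink[OF sn]) (rule that)
  have sing: "singular_points S2 \<phi> = {s, k, p}"
  proof -
    have "{s, k, p} \<subseteq> singular_points S2 \<phi>" using p sk by (auto simp: source_def sink_def)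
    moreover have "card (singular_points S2 \<phi>) \<le> card {s, k, p}" using card sk by simp
    ultimately show ?thesis using card_seteq[OF fin] by blast
  qed
  have inS: "s \<in> S2" "k \<in> S2" "p \<in> S2" using sing by (auto simp: singular_points_def)
  have fixed: "\<phi> t q = q" if "q \<in> {s, k, p}" for q t
    by (rule singular_point_fixed[OF compact_sphere smooth]) (use sing that in blast)
  obtain V where V: "basin S2 \<phi> k V" "{x \<in> S2. V x = 1/2} homeomorphic sphere (0::complex) 1"
    by (rule sink_basin[OF smooth sk(2)]) (rule that)
  obtain W where W: "basin S2 (reverse_flow \<phi>) s W" "{x \<in> S2. W x = 1/2} homeomorphic sphere (0::complex) 1"
    by (rule source_basin[OF smooth sk(1)]) (rule that)
  interpret A: basin S2 \<phi> k V by (rule V)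
  interpret B: basin S2 "reverse_flow \<phi>" s W by (rule W)
  have not_fixed: "y \<notin> {s, k, p}" if "y \<in> S2 - {p}" "((\<lambda>t. \<eta> t y) \<longlongrightarrow> p) at_top" "\<eta> = \<phi> \<or> \<eta> = reverse_flow \<phi>" for y \<eta>
  proof
    assume "y \<in> {s, k, p}"
    then have "\<eta> t y = y" for t using fixed that(3) by (auto simp: reverse_flow_def)
    then have "p = y" using that A.fixed_point_of_tendsto B.fixed_point_of_tendsto by (metis DiffD1)
    then show False using that by blast
  qed
  have stable: "y \<in> stable_manifold S2 \<phi> p - singular_points S2 \<phi>"
    if "y \<in> S2 - {p}" "((\<lambda>t. \<phi> t y) \<longlongrightarrow> p) at_top" for y
    using not_fixed[of y \<phi>] that sing by (simp add: stable_manifold_def)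
  obtain p' C where p': "p' \<in> singular_points S2 \<phi>" "\<not> hyperbolic S2 \<phi> p'"
    and C: "\<forall>D. (\<exists>x\<in>stable_manifold S2 \<phi> p' - singular_points S2 \<phi>. D = trajectory \<phi> x) \<longrightarrow> D = C"
    using type[unfolded saddle_source_type_def Ex1_def] by (elim bexE exE conjE) (rule that)
  have "p' = p" using p' p by blast
  have traj: "trajectory \<phi> y = C" if "y \<in> stable_manifold S2 \<phi> p - singular_points S2 \<phi>" for y
    by (rule C[rule_format]) (rule bexI[of _ y], rule refl, use that \<open>p' = p\<close> in simp)
  have same: "\<exists>t. z = \<phi> t y" if "y \<in> stable_manifold S2 \<phi> p - singular_points S2 \<phi>" "z \<in> stable_manifold S2 \<phi> p - singular_points S2 \<phi>" for y z
  proof -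
    have "trajectory \<phi> y = trajectory \<phi> z" using traj that by simp
    moreover have "z \<in> trajectory \<phi> z" unfolding trajectory_def
      using A.flow_0[of z] that(2) by (metis (no_types, lifting) DiffD1 mem_Collect_eq rangeI stable_manifold_def)
    ultimately show ?thesis by (auto simp: trajectory_def)
  qed
  \<comment> \<open>The saddle-source type fixes the orientation: in the reversed one both
    \<open>x1\<close> and \<open>x2\<close> would enter the saddle-node, on different
    trajectories.\<close>
  have \<psi>\<phi>: "\<psi> = \<phi>"
  proof (rule ccontr)
    assume "\<psi> \<noteq> \<phi>"
    then have r: "\<psi> = reverse_flow \<phi>" using \<psi> by blast
    have "x1 \<in> stable_manifold S2 \<phi> p - singular_points S2 \<phi>" "x2 \<in> stable_manifold S2 \<phi> p - singular_points S2 \<phi>"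
      using stable x(2,3,5,6) r by simp_all
    then obtain t where "x2 = \<phi> t x1" using same by blast
    then have "\<psi> (- t) x1 = x2" by (simp add: r reverse_flow_def)
    then show False using diff by blast
  qed
  have x0s: "x0 \<in> stable_manifold S2 \<phi> p - singular_points S2 \<phi>" using stable x(1,4) \<psi>\<phi> by blast
  have x0S: "x0 \<in> S2" using x(1) by blast
  \<comment> \<open>The alternative left by the previous result would now say that
    \<open>\<phi>\<close> equals its own reversal, and again two trajectories would enter the
    saddle-node.\<close>
  have alpha: "alpha_limit \<phi> x0 = {s}"
  proof (rule ccontr)
    assume "alpha_limit \<phi> x0 \<noteq> {s}"
    then have "\<phi> = reverse_flow \<phi>" using \<psi> \<psi>\<phi> by simp
    then have "\<psi> = reverse_flow \<psi>" using \<psi>\<phi> by simp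
    then have "((\<lambda>t. \<psi> t x1) \<longlongrightarrow> p) at_top" "((\<lambda>t. \<psi> t x2) \<longlongrightarrow> p) at_top" using x(5,6) by simp_all
    then have "x1 \<in> stable_manifold S2 \<phi> p - singular_points S2 \<phi>" "x2 \<in> stable_manifold S2 \<phi> p - singular_points S2 \<phi>"
      using stable x(2,3) \<psi>\<phi> by simp_all
    then obtain t where "x2 = \<phi> t x1" using same by blast
    then show False using diff[of t] \<psi>\<phi> by simp
  qed
  have Vfix: "V s = 1" "V p = 1"
    by (rule A.fixed_point_V; use inS fixed sk in auto)+
  have Wfix: "W k = 1" "W p = 1"
    by (rule B.fixed_point_V; use inS fixed sk in \<open>auto simp: reverse_flow_def\<close>)+
  have Ws: "W s = 0" using B.V_eq_0_iff inS by blast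
  have W_flow: "W (\<phi> t y) = lgs (- t) (W y)" if "y \<in> S2" for t y
    using B.V_flow[OF that, of "- t"] by (simp add: reverse_flow_def)
  have W0: "0 < W x0" "W x0 < 1"
  proof -
    have "s \<in> omega_limit (reverse_flow \<phi>) x0" using alpha by (simp add: alpha_limit_eq_omega_limit_reverse)
    then show "W x0 < 1" using B.attractor_in_omega_limit x0S by blast
    have "x0 \<noteq> s" using x0s sing by blast
    then show "0 < W x0" using B.V_eq_0_iff[OF x0S] B.V_bounds[OF x0S] by simp
  qed
  have V0: "V x0 = 1"
  proof (rule ccontr)
    assume "V x0 \<noteq> 1"
    then have "((\<lambda>t. \<phi> t x0) \<longlongrightarrow> k) at_top" using A.tendsto_attractor_iff[OF x0S] A.V_bounds[OF x0S] by simp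
    then show False using x(4) \<psi>\<phi> sk(5) tendsto_unique[OF trivial_limit_at_top_linorder] by blast
  qed
  have V0t: "V (\<phi> t x0) = 1" for t using A.V_flow[OF x0S] V0 by simp
  \<comment> \<open>A nonsingular point outside the basin of the sink has only singular omega-limit
    points; the sink and the source are excluded, so it tends to the saddle-node and lies on the
    unique entering trajectory.\<close>
  have V1: "y = s \<or> y = p \<or> (\<exists>t. y = \<phi> t x0)" if y: "y \<in> S2" "V y = 1" for y
  proof (cases "y \<in> {s, k, p}")
    case True
    then show ?thesis using y A.V_eq_0_iff[OF inS(2)] by auto
  next
    case False
    have "omega_limit \<phi> y \<subseteq> {s, k, p}" using A.omega_limit_nonwandering[OF y(1)] nw sing by simp
    moreover have "k \<notin> omega_limit \<phi> y" using A.attractor_in_omega_limit[OF y(1)] y(2) by auto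
    moreover have "s \<notin> omega_limit \<phi> y" using source_not_omega_limit[OF smooth sk(1) y(1)] False by blast
    ultimately have "omega_limit \<phi> y \<subseteq> {p}" by blast
    then have "((\<lambda>t. \<phi> t y) \<longlongrightarrow> p) at_top" by (rule A.tendsto_of_omega_limit[OF y(1)])
    then have "y \<in> stable_manifold S2 \<phi> p - singular_points S2 \<phi>" using stable y(1) False by blast
    then show ?thesis using same x0s by blast
  qed
  have W1t: "0 < W (\<phi> t x0)" "W (\<phi> t x0) < 1" for t
    using W_flow[OF x0S, of t] lgs_bounds[of "W x0" "- t"] lgs_eq_0_iff[of "W x0" "- t"] lgs_eq_1_iff[of "W x0" "- t"] W0
    by (auto simp: less_le)
  have Winj: "\<phi> t x0 = \<phi> u x0" if "W (\<phi> t x0) = W (\<phi> u x0)" for t u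
  proof -
    have "lgs (- t) (W x0) = lgs (- u) (W x0)" using that W_flow[OF x0S] by simp
    then have "t = u"
      using lgs_strict_decreasing[OF W0, of "- t" "- u"] lgs_strict_decreasing[OF W0, of "- u" "- t"]
      by (cases t u rule: linorder_cases) auto
    then show ?thesis by simp
  qed
  have "sn_system S2 \<phi> k V s W"
  proof (intro sn_system.intro sn_system_axioms.intro V(1) W(1))
    show "inj_on W {x \<in> S2. V x = 1}"
    proof (rule inj_onI)
      fix y z assume yz: "y \<in> {x \<in> S2. V x = 1}" "z \<in> {x \<in> S2. V x = 1}" "W y = W z"
      then have "y = s \<or> y = p \<or> (\<exists>t. y = \<phi> t x0)" "z = s \<or> z = p \<or> (\<exists>t. z = \<phi> t x0)" using V1 by auto
      then show "y = z" using yz(3) Ws Wfix W1t Winj by (elim disjE exE) (simp; metis less_irrefl zero_neq_one)+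
    qed
    show "{0..1} \<subseteq> W ` {x \<in> S2. V x = 1}"
    proof
      fix w :: real assume w: "w \<in> {0..1}"
      consider "w = 0" | "w = 1" | "0 < w" "w < 1" using w by fastforce
      then show "w \<in> W ` {x \<in> S2. V x = 1}"
      proof cases
        case 1 then show ?thesis using Ws Vfix inS by (intro image_eqI[of _ _ s]) auto
      next
        case 2 then show ?thesis using Wfix Vfix inS by (intro image_eqI[of _ _ p]) auto
      next
        case 3
        obtain a where a: "lgs a (1/2) = w" using lgs_half_surj 3 by metis
        \<comment> \<open>Bring \<open>W x0\<close> to 1/2 and then to \<open>w\<close>; the sign
          appears because \<open>W\<close> follows the logistic law in reversed time.\<close>
        let ?t = "- (a + ln (W x0 / (1 - W x0)))"
        have "W (\<phi> ?t x0) = lgs a (lgs (ln (W x0 / (1 - W x0))) (W x0))"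
          using W_flow[OF x0S, of ?t] W0 by (simp add: lgs_lgs add.commute del: lgs_simps(4))
        also have "\<dots> = w" unfolding lgs_eq_half[OF W0] by (rule a)
        finally show ?thesis using V0t A.flow_in[OF x0S] by (intro image_eqI[of _ _ "\<phi> ?t x0"]) auto
      qed
    qed
  qed
  moreover have "\<exists>q. arc_parametrization {x \<in> S2. V x = 1/2} q {x \<in> S2. V x = 1/2 \<and> W x < 1}"
  proof -
    let ?C = "{x \<in> S2. V x = 1/2}" and ?D = "{x \<in> S2. W x = 1/2}"
    let ?J = "{x \<in> S2. V x = 1/2 \<and> W x < 1}"
    have secA: "A.section_circle = ?C" and secB: "B.section_circle = ?D"
      by (auto simp: A.section_circle_def B.section_circle_def)
    have x0core: "x0 \<in> B.core" using W0 x0S by (simp add: B.core_def)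
    define a where "a = B.crossing x0"
    have aD: "a \<in> ?D" using B.crossing_in[OF x0core] by (simp add: a_def secB)
    have Va: "V a = 1" unfolding a_def B.crossing_def reverse_flow_def by (rule V0t)
    have Wk: "0 < W y" if "y \<in> S2" "V y < 1" for y
      using B.V_eq_0_iff[OF that(1)] B.V_bounds[OF that(1)] that Vfix by (auto simp: less_le)
    have Dcore: "c \<in> A.core" if c: "c \<in> ?D - {a}" for c
    proof -
      have "V c \<noteq> 0" using A.V_eq_0_iff[of c] c Wfix by auto
      moreover have "V c \<noteq> 1"
      proof
        assume "V c = 1"
        then have "\<exists>t. c = \<phi> t x0" using V1[of c] c Ws Wfix by auto
        then obtain t where "c = \<phi> t x0" ..
        then have "x0 = reverse_flow \<phi> t c" using A.flow_inverse(1)[OF x0S] by (simp add: reverse_flow_def)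
        then have "B.crossing x0 = c" by (intro B.crossing_eqI) (use c secB in auto)
        then show False using c by (simp add: a_def)
      qed
      ultimately show ?thesis using A.V_bounds[of c] c by (auto simp: A.core_def less_le)
    qed
    \<comment> \<open>Trajectories from the source to the sink cross both circles. So the arc is a
      continuous image of the source circle without the point of the trajectory to the saddle-node,
      and therefore connected.\<close>
    have J_eq: "?J = A.crossing ` (?D - {a})"
    proof (intro subset_antisym subsetI)
      fix c assume c: "c \<in> ?J"
      then have core: "c \<in> B.core" using Wk[of c] by (simp add: B.core_def)
      let ?d = "B.crossing c"
      have d: "?d \<in> ?D" "?d = \<phi> (- B.crossing_time c) c"
        using B.crossing_in[OF core] by (simp_all add: secB B.crossing_def reverse_flow_def)
      have "V ?d = lgs (- B.crossing_time c) (V c)" unfolding d(2) by (rule A.V_flow) (use c in auto)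
      moreover have "V c = 1/2" using c by simp
      ultimately have "V ?d = lgs (- B.crossing_time c) (1/2)" by (simp only:)
      then have "V ?d < 1" by (simp add: add_pos_pos)
      then have "?d \<noteq> a" using Va by auto
      moreover have "A.crossing ?d = c" by (rule A.crossing_eqI[OF _ d(2)]) (use c secA in auto)
      ultimately show "c \<in> A.crossing ` (?D - {a})" using d(1) by force
    next
      fix c assume "c \<in> A.crossing ` (?D - {a})"
      then obtain d where d: "d \<in> ?D - {a}" "c = A.crossing d" by blast
      have "W c = lgs (- A.crossing_time d) (W d)" unfolding d(2) A.crossing_def by (rule W_flow) (use d in auto)
      moreover have "W d = 1/2" using d by simp
      ultimately have "W c = lgs (- A.crossing_time d) (1/2)" by (simp only:)
      then have "W c < 1" by (simp add: add_pos_pos)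
      then show "c \<in> ?J" using A.crossing_in[OF Dcore[OF d(1)]] d(2) secA by auto
    qed
    have conn: "connected ?J"
      unfolding J_eq
      by (intro connected_continuous_image connected_punctured_circle[OF W(2) aD] continuous_on_subset[OF A.continuous_on_crossing])
        (use Dcore in blast)
    have ne: "?J \<noteq> {}" unfolding J_eq using connected_punctured_circle(2)[OF W(2) aD] by blast
    have op: "openin (top_of_set ?C) ?J"
    proof -
      have "continuous_on ?C W" by (rule continuous_on_subset[OF B.continuous_V]) auto
      then have "openin (top_of_set ?C) (?C \<inter> W -` {..<1})" by (rule continuous_openin_preimage_gen) auto
      moreover have "?C \<inter> W -` {..<1} = ?J" by auto
      ultimately show ?thesis by metis
    qed
    \<comment> \<open>The two trajectories leaving the saddle-node have \<open>W = 1\<close> and end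
      at the sink; they provide the two distinct points of the circle outside the arc.\<close>
    have sep: "A.crossing y \<in> ?C - ?J" "y \<in> A.core" if y: "y \<in> S2 - {p}" "((\<lambda>t. reverse_flow \<phi> t y) \<longlongrightarrow> p) at_top" for y
    proof -
      have yS: "y \<in> S2" and ns: "y \<notin> {s, k, p}" using y not_fixed[of y "reverse_flow \<phi>"] by blast+
      have Wy: "W y = 1"
      proof (rule ccontr)
        assume "W y \<noteq> 1"
        then have "((\<lambda>t. reverse_flow \<phi> t y) \<longlongrightarrow> s) at_top" using B.tendsto_attractor_iff[OF yS] B.V_bounds[OF yS] by simp
        then show False using y(2) sk(4) tendsto_unique[OF trivial_limit_at_top_linorder] by blast
      qed
      have "V y \<noteq> 1"
      proof
        assume "V y = 1"
        then obtain t where "y = \<phi> t x0" using V1[OF yS] ns by blast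
        then show False using W1t[of t] Wy by simp
      qed
      then show core: "y \<in> A.core" using A.V_cases[OF yS] ns by blast
      have "W (A.crossing y) = 1" unfolding A.crossing_def using W_flow[OF yS] Wy by simp
      then show "A.crossing y \<in> ?C - ?J" using A.crossing_in[OF core] secA by auto
    qed
    have s1: "A.crossing x1 \<in> ?C - ?J" "x1 \<in> A.core" and s2: "A.crossing x2 \<in> ?C - ?J" "x2 \<in> A.core"
      using sep[of x1] sep[of x2] x \<psi>\<phi> by simp_all
    have "A.crossing x1 \<noteq> A.crossing x2"
    proof
      assume eq: "A.crossing x1 = A.crossing x2"
      have "x2 = \<phi> (- A.crossing_time x2) (\<phi> (A.crossing_time x1) x1)"
        using A.flow_crossing[OF s2(2)] eq by (simp add: A.crossing_def)
      moreover have "x1 \<in> S2" using x(2) by blast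
      ultimately have "x2 = \<phi> (- A.crossing_time x2 + A.crossing_time x1) x1" using A.flow_add[of x1] by metis
      then show False using diff \<psi>\<phi> by metis
    qed
    then show ?thesis using homeomorphic_circle_arc_parametrization[OF V(2) op conn ne s1(1) s2(1)] by blast
  qed
  ultimately show ?thesis using that by blast
qed

theorem optimal_saddle_source_flows_equivalent:
  assumes "SN_flow S2 \<phi>" "saddle_source_type S2 \<phi>" "card (singular_points S2 \<phi>) \<le> 3"
    and "SN_flow S2 \<psi>" "saddle_source_type S2 \<psi>" "card (singular_points S2 \<psi>) \<le> 3"
  shows "topologically_equivalent S2 \<phi> \<psi>"
proof -
  obtain k V s W q where 1: "sn_system S2 \<phi> k V s W" "arc_parametrization {x \<in> S2. V x = 1/2} q {x \<in> S2. V x = 1/2 \<and> W x < 1}"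
    using SN_flow_sn_system[OF assms(1-3)] .
  obtain k' V' s' W' q' where 2: "sn_system S2 \<psi> k' V' s' W'" "arc_parametrization {x \<in> S2. V' x = 1/2} q' {x \<in> S2. V' x = 1/2 \<and> W' x < 1}"
    using SN_flow_sn_system[OF assms(4-6)] .
  interpret S: sn_system S2 \<phi> k V s W by (rule 1)
  interpret S': sn_system S2 \<psi> k' V' s' W' by (rule 2)
  obtain g g' where g: "homeomorphism {x \<in> S2. V x = 1/2} {x \<in> S2. V' x = 1/2} g g'"
    "g ` {x \<in> S2. V x = 1/2 \<and> W x < 1} = {x \<in> S2. V' x = 1/2 \<and> W' x < 1}"
    using arc_parametrization_homeomorphism[OF 1(2) 2(2)] by blast
  have "W' (g c) = 1 \<longleftrightarrow> W c = 1" if c: "c \<in> S2" "V c = 1/2" for c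
  proof -
    have gc: "g c \<in> S2" "V' (g c) = 1/2" using g(1) c by (auto simp: homeomorphism_def)
    have "g c \<in> g ` {x \<in> S2. V x = 1/2 \<and> W x < 1} \<longleftrightarrow> c \<in> {x \<in> S2. V x = 1/2 \<and> W x < 1}"
    proof
      assume "g c \<in> g ` {x \<in> S2. V x = 1/2 \<and> W x < 1}"
      then obtain d where d: "d \<in> {x \<in> S2. V x = 1/2 \<and> W x < 1}" "g c = g d" by blast
      have "g' (g c) = c" "g' (g d) = d" using g(1) c d(1) unfolding homeomorphism_def by auto
      then show "c \<in> {x \<in> S2. V x = 1/2 \<and> W x < 1}" using d by metis
    qed blast
    then have "W' (g c) < 1 \<longleftrightarrow> W c < 1" unfolding g(2) using c gc by simp
    then show ?thesis using S.B.V_bounds[OF c(1)] S'.B.V_bounds[OF gc(1)] by linarith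
  qed
  then have "sn_pair S2 \<phi> k V s W \<psi> k' V' s' W' g g'"
    by (intro sn_pair.intro sn_pair_axioms.intro 1 2 g(1)) auto
  then show ?thesis by (rule sn_pair.equivalent)
qed

section \<open>Global flows of Lipschitz vector fields\<close>

text \<open>The weight $e^{-Kt}$ makes the Picard operator a contraction on any bounded time interval.\<close>

lemma lipschitz_forward_solution:
  fixes F :: "'a::euclidean_space \<Rightarrow> 'a"
  assumes L: "L-lipschitz_on UNIV F" and T: "0 \<le> T"
  shows "\<exists>\<gamma>. \<gamma> 0 = x \<and> (\<forall>t\<in>{0..T}. (\<gamma> has_vector_derivative F (\<gamma> t)) (at t within {0..T}))"
proof -
  \<comment> \<open>Makes the contraction factor \<open>L / K\<close> at most 1/2; adding 1 keeps
    \<open>K\<close> positive for \<open>L = 0\<close>.\<close>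
  define K where "K = 2 * L + 1"
  have L0: "0 \<le> L" using L lipschitz_on_nonneg by blast
  have K: "0 < K" "L / K \<le> 1/2" using L0 by (auto simp: K_def field_simps)
  have contF: "continuous_on A F" for A using lipschitz_on_continuous_on[OF L] continuous_on_subset by blast
  \<comment> \<open>Clamping time to \<open>{0..T}\<close> turns functions on the interval into
    bounded continuous functions on the line, the complete space in which Banach's theorem is
    applied.\<close>
  define c where "c t = max 0 (min t T)" for t :: real
  have c: "c t \<in> {0..T}" "t \<in> {0..T} \<Longrightarrow> c t = t" for t using T by (auto simp: c_def)
  define I where "I u t = integral {0..t} (\<lambda>s. F (exp (K * s) *\<^sub>R apply_bcontfun u s))" for u :: "real \<Rightarrow>\<^sub>C 'a" and t
  have cont_int: "continuous_on A (\<lambda>s. F (exp (K * s) *\<^sub>R apply_bcontfun u s))" for u :: "real \<Rightarrow>\<^sub>C 'a" and A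
    by (rule continuous_on_compose2[OF contF[of UNIV]]) (auto intro!: continuous_intros)
  have integ: "(\<lambda>s. F (exp (K * s) *\<^sub>R apply_bcontfun u s)) integrable_on {0..t}" for u :: "real \<Rightarrow>\<^sub>C 'a" and t
    by (rule integrable_continuous_interval[OF cont_int])
  define G where "G u t = exp (- K * c t) *\<^sub>R (x + I u (c t))" for u t
  have "G u \<in> bcontfun" for u
  proof -
    have I: "continuous_on {0..T} (I u)"
      unfolding I_def by (rule indefinite_integral_continuous_1[OF integ])
    then have "continuous_on {0..T} (\<lambda>t. exp (- K * t) *\<^sub>R (x + I u t))" by (intro continuous_intros)
    then have b: "bounded ((\<lambda>t. exp (- K * t) *\<^sub>R (x + I u t)) ` {0..T})"
      by (intro compact_imp_bounded compact_continuous_image) auto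
    have "range (G u) \<subseteq> (\<lambda>t. exp (- K * t) *\<^sub>R (x + I u t)) ` {0..T}" using c(1) by (auto simp: G_def)
    then have "bounded (range (G u))" using b bounded_subset by blast
    moreover have "continuous_on UNIV (G u)"
    proof -
      have "continuous_on UNIV c" unfolding c_def by (intro continuous_intros)
      moreover have "continuous_on UNIV (\<lambda>t. I u (c t))"
        by (rule continuous_on_compose2[OF I \<open>continuous_on UNIV c\<close>]) (use c(1) in auto)
      ultimately show ?thesis unfolding G_def by (intro continuous_intros)
    qed
    ultimately show ?thesis by (simp add: bcontfun_def)
  qed
  then have G: "apply_bcontfun (Bcontfun (G u)) = G u" for u by (simp add: Bcontfun_inverse)
  have "dist (Bcontfun (G u)) (Bcontfun (G v)) \<le> 1/2 * dist u v" for u v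
  proof (rule dist_bound)
    fix t
    let ?f = "\<lambda>u s. F (exp (K * s) *\<^sub>R apply_bcontfun u s)"
    let ?d = "dist u v"
    have I2: "((\<lambda>s. L * ?d * exp (K * s)) has_integral L * ?d * (exp (K * c t) / K) - L * ?d * (exp (K * 0) / K)) {0..c t}"
      using K c(1)[of t]
      by (intro fundamental_theorem_of_calculus)
        (auto intro!: derivative_eq_intros simp flip: has_real_derivative_iff_has_vector_derivative)
    have "norm (I u (c t) - I v (c t)) = norm (integral {0..c t} (\<lambda>s. ?f u s - ?f v s))"
      unfolding I_def by (subst integral_diff[OF integ integ]) simp
    also have "\<dots> \<le> integral {0..c t} (\<lambda>s. L * ?d * exp (K * s))"
    proof (rule integral_norm_bound_integral)
      show "(\<lambda>s. ?f u s - ?f v s) integrable_on {0..c t}" by (intro integrable_diff integ)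
      show "(\<lambda>s. L * ?d * exp (K * s)) integrable_on {0..c t}" using I2 by blast
      fix s
      have "norm (?f u s - ?f v s) \<le> L * norm (exp (K * s) *\<^sub>R apply_bcontfun u s - exp (K * s) *\<^sub>R apply_bcontfun v s)"
        using lipschitz_on_normD[OF L] by simp
      also have "\<dots> = L * (exp (K * s) * dist (apply_bcontfun u s) (apply_bcontfun v s))"
        by (simp add: dist_norm flip: scaleR_diff_right)
      also have "\<dots> \<le> L * (exp (K * s) * ?d)"
        using L0 dist_bounded by (intro mult_left_mono) auto
      finally show "norm (?f u s - ?f v s) \<le> L * ?d * exp (K * s)" by (simp add: mult_ac)
    qed
    also have "\<dots> = L * ?d * (exp (K * c t) / K) - L * ?d * (exp (K * 0) / K)" using I2 by blast
    also have "\<dots> \<le> L * ?d * (exp (K * c t) / K)" using L0 K by simp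
    finally have *: "norm (I u (c t) - I v (c t)) \<le> L / K * ?d * exp (K * c t)" by (simp add: mult_ac)
    have "dist (G u t) (G v t) = exp (- K * c t) * norm (I u (c t) - I v (c t))"
      by (simp add: G_def dist_norm flip: scaleR_diff_right)
    also have "\<dots> \<le> exp (- K * c t) * (L / K * ?d * exp (K * c t))" using * by (intro mult_left_mono) auto
    also have "\<dots> = L / K * ?d" by (simp add: exp_minus field_simps)
    also have "\<dots> \<le> 1/2 * ?d" using K by (intro mult_right_mono) auto
    finally show "dist (apply_bcontfun (Bcontfun (G u)) t) (apply_bcontfun (Bcontfun (G v)) t) \<le> 1/2 * ?d" by (simp add: G)
  qed
  then obtain u where u: "Bcontfun (G u) = u" using banach_fix_type[of "1/2" "\<lambda>u. Bcontfun (G u)"] by auto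
  define \<gamma> where "\<gamma> t = exp (K * t) *\<^sub>R apply_bcontfun u t" for t
  have \<gamma>: "\<gamma> t = x + integral {0..t} (\<lambda>s. F (\<gamma> s))" if "t \<in> {0..T}" for t
  proof -
    have "apply_bcontfun u t = exp (- K * t) *\<^sub>R (x + I u t)" using G[of u] u c(2)[OF that] by (simp add: G_def)
    then show ?thesis by (simp add: \<gamma>_def I_def exp_minus)
  qed
  have "continuous_on {0..T} (\<lambda>s. F (\<gamma> s))" unfolding \<gamma>_def by (rule cont_int)
  then have "((\<lambda>t. x + integral {0..t} (\<lambda>s. F (\<gamma> s))) has_vector_derivative 0 + F (\<gamma> t)) (at t within {0..T})"
    if "t \<in> {0..T}" for t
    by (intro has_vector_derivative_add has_vector_derivative_const integral_has_vector_derivative that)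
  then have "(\<gamma> has_vector_derivative F (\<gamma> t)) (at t within {0..T})" if "t \<in> {0..T}" for t
    using has_vector_derivative_transform[OF that, of \<gamma> "\<lambda>t. x + integral {0..t} (\<lambda>s. F (\<gamma> s))"] \<gamma> that by simp
  moreover have "\<gamma> 0 = x" using \<gamma>[of 0] T by simp
  ultimately show ?thesis by blast
qed

lemma has_vector_derivative_shift:
  assumes "(\<gamma> has_vector_derivative v) (at (s * t + b) within (\<lambda>t. s * t + b) ` S)"
  shows "((\<lambda>t. \<gamma> (s * t + b)) has_vector_derivative s *\<^sub>R v) (at t within S)"
proof -
  have "((\<lambda>t. s * t + b) has_vector_derivative s) (at t within S)" by (auto intro!: derivative_eq_intros)
  from vector_diff_chain_within[OF this assms] show ?thesis by (simp add: o_def)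
qed

text \<open>Follow the reversed field from \<open>x\<close> for time \<open>T\<close>, then solve
  forward from there for time \<open>2 * T\<close>. By uniqueness this solution passes through
  \<open>x\<close> at time \<open>T\<close>, and no one-sided derivatives have to be glued at
  0.\<close>

lemma lipschitz_two_sided_solution:
  fixes F :: "'a::euclidean_space \<Rightarrow> 'a"
  assumes L: "L-lipschitz_on UNIV F" and T: "0 \<le> T"
  shows "\<exists>\<gamma>. \<gamma> 0 = x \<and> (\<forall>t\<in>{-T..T}. (\<gamma> has_vector_derivative F (\<gamma> t)) (at t within {-T..T}))"
proof -
  have L': "L-lipschitz_on UNIV (\<lambda>z. - F z)" using L by simp
  obtain b where b: "b 0 = x" "\<forall>t\<in>{0..T}. (b has_vector_derivative - F (b t)) (at t within {0..T})"
    using lipschitz_forward_solution[OF L' T] by blast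
  obtain g where g: "g 0 = b T" "\<forall>t\<in>{0..2*T}. (g has_vector_derivative F (g t)) (at t within {0..2*T})"
    using lipschitz_forward_solution[OF L, of "2 * T" "b T"] T by auto
  have "b (T - T) = g T"
  proof (rule integral_curves_unique[OF L T order_refl, of "\<lambda>t. b (T - t)" g])
    fix s assume s: "s \<in> {0..T}"
    have "(b has_vector_derivative - F (b ((-1) * s + T))) (at ((-1) * s + T) within (\<lambda>t. (-1) * t + T) ` {0..T})"
      by (rule has_vector_derivative_within_subset[of _ _ _ "{0..T}"]) (use b(2) s in auto)
    from has_vector_derivative_shift[OF this]
    show "b (T - s) \<in> UNIV \<and> ((\<lambda>t. b (T - t)) has_vector_derivative F (b (T - s))) (at s within {0..T})" by simp
    show "g s \<in> UNIV \<and> (g has_vector_derivative F (g s)) (at s within {0..T})"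
      using g(2) s by (auto intro!: has_vector_derivative_within_subset[of _ _ _ "{0..2*T}" "{0..T}"])
  qed (use g in simp)
  then have "g T = x" using b by simp
  moreover have "((\<lambda>t. g (1 * t + T)) has_vector_derivative 1 *\<^sub>R F (g (1 * t + T))) (at t within {-T..T})" if "t \<in> {-T..T}" for t
    by (rule has_vector_derivative_shift, rule has_vector_derivative_within_subset[of _ _ _ "{0..2*T}"]) (use g(2) that in auto)
  ultimately show ?thesis by (intro exI[of _ "\<lambda>t. g (t + T)"]) auto
qed

lemma two_sided_unique:
  fixes F :: "'a::euclidean_space \<Rightarrow> 'a"
  assumes L: "L-lipschitz_on UNIV F" and ab: "a 0 = b 0" and t: "t \<in> {-T..T}"
    and a: "\<And>t. t \<in> {-T..T} \<Longrightarrow> (a has_vector_derivative F (a t)) (at t within {-T..T})"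
    and b: "\<And>t. t \<in> {-T..T} \<Longrightarrow> (b has_vector_derivative F (b t)) (at t within {-T..T})"
  shows "a t = b t"
proof (cases "0 \<le> t")
  case True
  have sub: "{0..t} \<subseteq> {-T..T}" using t by auto
  show ?thesis
    by (rule integral_curves_unique[where T = t, OF L True order_refl])
      (use a b ab sub in \<open>auto intro!: has_vector_derivative_within_subset[OF _ sub]\<close>)
next
  case False
  have L': "L-lipschitz_on UNIV (\<lambda>z. - F z)" using L by simp
  have sub: "(\<lambda>s. (-1) * s + 0) ` {0..- t} \<subseteq> {-T..T}" using t by auto
  have rev: "((\<lambda>s. f (- s)) has_vector_derivative - F (f (- s))) (at s within {0..- t})"
    if "s \<in> {0..- t}" "\<And>t. t \<in> {-T..T} \<Longrightarrow> (f has_vector_derivative F (f t)) (at t within {-T..T})" for f s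
  proof -
    have "(f has_vector_derivative F (f ((-1) * s + 0))) (at ((-1) * s + 0) within (\<lambda>s. (-1) * s + 0) ` {0..- t})"
      by (rule has_vector_derivative_within_subset[OF _ sub]) (use that t in auto)
    from has_vector_derivative_shift[OF this] show ?thesis by simp
  qed
  have "a (- (- t)) = b (- (- t))"
    by (rule integral_curves_unique[OF L', of "- t" "- t" "\<lambda>s. a (- s)" "\<lambda>s. b (- s)"])
      (use False ab rev[OF _ a] rev[OF _ b] in auto)
  then show ?thesis by simp
qed

text \<open>Solutions on different windows agree where both are defined, so the value at
  \<open>t\<close> may be read off any window around it; radius \<open>\<bar>t\<bar> + 1\<close>
  keeps \<open>t\<close> in the interior, and radius \<open>\<bar>t\<bar> + 2\<close> covers a
  neighbourhood of \<open>t\<close>.\<close>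

theorem lipschitz_global_flow:
  fixes F :: "'a::euclidean_space \<Rightarrow> 'a"
  assumes L: "L-lipschitz_on UNIV F"
  obtains \<Phi> where "\<And>x. \<Phi> 0 x = x" "\<And>x t. ((\<lambda>t. \<Phi> t x) has_vector_derivative F (\<Phi> t x)) (at t)"
proof -
  have "\<forall>x T. \<exists>\<gamma>. 0 \<le> T \<longrightarrow> \<gamma> 0 = x \<and> (\<forall>t\<in>{-T..T}. (\<gamma> has_vector_derivative F (\<gamma> t)) (at t within {-T..T}))"
    using lipschitz_two_sided_solution[OF L] by blast
  then obtain g where g: "\<And>x T. 0 \<le> T \<Longrightarrow> g x T 0 = x"
    "\<And>x T t. 0 \<le> T \<Longrightarrow> t \<in> {-T..T} \<Longrightarrow> (g x T has_vector_derivative F (g x T t)) (at t within {-T..T})"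
    by metis
  have same: "g x T t = g x T' t" if "0 \<le> T" "T \<le> T'" "t \<in> {-T..T}" for x T T' t
  proof (rule two_sided_unique[OF L _ that(3)])
    show "g x T 0 = g x T' 0" using g(1) that by simp
    show "(g x T has_vector_derivative F (g x T t)) (at t within {-T..T})" if "t \<in> {-T..T}" for t
      using g(2) that \<open>0 \<le> T\<close> by blast
    show "(g x T' has_vector_derivative F (g x T' t)) (at t within {-T..T})" if "t \<in> {-T..T}" for t
      by (rule has_vector_derivative_within_subset[of _ _ _ "{-T'..T'}"]) (use that g(2) \<open>0 \<le> T\<close> \<open>T \<le> T'\<close> in auto)
  qed
  show ?thesis
  proof (rule that[of "\<lambda>t x. g x (\<bar>t\<bar> + 1) t"])
    show "g x (\<bar>0\<bar> + 1) 0 = x" for x using g(1) by simp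
    fix x and t :: real
    let ?T = "\<bar>t\<bar> + 2"
    have eq: "g x (\<bar>s\<bar> + 1) s = g x ?T s" if "s \<in> {t - 1<..<t + 1}" for s
      by (rule same) (use that in auto)
    have "t \<in> interior {-?T..?T}" by (auto simp: interior_atLeastAtMost_real)
    then have "(g x ?T has_vector_derivative F (g x ?T t)) (at t)"
      using g(2)[of ?T t x] at_within_interior[of t "{-?T..?T}"] by auto
    then have "((\<lambda>s. g x (\<bar>s\<bar> + 1) s) has_vector_derivative F (g x ?T t)) (at t)"
      by (rule has_vector_derivative_transform_within_open[of _ _ _ "{t - 1<..<t + 1}"]) (use eq in auto)
    then show "((\<lambda>s. g x (\<bar>s\<bar> + 1) s) has_vector_derivative F (g x (\<bar>t\<bar> + 1) t)) (at t)" using eq[of t] by simp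
  qed
qed

section \<open>Smooth functions\<close>

lemma Ck_on_Suc_imp: "Ck_on (Suc k) U f \<Longrightarrow> Ck_on k U f"
proof (induction k arbitrary: f)
  case 0
  then show ?case by (simp add: continuous_at_imp_continuous_on differentiable_imp_continuous_within)
next
  case (Suc k)
  then show ?case using Ck_on.simps(2)[of k U f] Ck_on.simps(2)[of "Suc k" U f] by blast
qed

lemma Ck_on_const: "Ck_on k U (\<lambda>x. c)"
  by (induction k arbitrary: c) auto

lemma Ck_on_SucI:
  assumes "open U" "\<And>x. x \<in> U \<Longrightarrow> (f has_derivative f' x) (at x)" "\<And>v. Ck_on k U (\<lambda>x. f' x v)"
  shows "Ck_on (Suc k) U f"
  unfolding Ck_on.simps
proof (intro conjI ballI allI)
  show "f differentiable at x" if "x \<in> U" for x using assms(2)[OF that] by (rule differentiableI)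
  have "f' x v = frechet_derivative f (at x) v" if "x \<in> U" for x v using frechet_derivative_at[OF assms(2)[OF that]] by simp
  then show "Ck_on k U (\<lambda>x. frechet_derivative f (at x) v)" for v
    using Ck_on_cong[OF assms(1), of "\<lambda>x. f' x v" "\<lambda>x. frechet_derivative f (at x) v" k] assms(3) by blast
qed

lemma Ck_on_SucD:
  assumes "Ck_on (Suc k) U f"
  shows "x \<in> U \<Longrightarrow> (f has_derivative frechet_derivative f (at x)) (at x)"
    and "Ck_on k U (\<lambda>x. frechet_derivative f (at x) v)"
  using assms by (auto simp: frechet_derivative_works)

lemma Ck_on_bounded_linear:
  assumes "bounded_linear f" "open U"
  shows "Ck_on k U f"
proof (cases k)
  case 0
  then show ?thesis using assms by (simp add: linear_continuous_on)
next
  case (Suc n)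
  then show ?thesis
    using Ck_on_SucI[OF assms(2), of f "\<lambda>x. f"] bounded_linear_imp_has_derivative[OF assms(1)] Ck_on_const by blast
qed

lemma Ck_on_linear_compose:
  assumes "bounded_linear h" "open U" "Ck_on k U f"
  shows "Ck_on k U (\<lambda>x. h (f x))"
  using assms(3)
proof (induction k arbitrary: f)
  case 0
  then show ?case using assms(1) by (simp add: bounded_linear.continuous_on)
next
  case (Suc k)
  show ?case
    by (rule Ck_on_SucI[OF assms(2) bounded_linear.has_derivative[OF assms(1) Ck_on_SucD(1)[OF Suc.prems]] Suc.IH])
      (assumption | rule Ck_on_SucD(2)[OF Suc.prems])+
qed

lemma Ck_on_add:
  assumes "open U" shows "Ck_on k U f \<Longrightarrow> Ck_on k U g \<Longrightarrow> Ck_on k U (\<lambda>x. f x + g x)"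
proof (induction k arbitrary: f g)
  case 0
  then show ?case by (simp add: continuous_on_add)
next
  case (Suc k)
  show ?case
    by (rule Ck_on_SucI[OF assms has_derivative_add[OF Ck_on_SucD(1)[OF Suc.prems(1)] Ck_on_SucD(1)[OF Suc.prems(2)]] Suc.IH])
      (assumption | rule Ck_on_SucD(2)[OF Suc.prems(1)] Ck_on_SucD(2)[OF Suc.prems(2)])+
qed

lemma Ck_on_scaleR:
  fixes f :: "'a::real_normed_vector \<Rightarrow> real"
  assumes "open U" shows "Ck_on k U f \<Longrightarrow> Ck_on k U g \<Longrightarrow> Ck_on k U (\<lambda>x. f x *\<^sub>R g x)"
proof (induction k arbitrary: f g)
  case 0
  then show ?case by (simp add: continuous_on_scaleR)
next
  case (Suc k)
  show ?case
    by (rule Ck_on_SucI[OF assms has_derivative_scaleR[OF Ck_on_SucD(1)[OF Suc.prems(1)] Ck_on_SucD(1)[OF Suc.prems(2)]]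
          Ck_on_add[OF assms Suc.IH Suc.IH]])
      (assumption | rule Ck_on_SucD(2)[OF Suc.prems(1)] Ck_on_SucD(2)[OF Suc.prems(2)] Ck_on_Suc_imp[OF Suc.prems(1)] Ck_on_Suc_imp[OF Suc.prems(2)])+
qed

lemma Ck_on_sum:
  assumes "open U" "finite B" "\<And>b. b \<in> B \<Longrightarrow> Ck_on k U (f b)"
  shows "Ck_on k U (\<lambda>x. \<Sum>b\<in>B. f b x)"
  using assms(2,3) by (induction B rule: finite_induct) (simp_all add: Ck_on_const Ck_on_add[OF assms(1)])

text \<open>Expanding the chain rule over the basis turns it into a finite sum of products in which
  only fixed partial derivatives of \<open>f\<close> are composed with \<open>g\<close>, and to
  these the induction hypothesis applies.\<close>

lemma Ck_on_compose:
  fixes g :: "'a::real_normed_vector \<Rightarrow> 'b::euclidean_space"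
  assumes U: "open U" and V: "g ` U \<subseteq> V"
  shows "Ck_on k V f \<Longrightarrow> Ck_on k U g \<Longrightarrow> Ck_on k U (\<lambda>x. f (g x))"
proof (induction k arbitrary: f)
  case 0
  then show ?case using V by (simp add: continuous_on_compose2)
next
  case (Suc k)
  let ?Df = "\<lambda>y. frechet_derivative f (at y)" and ?Dg = "\<lambda>x. frechet_derivative g (at x)"
  have D: "((\<lambda>x. f (g x)) has_derivative (\<lambda>v. \<Sum>b\<in>Basis. (?Dg x v \<bullet> b) *\<^sub>R ?Df (g x) b)) (at x)" if x: "x \<in> U" for x
  proof -
    have df: "(f has_derivative ?Df (g x)) (at (g x))" using Ck_on_SucD(1)[OF Suc.prems(1)] V x by blast
    have "((\<lambda>x. f (g x)) has_derivative (\<lambda>v. ?Df (g x) (?Dg x v))) (at x)"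
      by (rule has_derivative_compose[OF Ck_on_SucD(1)[OF Suc.prems(2) x] df])
    moreover have "?Df (g x) w = (\<Sum>b\<in>Basis. (w \<bullet> b) *\<^sub>R ?Df (g x) b)" for w
      using linear_sum[OF has_derivative_linear[OF df], of "\<lambda>b. (w \<bullet> b) *\<^sub>R b" Basis]
        linear_scale[OF has_derivative_linear[OF df]] by (simp add: euclidean_representation)
    then have "(\<lambda>v. ?Df (g x) (?Dg x v)) = (\<lambda>v. \<Sum>b\<in>Basis. (?Dg x v \<bullet> b) *\<^sub>R ?Df (g x) b)" by (rule ext)
    ultimately show ?thesis by (simp only:)
  qed
  show ?case
  proof (rule Ck_on_SucI[OF U D])
    show "Ck_on k U (\<lambda>x. \<Sum>b\<in>Basis. (?Dg x v \<bullet> b) *\<^sub>R ?Df (g x) b)" for v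
      by (intro Ck_on_sum[OF U finite_Basis] Ck_on_scaleR[OF U] Ck_on_linear_compose[OF bounded_linear_inner_left U]
          Suc.IH Ck_on_SucD(2)[OF Suc.prems(1)] Ck_on_SucD(2)[OF Suc.prems(2)] Ck_on_Suc_imp[OF Suc.prems(2)])
  qed
qed

lemma Ck_on_Un: "open U \<Longrightarrow> open V \<Longrightarrow> Ck_on k U f \<Longrightarrow> Ck_on k V f \<Longrightarrow> Ck_on k (U \<union> V) f"
proof (induction k arbitrary: f)
  case 0
  then show ?case by (simp add: continuous_on_open_Un)
qed auto

lemma Ck_on_mult: "open U \<Longrightarrow> Ck_on k U f \<Longrightarrow> Ck_on k U g \<Longrightarrow> Ck_on k U (\<lambda>x. f x * g x :: real)"
  using Ck_on_scaleR[of U k f g] by simp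

lemma Ck_on_diff: "open U \<Longrightarrow> Ck_on k U f \<Longrightarrow> Ck_on k U g \<Longrightarrow> Ck_on k U (\<lambda>x. f x - g x)"
  using Ck_on_add[of U k f "\<lambda>x. - g x"] Ck_on_uminus[of U k g] by simp

lemma Ck_on_power2: "open U \<Longrightarrow> Ck_on k U f \<Longrightarrow> Ck_on k U (\<lambda>x. (f x :: real)\<^sup>2)"
  unfolding power2_eq_square by (rule Ck_on_mult)

lemma Ck_on_inverse_aux: "Ck_on k (- {0}) (inverse :: real \<Rightarrow> real)"
proof (induction k)
  case 0
  then show ?case by (auto intro!: continuous_intros)
next
  case (Suc k)
  have op: "open (- {0::real})" by auto
  show ?case
  proof (rule Ck_on_SucI[OF op])
    show "(inverse has_derivative (\<lambda>v. - (inverse x * v * inverse x))) (at x)" if "x \<in> - {0}" for x :: real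
      using has_derivative_inverse'[of x] that by simp
    show "Ck_on k (- {0}) (\<lambda>x::real. - (inverse x * v * inverse x))" for v
      by (intro Ck_on_uminus[OF op] Ck_on_mult[OF op] Suc.IH Ck_on_const)
  qed
qed

lemma Ck_on_divide:
  assumes "open U" "Ck_on k U f" "Ck_on k U g" "\<And>x. x \<in> U \<Longrightarrow> g x \<noteq> 0"
  shows "Ck_on k U (\<lambda>x. f x / g x :: real)"
  unfolding divide_inverse
  by (intro Ck_on_mult assms Ck_on_compose[OF assms(1) _ Ck_on_inverse_aux]) (use assms(4) in auto)

lemma Ck_on_Pair:
  assumes "open U" "Ck_on k U f" "Ck_on k U g"
  shows "Ck_on k U (\<lambda>x. (f x, g x))"
proof -
  have "bounded_linear (\<lambda>y. (y, 0))" "bounded_linear (\<lambda>y. (0, y))"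
    by (intro bounded_linear_Pair bounded_linear_ident bounded_linear_zero)+
  then have "Ck_on k U (\<lambda>x. (f x, 0))" "Ck_on k U (\<lambda>x. (0, g x))"
    using Ck_on_linear_compose[OF _ assms(1)] assms(2,3) by blast+
  from Ck_on_add[OF assms(1) this] show ?thesis by simp
qed

section \<open>Flat functions and a smooth cutoff\<close>

definition flat :: "nat \<Rightarrow> real \<Rightarrow> real" where
  "flat n x = (if 0 < x then exp (- 1 / x) / x ^ n else 0)"

lemma flat_tendsto_0: "(flat n \<longlongrightarrow> 0) (at 0)"
proof -
  have "((\<lambda>t. t ^ n / exp t) \<longlongrightarrow> (0::real)) at_top" by (rule tendsto_power_div_exp_0)
  from filterlim_compose[OF this filterlim_inverse_at_top_right]
  have "((\<lambda>x. inverse x ^ n / exp (inverse x)) \<longlongrightarrow> (0::real)) (at_right 0)" .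
  then have "(flat n \<longlongrightarrow> 0) (at_right 0)"
  proof (rule Lim_transform_eventually)
    show "\<forall>\<^sub>F x in at_right 0. inverse x ^ n / exp (inverse x) = flat n x"
      using eventually_at_right_less[of 0]
      by eventually_elim (simp add: flat_def exp_minus divide_simps)
  qed
  moreover have "(flat n \<longlongrightarrow> 0) (at_left 0)"
    by (rule Lim_transform_eventually[OF tendsto_const[of 0]]) (auto simp: flat_def eventually_at_filter)
  ultimately show ?thesis by (simp add: filterlim_split_at)
qed

text \<open>The powers in the denominator are carried along so that the span of the family is closed
  under differentiation; smoothness is then an induction for all \<open>n\<close> at once. At 0 the
  difference quotient of \<open>flat n\<close> is \<open>flat (n + 1)\<close>.\<close>

lemma flat_has_derivative: "(flat n has_real_derivative flat (n + 2) x - real n * flat (n + 1) x) (at x)"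
proof -
  consider "0 < x" | "x < 0" | "x = 0" by linarith
  then show ?thesis
  proof cases
    case 1
    have "((\<lambda>x. exp (- 1 / x) * inverse x ^ n) has_real_derivative flat (n + 2) x - real n * flat (n + 1) x) (at x)"
      using 1 by (auto intro!: derivative_eq_intros simp: flat_def)
        (cases n; simp add: field_simps power2_eq_square)
    then show ?thesis
      by (rule has_field_derivative_transform_within_open[of _ _ _ "{0<..}"]) (use 1 in \<open>auto simp: flat_def field_simps\<close>)
  next
    case 2
    have "((\<lambda>x. 0) has_real_derivative flat (n + 2) x - real n * flat (n + 1) x) (at x)"
      using 2 by (simp add: flat_def)
    then show ?thesis
      by (rule has_field_derivative_transform_within_open[of _ _ _ "{..<0}"]) (use 2 in \<open>auto simp: flat_def\<close>)
  next
    case 3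
    have "(\<lambda>h. (flat n (0 + h) - flat n 0) / h) \<midarrow>0\<rightarrow> 0"
    proof (rule Lim_transform_eventually[OF flat_tendsto_0[of "n + 1"]])
      show "\<forall>\<^sub>F h in at 0. flat (n + 1) h = (flat n (0 + h) - flat n 0) / h"
        by (auto simp: flat_def eventually_at_filter)
    qed
    then show ?thesis using 3 by (simp add: DERIV_def flat_def)
  qed
qed

lemma Ck_on_flat: "Ck_on k UNIV (flat n)"
proof (induction k arbitrary: n)
  case 0
  have "isCont (flat n) x" for x using flat_has_derivative DERIV_isCont by blast
  then show ?case by (simp add: continuous_at_imp_continuous_on)
next
  case (Suc k)
  show ?case
  proof (rule Ck_on_SucI[OF open_UNIV])
    show "(flat n has_derivative (\<lambda>v. (flat (n + 2) x - real n * flat (n + 1) x) * v)) (at x)" for x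
      using flat_has_derivative[of n x] by (simp add: has_field_derivative_def)
    show "Ck_on k UNIV (\<lambda>x. (flat (n + 2) x - real n * flat (n + 1) x) * v)" for v
      by (intro Ck_on_mult Ck_on_diff Ck_on_const Suc.IH open_UNIV)
  qed
qed

lemma flat_pos_iff: "0 < flat n x \<longleftrightarrow> 0 < x" and flat_nonneg: "0 \<le> flat n x"
  by (auto simp: flat_def)

text \<open>The argument is a squared radius: the value is 1 on the disc of radius 1/2 and 0 from
  squared radius 1/2 on. The source at distance 1 from the origin is thus left untouched.\<close>

definition cutoff :: "real \<Rightarrow> real" where
  "cutoff \<rho> = flat 0 (1/2 - \<rho>) / (flat 0 (1/2 - \<rho>) + flat 0 (\<rho> - 1/4))"

lemma cutoff_denominator: "0 < flat 0 (1/2 - \<rho>) + flat 0 (\<rho> - 1/4)"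
proof (cases "\<rho> < 1/2")
  case True
  then have "0 < flat 0 (1/2 - \<rho>)" by (simp add: flat_pos_iff)
  then show ?thesis using flat_nonneg[of 0 "\<rho> - 1/4"] by linarith
next
  case False
  then have "0 < flat 0 (\<rho> - 1/4)" by (simp add: flat_pos_iff)
  then show ?thesis using flat_nonneg[of 0 "1/2 - \<rho>"] by linarith
qed

lemma cutoff_bounds: "0 \<le> cutoff \<rho>" "cutoff \<rho> \<le> 1"
  using cutoff_denominator[of \<rho>] flat_nonneg[of 0] by (auto simp: cutoff_def)

lemma cutoff_eq_1: "\<rho> \<le> 1/4 \<Longrightarrow> cutoff \<rho> = 1"
  using cutoff_denominator[of \<rho>] by (auto simp: cutoff_def flat_def)

lemma cutoff_eq_0: "1/2 \<le> \<rho> \<Longrightarrow> cutoff \<rho> = 0"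
  by (auto simp: cutoff_def flat_def)

lemma Ck_on_cutoff: "Ck_on k UNIV cutoff"
proof -
  have lin: "Ck_on k UNIV (\<lambda>\<rho>::real. 1/2 - \<rho>)" "Ck_on k UNIV (\<lambda>\<rho>::real. \<rho> - 1/4)"
    by (intro Ck_on_diff open_UNIV Ck_on_const Ck_on_bounded_linear[OF bounded_linear_ident])+
  have "Ck_on k UNIV (\<lambda>\<rho>. flat 0 (1/2 - \<rho>))" "Ck_on k UNIV (\<lambda>\<rho>. flat 0 (\<rho> - 1/4))"
    by (rule Ck_on_compose[OF open_UNIV subset_UNIV Ck_on_flat] lin)+
  then show ?thesis
    unfolding cutoff_def[abs_def]
    by (intro Ck_on_divide Ck_on_add open_UNIV) (use cutoff_denominator in \<open>auto simp: less_imp_neq[symmetric]\<close>)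
qed

section \<open>The flow in the plane\<close>

text \<open>Off a disc about the saddle-node 0 the field is the linear source $(x, y + 1)$ with singular
  point $(0, -1)$; on a smaller disc it is $(x, y^2)$. The first argument of \<^term>\<open>shear\<close> stands for $x^2 + y^2$.\<close>

definition shear :: "real \<Rightarrow> real \<Rightarrow> real" where
  "shear \<rho> y = 1 + cutoff \<rho> * (y\<^sup>2 - y - 1)"

definition plane_field :: "real \<times> real \<Rightarrow> real \<times> real" where
  "plane_field z = (fst z, snd z + shear ((fst z)\<^sup>2 + (snd z)\<^sup>2) (snd z))"

lemma plane_field_far: "1/2 \<le> (fst z)\<^sup>2 + (snd z)\<^sup>2 \<Longrightarrow> plane_field z = (fst z, snd z + 1)"
  by (simp add: plane_field_def shear_def cutoff_eq_0)

lemma plane_field_near: "(fst z)\<^sup>2 + (snd z)\<^sup>2 \<le> 1/4 \<Longrightarrow> plane_field z = saddle_node_model z"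
  by (simp add: plane_field_def shear_def cutoff_eq_1 saddle_node_model_def)

text \<open>A convex combination of \<open>1 + y\<close> and \<open>y\<^sup>2\<close>. Both are
  nonnegative for \<open>y \<ge> -1\<close>, so the interpolation creates no new zero and
  \<open>y\<close> never decreases there.\<close>

lemma snd_plane_field: "snd (plane_field z) = (1 - cutoff ((fst z)\<^sup>2 + (snd z)\<^sup>2)) * (1 + snd z) + cutoff ((fst z)\<^sup>2 + (snd z)\<^sup>2) * (snd z)\<^sup>2"
  by (simp add: plane_field_def shear_def algebra_simps)

lemma snd_plane_field_nonneg: "- 1 \<le> snd z \<Longrightarrow> 0 \<le> snd (plane_field z)"
  unfolding snd_plane_field
  by (rule add_nonneg_nonneg[OF mult_nonneg_nonneg mult_nonneg_nonneg]) (auto simp: cutoff_bounds)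

lemma plane_field_eq_0_iff: "plane_field z = 0 \<longleftrightarrow> z = (0, 0) \<or> z = (0, -1)"
proof
  assume 0: "plane_field z = 0"
  then have x: "fst z = 0" by (simp add: plane_field_def zero_prod_def)
  let ?c = "cutoff ((fst z)\<^sup>2 + (snd z)\<^sup>2)"
  show "z = (0, 0) \<or> z = (0, -1)"
  proof (cases "- 1 \<le> snd z")
    case True
    have s: "(1 - ?c) * (1 + snd z) + ?c * (snd z)\<^sup>2 = 0" using 0 snd_plane_field[of z] by (simp add: zero_prod_def)
    moreover have "0 \<le> (1 - ?c) * (1 + snd z)" "0 \<le> ?c * (snd z)\<^sup>2" using cutoff_bounds True by auto
    ultimately have "(1 - ?c) * (1 + snd z) = 0" "?c * (snd z)\<^sup>2 = 0" by linarith+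
    then have "?c = 1 \<or> snd z = - 1" "?c = 0 \<or> snd z = 0" by auto
    then have "snd z = 0 \<or> snd z = - 1" by auto
    then show ?thesis using x by (metis prod.collapse)
  next
    case False
    then have "1 < (snd z)\<^sup>2" using power_strict_mono[of 1 "- snd z" 2] by simp
    then have "plane_field z = (fst z, snd z + 1)" by (intro plane_field_far) (simp add: x)
    then show ?thesis using 0 False by (simp add: zero_prod_def)
  qed
next
  assume "z = (0, 0) \<or> z = (0, -1)"
  then show "plane_field z = 0"
    using plane_field_near[of "(0, 0)"] plane_field_far[of "(0, -1)"] by (auto simp: saddle_node_model_def zero_prod_def)
qed

lemma Ck_on_shear:
  assumes "open U" "Ck_on k U f" "Ck_on k U g"
  shows "Ck_on k U (\<lambda>x. shear (f x) (g x))"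
  unfolding shear_def
  by (intro Ck_on_add Ck_on_mult Ck_on_diff Ck_on_power2 assms Ck_on_const Ck_on_compose[OF assms(1) subset_UNIV Ck_on_cutoff])

text \<open>Apart from the identity the field is constant outside the unit disc. It therefore
  factors through the nearest-point projection to the disc, which is 1-Lipschitz, and compactness of
  the disc gives the constant.\<close>

lemma plane_field_lipschitz: obtains L where "L-lipschitz_on UNIV plane_field"
proof -
  define F :: "real \<times> real \<Rightarrow> real \<times> real" where "F z = (0, shear ((fst z)\<^sup>2 + (snd z)\<^sup>2) (snd z))" for z
  let ?D = "cball (0 :: real \<times> real) 1"
  have lin: "Ck_on k UNIV (fst :: real \<times> real \<Rightarrow> real)" "Ck_on k UNIV (snd :: real \<times> real \<Rightarrow> real)" for k
    by (intro Ck_on_bounded_linear bounded_linear_fst bounded_linear_snd open_UNIV)+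
  have "Ck_on k UNIV F" for k unfolding F_def
    by (intro Ck_on_Pair Ck_on_shear Ck_on_add Ck_on_power2 Ck_on_const lin open_UNIV)
  then obtain L where L: "L-lipschitz_on ?D F" using C1_lipschitz_on_compact[of UNIV F ?D] by auto
  have F_proj: "F z = F (closest_point ?D z)" for z
  proof (cases "z \<in> ?D")
    case True
    then show ?thesis by (simp add: closest_point_self)
  next
    case False
    have far: "F w = (0, 1)" if "1 \<le> norm w" for w
    proof -
      have "1 \<le> (norm w)\<^sup>2" using that by (simp add: one_le_power)
      then have "1/2 \<le> (fst w)\<^sup>2 + (snd w)\<^sup>2" by (simp add: norm_prod_def)
      then show ?thesis by (simp add: F_def shear_def cutoff_eq_0)
    qed
    have "affine hull ?D = UNIV" by (rule affine_hull_nonempty_interior) (simp add: interior_cball)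
    then have "z \<in> affine hull ?D - rel_interior ?D" using False rel_interior_subset[of ?D] by blast
    then have "closest_point ?D z \<in> rel_frontier ?D" by (intro closest_point_in_rel_frontier) auto
    then have "norm (closest_point ?D z) = 1" by (simp add: rel_frontier_cball)
    then show ?thesis using far[of z] far[of "closest_point ?D z"] False by simp
  qed
  have "L-lipschitz_on UNIV F"
  proof (rule lipschitz_onI)
    fix z w
    have "closest_point ?D z \<in> ?D" "closest_point ?D w \<in> ?D" by (intro closest_point_in_set; simp)+
    then have "dist (F (closest_point ?D z)) (F (closest_point ?D w)) \<le> L * dist (closest_point ?D z) (closest_point ?D w)"
      using lipschitz_onD[OF L] by blast
    also have "\<dots> \<le> L * dist z w"
      by (intro mult_left_mono closest_point_lipschitz lipschitz_on_nonneg[OF L]) auto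
    finally show "dist (F z) (F w) \<le> L * dist z w" using F_proj by simp
  qed (rule lipschitz_on_nonneg[OF L])
  from lipschitz_on_add[OF lipschitz_on_id this] have "(1 + L)-lipschitz_on UNIV (\<lambda>z. z + F z)" .
  moreover have "(\<lambda>z. z + F z) = plane_field" by (auto simp: F_def plane_field_def fun_eq_iff prod_eq_iff)
  ultimately show ?thesis using that by metis
qed

section \<open>Trajectories in the plane\<close>

definition plane_flow :: "real \<Rightarrow> real \<times> real \<Rightarrow> real \<times> real" where
  "plane_flow = (SOME \<Phi>. (\<forall>x. \<Phi> 0 x = x) \<and> (\<forall>x t. ((\<lambda>t. \<Phi> t x) has_vector_derivative plane_field (\<Phi> t x)) (at t)))"

lemma plane_flow_0: "plane_flow 0 z = z"
  and plane_flow_derivative: "((\<lambda>t. plane_flow t z) has_vector_derivative plane_field (plane_flow t z)) (at t)"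
proof -
  obtain L where "L-lipschitz_on UNIV plane_field" using plane_field_lipschitz .
  then obtain \<Phi> where "\<And>x. \<Phi> 0 x = x" "\<And>x t. ((\<lambda>t. \<Phi> t x) has_vector_derivative plane_field (\<Phi> t x)) (at t)"
    using lipschitz_global_flow by blast
  then have "(\<forall>x. \<Phi> 0 x = x) \<and> (\<forall>x t. ((\<lambda>t. \<Phi> t x) has_vector_derivative plane_field (\<Phi> t x)) (at t))" by blast
  then have *: "(\<forall>x. plane_flow 0 x = x) \<and> (\<forall>x t. ((\<lambda>t. plane_flow t x) has_vector_derivative plane_field (plane_flow t x)) (at t))"
    unfolding plane_flow_def by (rule someI[of "\<lambda>\<Phi>. (\<forall>x. \<Phi> 0 x = x) \<and> (\<forall>x t. ((\<lambda>t. \<Phi> t x) has_vector_derivative plane_field (\<Phi> t x)) (at t))"])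
  then show "plane_flow 0 z = z" "((\<lambda>t. plane_flow t z) has_vector_derivative plane_field (plane_flow t z)) (at t)" by blast+
qed

lemma plane_flow_unique:
  assumes "\<gamma> 0 = z" "\<And>s. s \<in> {0..T} \<Longrightarrow> (\<gamma> has_vector_derivative plane_field (\<gamma> s)) (at s within {0..T})" "t \<in> {0..T}"
  shows "\<gamma> t = plane_flow t z"
proof -
  obtain L where L: "L-lipschitz_on UNIV plane_field" using plane_field_lipschitz .
  show ?thesis
    by (rule integral_curves_unique[OF L, of t T])
      (use assms plane_flow_0 has_vector_derivative_at_within[OF plane_flow_derivative] in auto)
qed

lemma plane_flow_unique_global:
  assumes "\<gamma> 0 = z" "\<And>s. (\<gamma> has_vector_derivative plane_field (\<gamma> s)) (at s)"
  shows "\<gamma> t = plane_flow t z"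
proof -
  obtain L where L: "L-lipschitz_on UNIV plane_field" using plane_field_lipschitz .
  show ?thesis
    by (rule two_sided_unique[OF L, of _ _ _ "\<bar>t\<bar>"])
      (use assms plane_flow_0 in \<open>auto intro: has_vector_derivative_at_within plane_flow_derivative\<close>)
qed

lemma plane_flow_add: "plane_flow (s + t) z = plane_flow s (plane_flow t z)"
proof (rule plane_flow_unique_global[of "\<lambda>s. plane_flow (s + t) z"])
  fix s
  have "((\<lambda>r. plane_flow r z) has_vector_derivative plane_field (plane_flow (1 * s + t) z)) (at (1 * s + t) within range (\<lambda>r. 1 * r + t))"
    by (rule has_vector_derivative_at_within[OF plane_flow_derivative])
  from has_vector_derivative_shift[OF this]
  show "((\<lambda>s. plane_flow (s + t) z) has_vector_derivative plane_field (plane_flow (s + t) z)) (at s)" by simp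
qed simp

lemma fst_plane_flow: "fst (plane_flow t z) = fst z * exp t"
proof -
  define f where "f t = fst (plane_flow t z) * exp (- t)" for t
  have d: "((\<lambda>t. fst (plane_flow t z)) has_real_derivative fst (plane_flow t z)) (at t)" for t
    using bounded_linear.has_vector_derivative[OF bounded_linear_fst plane_flow_derivative[of z t]]
    by (simp add: has_real_derivative_iff_has_vector_derivative plane_field_def)
  have "(f has_real_derivative 0) (at t)" for t
    unfolding f_def by (rule derivative_eq_intros d refl)+ simp
  then have "f t = f 0" using DERIV_isconst_all by blast
  then show ?thesis by (simp add: f_def plane_flow_0 exp_minus field_simps)
qed

lemma snd_plane_flow_derivative:
  "((\<lambda>t. snd (plane_flow t z)) has_real_derivative snd (plane_field (plane_flow t z))) (at t)"
  using bounded_linear.has_vector_derivative[OF bounded_linear_snd plane_flow_derivative[of z t]]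
  by (simp add: has_real_derivative_iff_has_vector_derivative)

text \<open>The second coordinate of the curve stays at most -1, so it never meets the disc where
  the linear source was modified.\<close>

lemma plane_flow_below:
  assumes "y \<le> - 1"
  shows "plane_flow t (x, y) = (x * exp t, (y + 1) * exp t - 1)"
proof -
  have "(\<lambda>t. (x * exp t, (y + 1) * exp t - 1)) t = plane_flow t (x, y)"
  proof (rule plane_flow_unique_global)
    fix s
    have "(y + 1) * exp s \<le> 0" using assms by (simp add: mult_le_0_iff)
    then have "1 \<le> 1 - (y + 1) * exp s" by simp
    then have "1 \<le> (1 - (y + 1) * exp s)\<^sup>2" by (rule one_le_power)
    then have "1/2 \<le> (x * exp s)\<^sup>2 + ((y + 1) * exp s - 1)\<^sup>2"
      using zero_le_power2[of "x * exp s"] power2_commute[of "(y + 1) * exp s" 1] by linarith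
    then have eq: "plane_field (x * exp s, (y + 1) * exp s - 1) = (x * exp s, (y + 1) * exp s)"
      using plane_field_far[of "(x * exp s, (y + 1) * exp s - 1)"] by simp
    have "((\<lambda>t. x * exp t) has_real_derivative x * exp s) (at s)" "((\<lambda>t. (y + 1) * exp t - 1) has_real_derivative (y + 1) * exp s) (at s)"
      by (auto intro!: derivative_eq_intros)
    then show "((\<lambda>t. (x * exp t, (y + 1) * exp t - 1)) has_vector_derivative plane_field (x * exp s, (y + 1) * exp s - 1)) (at s)"
      unfolding eq by (intro has_vector_derivative_Pair) (simp_all add: has_real_derivative_iff_has_vector_derivative)
  qed simp
  then show ?thesis by simp
qed

text \<open>Otherwise the explicit formula, run backwards from the point reached, would place
  \<open>z\<close> itself in the lower half-plane.\<close>

lemma plane_flow_above: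
  assumes "- 1 < snd z"
  shows "- 1 < snd (plane_flow t z)"
proof (rule ccontr)
  assume "\<not> ?thesis"
  then have le: "snd (plane_flow t z) \<le> - 1" by simp
  have "z = plane_flow (- t) (plane_flow t z)" using plane_flow_add[of "- t" t z] plane_flow_0 by simp
  also have "\<dots> = (fst (plane_flow t z) * exp (- t), (snd (plane_flow t z) + 1) * exp (- t) - 1)"
    using plane_flow_below[OF le, of "- t" "fst (plane_flow t z)"] by simp
  finally have "snd z = (snd (plane_flow t z) + 1) * exp (- t) - 1" by (metis snd_conv)
  moreover have "(snd (plane_flow t z) + 1) * exp (- t) \<le> 0" using le by (simp add: mult_le_0_iff)
  ultimately show False using assms by simp
qed

lemma plane_flow_mono:
  assumes "- 1 < snd z" "s \<le> t"
  shows "snd (plane_flow s z) \<le> snd (plane_flow t z)"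
proof (rule DERIV_nonneg_imp_nondecreasing[OF assms(2)])
  fix r
  have "0 \<le> snd (plane_field (plane_flow r z))" using snd_plane_field_nonneg plane_flow_above[OF assms(1)] by (simp add: less_imp_le)
  then show "\<exists>y. ((\<lambda>t. snd (plane_flow t z)) has_real_derivative y) (at r) \<and> 0 \<le> y" using snd_plane_flow_derivative by blast
qed

lemma plane_flow_fixed_iff: "(\<forall>t. plane_flow t z = z) \<longleftrightarrow> z = (0, 0) \<or> z = (0, -1)"
proof
  assume "\<forall>t. plane_flow t z = z"
  then have "(\<lambda>t. plane_flow t z) = (\<lambda>t. z)" by auto
  then have "((\<lambda>t. z) has_vector_derivative plane_field z) (at 0)" using plane_flow_derivative[of z 0] plane_flow_0[of z] by simp
  then have "plane_field z = 0" using vector_derivative_unique_at has_vector_derivative_const by blast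
  then show "z = (0, 0) \<or> z = (0, -1)" by (simp add: plane_field_eq_0_iff)
next
  assume "z = (0, 0) \<or> z = (0, -1)"
  then have "plane_field z = 0" by (simp add: plane_field_eq_0_iff)
  then have "(\<lambda>_. z) t = plane_flow t z" for t by (intro plane_flow_unique_global) auto
  then show "\<forall>t. plane_flow t z = z" by simp
qed

text \<open>On the y-axis reaching level 0 would mean arriving at the singular point
  \<open>(0, 0)\<close> in finite time.\<close>

lemma plane_flow_stays_negative:
  assumes "- 1 < y" "y < 0"
  shows "snd (plane_flow t (0, y)) < 0"
proof (rule ccontr)
  assume "\<not> ?thesis"
  then have ge: "0 \<le> snd (plane_flow t (0, y))" by simp
  have "0 \<le> t"
  proof (rule ccontr)
    assume "\<not> 0 \<le> t"
    then have "snd (plane_flow t (0, y)) \<le> snd (plane_flow 0 (0, y))" using plane_flow_mono[of "(0, y)" t 0] assms by simp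
    then show False using ge assms by (simp add: plane_flow_0)
  qed
  have "continuous_on {0..t} (\<lambda>t. snd (plane_flow t (0, y)))"
    using snd_plane_flow_derivative by (meson DERIV_isCont continuous_at_imp_continuous_on)
  then obtain r where "snd (plane_flow r (0, y)) = 0"
    using IVT'[of "\<lambda>t. snd (plane_flow t (0, y))" 0 0 t] ge \<open>0 \<le> t\<close> assms by (auto simp: plane_flow_0)
  then have "plane_flow r (0, y) = (0, 0)" using fst_plane_flow[of r "(0, y)"] by (simp add: prod_eq_iff)
  then have "(0, y) = plane_flow (- r) (0, 0)" using plane_flow_add[of "- r" r "(0, y)"] plane_flow_0 by simp
  also have "\<dots> = (0, 0)" using plane_flow_fixed_iff by blast
  finally show False using assms by simp
qed

lemma mono_bounded_tendsto_at_top: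
  fixes f :: "real \<Rightarrow> real"
  assumes mono: "\<And>s t. s \<le> t \<Longrightarrow> f s \<le> f t" and b: "\<And>t. f t \<le> B"
  obtains l where "(f \<longlongrightarrow> l) at_top" "\<And>t. f t \<le> l" "l \<le> B"
proof -
  have bdd: "bdd_above (range f)" by (rule bdd_aboveI[of _ B]) (use b in auto)
  define l where "l = Sup (range f)"
  have le: "f t \<le> l" for t unfolding l_def by (rule cSup_upper[OF rangeI bdd])
  have "(f \<longlongrightarrow> l) at_top"
  proof (rule increasing_tendsto)
    fix x assume "x < l"
    then obtain s where s: "x < f s" unfolding l_def using less_cSupD[of "range f" x] by auto
    have "x < f t" if "s \<le> t" for t using mono[OF that] s by linarith
    then show "\<forall>\<^sub>F t in at_top. x < f t" by (auto simp: eventually_at_top_linorder)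
  qed (simp add: le)
  moreover have "l \<le> B" unfolding l_def using b by (intro cSup_least) auto
  ultimately show ?thesis using that le by blast
qed

text \<open>Increments over unit intervals tend to 0; by the mean value theorem they are values of
  the derivative at times tending to infinity.\<close>

lemma derivative_limit_eq_0:
  fixes f :: "real \<Rightarrow> real"
  assumes d: "\<And>t. (f has_real_derivative f' t) (at t)" and f: "(f \<longlongrightarrow> l) at_top" and f': "(f' \<longlongrightarrow> w) at_top"
  shows "w = 0"
proof -
  have "\<exists>\<xi>. real n < \<xi> \<and> \<xi> < real n + 1 \<and> f (real n + 1) - f (real n) = f' \<xi>" for n :: nat
    using MVT2[of "real n" "real n + 1" f f'] d by auto
  then obtain \<xi> where \<xi>: "\<And>n. real n < \<xi> n" "\<And>n. f (real n + 1) - f (real n) = f' (\<xi> n)" by metis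
  have "filterlim \<xi> at_top sequentially"
    by (rule filterlim_at_top_mono[OF filterlim_real_sequentially always_eventually]) (use \<xi>(1) less_imp_le in blast)
  from filterlim_compose[OF f' this] have 1: "(\<lambda>n. f (real n + 1) - f (real n)) \<longlonglongrightarrow> w" unfolding \<xi>(2) .
  have "filterlim (\<lambda>n. real n + 1) at_top sequentially"
    by (rule filterlim_at_top_mono[OF filterlim_real_sequentially]) auto
  from tendsto_diff[OF filterlim_compose[OF f this] filterlim_compose[OF f filterlim_real_sequentially]]
  have "(\<lambda>n. f (real n + 1) - f (real n)) \<longlonglongrightarrow> 0" by simp
  then show ?thesis using LIMSEQ_unique 1 by blast
qed

lemma plane_field_tendsto: "(z \<longlongrightarrow> q) F \<Longrightarrow> ((\<lambda>t. plane_field (z t)) \<longlongrightarrow> plane_field q) F"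
proof -
  obtain L where "L-lipschitz_on UNIV plane_field" using plane_field_lipschitz .
  then have "continuous_on UNIV plane_field" by (rule lipschitz_on_continuous_on)
  then show "(z \<longlongrightarrow> q) F \<Longrightarrow> ((\<lambda>t. plane_field (z t)) \<longlongrightarrow> plane_field q) F"
    using continuous_on_tendsto_compose by fastforce
qed

text \<open>Off the y-axis the first coordinate grows exponentially. On the axis above -1 the second
  coordinate is monotone: it is unbounded, or it converges to a zero of the field, which can only be
  the origin approached from below.\<close>

lemma plane_flow_forward_limit:
  assumes "z \<noteq> (0, 0)" "z \<noteq> (0, -1)"
  shows "filterlim (\<lambda>t. norm (plane_flow t z)) at_top at_top \<or>
    fst z = 0 \<and> - 1 < snd z \<and> snd z < 0 \<and> ((\<lambda>t. plane_flow t z) \<longlongrightarrow> (0, 0)) at_top"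
proof -
  have exp_lim: "filterlim (\<lambda>t. c * exp t) at_top at_top" if "0 < c" for c :: real
    by (rule filterlim_tendsto_pos_mult_at_top[OF tendsto_const that exp_at_top])
  obtain x y where z: "z = (x, y)" by (cases z)
  consider "x \<noteq> 0" | "x = 0" "y < - 1" | "x = 0" "- 1 < y" using assms z by fastforce
  then show ?thesis
  proof cases
    case 1
    have "\<bar>x\<bar> * exp t \<le> norm (plane_flow t z)" for t
      using norm_fst_le[of "fst (plane_flow t z)" "snd (plane_flow t z)"] fst_plane_flow[of t z] z by (simp add: abs_mult)
    then show ?thesis using filterlim_at_top_mono[OF exp_lim[of "\<bar>x\<bar>"]] 1 by auto
  next
    case 2
    have "(- 1 - y) * exp t \<le> norm (plane_flow t z)" for t
      using norm_snd_le[of "snd (plane_flow t z)" "fst (plane_flow t z)"] plane_flow_below[of y t x] z 2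
      by (auto simp: algebra_simps)
    then show ?thesis using filterlim_at_top_mono[OF exp_lim[of "- 1 - y"]] 2 by auto
  next
    case 3
    let ?f = "\<lambda>t. snd (plane_flow t z)"
    have mono: "?f s \<le> ?f t" if "s \<le> t" for s t using plane_flow_mono[of z s t] that z 3 by simp
    show ?thesis
    proof (cases "\<exists>B. \<forall>t. ?f t \<le> B")
      case True
      then obtain l where l: "(?f \<longlongrightarrow> l) at_top" "\<And>t. ?f t \<le> l"
        using mono_bounded_tendsto_at_top[of ?f] mono by metis
      have "fst (plane_flow t z) = 0" for t using fst_plane_flow[of t z] z 3 by simp
      then have eq: "plane_flow t z = (0, ?f t)" for t by (simp add: prod_eq_iff)
      have lim: "((\<lambda>t. plane_flow t z) \<longlongrightarrow> (0, l)) at_top" by (subst eq) (intro tendsto_intros l(1))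
      have "snd (plane_field (0, l)) = 0"
        by (rule derivative_limit_eq_0[OF snd_plane_flow_derivative l(1)]) (intro tendsto_snd plane_field_tendsto lim)
      then have "plane_field (0, l) = 0" by (simp add: plane_field_def zero_prod_def)
      then have "l = 0 \<or> l = - 1" by (auto simp: plane_field_eq_0_iff)
      moreover have "y \<le> l" using l(2)[of 0] z by (simp add: plane_flow_0)
      ultimately have "l = 0" "y \<le> 0" using 3 by auto
      moreover have "y \<noteq> 0" using assms z 3 by auto
      ultimately show ?thesis using lim z 3 by auto
    next
      case False
      have "filterlim ?f at_top at_top"
        unfolding filterlim_at_top
      proof
        fix B
        obtain s where "B < ?f s" using False by (meson not_le)
        then have "B \<le> ?f t" if "s \<le> t" for t using mono[OF that] by linarith
        then show "\<forall>\<^sub>F t in at_top. B \<le> ?f t" by (auto simp: eventually_at_top_linorder)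
      qed
      moreover have "?f t \<le> norm (plane_flow t z)" for t
        using norm_snd_le[of "snd (plane_flow t z)" "fst (plane_flow t z)"] by auto
      ultimately show ?thesis using filterlim_at_top_mono[of ?f at_top "\<lambda>t. norm (plane_flow t z)"] by auto
    qed
  qed
qed

text \<open>Backwards the first coordinate tends to 0. The second is given by a formula below -1 and
  is otherwise monotone and bounded by -1, so its limit is that of a singular point.\<close>

lemma plane_flow_backward_limit:
  obtains l where "l = 0 \<and> 0 \<le> snd z \<or> l = - 1" "((\<lambda>t. plane_flow (- t) z) \<longlongrightarrow> (0, l)) at_top"
proof -
  have e: "((\<lambda>t. exp (- t)) \<longlongrightarrow> (0::real)) at_top"
    by (rule filterlim_compose[OF exp_at_bot filterlim_uminus_at_bot_at_top])
  have x: "((\<lambda>t. fst (plane_flow (- t) z)) \<longlongrightarrow> 0) at_top"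
    unfolding fst_plane_flow using tendsto_mult_right_zero[OF e] by simp
  have pair: "((\<lambda>t. plane_flow (- t) z) \<longlongrightarrow> (0, l)) at_top" if "((\<lambda>t. snd (plane_flow (- t) z)) \<longlongrightarrow> l) at_top" for l
    using tendsto_Pair[OF x that] by simp
  show ?thesis
  proof (cases "snd z \<le> - 1")
    case True
    have "((\<lambda>t. (snd z + 1) * exp (- t) - 1) \<longlongrightarrow> 0 - 1) at_top"
      by (intro tendsto_intros tendsto_mult_right_zero e)
    moreover have "snd (plane_flow (- t) z) = (snd z + 1) * exp (- t) - 1" for t
      using plane_flow_below[OF True, of "- t" "fst z"] by simp
    ultimately show ?thesis using pair[of "- 1"] that[of "- 1"] by simp
  next
    case False
    let ?f = "\<lambda>t. - snd (plane_flow (- t) z)"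
    have "?f s \<le> ?f t" if "s \<le> t" for s t using plane_flow_mono[of z "- t" "- s"] that False by simp
    moreover have "?f t \<le> 1" for t using plane_flow_above[of z "- t"] False by simp
    ultimately obtain l where l: "(?f \<longlongrightarrow> l) at_top" "\<And>t. ?f t \<le> l"
      using mono_bounded_tendsto_at_top[of ?f 1] by metis
    have lim: "((\<lambda>t. plane_flow (- t) z) \<longlongrightarrow> (0, - l)) at_top"
      by (rule pair) (use tendsto_minus[OF l(1)] in simp)
    have d: "(?f has_real_derivative snd (plane_field (plane_flow (- t) z))) (at t)" for t
      using DERIV_minus[OF DERIV_mirror[THEN iffD1, OF snd_plane_flow_derivative[of z "- t"]]] by simp
    have "snd (plane_field (0, - l)) = 0"
      by (rule derivative_limit_eq_0[OF d l(1)]) (intro tendsto_snd plane_field_tendsto lim)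
    then have "plane_field (0, - l) = 0" by (simp add: plane_field_def zero_prod_def)
    then have "- l = 0 \<or> - l = - 1" by (auto simp: plane_field_eq_0_iff)
    moreover have "- l \<le> snd z" using l(2)[of 0] by (simp add: plane_flow_0)
    ultimately show ?thesis using that[of "- l"] lim by force
  qed
qed

section \<open>The flow on the sphere\<close>

lemma vec3_eq_iff: "X = Y \<longleftrightarrow> X $ 1 = Y $ 1 \<and> X $ 2 = Y $ 2 \<and> X $ 3 = (Y :: 'a ^ 3) $ 3"
  by (simp add: vec_eq_iff forall_3)

lemma S2_iff: "X \<in> S2 \<longleftrightarrow> (X $ 1)\<^sup>2 + (X $ 2)\<^sup>2 + (X $ 3)\<^sup>2 = 1"
  by (simp add: norm_eq_1 inner_vec_def sum_3 power2_eq_square)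

lemma axis3_nth [simp]:
  "axis 1 a $ (2::3) = (0::real)" "axis 1 a $ (3::3) = (0::real)" "axis 2 a $ (1::3) = (0::real)"
  "axis 2 a $ (3::3) = (0::real)" "axis 3 a $ (1::3) = (0::real)" "axis 3 a $ (2::3) = (0::real)"
  "axis i a $ i = (a::real)"
  by (auto simp: axis_def)

section \<open>Stereographic projection from the sink\<close>

definition inv_denominator :: "real \<times> real \<Rightarrow> real" where
  "inv_denominator z = 1 / (1 + ((fst z)\<^sup>2 + (snd z)\<^sup>2))"

definition stereo :: "real ^ 3 \<Rightarrow> real \<times> real" where
  "stereo X = (X $ 1 / (1 - X $ 3), X $ 2 / (1 - X $ 3))"

definition unstereo :: "real \<times> real \<Rightarrow> real ^ 3" where
  "unstereo z = (2 * fst z * inv_denominator z) *\<^sub>R axis 1 1 + (2 * snd z * inv_denominator z) *\<^sub>R axis 2 1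
     + (1 - 2 * inv_denominator z) *\<^sub>R axis 3 1"

abbreviation north :: "real ^ 3" where "north \<equiv> axis 3 1"

lemma unstereo_nth [simp]: "unstereo z $ 1 = 2 * fst z * inv_denominator z"
  "unstereo z $ 2 = 2 * snd z * inv_denominator z" "unstereo z $ 3 = 1 - 2 * inv_denominator z"
  by (simp_all add: unstereo_def)

lemma inv_denominator: "0 < inv_denominator z" "(1 + ((fst z)\<^sup>2 + (snd z)\<^sup>2)) * inv_denominator z = 1"
  "((fst z)\<^sup>2 + (snd z)\<^sup>2) * (inv_denominator z)\<^sup>2 = inv_denominator z - (inv_denominator z)\<^sup>2"
proof -
  have p: "0 < 1 + ((fst z)\<^sup>2 + (snd z)\<^sup>2)" using zero_le_power2[of "fst z"] zero_le_power2[of "snd z"] by linarith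
  then show "0 < inv_denominator z" and 1: "(1 + ((fst z)\<^sup>2 + (snd z)\<^sup>2)) * inv_denominator z = 1"
    by (simp_all add: inv_denominator_def)
  have "((fst z)\<^sup>2 + (snd z)\<^sup>2) * (inv_denominator z)\<^sup>2 = ((1 + ((fst z)\<^sup>2 + (snd z)\<^sup>2)) * inv_denominator z - inv_denominator z) * inv_denominator z"
    by (simp add: power2_eq_square algebra_simps)
  also have "\<dots> = inv_denominator z - (inv_denominator z)\<^sup>2" unfolding 1 by (simp add: power2_eq_square algebra_simps)
  finally show "((fst z)\<^sup>2 + (snd z)\<^sup>2) * (inv_denominator z)\<^sup>2 = inv_denominator z - (inv_denominator z)\<^sup>2" .
qed

lemma unstereo_in: "unstereo z \<in> S2" "unstereo z \<noteq> north" "unstereo z $ 3 < 1"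
proof -
  let ?s = "inv_denominator z"
  have "(unstereo z $ 1)\<^sup>2 + (unstereo z $ 2)\<^sup>2 + (unstereo z $ 3)\<^sup>2 = 4 * (((fst z)\<^sup>2 + (snd z)\<^sup>2) * ?s\<^sup>2) + (1 - 2 * ?s)\<^sup>2"
    by (simp add: power2_eq_square algebra_simps)
  also have "\<dots> = 1" unfolding inv_denominator(3) by (simp add: power2_eq_square algebra_simps)
  finally show "unstereo z \<in> S2" unfolding S2_iff .
  show "unstereo z $ 3 < 1" using inv_denominator(1)[of z] by simp
  then show "unstereo z \<noteq> north" by (auto simp: vec3_eq_iff)
qed

lemma stereo_unstereo [simp]: "stereo (unstereo z) = z"
  using inv_denominator(1)[of z] by (simp add: stereo_def prod_eq_iff)

lemma S2_third_less: "X \<in> S2 \<Longrightarrow> X \<noteq> north \<Longrightarrow> X $ 3 < 1"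
proof -
  assume X: "X \<in> S2" "X \<noteq> north"
  have sq: "(X $ 1)\<^sup>2 + (X $ 2)\<^sup>2 + (X $ 3)\<^sup>2 = 1" using X(1) by (simp only: S2_iff)
  then have "(X $ 3)\<^sup>2 \<le> 1\<^sup>2" using zero_le_power2[of "X $ 1"] zero_le_power2[of "X $ 2"] unfolding one_power2 by linarith
  then have "X $ 3 \<le> 1" by (rule power2_le_imp_le) simp
  moreover have "X $ 3 \<noteq> 1"
  proof
    assume 1: "X $ 3 = 1"
    then have "(X $ 1)\<^sup>2 + (X $ 2)\<^sup>2 = 0" using sq by simp
    then have "X $ 1 = 0" "X $ 2 = 0" by (simp_all add: sum_power2_eq_zero_iff)
    then show False using X(2) 1 by (simp add: vec3_eq_iff)
  qed
  ultimately show "X $ 3 < 1" by simp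
qed

lemma unstereo_stereo:
  assumes "X \<in> S2" "X \<noteq> north" shows "unstereo (stereo X) = X"
proof -
  have lt: "X $ 3 < 1" using S2_third_less[OF assms] .
  have sq: "(X $ 1)\<^sup>2 + (X $ 2)\<^sup>2 = (1 - X $ 3) * (1 + X $ 3)"
    using assms(1) unfolding S2_iff by (simp add: power2_eq_square algebra_simps)
  have "(fst (stereo X))\<^sup>2 + (snd (stereo X))\<^sup>2 = ((X $ 1)\<^sup>2 + (X $ 2)\<^sup>2) / (1 - X $ 3)\<^sup>2"
    by (simp add: stereo_def power_divide add_divide_distrib)
  also have "\<dots> = (1 + X $ 3) / (1 - X $ 3)" unfolding sq using lt by (simp add: power2_eq_square)
  finally have "1 + ((fst (stereo X))\<^sup>2 + (snd (stereo X))\<^sup>2) = 1 + (1 + X $ 3) / (1 - X $ 3)" by simp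
  also have "\<dots> = 2 / (1 - X $ 3)" using lt by (simp add: field_simps)
  finally have i: "inv_denominator (stereo X) = (1 - X $ 3) / 2" unfolding inv_denominator_def by simp
  show ?thesis unfolding vec3_eq_iff unstereo_nth i using lt by (simp add: stereo_def field_simps)
qed

definition shear_direction :: "real ^ 3 \<Rightarrow> real ^ 3" where
  "shear_direction X = (- (X $ 1 * X $ 2)) *\<^sub>R axis 1 1 + (1 - X $ 3 - (X $ 2)\<^sup>2) *\<^sub>R axis 2 1 + (X $ 2 * (1 - X $ 3)) *\<^sub>R axis 3 1"

text \<open>On the sphere the first argument is the squared norm of \<open>stereo X\<close>. The
  formula is used where the division is safe in the ambient space; for \<open>X $ 3 > - 1/4\<close>
  the cutoff has already vanished and the value is 1. These two open regions overlap and cover the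
  whole space, which gives smoothness everywhere.\<close>

definition sphere_shear :: "real ^ 3 \<Rightarrow> real" where
  "sphere_shear X = (if X $ 3 < 1/2 then shear ((1 + X $ 3) / (1 - X $ 3)) (X $ 2 / (1 - X $ 3)) else 1)"

text \<open>The image of \<^term>\<open>plane_field\<close>: the dilation field becomes the gradient of the height and
  the constant field $(0, 1)$ becomes \<^term>\<open>shear_direction\<close>.\<close>

definition sphere_field :: "real ^ 3 \<Rightarrow> real ^ 3" where
  "sphere_field X = (north - X $ 3 *\<^sub>R X) + sphere_shear X *\<^sub>R shear_direction X"

definition sphere_flow :: "real \<Rightarrow> real ^ 3 \<Rightarrow> real ^ 3" where
  "sphere_flow t X = (if X = north then north else unstereo (plane_flow t (stereo X)))"

lemma sphere_shear_eq_1: "- 1/4 < X $ 3 \<Longrightarrow> sphere_shear X = 1"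
proof -
  assume X: "- 1/4 < X $ 3"
  have "1/2 \<le> (1 + X $ 3) / (1 - X $ 3)" if "X $ 3 < 1/2" using X that by (simp add: field_simps)
  then show ?thesis by (simp add: sphere_shear_def shear_def cutoff_eq_0)
qed

lemma sphere_shear_unstereo: "sphere_shear (unstereo z) = shear ((fst z)\<^sup>2 + (snd z)\<^sup>2) (snd z)"
proof -
  let ?s = "inv_denominator z"
  have s: "0 < ?s" by (rule inv_denominator)
  have \<rho>: "(fst z)\<^sup>2 + (snd z)\<^sup>2 = (1 - ?s) / ?s" using inv_denominator(2)[of z] s by (simp add: field_simps)
  show ?thesis
  proof (cases "unstereo z $ 3 < 1/2")
    case True
    have "(1 + unstereo z $ 3) / (1 - unstereo z $ 3) = (fst z)\<^sup>2 + (snd z)\<^sup>2" unfolding \<rho> using s by (simp add: field_simps)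
    moreover have "unstereo z $ 2 / (1 - unstereo z $ 3) = snd z" using s by simp
    ultimately show ?thesis using True by (simp only: sphere_shear_def if_True)
  next
    case False
    then have "?s \<le> 1/4" by simp
    then have "1/2 \<le> (1 - ?s) / ?s" using s by (simp add: field_simps)
    then have "1/2 \<le> (fst z)\<^sup>2 + (snd z)\<^sup>2" by (simp only: \<rho>)
    then show ?thesis using False by (simp add: sphere_shear_def shear_def cutoff_eq_0)
  qed
qed

lemma has_vector_derivative_vec3:
  fixes f :: "real \<Rightarrow> real ^ 3"
  assumes "((\<lambda>t. f t $ 1) has_real_derivative D $ 1) F" "((\<lambda>t. f t $ 2) has_real_derivative D $ 2) F"
    "((\<lambda>t. f t $ 3) has_real_derivative D $ 3) F"
  shows "(f has_vector_derivative D) F"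
proof -
  have expand: "X = X $ 1 *\<^sub>R axis 1 1 + X $ 2 *\<^sub>R axis 2 1 + X $ 3 *\<^sub>R axis 3 1" for X :: "real ^ 3"
    by (simp add: vec3_eq_iff)
  have "((\<lambda>t. f t $ 1 *\<^sub>R axis 1 1 + f t $ 2 *\<^sub>R axis 2 1 + f t $ 3 *\<^sub>R axis 3 1 :: real ^ 3) has_vector_derivative
    (D $ 1 *\<^sub>R axis 1 1 + D $ 2 *\<^sub>R axis 2 1 + D $ 3 *\<^sub>R axis 3 1)) F"
    using assms unfolding has_field_derivative_def has_vector_derivative_def
    by (auto intro!: derivative_eq_intros simp: algebra_simps)
  then show ?thesis using expand[symmetric] by simp
qed

text \<open>With \<open>s\<close> for the inverse denominator, the identity expressing the squared
  norm times \<open>s\<^sup>2\<close> as \<open>s - s\<^sup>2\<close> makes the derivative of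
  \<open>s\<close> polynomial, and the components agree by algebra.\<close>

lemma unstereo_curve_derivative:
  assumes "(z has_vector_derivative plane_field (z t)) (at t)"
  shows "((\<lambda>t. unstereo (z t)) has_vector_derivative sphere_field (unstereo (z t))) (at t)"
proof -
  let ?x = "\<lambda>t. fst (z t)" and ?y = "\<lambda>t. snd (z t)" and ?s = "\<lambda>t. inv_denominator (z t)"
  define b where "b = shear ((?x t)\<^sup>2 + (?y t)\<^sup>2) (?y t)"
  have x: "(?x has_real_derivative ?x t) (at t)"
    using bounded_linear.has_vector_derivative[OF bounded_linear_fst assms]
    by (simp add: has_real_derivative_iff_has_vector_derivative plane_field_def)
  have y: "(?y has_real_derivative ?y t + b) (at t)"
    using bounded_linear.has_vector_derivative[OF bounded_linear_snd assms]
    by (simp add: has_real_derivative_iff_has_vector_derivative plane_field_def b_def)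
  have ne: "1 + ((?x t)\<^sup>2 + (?y t)\<^sup>2) \<noteq> 0" using inv_denominator(2)[of "z t"] by auto
  have "((\<lambda>t. 1 / (1 + ((?x t)\<^sup>2 + (?y t)\<^sup>2))) has_real_derivative
    - (2 * ?x t * ?x t + 2 * ?y t * (?y t + b)) / (1 + ((?x t)\<^sup>2 + (?y t)\<^sup>2))\<^sup>2) (at t)"
    by (rule derivative_eq_intros x y refl ne)+ (simp add: power2_eq_square algebra_simps)
  then have s': "(?s has_real_derivative - (2 * ?x t * ?x t + 2 * ?y t * (?y t + b)) * (?s t)\<^sup>2) (at t)"
    by (simp add: inv_denominator_def[abs_def] power_divide)
  have "- (2 * ?x t * ?x t + 2 * ?y t * (?y t + b)) * (?s t)\<^sup>2 = - 2 * (((?x t)\<^sup>2 + (?y t)\<^sup>2) * (?s t)\<^sup>2) - 2 * ?y t * b * (?s t)\<^sup>2"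
    by (simp add: power2_eq_square algebra_simps)
  also have "\<dots> = - 2 * ?s t + 2 * (?s t)\<^sup>2 - 2 * ?y t * b * (?s t)\<^sup>2" unfolding inv_denominator(3) by simp
  finally have s: "(?s has_real_derivative - 2 * ?s t + 2 * (?s t)\<^sup>2 - 2 * ?y t * b * (?s t)\<^sup>2) (at t)" using s' by simp
  have G: "sphere_field (unstereo (z t)) = (north - unstereo (z t) $ 3 *\<^sub>R unstereo (z t)) + b *\<^sub>R shear_direction (unstereo (z t))"
    by (simp add: sphere_field_def sphere_shear_unstereo b_def)
  show ?thesis
    unfolding G
  proof (rule has_vector_derivative_vec3)
    show "((\<lambda>t. unstereo (z t) $ 1) has_real_derivative (north - unstereo (z t) $ 3 *\<^sub>R unstereo (z t) + b *\<^sub>R shear_direction (unstereo (z t))) $ 1) (at t)"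
      unfolding unstereo_nth
      by (rule derivative_eq_intros x s refl)+ (simp add: shear_direction_def power2_eq_square algebra_simps)
    show "((\<lambda>t. unstereo (z t) $ 2) has_real_derivative (north - unstereo (z t) $ 3 *\<^sub>R unstereo (z t) + b *\<^sub>R shear_direction (unstereo (z t))) $ 2) (at t)"
      unfolding unstereo_nth
      by (rule derivative_eq_intros y s refl)+ (simp add: shear_direction_def power2_eq_square algebra_simps)
    show "((\<lambda>t. unstereo (z t) $ 3) has_real_derivative (north - unstereo (z t) $ 3 *\<^sub>R unstereo (z t) + b *\<^sub>R shear_direction (unstereo (z t))) $ 3) (at t)"
      unfolding unstereo_nth
      by (rule derivative_eq_intros s refl)+ (simp add: shear_direction_def power2_eq_square algebra_simps)
  qed
qed

lemma sphere_field_north: "sphere_field north = 0"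
  by (simp add: sphere_field_def shear_direction_def vec3_eq_iff)

lemma sphere_flow_in: "X \<in> S2 \<Longrightarrow> sphere_flow t X \<in> S2"
  using unstereo_in by (auto simp: sphere_flow_def)

lemma sphere_flow_0: "X \<in> S2 \<Longrightarrow> sphere_flow 0 X = X"
  by (simp add: sphere_flow_def plane_flow_0 unstereo_stereo)

lemma sphere_flow_derivative: "((\<lambda>t. sphere_flow t X) has_vector_derivative sphere_field (sphere_flow t X)) (at t)"
proof (cases "X = north")
  case True
  then show ?thesis using sphere_field_north by (simp add: sphere_flow_def)
next
  case False
  then show ?thesis using unstereo_curve_derivative[OF plane_flow_derivative] by (simp add: sphere_flow_def)
qed

lemma velocity_sphere_flow: "X \<in> S2 \<Longrightarrow> velocity sphere_flow X = sphere_field X"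
  unfolding velocity_def using vector_derivative_at[OF sphere_flow_derivative[of X 0]] sphere_flow_0 by simp

lemma Ck_on_sphere_field: "Ck_on k UNIV sphere_field"
proof -
  have nth: "Ck_on k U (\<lambda>X::real^3. X $ i)" if "open U" for U i
    by (rule Ck_on_bounded_linear[OF bounded_linear_vec_nth that])
  have id: "Ck_on k UNIV (\<lambda>X::real^3. X)" by (rule Ck_on_bounded_linear[OF bounded_linear_ident open_UNIV])
  have cont: "continuous_on UNIV (\<lambda>X::real^3. X $ 3)" by (intro continuous_intros)
  have op: "open {X::real^3. X $ 3 < 1/2}" "open {X::real^3. - 1/4 < X $ 3}"
    by (intro open_Collect_less cont continuous_on_const)+
  have "Ck_on k {X. X $ 3 < 1/2} (\<lambda>X::real^3. shear ((1 + X $ 3) / (1 - X $ 3)) (X $ 2 / (1 - X $ 3)))"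
    by (intro Ck_on_shear Ck_on_divide Ck_on_add Ck_on_diff Ck_on_const nth op) auto
  then have 1: "Ck_on k {X. X $ 3 < 1/2} sphere_shear"
    by (rule Ck_on_cong[OF op(1), rotated]) (simp add: sphere_shear_def)
  have 2: "Ck_on k {X. - 1/4 < X $ 3} sphere_shear"
    by (rule Ck_on_cong[OF op(2) _ Ck_on_const[of _ _ 1]]) (simp add: sphere_shear_eq_1)
  have "{X::real^3. X $ 3 < 1/2} \<union> {X. - 1/4 < X $ 3} = UNIV" by auto
  then have "Ck_on k UNIV sphere_shear" using Ck_on_Un[OF op 1 2] by simp
  then show ?thesis
    unfolding sphere_field_def[abs_def] shear_direction_def
    by (intro Ck_on_add Ck_on_diff Ck_on_scaleR Ck_on_mult Ck_on_power2 Ck_on_uminus Ck_on_const nth id open_UNIV)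
qed

lemma smooth_flow_sphere_flow: "smooth_flow S2 sphere_flow"
proof -
  have "smooth_along S2 (velocity sphere_flow)"
    unfolding smooth_along_def
    by (rule exI[of _ UNIV], rule exI[of _ sphere_field]) (auto simp: Ck_on_sphere_field velocity_sphere_flow)
  moreover have "((\<lambda>t. sphere_flow t X) has_vector_derivative velocity sphere_flow (sphere_flow t X)) (at t)" if "X \<in> S2" for X t
    using sphere_flow_derivative velocity_sphere_flow[OF sphere_flow_in[OF that]] by simp
  ultimately show ?thesis unfolding smooth_flow_def using sphere_flow_0 sphere_flow_in by blast
qed

text \<open>The saddle-node; \<open>east\<close>, below, is the source, and \<open>north\<close> is
  the sink.\<close>

definition south :: "real ^ 3" where "south = unstereo (0, 0)"
definition east :: "real ^ 3" where "east = unstereo (0, -1)"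

lemma south_nth [simp]: "south $ 1 = 0" "south $ 2 = 0" "south $ 3 = - 1"
  by (simp_all add: south_def inv_denominator_def)

lemma east_nth [simp]: "east $ 1 = 0" "east $ 2 = - 1" "east $ 3 = 0"
  by (simp_all add: east_def inv_denominator_def)

lemma poles_in: "north \<in> S2" "south \<in> S2" "east \<in> S2"
  unfolding S2_iff by simp_all

lemma poles_distinct: "north \<noteq> south" "north \<noteq> east" "south \<noteq> east"
  by (auto simp: vec3_eq_iff)

interpretation F: compact_flow S2 sphere_flow
  by (rule smooth_flow_compact_flow[OF compact_sphere smooth_flow_sphere_flow])

lemma singular_points_sphere_flow: "singular_points S2 sphere_flow = {north, south, east}"
proof (intro subset_antisym subsetI)
  fix X assume X: "X \<in> singular_points S2 sphere_flow"
  show "X \<in> {north, south, east}"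
  proof (cases "X = north")
    case False
    have XS: "X \<in> S2" using X by (simp add: singular_points_def)
    have "sphere_flow t X = X" for t by (rule singular_point_fixed[OF compact_sphere smooth_flow_sphere_flow X])
    then have "unstereo (plane_flow t (stereo X)) = X" for t using False by (simp add: sphere_flow_def)
    then have "plane_flow t (stereo X) = stereo X" for t using stereo_unstereo by metis
    then have "stereo X = (0, 0) \<or> stereo X = (0, -1)" using plane_flow_fixed_iff by blast
    then show ?thesis using unstereo_stereo[OF XS False] by (auto simp: south_def east_def)
  qed simp
next
  fix X assume "X \<in> {north, south, east}"
  moreover have "sphere_flow t north = north" for t by (simp add: sphere_flow_def)
  moreover have "sphere_flow t south = south" "sphere_flow t east = east" for t
  proof -
    have "plane_flow t (0, 0) = (0, 0)" "plane_flow t (0, -1) = (0, -1)"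
      using plane_flow_fixed_iff[of "(0, 0)"] plane_flow_fixed_iff[of "(0, -1)"] by blast+
    then show "sphere_flow t south = south" "sphere_flow t east = east"
      using unstereo_in(2) by (simp_all add: sphere_flow_def south_def east_def)
  qed
  ultimately show "X \<in> singular_points S2 sphere_flow" using fixed_point_singular poles_in by blast
qed

lemma unstereo_tendsto:
  assumes "(z \<longlongrightarrow> q) F" shows "((\<lambda>t. unstereo (z t)) \<longlongrightarrow> unstereo q) F"
proof -
  have "1 + ((fst w)\<^sup>2 + (snd w)\<^sup>2) \<noteq> 0" for w :: "real \<times> real" using inv_denominator(2)[of w] by auto
  then have "continuous_on UNIV unstereo" unfolding unstereo_def[abs_def] inv_denominator_def by (intro continuous_intros) auto
  then show ?thesis using continuous_on_tendsto_compose assms by fastforce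
qed

text \<open>The function \<open>1 - X $ 3\<close> vanishes on the sphere only at
  \<open>north\<close>, and at the image of \<open>w\<close> it equals 2 divided by
  \<open>1 + (norm w)\<^sup>2\<close>.\<close>

lemma unstereo_tendsto_north:
  assumes "filterlim (\<lambda>t. norm (z t)) at_top F"
  shows "((\<lambda>t. unstereo (z t)) \<longlongrightarrow> north) F"
proof (rule compact_tendsto_unique_zero[of S2 "\<lambda>X. 1 - X $ 3"])
  have eq: "1 - unstereo w $ 3 = 2 / (1 + (norm w)\<^sup>2)" for w
    by (simp add: inv_denominator_def norm_prod_def)
  have "filterlim (\<lambda>t. 1 + (norm (z t))\<^sup>2) at_top F"
    by (intro filterlim_tendsto_add_at_top[OF tendsto_const] filterlim_pow_at_top assms) simp
  then show "((\<lambda>t. 1 - unstereo (z t) $ 3) \<longlongrightarrow> 0) F"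
    unfolding eq by (intro tendsto_divide_0[OF tendsto_const] filterlim_at_top_imp_at_infinity)
  show "X = north" if "X \<in> S2" "1 - X $ 3 = 0" for X using S2_third_less that by fastforce
  show "\<forall>\<^sub>F t in F. unstereo (z t) \<in> S2" by (rule always_eventually) (use unstereo_in(1) in blast)
qed (auto intro!: continuous_intros)

text \<open>The only trajectory that does not end at the sink is the one from the source to the saddle-node.\<close>

lemma sphere_flow_forward_limit:
  assumes "X \<in> S2 - {north, south, east}"
  shows "((\<lambda>t. sphere_flow t X) \<longlongrightarrow> north) at_top \<or>
    fst (stereo X) = 0 \<and> - 1 < snd (stereo X) \<and> snd (stereo X) < 0 \<and> ((\<lambda>t. sphere_flow t X) \<longlongrightarrow> south) at_top"
proof -
  have X: "X \<in> S2" "X \<noteq> north" using assms by auto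
  have eq: "(\<lambda>t. sphere_flow t X) = (\<lambda>t. unstereo (plane_flow t (stereo X)))" using X by (simp add: sphere_flow_def)
  have "stereo X \<noteq> (0, 0)" "stereo X \<noteq> (0, -1)" using unstereo_stereo[OF X] assms by (auto simp: south_def east_def)
  from plane_flow_forward_limit[OF this] show ?thesis
    unfolding eq south_def using unstereo_tendsto[of "\<lambda>t. plane_flow t (stereo X)" "(0, 0)" at_top]
      unstereo_tendsto_north[of "\<lambda>t. plane_flow t (stereo X)" at_top] by blast
qed

lemma sphere_flow_backward_limit:
  assumes "X \<in> S2 - {north}"
  shows "((\<lambda>t. reverse_flow sphere_flow t X) \<longlongrightarrow> east) at_top \<or>
    0 \<le> snd (stereo X) \<and> ((\<lambda>t. reverse_flow sphere_flow t X) \<longlongrightarrow> south) at_top"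
proof -
  have eq: "(\<lambda>t. reverse_flow sphere_flow t X) = (\<lambda>t. unstereo (plane_flow (- t) (stereo X)))"
    using assms by (simp add: sphere_flow_def reverse_flow_def)
  obtain l where l: "l = 0 \<and> 0 \<le> snd (stereo X) \<or> l = - 1" "((\<lambda>t. plane_flow (- t) (stereo X)) \<longlongrightarrow> (0, l)) at_top"
    using plane_flow_backward_limit by blast
  show ?thesis unfolding eq south_def east_def using unstereo_tendsto[OF l(2)] l(1) by auto
qed

section \<open>The sphere flow is an optimal SN-flow\<close>

definition linear_sphere_derivative :: "real ^ 3 \<Rightarrow> real ^ 3 \<Rightarrow> real ^ 3" where
  "linear_sphere_derivative X v = - (v $ 3 *\<^sub>R X + X $ 3 *\<^sub>R v)
    + ((- (v $ 1 * X $ 2 + X $ 1 * v $ 2)) *\<^sub>R axis 1 1 + (- v $ 3 - 2 * X $ 2 * v $ 2) *\<^sub>R axis 2 1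
    + (v $ 2 * (1 - X $ 3) - X $ 2 * v $ 3) *\<^sub>R axis 3 1)"

text \<open>In this region \<open>sphere_shear\<close> is 1 and the field is polynomial; it contains
  both the sink and the source. On their tangent planes the linear part is minus or plus the
  identity.\<close>

lemma velocity_sphere_flow_derivative:
  assumes X: "X \<in> S2" "- 1/4 < X $ 3"
  shows "(velocity sphere_flow has_derivative linear_sphere_derivative X) (at X within S2)"
proof -
  let ?P = "\<lambda>X::real^3. (north - X $ 3 *\<^sub>R X) + shear_direction X"
  have nth: "((\<lambda>X::real^3. X $ i) has_derivative (\<lambda>v. v $ i)) F" for i F
    by (rule bounded_linear_imp_has_derivative[OF bounded_linear_vec_nth])
  have "(?P has_derivative linear_sphere_derivative X) (at X)"
    unfolding shear_direction_def linear_sphere_derivative_def power2_eq_square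
    by (rule derivative_eq_intros nth refl)+ (auto simp: fun_eq_iff vec3_eq_iff algebra_simps)
  moreover have "open {X::real^3. - 1/4 < X $ 3}" by (intro open_Collect_less continuous_intros)
  moreover have "?P Y = sphere_field Y" if "Y \<in> {X. - 1/4 < X $ 3}" for Y
    using that by (simp add: sphere_field_def sphere_shear_eq_1)
  ultimately have "(sphere_field has_derivative linear_sphere_derivative X) (at X)"
    using has_derivative_transform_within_open[of ?P "linear_sphere_derivative X" X UNIV "{X. - 1/4 < X $ 3}" sphere_field] X(2) by auto
  then have "(sphere_field has_derivative linear_sphere_derivative X) (at X within S2)" by (rule has_derivative_at_withinI)
  then show ?thesis by (rule has_derivative_transform[OF X(1), rotated]) (rule velocity_sphere_flow)
qed

text \<open>Pair the two equations with \<open>u\<close> and \<open>v\<close> and add: the terms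
  with the imaginary part cancel.\<close>

lemma scalar_eigenvalue:
  fixes V :: "'a::real_inner set"
  assumes "complex_eigenvalue_on V A z" "\<And>v. v \<in> V \<Longrightarrow> A v = c *\<^sub>R v"
  shows "Re z = c"
proof -
  obtain u v where V: "u \<in> V" "v \<in> V" and uv: "u \<noteq> 0 \<or> v \<noteq> 0"
    "A u = Re z *\<^sub>R u - Im z *\<^sub>R v" "A v = Im z *\<^sub>R u + Re z *\<^sub>R v"
    using assms(1) unfolding complex_eigenvalue_on_def by blast
  note uv = uv(1) uv(2,3)[unfolded V[THEN assms(2)]]
  have "c * (u \<bullet> u) = Re z * (u \<bullet> u) - Im z * (v \<bullet> u)"
    using arg_cong[OF uv(2), of "\<lambda>w. w \<bullet> u"] by (simp add: inner_diff_left)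
  moreover have "c * (v \<bullet> v) = Im z * (u \<bullet> v) + Re z * (v \<bullet> v)"
    using arg_cong[OF uv(3), of "\<lambda>w. w \<bullet> v"] by (simp add: inner_add_left)
  ultimately have "(c - Re z) * (u \<bullet> u + v \<bullet> v) = 0"
    by (simp add: algebra_simps inner_commute)
  moreover have "0 < u \<bullet> u + v \<bullet> v"
    using uv(1) inner_ge_zero[of u] inner_ge_zero[of v] inner_gt_zero_iff[of u] inner_gt_zero_iff[of v] by linarith
  ultimately show ?thesis by simp
qed

lemma sink_north: "sink S2 sphere_flow north"
  unfolding sink_def
proof (intro conjI allI impI)
  show "north \<in> singular_points S2 sphere_flow" by (simp add: singular_points_sphere_flow)
  fix z assume "linear_part_eigenvalue S2 sphere_flow north z"
  then have "complex_eigenvalue_on {v. v \<bullet> north = 0} (linear_sphere_derivative north) z"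
    using linear_part_eigenvalue_iff[OF velocity_sphere_flow_derivative[OF poles_in(1)]] tangent_vectors_S2[OF poles_in(1)] by simp
  moreover have "linear_sphere_derivative north v = (- 1) *\<^sub>R v" if "v \<in> {v. v \<bullet> north = 0}" for v
    using that by (simp add: linear_sphere_derivative_def vec3_eq_iff inner_axis)
  ultimately have "Re z = - 1" by (rule scalar_eigenvalue)
  then show "Re z < 0" by simp
qed

lemma source_east: "source S2 sphere_flow east"
  unfolding source_def
proof (intro conjI allI impI)
  show "east \<in> singular_points S2 sphere_flow" by (simp add: singular_points_sphere_flow)
  fix z assume "linear_part_eigenvalue S2 sphere_flow east z"
  then have "complex_eigenvalue_on {v. v \<bullet> east = 0} (linear_sphere_derivative east) z"
    using linear_part_eigenvalue_iff[OF velocity_sphere_flow_derivative[OF poles_in(3)]] tangent_vectors_S2[OF poles_in(3)] by simp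
  moreover have "linear_sphere_derivative east v = 1 *\<^sub>R v" if "v \<in> {v. v \<bullet> east = 0}" for v
    using that by (simp add: linear_sphere_derivative_def vec3_eq_iff inner_vec_def sum_3)
  ultimately have "Re z = 1" by (rule scalar_eigenvalue)
  then show "0 < Re z" by simp
qed

text \<open>Along the meridian through the saddle-node the field vanishes to second order.\<close>

lemma not_hyperbolic_south: "\<not> hyperbolic S2 sphere_flow south"
proof -
  define \<gamma> where "\<gamma> t = unstereo (0, t)" for t
  define s where "s t = 1 / (1 + t\<^sup>2)" for t :: real
  have ne: "1 + t\<^sup>2 \<noteq> 0" for t :: real using zero_le_power2[of t] by linarith
  have ds: "(s has_real_derivative - 2 * t * (s t)\<^sup>2) (at t)" for t
    unfolding s_def by (rule derivative_eq_intros refl ne)+ (simp add: power2_eq_square)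
  have \<gamma>: "\<gamma> t = (2 * t * s t) *\<^sub>R axis 2 1 + (1 - 2 * s t) *\<^sub>R axis 3 1" for t
    by (simp add: \<gamma>_def unstereo_def inv_denominator_def s_def)
  define D where "D t = (2 * s t - 4 * t\<^sup>2 * (s t)\<^sup>2) *\<^sub>R axis 2 (1::real) + (4 * t * (s t)\<^sup>2) *\<^sub>R (axis 3 1 :: real ^ 3)" for t
  have d: "(\<gamma> has_vector_derivative D t) (at t)" for t
  proof (rule has_vector_derivative_vec3)
    show "((\<lambda>t. \<gamma> t $ 1) has_real_derivative D t $ 1) (at t)" unfolding \<gamma> D_def by simp
    show "((\<lambda>t. \<gamma> t $ 2) has_real_derivative D t $ 2) (at t)" unfolding \<gamma> D_def
      by (simp, (rule derivative_eq_intros ds refl)+) (simp add: power2_eq_square algebra_simps)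
    show "((\<lambda>t. \<gamma> t $ 3) has_real_derivative D t $ 3) (at t)" unfolding \<gamma> D_def
      by (simp, (rule derivative_eq_intros ds refl)+) (simp add: power2_eq_square algebra_simps)
  qed
  have cs: "continuous_on A s" for A unfolding s_def by (intro continuous_intros) (use ne in auto)
  have C1: "\<gamma> C1_differentiable_on {-1<..<1}"
    unfolding C1_differentiable_on_def
    by (intro exI[of _ D] conjI ballI d) (auto simp: D_def[abs_def] intro!: continuous_intros cs)
  have im: "\<gamma> ` {-1<..<1} \<subseteq> S2" "\<gamma> 0 = south" using unstereo_in(1) by (auto simp: \<gamma>_def south_def)
  have v: "vector_derivative \<gamma> (at 0) = 2 *\<^sub>R axis 2 1" using vector_derivative_at[OF d[of 0]] by (simp add: D_def s_def)
  let ?A = "frechet_derivative (velocity sphere_flow) (at south within S2)"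
  have A: "(velocity sphere_flow has_derivative ?A) (at south within S2)"
    by (rule smooth_flow_differentiable[OF smooth_flow_sphere_flow poles_in(2)])
  have dA: "((\<lambda>t. velocity sphere_flow (\<gamma> t)) has_vector_derivative ?A (2 *\<^sub>R axis 2 1)) (at 0)"
    using tangent_vectors_derivative[OF A C1 im] by (simp add: v)
  \<comment> \<open>On this segment the plane field is \<open>(0, t\<^sup>2)\<close>, so its image
    is \<open>t\<^sup>2\<close> times the velocity \<open>D t\<close> of the meridian.\<close>
  have vel: "velocity sphere_flow (\<gamma> t) = t\<^sup>2 *\<^sub>R D t" if "t \<in> {-1/2<..<1/2}" for t
  proof -
    have "t\<^sup>2 \<le> (1/2)\<^sup>2" using that by (intro power2_le_iff_abs_le[THEN iffD2]) auto
    then have "shear (t\<^sup>2) t = t\<^sup>2 - t" by (simp add: shear_def cutoff_eq_1 power_divide)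
    then have sh: "sphere_shear (\<gamma> t) = t\<^sup>2 - t" by (simp add: \<gamma>_def sphere_shear_unstereo)
    have st: "t\<^sup>2 * (s t)\<^sup>2 = s t - (s t)\<^sup>2" using inv_denominator(3)[of "(0, t)"] by (simp add: inv_denominator_def s_def)
    have "velocity sphere_flow (\<gamma> t) = north - \<gamma> t $ 3 *\<^sub>R \<gamma> t + (t\<^sup>2 - t) *\<^sub>R shear_direction (\<gamma> t)"
      using velocity_sphere_flow[of "\<gamma> t", unfolded \<gamma>_def, OF unstereo_in(1)] unfolding \<gamma>_def[symmetric] sphere_field_def sh .
    also have "\<dots> = t\<^sup>2 *\<^sub>R D t"
    proof -
      have g: "\<gamma> t $ 1 = 0" "\<gamma> t $ 2 = 2 * t * s t" "\<gamma> t $ 3 = 1 - 2 * s t" by (simp_all add: \<gamma>)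
      have D: "D t $ 1 = 0" "D t $ 2 = 2 * s t - 4 * t\<^sup>2 * (s t)\<^sup>2" "D t $ 3 = 4 * t * (s t)\<^sup>2" by (simp_all add: D_def)
      have T: "shear_direction (\<gamma> t) $ 1 = 0" "shear_direction (\<gamma> t) $ 2 = 2 * s t - 4 * (t\<^sup>2 * (s t)\<^sup>2)"
        "shear_direction (\<gamma> t) $ 3 = 4 * t * (s t)\<^sup>2" by (simp_all add: shear_direction_def g power2_eq_square)
      have "- ((1 - 2 * s t) * (2 * t * s t)) + (t\<^sup>2 - t) * (2 * s t - 4 * (t\<^sup>2 * (s t)\<^sup>2)) = t\<^sup>2 * (2 * s t - 4 * (t\<^sup>2 * (s t)\<^sup>2))"
        unfolding st by (simp add: power2_eq_square algebra_simps)
      moreover have "1 - (1 - 2 * s t) * (1 - 2 * s t) + (t\<^sup>2 - t) * (4 * t * (s t)\<^sup>2) = t\<^sup>2 * (4 * t * (s t)\<^sup>2)"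
      proof -
        have "1 - (1 - 2 * s t) * (1 - 2 * s t) = 4 * (s t - (s t)\<^sup>2)" by (simp add: power2_eq_square algebra_simps)
        also have "\<dots> = 4 * (t\<^sup>2 * (s t)\<^sup>2)" by (simp only: st)
        finally show ?thesis by (simp add: power2_eq_square algebra_simps)
      qed
      ultimately show ?thesis by (simp add: vec3_eq_iff g D T)
    qed
    finally show ?thesis .
  qed
  have D_cont: "(D \<longlongrightarrow> D 0) (at 0)"
  proof -
    have "continuous_on UNIV D" unfolding D_def[abs_def] by (intro continuous_intros cs)
    then show ?thesis by (simp add: continuous_on_def)
  qed
  have "((\<lambda>t. t\<^sup>2 *\<^sub>R D t) has_vector_derivative 0) (at 0)"
  proof -
    have "((\<lambda>t. \<bar>t\<bar> *\<^sub>R D t) \<longlongrightarrow> \<bar>0\<bar> *\<^sub>R D 0) (at 0)" by (intro tendsto_intros D_cont)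
    moreover have "1 / \<bar>t\<bar> * t\<^sup>2 = \<bar>t\<bar>" for t :: real by (cases "t = 0") (simp_all add: power2_eq_square field_simps)
    ultimately show ?thesis unfolding has_vector_derivative_def has_derivative_at2 by (simp add: bounded_linear_zero)
  qed
  then have "((\<lambda>t. velocity sphere_flow (\<gamma> t)) has_vector_derivative 0) (at 0)"
    by (rule has_vector_derivative_transform_within_open[of _ _ _ "{-1/2<..<1/2}"]) (use vel in auto)
  then have "?A (2 *\<^sub>R axis 2 1) = 0" using vector_derivative_unique_at dA by blast
  moreover have "?A 0 = 0" using linear_0[OF has_derivative_linear[OF A]] .
  moreover have "(2::real) *\<^sub>R axis 2 1 \<in> tangent_vectors S2 south" "0 \<in> tangent_vectors S2 south"
    by (auto simp: tangent_vectors_S2[OF poles_in(2)] inner_vec_def sum_3)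
  moreover have "(2::real) *\<^sub>R axis 2 1 \<noteq> (0 :: real ^ 3)" by (simp add: vec3_eq_iff)
  ultimately have "linear_part_eigenvalue S2 sphere_flow south 0"
    unfolding linear_part_eigenvalue_def complex_eigenvalue_on_def
    by (intro bexI[of _ "2 *\<^sub>R axis 2 1"] bexI[of _ 0]) auto
  then show ?thesis unfolding hyperbolic_def by force
qed

lemma source_hyperbolic: "source M \<phi> p \<Longrightarrow> hyperbolic M \<phi> p" and sink_hyperbolic: "sink M \<phi> p \<Longrightarrow> hyperbolic M \<phi> p"
  unfolding source_def sink_def hyperbolic_def by force+

lemma nonhyperbolic_sphere_flow: "{x \<in> singular_points S2 sphere_flow. \<not> hyperbolic S2 sphere_flow x} = {south}"
  using not_hyperbolic_south source_hyperbolic[OF source_east] sink_hyperbolic[OF sink_north]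
  by (auto simp: singular_points_sphere_flow)

text \<open>Stereographic projection itself is the chart, on the disc of radius 1/2 where the plane
  field is the model; uniqueness of integral curves identifies arcs of the flow with arcs of the
  model.\<close>

lemma saddle_node_south: "saddle_node S2 sphere_flow south"
proof -
  define U where "U = unstereo ` ball 0 (1/2)"
  have US: "U \<subseteq> S2" using unstereo_in by (auto simp: U_def)
  have U_eq: "U = S2 \<inter> ({X. X $ 3 < 1} \<inter> stereo -` ball 0 (1/2))"
  proof (intro subset_antisym subsetI)
    fix X assume "X \<in> U"
    then show "X \<in> S2 \<inter> ({X. X $ 3 < 1} \<inter> stereo -` ball 0 (1/2))"
      unfolding U_def using unstereo_in by auto
  next
    fix X assume X: "X \<in> S2 \<inter> ({X. X $ 3 < 1} \<inter> stereo -` ball 0 (1/2))"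
    then have "X \<noteq> north" by (auto simp: vec3_eq_iff)
    then have "X = unstereo (stereo X)" using unstereo_stereo X by auto
    then show "X \<in> U" using X unfolding U_def by blast
  qed
  have cstereo: "continuous_on {X. X $ 3 < 1} stereo" unfolding stereo_def[abs_def] by (intro continuous_intros) auto
  have op: "open {X :: real^3. X $ 3 < 1}" by (intro open_Collect_less continuous_intros)
  have "open ({X. X $ 3 < 1} \<inter> stereo -` ball 0 (1/2))"
    using continuous_open_preimage[OF cstereo op open_ball] .
  then have openU: "openin (top_of_set S2) U" unfolding U_eq by (rule openin_open_Int)
  have cuns: "continuous_on A unstereo" for A
  proof -
    have "1 + ((fst w)\<^sup>2 + (snd w)\<^sup>2) \<noteq> 0" for w :: "real \<times> real" using inv_denominator(2)[of w] by auto
    then show ?thesis unfolding unstereo_def[abs_def] inv_denominator_def by (intro continuous_intros) auto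
  qed
  have hom: "homeomorphism U (ball 0 (1/2)) stereo unstereo"
  proof (rule homeomorphismI)
    show "continuous_on U stereo" by (rule continuous_on_subset[OF cstereo]) (use U_eq in blast)
  qed (auto simp: U_def cuns simp del: mem_ball)
  have near: "plane_field z = saddle_node_model z" if "z \<in> ball 0 (1/2)" for z
  proof -
    have "(norm z)\<^sup>2 \<le> (1/2)\<^sup>2" using that by (intro power_mono) auto
    then show ?thesis by (intro plane_field_near) (simp add: norm_prod_def power_divide)
  qed
  have flows: "flows_to (velocity sphere_flow) U X Y \<longleftrightarrow> flows_to saddle_node_model (ball 0 (1/2)) (stereo X) (stereo Y)"
    if XY: "X \<in> U" "Y \<in> U" for X Y
  proof -
    have n: "X \<noteq> north" "X \<in> S2" "Y \<in> S2" "Y \<noteq> north" using XY unstereo_in by (auto simp: U_def)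
    have flow: "sphere_flow t X = unstereo (plane_flow t (stereo X))" for t using n by (simp add: sphere_flow_def)
    have inU: "unstereo z \<in> U \<longleftrightarrow> z \<in> ball 0 (1/2)" for z
      unfolding U_def by (rule inj_image_mem_iff) (rule inj_on_inverseI[of _ stereo], rule stereo_unstereo)
    have "flows_to (velocity sphere_flow) U X Y \<longleftrightarrow> orbit_arc_in sphere_flow U X Y"
      by (rule flows_to_iff_orbit_arc[OF compact_sphere smooth_flow_sphere_flow US XY(1)])
    also have "\<dots> \<longleftrightarrow> (\<exists>T\<ge>0. plane_flow T (stereo X) = stereo Y \<and> (\<forall>t\<in>{0..T}. plane_flow t (stereo X) \<in> ball 0 (1/2)))"
    proof -
      have "unstereo (plane_flow T (stereo X)) = Y \<longleftrightarrow> plane_flow T (stereo X) = stereo Y" for T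
        using unstereo_stereo[OF n(3,4)] stereo_unstereo by metis
      then show ?thesis unfolding orbit_arc_in_def flow inU by simp
    qed
    also have "\<dots> \<longleftrightarrow> flows_to saddle_node_model (ball 0 (1/2)) (stereo X) (stereo Y)"
    proof
      assume "\<exists>T\<ge>0. plane_flow T (stereo X) = stereo Y \<and> (\<forall>t\<in>{0..T}. plane_flow t (stereo X) \<in> ball 0 (1/2))"
      then obtain T where T: "0 \<le> T" "plane_flow T (stereo X) = stereo Y" "\<And>t. t \<in> {0..T} \<Longrightarrow> plane_flow t (stereo X) \<in> ball 0 (1/2)" by blast
      have "((\<lambda>t. plane_flow t (stereo X)) has_vector_derivative saddle_node_model (plane_flow t (stereo X))) (at t within {0..T})"
        if "t \<in> {0..T}" for t
        using has_vector_derivative_at_within[OF plane_flow_derivative[of "stereo X" t]] near[OF T(3)[OF that]] by simp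
      then show "flows_to saddle_node_model (ball 0 (1/2)) (stereo X) (stereo Y)"
        unfolding flows_to_def
        by (intro exI[of _ T] exI[of _ "\<lambda>t. plane_flow t (stereo X)"] conjI ballI T plane_flow_0)
    next
      assume "flows_to saddle_node_model (ball 0 (1/2)) (stereo X) (stereo Y)"
      then obtain T \<gamma> where T: "0 \<le> T" "\<gamma> 0 = stereo X" "\<gamma> T = stereo Y"
        "\<And>t. t \<in> {0..T} \<Longrightarrow> \<gamma> t \<in> ball 0 (1/2) \<and> (\<gamma> has_vector_derivative saddle_node_model (\<gamma> t)) (at t within {0..T})"
        unfolding flows_to_def by blast
      have eq: "\<gamma> t = plane_flow t (stereo X)" if "t \<in> {0..T}" for t
      proof (rule plane_flow_unique[of \<gamma> _ T, OF T(2) _ that])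
        show "(\<gamma> has_vector_derivative plane_field (\<gamma> s)) (at s within {0..T})" if "s \<in> {0..T}" for s
          using T(4)[OF that] near[of "\<gamma> s"] by simp
      qed
      have "plane_flow T (stereo X) = stereo Y" using eq[of T] T(1,3) by simp
      moreover have "\<forall>t\<in>{0..T}. plane_flow t (stereo X) \<in> ball 0 (1/2)" using eq T(4) by metis
      ultimately show "\<exists>T\<ge>0. plane_flow T (stereo X) = stereo Y \<and> (\<forall>t\<in>{0..T}. plane_flow t (stereo X) \<in> ball 0 (1/2))"
        using T(1) by blast
    qed
    finally show ?thesis .
  qed
  have pU: "south \<in> U" unfolding U_def south_def by (intro imageI) (simp add: zero_prod_def[symmetric])
  have "saddle_node_chart S2 sphere_flow south False U stereo"
    unfolding saddle_node_chart_def
  proof (intro conjI exI[of _ "1/2"] ballI)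
    show "stereo south = 0" by (simp add: south_def zero_prod_def)
    show "\<exists>g. homeomorphism U (ball 0 (1/2)) stereo g" using hom by blast
    show "flows_to (velocity sphere_flow) U x y \<longleftrightarrow> (if False then flows_to saddle_node_model (ball 0 (1/2)) (stereo y) (stereo x)
        else flows_to saddle_node_model (ball 0 (1/2)) (stereo x) (stereo y))" if "x \<in> U" "y \<in> U" for x y
      using flows[OF that] by simp
  qed (use openU pU in simp_all)
  then show ?thesis unfolding saddle_node_def by blast
qed

section \<open>Verification of the global conditions\<close>

lemma sphere_flow_limits:
  assumes "X \<in> S2 - {north, south, east}"
  shows "((\<lambda>t. sphere_flow t X) \<longlongrightarrow> north) at_top \<or>
      ((\<lambda>t. sphere_flow t X) \<longlongrightarrow> south) at_top \<and> ((\<lambda>t. reverse_flow sphere_flow t X) \<longlongrightarrow> east) at_top"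
    and "((\<lambda>t. reverse_flow sphere_flow t X) \<longlongrightarrow> east) at_top \<or> ((\<lambda>t. reverse_flow sphere_flow t X) \<longlongrightarrow> south) at_top"
  using sphere_flow_forward_limit[OF assms] sphere_flow_backward_limit[of X] assms by auto

lemma limit_unique_at_top:
  "((f :: real \<Rightarrow> real ^ 3) \<longlongrightarrow> a) at_top \<Longrightarrow> (f \<longlongrightarrow> b) at_top \<Longrightarrow> a = b"
  using tendsto_unique[OF trivial_limit_at_top_linorder] by blast

lemma fixed_sphere_flow: "q \<in> {north, south, east} \<Longrightarrow> sphere_flow t q = q"
  using singular_point_fixed[OF compact_sphere smooth_flow_sphere_flow] singular_points_sphere_flow by blast

lemma singular_limit:
  assumes "q \<in> {north, south, east}"
  shows "((\<lambda>t. sphere_flow t q) \<longlongrightarrow> q) at_top" "((\<lambda>t. reverse_flow sphere_flow t q) \<longlongrightarrow> q) at_top"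
  using fixed_sphere_flow[OF assms] by (simp_all add: reverse_flow_def)

text \<open>Every nonsingular point tends to the sink or comes from the source, so at least one of
  \<open>V\<close> and \<open>1 - W\<close> strictly decreases along its trajectory while the other
  does not increase.\<close>

lemma nonwandering_sphere_flow: "nonwandering_set S2 sphere_flow = singular_points S2 sphere_flow"
proof (intro subset_antisym subsetI)
  fix x assume "x \<in> singular_points S2 sphere_flow"
  then have x: "x \<in> S2" "\<And>t. sphere_flow t x = x"
    using fixed_sphere_flow singular_points_sphere_flow by (auto simp: singular_points_def)
  have "\<exists>t\<ge>T. \<exists>y\<in>U \<inter> S2. sphere_flow t y \<in> U" if "x \<in> U" for U T
    by (rule exI[of _ T], rule conjI[OF order_refl], rule bexI[of _ x]) (use x that in auto)
  then show "x \<in> nonwandering_set S2 sphere_flow" using x(1) unfolding nonwandering_set_def by blast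
next
  fix x assume nw: "x \<in> nonwandering_set S2 sphere_flow"
  show "x \<in> singular_points S2 sphere_flow"
  proof (rule ccontr)
    assume "x \<notin> singular_points S2 sphere_flow"
    then have x: "x \<in> S2 - {north, south, east}" using nw by (auto simp: singular_points_sphere_flow nonwandering_set_def)
    then have xS: "x \<in> S2" by blast
    obtain V where "basin S2 sphere_flow north V" by (rule sink_basin[OF smooth_flow_sphere_flow sink_north])
    then interpret A: basin S2 sphere_flow north V .
    obtain W where "basin S2 (reverse_flow sphere_flow) east W" by (rule source_basin[OF smooth_flow_sphere_flow source_east])
    then interpret B: basin S2 "reverse_flow sphere_flow" east W .
    have W_flow: "W (sphere_flow t y) = 1 - lgs t (1 - W y)" if "y \<in> S2" for t y
      using B.V_flow[OF that, of "- t"] B.V_bounds[OF that] lgs_complement[of "W y" t] by (simp add: reverse_flow_def)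
    have V_flow: "V (sphere_flow t y) = lgs t (V y)" if "y \<in> S2" for t y by (rule A.V_flow[OF that])
    have pos: "0 < V x" "W x > 0"
      using A.V_eq_0_iff[OF xS] B.V_eq_0_iff[OF xS] A.V_bounds[OF xS] B.V_bounds[OF xS] x by (auto simp: less_le)
    have "V x < 1 \<or> W x < 1"
      using sphere_flow_limits(1)[OF x] A.tendsto_attractor_iff[OF xS] B.tendsto_attractor_iff[OF xS] by blast
    have "x \<notin> nonwandering_set S2 sphere_flow"
    proof (rule F.wandering_of_decreasing[of "\<lambda>y. V y - W y"])
      show "continuous_on S2 (\<lambda>y. V y - W y)" by (intro continuous_intros A.continuous_V B.continuous_V)
      show "V (sphere_flow t y) - W (sphere_flow t y) \<le> V y - W y" if "y \<in> S2" "0 \<le> t" for y t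
        using lgs_decreasing[of "V y" 0 t] lgs_decreasing[of "1 - W y" 0 t] A.V_bounds[OF that(1)] B.V_bounds[OF that(1)] that(2)
        unfolding V_flow[OF that(1)] W_flow[OF that(1)] by simp
      show "V (sphere_flow 1 x) - W (sphere_flow 1 x) < V x - W x"
        using \<open>V x < 1 \<or> W x < 1\<close>
      proof
        assume "V x < 1"
        then show ?thesis using lgs_strict_decreasing[of "V x" 0 1] lgs_decreasing[of "1 - W x" 0 1] B.V_bounds[OF xS] pos
          unfolding V_flow[OF xS] W_flow[OF xS] by simp
      next
        assume "W x < 1"
        then show ?thesis using lgs_decreasing[of "V x" 0 1] lgs_strict_decreasing[of "1 - W x" 0 1] A.V_bounds[OF xS] pos
          unfolding V_flow[OF xS] W_flow[OF xS] by simp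
      qed
    qed (rule xS)
    then show False using nw by blast
  qed
qed

text \<open>Tangent vectors are defined by curves on a fixed interval, so a curve in
  \<open>M\<close> cannot simply be restricted to short times.\<close>

lemma tangent_vectors_openin:
  assumes "openin (top_of_set M) Q" "x \<in> Q" "w \<in> tangent_vectors M x"
  shows "w \<in> tangent_vectors Q x"
proof -
  obtain \<gamma> where \<gamma>: "\<gamma> C1_differentiable_on {-1<..<1}" "\<gamma> ` {-1<..<1} \<subseteq> M" "\<gamma> 0 = x" "w = vector_derivative \<gamma> (at 0)"
    using assms(3) unfolding tangent_vectors_def by blast
  obtain D where D: "\<And>t. t \<in> {-1<..<1} \<Longrightarrow> (\<gamma> has_vector_derivative D t) (at t)" "continuous_on {-1<..<1} D"
    using \<gamma>(1) unfolding C1_differentiable_on_def by blast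
  obtain S where S: "open S" "Q = M \<inter> S" using assms(1) by (auto simp: openin_open)
  have "(\<gamma> \<longlongrightarrow> x) (at 0)"
    using has_vector_derivative_continuous[OF D(1)[of 0]] \<gamma>(3) by (simp add: isCont_def)
  then have "\<forall>\<^sub>F t in at 0. \<gamma> t \<in> S" using topological_tendstoD S assms(2) by blast
  then obtain d where d: "0 < d" "\<And>t. t \<noteq> 0 \<Longrightarrow> dist t 0 < d \<Longrightarrow> \<gamma> t \<in> S" by (auto simp: eventually_at)
  define r where "r = min (d/2) (1/2)"
  have r: "0 < r" "r < 1" "r < d" using d(1) by (auto simp: r_def)
  \<comment> \<open>A change of parameter with derivative 1 at 0 whose values stay within
    \<open>r\<close>: it confines the curve to short times and keeps its velocity at 0.\<close>
  define \<sigma> where "\<sigma> t = r * sin (t / r)" for t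
  have \<sigma>: "\<bar>\<sigma> t\<bar> \<le> r" for t using r abs_sin_le_one[of "t / r"] by (simp add: \<sigma>_def abs_mult mult_left_le)
  have \<sigma>1: "\<sigma> t \<in> {-1<..<1}" for t using \<sigma>[of t] r by auto
  have d\<sigma>: "(\<sigma> has_vector_derivative cos (t / r)) (at t)" for t
    unfolding \<sigma>_def has_real_derivative_iff_has_vector_derivative[symmetric]
    by (rule derivative_eq_intros refl)+ (use r in auto)
  have dd: "((\<lambda>t. \<gamma> (\<sigma> t)) has_vector_derivative cos (t / r) *\<^sub>R D (\<sigma> t)) (at t)" for t
    using vector_diff_chain_at[OF d\<sigma> D(1)[OF \<sigma>1]] by (simp add: o_def)
  have c\<sigma>: "continuous_on A \<sigma>" for A unfolding \<sigma>_def by (intro continuous_intros) (use r in auto)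
  have "(\<lambda>t. \<gamma> (\<sigma> t)) C1_differentiable_on {-1<..<1}"
    unfolding C1_differentiable_on_def
  proof (intro exI[of _ "\<lambda>t. cos (t / r) *\<^sub>R D (\<sigma> t)"] conjI ballI dd)
    show "continuous_on {-1<..<1} (\<lambda>t. cos (t / r) *\<^sub>R D (\<sigma> t))"
      by (intro continuous_intros continuous_on_compose2[OF D(2) c\<sigma>]) (use r \<sigma>1 in auto)
  qed
  moreover have "\<gamma> (\<sigma> t) \<in> Q" for t
  proof (cases "\<sigma> t = 0")
    case True
    then show ?thesis using \<gamma>(3) assms(2) by simp
  next
    case False
    then have "\<gamma> (\<sigma> t) \<in> S" using d(2)[of "\<sigma> t"] \<sigma>[of t] r by simp
    then show ?thesis using S(2) \<gamma>(2) \<sigma>1 by blast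
  qed
  moreover have "\<gamma> (\<sigma> 0) = x" using \<gamma>(3) by (simp add: \<sigma>_def)
  moreover have "vector_derivative (\<lambda>t. \<gamma> (\<sigma> t)) (at 0) = w"
  proof -
    have "vector_derivative (\<lambda>t. \<gamma> (\<sigma> t)) (at 0) = D 0" using vector_derivative_at[OF dd[of 0]] by (simp add: \<sigma>_def)
    also have "\<dots> = w" using vector_derivative_at[OF D(1)[of 0]] \<gamma>(4) by simp
    finally show ?thesis .
  qed
  ultimately show ?thesis unfolding tangent_vectors_def by blast
qed

lemma zero_tangent_vector: "x \<in> W \<Longrightarrow> 0 \<in> tangent_vectors W x"
  unfolding tangent_vectors_def
  by (rule CollectI, rule exI[of _ "\<lambda>_. x"]) auto

lemma unstable_manifold_eq_reverse: "unstable_manifold M \<phi> p = stable_manifold M (reverse_flow \<phi>) p"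
  by (simp add: unstable_manifold_def stable_manifold_def reverse_flow_def filterlim_at_bot_mirror)

lemma (in basin) openin_stable_manifold: "openin (top_of_set M) (stable_manifold M \<phi> k)"
proof -
  have "stable_manifold M \<phi> k = M \<inter> V -` {..<1}"
    unfolding stable_manifold_def using tendsto_attractor_iff by auto
  then show ?thesis using continuous_openin_preimage_gen[OF continuous_V] by auto
qed

text \<open>At every point considered the stable manifold belongs to the sink or the unstable
  manifold to the source. Such a manifold is open in the sphere, so it alone contributes all tangent
  vectors.\<close>

lemma transversal_sphere_flow: "transversal_manifolds S2 sphere_flow"
  unfolding transversal_manifolds_def
proof (intro ballI impI)
  fix p q x w
  assume p: "p \<in> singular_points S2 sphere_flow" and q: "q \<in> singular_points S2 sphere_flow"
    and x: "x \<in> unstable_manifold S2 sphere_flow p \<inter> stable_manifold S2 sphere_flow q"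
    and hyp: "x \<in> singular_points S2 sphere_flow \<longrightarrow> hyperbolic S2 sphere_flow x" and w: "w \<in> tangent_vectors S2 x"
  have xS: "x \<in> S2" and fwd: "((\<lambda>t. sphere_flow t x) \<longlongrightarrow> q) at_top"
    and bwd: "((\<lambda>t. reverse_flow sphere_flow t x) \<longlongrightarrow> p) at_top"
    using x by (auto simp: stable_manifold_def unstable_manifold_eq_reverse)
  have "q = north \<or> p = east"
  proof (cases "x \<in> {north, south, east}")
    case True
    have "q = x" "p = x" using limit_unique_at_top singular_limit[OF True] fwd bwd by blast+
    moreover have "x \<noteq> south" using hyp True not_hyperbolic_south singular_points_sphere_flow by auto
    ultimately show ?thesis using True by auto
  next
    case False
    then have "x \<in> S2 - {north, south, east}" using xS by blast
    from sphere_flow_limits(1)[OF this] show ?thesis using limit_unique_at_top fwd bwd by blast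
  qed
  then show "\<exists>u\<in>tangent_vectors (unstable_manifold S2 sphere_flow p) x.
        \<exists>v\<in>tangent_vectors (stable_manifold S2 sphere_flow q) x. w = u + v"
  proof
    assume "q = north"
    obtain V where "basin S2 sphere_flow north V" by (rule sink_basin[OF smooth_flow_sphere_flow sink_north])
    then have "openin (top_of_set S2) (stable_manifold S2 sphere_flow q)" using basin.openin_stable_manifold \<open>q = north\<close> by blast
    then have "w \<in> tangent_vectors (stable_manifold S2 sphere_flow q) x" using tangent_vectors_openin x w by blast
    moreover have "0 \<in> tangent_vectors (unstable_manifold S2 sphere_flow p) x" using zero_tangent_vector x by blast
    moreover have "w = 0 + w" by simp
    ultimately show ?thesis by blast
  next
    assume "p = east"
    obtain W where "basin S2 (reverse_flow sphere_flow) east W" by (rule source_basin[OF smooth_flow_sphere_flow source_east])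
    then have "openin (top_of_set S2) (unstable_manifold S2 sphere_flow p)"
      using basin.openin_stable_manifold \<open>p = east\<close> unfolding unstable_manifold_eq_reverse by blast
    then have "w \<in> tangent_vectors (unstable_manifold S2 sphere_flow p) x" using tangent_vectors_openin x w by blast
    moreover have "0 \<in> tangent_vectors (stable_manifold S2 sphere_flow q) x" using zero_tangent_vector x by blast
    moreover have "w = w + 0" by simp
    ultimately show ?thesis by blast
  qed
qed

text \<open>Charts at the saddle-node are arbitrary; from the chart one reads that \<open>x\<close>
  differs from \<open>south\<close>. The global limits then leave only the source as the other end
  of an incoming trajectory and the sink as that of an outgoing one.\<close>

lemma separatrix_sphere_flow: "separatrix_condition S2 sphere_flow south"
  unfolding separatrix_condition_def
proof (intro allI impI conjI)
  fix x assume sep: "on_hyperbolic_separatrix S2 sphere_flow south x"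
  then obtain rev U h where ch: "saddle_node_chart S2 sphere_flow south rev U h"
    and xU: "x \<in> U" and hx: "fst (h x) = 0 \<and> snd (h x) < 0 \<or> fst (h x) \<noteq> 0 \<and> snd (h x) = 0"
    unfolding on_hyperbolic_separatrix_def by (elim exE conjE)
  have h: "openin (top_of_set S2) U" "h south = 0" using ch unfolding saddle_node_chart_def by simp_all
  have xS: "x \<in> S2" using openin_imp_subset[OF h(1)] xU by blast
  have xs: "x \<noteq> south" using h(2) hx by auto
  { assume om: "omega_limit sphere_flow x = {south}"
    have ns: "x \<in> S2 - {north, south, east}"
    proof (rule ccontr)
      assume "\<not> ?thesis"
      then have "x \<in> {north, south, east}" using xS by blast
      then have "omega_limit sphere_flow x = {x}" using omega_limit_of_tendsto singular_limit(1) by blast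
      then show False using om xs by simp
    qed
    have "((\<lambda>t. sphere_flow t x) \<longlongrightarrow> south) at_top" by (rule F.tendsto_of_omega_limit[OF xS]) (simp add: om)
    then have "((\<lambda>t. reverse_flow sphere_flow t x) \<longlongrightarrow> east) at_top"
      using sphere_flow_limits(1)[OF ns] limit_unique_at_top poles_distinct(1) by metis
    then have "omega_limit (reverse_flow sphere_flow) x = {east}" by (rule omega_limit_of_tendsto[of "reverse_flow sphere_flow" x east])
    then have "alpha_limit sphere_flow x = {east}" by (simp add: alpha_limit_eq_omega_limit_reverse)
    then show "\<exists>q. (source S2 sphere_flow q \<or> sink S2 sphere_flow q) \<and> alpha_limit sphere_flow x = {q}" using source_east by blast }
  { assume al: "alpha_limit sphere_flow x = {south}"
    then have om: "omega_limit (reverse_flow sphere_flow) x = {south}" by (simp add: alpha_limit_eq_omega_limit_reverse)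
    have ns: "x \<in> S2 - {north, south, east}"
    proof (rule ccontr)
      assume "\<not> ?thesis"
      then have "x \<in> {north, south, east}" using xS by blast
      then have "omega_limit (reverse_flow sphere_flow) x = {x}"
        using omega_limit_of_tendsto[of "reverse_flow sphere_flow" x x] singular_limit(2) by blast
      then show False using om xs by simp
    qed
    have "((\<lambda>t. reverse_flow sphere_flow t x) \<longlongrightarrow> south) at_top"
      by (rule compact_flow.tendsto_of_omega_limit[OF compact_flow_reverse[OF F.compact_flow_axioms] xS]) (simp add: om)
    then have "\<not> ((\<lambda>t. reverse_flow sphere_flow t x) \<longlongrightarrow> east) at_top"
      using limit_unique_at_top poles_distinct(3) by metis
    then have "((\<lambda>t. sphere_flow t x) \<longlongrightarrow> north) at_top" using sphere_flow_limits(1)[OF ns] by blast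
    then have "omega_limit sphere_flow x = {north}" by (rule omega_limit_of_tendsto[of sphere_flow x north])
    then show "\<exists>q. (source S2 sphere_flow q \<or> sink S2 sphere_flow q) \<and> omega_limit sphere_flow x = {q}" using sink_north by blast }
qed

lemma SN_flow_sphere_flow: "SN_flow S2 sphere_flow"
  unfolding SN_flow_def
  using smooth_flow_sphere_flow nonwandering_sphere_flow transversal_sphere_flow
    nonhyperbolic_sphere_flow saddle_node_south separatrix_sphere_flow
  by (auto simp: singular_points_sphere_flow)

lemma card_singular_points_sphere_flow: "card (singular_points S2 sphere_flow) = 3"
  using poles_distinct by (simp add: singular_points_sphere_flow)

text \<open>By the intermediate value theorem one trajectory covers the open segment from the source to the saddle-node.\<close>

lemma plane_segment_trajectory:
  assumes "- 1 < a" "a < 0" "- 1 < b" "b < 0"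
  shows "\<exists>t. plane_flow t (0, a) = (0, b)"
proof -
  let ?f = "\<lambda>t. snd (plane_flow t (0, a))"
  have f: "fst (plane_flow t (0, a)) = 0" for t by (simp add: fst_plane_flow)
  have "\<not> filterlim (\<lambda>t. norm (plane_flow t (0, a))) at_top at_top"
  proof
    assume "filterlim (\<lambda>t. norm (plane_flow t (0, a))) at_top at_top"
    then have "\<forall>\<^sub>F t in at_top. 1 \<le> norm (plane_flow t (0, a))" by (simp add: filterlim_at_top)
    then obtain t where "1 \<le> norm (plane_flow t (0, a))" by (auto simp: eventually_at_top_linorder)
    moreover have "norm (plane_flow t (0, a)) = \<bar>?f t\<bar>" using f by (simp add: norm_prod_def)
    ultimately show False using plane_flow_above[of "(0, a)" t] plane_flow_stays_negative[of a t] assms by simp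
  qed
  then have "((\<lambda>t. plane_flow t (0, a)) \<longlongrightarrow> (0, 0)) at_top" using plane_flow_forward_limit[of "(0, a)"] assms by auto
  then have "(?f \<longlongrightarrow> 0) at_top" using tendsto_snd by fastforce
  then have "\<forall>\<^sub>F t in at_top. b < ?f t" using assms order_tendstoD(1) by blast
  then obtain t1 where t1: "b < ?f t1" by (auto simp: eventually_at_top_linorder)
  obtain l where "l = 0 \<and> 0 \<le> a \<or> l = - 1" "((\<lambda>t. plane_flow (- t) (0, a)) \<longlongrightarrow> (0, l)) at_top"
    using plane_flow_backward_limit[of "(0, a)"] by auto
  then have "((\<lambda>t. plane_flow (- t) (0, a)) \<longlongrightarrow> (0, - 1)) at_top" using assms by auto
  then have "((\<lambda>t. ?f (- t)) \<longlongrightarrow> - 1) at_top" using tendsto_snd by fastforce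
  then have "\<forall>\<^sub>F t in at_top. ?f (- t) < b" using assms order_tendstoD(2) by blast
  then obtain t2 where t2: "?f (- t2) < b" by (auto simp: eventually_at_top_linorder)
  have "connected (range ?f)"
    by (intro connected_continuous_image connected_UNIV continuous_at_imp_continuous_on ballI DERIV_isCont[OF snd_plane_flow_derivative])
  then have "b \<in> range ?f" using connectedD_interval[of "range ?f" "?f (- t2)" "?f t1" b] t1 t2 by auto
  then obtain t where "b = ?f t" by blast
  then have "plane_flow t (0, a) = (0, b)" using f by (simp add: prod_eq_iff)
  then show ?thesis ..
qed

text \<open>In the plane the points tending to the saddle-node form the open segment from
  \<open>(0, -1)\<close> to \<open>(0, 0)\<close>, a single trajectory.\<close>

lemma saddle_source_sphere_flow: "saddle_source_type S2 sphere_flow"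
proof -
  let ?S = "stable_manifold S2 sphere_flow south - singular_points S2 sphere_flow"
  have S: "fst (stereo x) = 0 \<and> - 1 < snd (stereo x) \<and> snd (stereo x) < 0 \<and> x \<in> S2 \<and> x \<noteq> north" if "x \<in> ?S" for x
  proof -
    have x: "x \<in> S2 - {north, south, east}" "((\<lambda>t. sphere_flow t x) \<longlongrightarrow> south) at_top"
      using that by (auto simp: stable_manifold_def singular_points_sphere_flow)
    then show ?thesis using sphere_flow_forward_limit[OF x(1)] limit_unique_at_top poles_distinct(1) by blast
  qed
  define m where "m = unstereo (0, - 1/2)"
  have mS: "m \<in> ?S"
  proof -
    have m: "m \<in> S2" "m \<noteq> north" "stereo m = (0, - 1/2)" using unstereo_in by (auto simp: m_def)
    have "stereo south = (0, 0)" "stereo east = (0, - 1)" by (simp_all add: south_def east_def)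
    then have ns: "m \<notin> {north, south, east}" using m by auto
    \<comment> \<open>Points of the segment have norm less than 1 and therefore lie in the closed
      southern hemisphere.\<close>
    have "\<not> ((\<lambda>t. sphere_flow t m) \<longlongrightarrow> north) at_top"
    proof
      assume "((\<lambda>t. sphere_flow t m) \<longlongrightarrow> north) at_top"
      then have "((\<lambda>t. sphere_flow t m $ 3) \<longlongrightarrow> north $ 3) at_top" by (rule tendsto_vec_nth)
      then have "\<forall>\<^sub>F t in at_top. 0 < sphere_flow t m $ 3" by (rule order_tendstoD) simp
      then obtain t where t: "0 < sphere_flow t m $ 3" by (auto simp: eventually_at_top_linorder)
      let ?w = "plane_flow t (0, - 1/2)"
      have f: "fst ?w = 0" "- 1 < snd ?w" "snd ?w < 0"
        using fst_plane_flow[of t "(0, - 1/2)"] plane_flow_above[of "(0, - 1/2)" t] plane_flow_stays_negative[of "- 1/2" t] by auto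
      then have "(snd ?w)\<^sup>2 \<le> 1" using abs_square_le_1[of "snd ?w"] by auto
      then have "1/2 \<le> inv_denominator ?w" using f(1) by (simp add: inv_denominator_def field_simps add_pos_nonneg)
      then show False using t m by (simp add: sphere_flow_def)
    qed
    then have "((\<lambda>t. sphere_flow t m) \<longlongrightarrow> south) at_top" using sphere_flow_limits(1)[of m] m(1) ns by blast
    then show ?thesis using m(1) ns by (simp add: stable_manifold_def singular_points_sphere_flow)
  qed
  have traj: "trajectory sphere_flow x = trajectory sphere_flow m" if x: "x \<in> ?S" for x
  proof -
    have "stereo x = (0, snd (stereo x))" "stereo m = (0, snd (stereo m))" using S[OF x] S[OF mS] by (simp_all add: prod_eq_iff)
    then obtain t where t: "plane_flow t (stereo m) = stereo x"
      using plane_segment_trajectory[of "snd (stereo m)" "snd (stereo x)"] S[OF x] S[OF mS] by metis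
    then have xm: "x = sphere_flow t m" using S[OF x] S[OF mS] unstereo_stereo by (simp add: sphere_flow_def)
    have mS2: "m \<in> S2" using S[OF mS] by blast
    have "sphere_flow s x = sphere_flow (s + t) m" for s using F.flow_add[OF mS2, of s t] xm by simp
    then have "trajectory sphere_flow x = range (\<lambda>s. sphere_flow (s + t) m)" by (simp add: trajectory_def)
    also have "\<dots> = (\<lambda>r. sphere_flow r m) ` range (\<lambda>s. s + t)" by (simp only: image_image)
    also have "range (\<lambda>s. s + t) = UNIV" by (rule surjI[of _ "\<lambda>r. r - t"]) simp
    finally show ?thesis by (simp add: trajectory_def)
  qed
  have ex1: "\<exists>!C. \<exists>x\<in>?S. C = trajectory sphere_flow x"
  proof (rule ex1I)
    show "\<exists>x\<in>?S. trajectory sphere_flow m = trajectory sphere_flow x" by (rule bexI[OF refl mS])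
    show "C = trajectory sphere_flow m" if "\<exists>x\<in>?S. C = trajectory sphere_flow x" for C using that traj by blast
  qed
  have "south \<in> singular_points S2 sphere_flow" by (simp add: singular_points_sphere_flow)
  then show ?thesis
    unfolding saddle_source_type_def by (rule bexI[rotated]) (rule conjI[OF not_hyperbolic_south ex1])
qed

lemma optimal_sphere_flow: "optimal_SN_flow S2 sphere_flow"
  unfolding optimal_SN_flow_def using SN_flow_sphere_flow SN_flow_card_ge_3 card_singular_points_sphere_flow by auto

theorem mainTheorem11:
  shows "\<exists>\<phi>. optimal_SN_flow S2 \<phi> \<and> saddle_source_type S2 \<phi> \<and>
    (\<forall>\<psi>. optimal_SN_flow S2 \<psi> \<and> saddle_source_type S2 \<psi> \<longrightarrow> topologically_equivalent S2 \<phi> \<psi>)"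
proof (intro exI[of _ sphere_flow] conjI allI impI optimal_sphere_flow saddle_source_sphere_flow)
  fix \<psi> assume \<psi>: "optimal_SN_flow S2 \<psi> \<and> saddle_source_type S2 \<psi>"
  \<comment> \<open>Existence helps uniqueness: comparison with \<open>sphere_flow\<close> is what
    bounds the number of singular points of an optimal flow by three.\<close>
  then have "SN_flow S2 \<psi>" "card (singular_points S2 \<psi>) \<le> card (singular_points S2 sphere_flow)"
    using SN_flow_sphere_flow unfolding optimal_SN_flow_def by blast+
  then show "topologically_equivalent S2 sphere_flow \<psi>"
    using optimal_saddle_source_flows_equivalent[OF SN_flow_sphere_flow saddle_source_sphere_flow] \<psi>
      card_singular_points_sphere_flow by simp
qed

end
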